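(* Assume the soft potential hypothesis with parameter $b$, and choose $\ell>3/b$. Let $f(t)=U(t)f_0$ be the solution of the linearized relativistic Boltzmann equation $(\partial_t+\hat p\cdot\nabla_x+L)f=0$ with initial data $f_0$ satisfying $$\int_{\mathbb{T}^3}dx\int_{\mathbb{R}^3}dp\,\begin{pmatrix}1\\ p\\ p_0\end{pmatrix}\sqrt{J(p)}\,f_0(x,p)=0,$$ and let $R_1(f)(t)$ be the remainder defined in the context. For any small $\eta>0$ and any $k\ge1$ there exists a $k'=k'(k)\ge k$ such that (for the parameter $M$ in the definition of $R_1$ chosen sufficiently large) $$w_\ell(p)\,|R_1(f)(t)|\le\eta\,(1+t)^{-k}\,|||f|||_{k,\ell}+C_{\ell,k',\eta}\,(1+t)^{-k}\,\|f_0\|_{\infty,\ell+k'} .$$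
   Context: All physical constants are normalized to one. For $p,q\in\mathbb{R}^3$ put $p_0=\sqrt{1+|p|^2}$, $\hat p=p/p_0$, $s=2(p_0q_0-p\cdot q+1)$, $g=\sqrt{2(p_0q_0-p\cdot q-1)}\ge0$ (so $s=g^2+4$), $v=v(p,q)=g\sqrt s/(p_0q_0)$, and $J(p)=e^{-p_0}/(4\pi)$. For $\omega\in\mathbb{S}^2$ the post-collisional momenta are $$p'=\tfrac{p+q}{2}+\tfrac g2\Big(\omega+\big(\tfrac{p_0+q_0}{\sqrt s}-1\big)(p+q)\tfrac{(p+q)\cdot\omega}{|p+q|^2}\Big),\quad q'=\tfrac{p+q}{2}-\tfrac g2\Big(\omega+\big(\tfrac{p_0+q_0}{\sqrt s}-1\big)(p+q)\tfrac{(p+q)\cdot\omega}{|p+q|^2}\Big),$$ with energies $p_0'=\sqrt{1+|p'|^2}$, $q_0'=\sqrt{1+|q'|^2}$; the scattering angle $\theta\in[0,\pi]$ is given by $\cos\theta=\big[-(p_0-q_0)(p_0'-q_0')+(p-q)\cdot(p'-q')\big]/g^2$. Soft potential hypothesis: the kernel $\sigma=\sigma(g,\theta)\ge0$ satisfies, up to positive multiplicative constants, $\sigma\lesssim g^{-b}\sigma_0$ and $\sigma\gtrsim (g/\sqrt s)\,g^{-b}\sigma_0$, where $\sigma_0\ge0$ is a function of the angle, nonzero on a set of positive measure, with $\sigma_0\lesssim\sin^\gamma\theta$, $\gamma>-2$, and $0<b<\min(4,4+\gamma)$. Operators: $L(h)=\nu(p)h-K(h)$, $\nu(p)=\int_{\mathbb{R}^3}dq\int_{\mathbb{S}^2}d\omega\,v\,\sigma(g,\theta)J(q)$,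 $K=K_2-K_1$ with $K_2(h)=\int dq\,d\omega\,v\,\sigma\sqrt{J(q)}\{\sqrt{J(q')}h(p')+\sqrt{J(p')}h(q')\}$ and $K_1(h)=\int dq\,d\omega\,v\,\sigma\sqrt{J(q)J(p)}\,h(q)$. $U(t)$ is the solution semigroup of $(\partial_t+\hat p\cdot\nabla_x+L)f=0$ on $\mathbb{T}^3\times\mathbb{R}^3$. Cut-off: for a small $\epsilon>0$, $\chi=\chi(g)$ is a smooth function with $\chi=1$ for $g\ge2\epsilon$ and $\chi=0$ for $g\le\epsilon$. The cut-off kernel is $k^\chi=k_2^\chi-k_1^\chi$, with $$k_1^\chi(p,q)=\sqrt{J(q)J(p)}\,\chi(g)\int_{\mathbb{S}^2}d\omega\,v\,\sigma(g,\theta),$$ $$k_2^\chi(p,q)=c_2\frac{s^{3/2}}{g\,p_0q_0}\chi(g)\int_0^\infty dy\,e^{-l\sqrt{1+y^2}}\,\sigma\Big(\frac{g}{\sin(\psi/2)},\psi\Big)\frac{y(1+\sqrt{1+y^2})}{\sqrt{1+y^2}}I_0(jy),$$ where $c_2>0$ is a numerical constant, $I_0(y)=\frac1{2\pi}\int_0^{2\pi}e^{y\cos\varphi}d\varphi$, $l=(p_0+q_0)/2$, $j=|p\times q|/g$, and $\psi\in[0,\pi]$ with $\sin(\psi/2)=\sqrt2\,g\,[g^2-4+(g^2+4)\sqrt{1+y^2}]^{-1/2}$. ($k_i^\chi$ is the kernel the paper uses to represent $K_i^\chi(h)=\int k_i^\chi(p,q)h(q)\,dq$, the part of $K_i$ carrying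 the factor $\chi(g)$, and $c_2$ is the constant arising there.) Remainder: for a large parameter $M\gg1$ let $\mathbf 1_{high}=\mathbf 1_{|p|>M}\mathbf 1_{|q_1|\le M}+\mathbf 1_{|q_1|>M}$, $y_2=x-\hat p(t-s_1)-\hat q_1(s_1-s_2)$, and $$R_1(f)(t)=\int_{\mathbb{R}^3}dq_1\,k^\chi(p,q_1)\int_{\mathbb{R}^3}dq_2\,k^\chi(q_1,q_2)\,\mathbf 1_{\frac12|p|\le|q_1|\le2|p|}\,\mathbf 1_{\frac12|q_1|\le|q_2|\le2|q_1|}\,\mathbf 1_{high}\int_0^tds_1\,e^{-\nu(p)(t-s_1)}\int_0^{s_1}ds_2\,e^{-\nu(q_1)(s_1-s_2)}\{U(s_2)f_0\}(y_2,q_2),$$ a function of $(t,x,p)$. Norms: $w_\ell(p)=p_0^{\ell b/2}$, $\|h\|_{\infty,\ell}=\operatorname{ess\,sup}_{x,p}|w_\ell(p)h(x,p)|$, $|||f|||_{k,\ell}=\sup_{s\ge0}(1+s)^k\|f(s)\|_{\infty,\ell}$. *)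

theory Defs
  imports "HOL-Analysis.Analysis" "HOL-Probability.Essential_Supremum"
begin

type_synonym vec3 = "real ^ 3"

definition energy :: "vec3 \<Rightarrow> real" where
  "energy p = sqrt (1 + (norm p)\<^sup>2)"

definition velocity :: "vec3 \<Rightarrow> vec3" where
  "velocity p = p /\<^sub>R energy p"

definition mandel_s :: "vec3 \<Rightarrow> vec3 \<Rightarrow> real" where
  "mandel_s p q = 2 * (energy p * energy q - p \<bullet> q + 1)"

definition rel_mom :: "vec3 \<Rightarrow> vec3 \<Rightarrow> real" where
  "rel_mom p q = sqrt (2 * (energy p * energy q - p \<bullet> q - 1))"

definition moller_velocity :: "vec3 \<Rightarrow> vec3 \<Rightarrow> real" where
  "moller_velocity p q = rel_mom p q * sqrt (mandel_s p q) / (energy p * energy q)"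

definition juttner :: "vec3 \<Rightarrow> real" where
  "juttner p = exp (- energy p) / (4 * pi)"

text \<open>The degenerate case \<open>p + q = 0\<close> needs no special treatment: the second summand
  below vanishes by the convention \<open>x / 0 = 0\<close>, in accordance with
  \<open>energy p + energy q = sqrt (mandel_s p q)\<close> there.\<close>

definition scatter_dir :: "vec3 \<Rightarrow> vec3 \<Rightarrow> vec3 \<Rightarrow> vec3" where
  "scatter_dir p q \<omega> =
     \<omega> + (((energy p + energy q) / sqrt (mandel_s p q) - 1) *
            (((p + q) \<bullet> \<omega>) / (norm (p + q))\<^sup>2)) *\<^sub>R (p + q)"

definition post_p :: "vec3 \<Rightarrow> vec3 \<Rightarrow> vec3 \<Rightarrow> vec3" where
  "post_p p q \<omega> = (1/2) *\<^sub>R (p + q) + (rel_mom p q / 2) *\<^sub>R scatter_dir p q \<omega>"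

definition post_q :: "vec3 \<Rightarrow> vec3 \<Rightarrow> vec3 \<Rightarrow> vec3" where
  "post_q p q \<omega> = (1/2) *\<^sub>R (p + q) - (rel_mom p q / 2) *\<^sub>R scatter_dir p q \<omega>"

definition scatter_angle :: "vec3 \<Rightarrow> vec3 \<Rightarrow> vec3 \<Rightarrow> real" where
  "scatter_angle p q \<omega> =
     arccos ((- (energy p - energy q) * (energy (post_p p q \<omega>) - energy (post_q p q \<omega>))
              + (p - q) \<bullet> (post_p p q \<omega> - post_q p q \<omega>)) / (rel_mom p q)\<^sup>2)"

text \<open>Surface measure on the unit sphere, as a measure on the ambient space: the surface
  area of a set of directions is three times the volume of the cone that it spans in the
  unit ball.\<close>

definition sphere_measure :: "vec3 measure" where
  "sphere_measure =
     scale_measure 3 (distr (restrict_space lborel (ball 0 1)) borel (\<lambda>x. x /\<^sub>R norm x))"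

text \<open>A kernel \<open>\<sigma> g \<theta>\<close> is only relevant for \<open>g > 0\<close> and up to null sets of angles. The
  bounds are imposed on the open interval of angles because \<open>sin \<theta> powr \<gamma>\<close> is infinite at the
  end points if \<open>\<gamma> < 0\<close>, whereas \<open>0 powr \<gamma> = 0\<close> in the library.\<close>

definition soft_potential :: "real \<Rightarrow> (real \<Rightarrow> real \<Rightarrow> real) \<Rightarrow> bool" where
  "soft_potential b \<sigma> \<longleftrightarrow>
     (\<lambda>(g, \<theta>). \<sigma> g \<theta>) \<in> borel_measurable borel \<and>
     (\<forall>g>0. \<forall>\<theta>\<in>{0..pi}. \<sigma> g \<theta> \<ge> 0) \<and>
     (\<exists>(\<sigma>0 :: real \<Rightarrow> real) \<gamma>.
        \<sigma>0 \<in> borel_measurable borel \<and>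
        (\<forall>\<theta>\<in>{0..pi}. \<sigma>0 \<theta> \<ge> 0) \<and>
        emeasure lborel {\<theta> \<in> {0..pi}. \<sigma>0 \<theta> \<noteq> 0} > 0 \<and>
        \<gamma> > -2 \<and> 0 < b \<and> b < min 4 (4 + \<gamma>) \<and>
        (\<exists>C>0. \<forall>\<theta>\<in>{0<..<pi}. \<sigma>0 \<theta> \<le> C * sin \<theta> powr \<gamma>) \<and>
        (\<exists>C>0. \<forall>g>0. \<forall>\<theta>\<in>{0<..<pi}. \<sigma> g \<theta> \<le> C * (g powr (- b) * \<sigma>0 \<theta>)) \<and>
        (\<exists>c>0. \<forall>g>0. \<forall>\<theta>\<in>{0<..<pi}.
            \<sigma> g \<theta> \<ge> c * (g / sqrt (g\<^sup>2 + 4) * g powr (- b) * \<sigma>0 \<theta>)))"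

definition coll_freq :: "(real \<Rightarrow> real \<Rightarrow> real) \<Rightarrow> vec3 \<Rightarrow> real" where
  "coll_freq \<sigma> p =
     (LINT (q, \<omega>)|(lborel \<Otimes>\<^sub>M sphere_measure).
        moller_velocity p q * \<sigma> (rel_mom p q) (scatter_angle p q \<omega>) * juttner q)"

definition K1_op :: "(real \<Rightarrow> real \<Rightarrow> real) \<Rightarrow> (vec3 \<Rightarrow> real) \<Rightarrow> vec3 \<Rightarrow> real" where
  "K1_op \<sigma> h p =
     (LINT (q, \<omega>)|(lborel \<Otimes>\<^sub>M sphere_measure).
        moller_velocity p q * \<sigma> (rel_mom p q) (scatter_angle p q \<omega>)
        * sqrt (juttner q * juttner p) * h q)"

definition K2_op :: "(real \<Rightarrow> real \<Rightarrow> real) \<Rightarrow> (vec3 \<Rightarrow> real) \<Rightarrow> vec3 \<Rightarrow> real" where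
  "K2_op \<sigma> h p =
     (LINT (q, \<omega>)|(lborel \<Otimes>\<^sub>M sphere_measure).
        moller_velocity p q * \<sigma> (rel_mom p q) (scatter_angle p q \<omega>) * sqrt (juttner q)
        * (sqrt (juttner (post_q p q \<omega>)) * h (post_p p q \<omega>)
           + sqrt (juttner (post_p p q \<omega>)) * h (post_q p q \<omega>)))"

definition K_op :: "(real \<Rightarrow> real \<Rightarrow> real) \<Rightarrow> (vec3 \<Rightarrow> real) \<Rightarrow> vec3 \<Rightarrow> real" where
  "K_op \<sigma> h p = K2_op \<sigma> h p - K1_op \<sigma> h p"

definition L_op :: "(real \<Rightarrow> real \<Rightarrow> real) \<Rightarrow> (vec3 \<Rightarrow> real) \<Rightarrow> vec3 \<Rightarrow> real" where
  "L_op \<sigma> h p = coll_freq \<sigma> p * h p - K_op \<sigma> h p"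

text \<open>The torus is \<open>\<real>\<^sup>3 / \<int>\<^sup>3\<close>; functions on it are functions on \<open>\<real>\<^sup>3\<close> that have period one in each
  coordinate, and they are integrated over the unit cube.\<close>

definition phase_measure :: "(vec3 \<times> vec3) measure" where
  "phase_measure = restrict_space lborel (cbox 0 1) \<Otimes>\<^sub>M lborel"

definition periodic :: "(vec3 \<Rightarrow> vec3 \<Rightarrow> real) \<Rightarrow> bool" where
  "periodic h \<longleftrightarrow> (\<forall>x p i. h (x + axis i 1) p = h x p)"

definition L2_sq :: "(vec3 \<Rightarrow> vec3 \<Rightarrow> real) \<Rightarrow> ennreal" where
  "L2_sq h = (\<integral>\<^sup>+ (x, p). ennreal ((h x p)\<^sup>2) \<partial>phase_measure)"

definition phase_L2 :: "(vec3 \<Rightarrow> vec3 \<Rightarrow> real) \<Rightarrow> bool" where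
  "phase_L2 h \<longleftrightarrow> periodic h \<and> (\<lambda>(x, p). h x p) \<in> borel_measurable borel \<and> L2_sq h < \<infinity>"

text \<open>\<open>semigroup_solution \<sigma> f0 f\<close> says that \<open>f t = U(t) f0\<close> for \<open>t \<ge> 0\<close>, where \<open>U\<close> is the solution
  semigroup on \<open>L\<^sup>2\<close> of the equation \<open>\<partial>\<^sub>t f + velocity p \<bullet> \<nabla>\<^sub>x f + L f = 0\<close>: the function
  \<open>f\<close> lies in \<open>C([0,\<infinity>); L\<^sup>2)\<close> and satisfies the equation integrated along the characteristics
  \<open>t \<mapsto> x + t velocity p\<close>. This determines each \<open>f t\<close> up to a null set. As \<open>f\<close> is later evaluated
  pointwise under integrals, it is a representative that is measurable in all variables.\<close>

definition semigroup_solution ::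
    "(real \<Rightarrow> real \<Rightarrow> real) \<Rightarrow> (vec3 \<Rightarrow> vec3 \<Rightarrow> real) \<Rightarrow> (real \<Rightarrow> vec3 \<Rightarrow> vec3 \<Rightarrow> real) \<Rightarrow> bool" where
  "semigroup_solution \<sigma> f0 f \<longleftrightarrow>
     phase_L2 f0 \<and>
     (\<lambda>(t, x, p). f t x p) \<in> borel_measurable (restrict_space borel ({0..} \<times> UNIV)) \<and>
     (\<forall>t\<ge>0. phase_L2 (f t)) \<and>
     (\<forall>t\<ge>0. ((\<lambda>s. L2_sq (\<lambda>x p. f s x p - f t x p)) \<longlongrightarrow> 0) (at t within {0..})) \<and>
     (\<forall>t\<ge>0. AE (x, p) in phase_measure.
        f t (x + t *\<^sub>R velocity p) p =
          f0 x p - (LBINT s:{0..t}. L_op \<sigma> (f s (x + s *\<^sub>R velocity p)) p))"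

definition conservation_laws :: "(vec3 \<Rightarrow> vec3 \<Rightarrow> real) \<Rightarrow> bool" where
  "conservation_laws f0 \<longleftrightarrow>
     (LINT (x, p)|phase_measure. sqrt (juttner p) * f0 x p) = 0 \<and>
     (LINT (x, p)|phase_measure. (sqrt (juttner p) * f0 x p) *\<^sub>R p) = 0 \<and>
     (LINT (x, p)|phase_measure. energy p * sqrt (juttner p) * f0 x p) = 0"

definition smooth_cutoff :: "real \<Rightarrow> (real \<Rightarrow> real) \<Rightarrow> bool" where
  "smooth_cutoff \<epsilon> chi \<longleftrightarrow>
     (\<forall>n. ((deriv ^^ n) chi) differentiable_on UNIV) \<and>
     (\<forall>g. g \<ge> 2 * \<epsilon> \<longrightarrow> chi g = 1) \<and> (\<forall>g. g \<le> \<epsilon> \<longrightarrow> chi g = 0)"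

definition bessel_I0 :: "real \<Rightarrow> real" where
  "bessel_I0 y = 1 / (2 * pi) * (LBINT \<phi>:{0..2 * pi}. exp (y * cos \<phi>))"

definition sin_half_psi :: "real \<Rightarrow> real \<Rightarrow> real" where
  "sin_half_psi g y = sqrt 2 * g / sqrt (g\<^sup>2 - 4 + (g\<^sup>2 + 4) * sqrt (1 + y\<^sup>2))"

definition psi_angle :: "real \<Rightarrow> real \<Rightarrow> real" where
  "psi_angle g y = 2 * arcsin (sin_half_psi g y)"

definition k1_cut :: "(real \<Rightarrow> real \<Rightarrow> real) \<Rightarrow> (real \<Rightarrow> real) \<Rightarrow> vec3 \<Rightarrow> vec3 \<Rightarrow> real" where
  "k1_cut \<sigma> chi p q =
     sqrt (juttner q * juttner p) * chi (rel_mom p q) *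
     (LINT \<omega>|sphere_measure. moller_velocity p q * \<sigma> (rel_mom p q) (scatter_angle p q \<omega>))"

definition k2_cut ::
    "(real \<Rightarrow> real \<Rightarrow> real) \<Rightarrow> (real \<Rightarrow> real) \<Rightarrow> real \<Rightarrow> vec3 \<Rightarrow> vec3 \<Rightarrow> real" where
  "k2_cut \<sigma> chi c2 p q =
     (let g = rel_mom p q; s = mandel_s p q;
          l = (energy p + energy q) / 2; j = norm (cross3 p q) / g
      in c2 * (s powr (3/2) / (g * energy p * energy q)) * chi g *
         (LBINT y:{0..}.
            exp (- l * sqrt (1 + y\<^sup>2)) * \<sigma> (g / sin (psi_angle g y / 2)) (psi_angle g y)
            * (y * (1 + sqrt (1 + y\<^sup>2)) / sqrt (1 + y\<^sup>2)) * bessel_I0 (j * y)))"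

definition k_cut ::
    "(real \<Rightarrow> real \<Rightarrow> real) \<Rightarrow> (real \<Rightarrow> real) \<Rightarrow> real \<Rightarrow> vec3 \<Rightarrow> vec3 \<Rightarrow> real" where
  "k_cut \<sigma> chi c2 p q = k2_cut \<sigma> chi c2 p q - k1_cut \<sigma> chi p q"

definition ind_high :: "real \<Rightarrow> vec3 \<Rightarrow> vec3 \<Rightarrow> real" where
  "ind_high M p q1 =
     of_bool (norm p > M) * of_bool (norm q1 \<le> M) + of_bool (norm q1 > M)"

definition ind_comparable :: "vec3 \<Rightarrow> vec3 \<Rightarrow> real" where
  "ind_comparable p q = of_bool (norm p / 2 \<le> norm q \<and> norm q \<le> 2 * norm p)"

text \<open>In the remainder the argument \<open>f s\<close> plays the role of \<open>U(s) f0\<close>.\<close>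

definition R1 ::
    "(real \<Rightarrow> real \<Rightarrow> real) \<Rightarrow> (real \<Rightarrow> real) \<Rightarrow> real \<Rightarrow> real \<Rightarrow>
     (real \<Rightarrow> vec3 \<Rightarrow> vec3 \<Rightarrow> real) \<Rightarrow> real \<Rightarrow> vec3 \<Rightarrow> vec3 \<Rightarrow> real" where
  "R1 \<sigma> chi c2 M f t x p =
     (LBINT q1. k_cut \<sigma> chi c2 p q1 *
       (LBINT q2. k_cut \<sigma> chi c2 q1 q2 *
          ind_comparable p q1 * ind_comparable q1 q2 * ind_high M p q1 *
          (LBINT s1:{0..t}. exp (- coll_freq \<sigma> p * (t - s1)) *
            (LBINT s2:{0..s1}. exp (- coll_freq \<sigma> q1 * (s1 - s2)) *
               f s2 (x - (t - s1) *\<^sub>R velocity p - (s1 - s2) *\<^sub>R velocity q1) q2))))"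

definition weight :: "real \<Rightarrow> real \<Rightarrow> vec3 \<Rightarrow> real" where
  "weight b l p = energy p powr (l * b / 2)"

definition sup_norm :: "real \<Rightarrow> real \<Rightarrow> (vec3 \<Rightarrow> vec3 \<Rightarrow> real) \<Rightarrow> ereal" where
  "sup_norm b l h = esssup phase_measure (\<lambda>(x, p). ereal \<bar>weight b l p * h x p\<bar>)"

definition decay_norm :: "real \<Rightarrow> real \<Rightarrow> real \<Rightarrow> (real \<Rightarrow> vec3 \<Rightarrow> vec3 \<Rightarrow> real) \<Rightarrow> ereal" where
  "decay_norm b k l f = (SUP s\<in>{0..}. ereal ((1 + s) powr k) * sup_norm b l (f s))"

end

theory Submission
  imports Defs "HOL-Real_Asymp.Real_Asymp"
begin

text \<open>Only the decay of the solution for large momenta is needed, and it comes from a maximum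
  principle rather than from the decay of the semigroup on \<open>L\<^sup>2\<close>. For momenta \<open>p\<close> of large energy the
  operator \<open>K\<close> is small compared with \<open>\<nu>(p) \<sim> p\<^sub>0\<^bsup>-b/2\<^esup>\<close> on functions that vary polynomially in the energy.
  Hence functions of the form \<open>A (1 + a s p\<^sub>0\<^bsup>-b/2\<^esup>)\<^bsup>-k\<^esup> p\<^sub>0\<^bsup>-m\<^esup>\<close> are supersolutions of the equation along
  characteristics in the region \<open>p\<^sub>0 \<ge> R\<close>, while in the region \<open>p\<^sub>0 \<le> R\<close> the solution lies below them
  by the definition of the norm \<open>|||f|||\<close>, provided that \<open>A = \<parallel>f\<^sub>0\<parallel> + R\<^bsup>m\<^esup> |||f|||\<close>. So \<open>f\<close> is bounded by the
  supersolution everywhere. In the remainder all momenta are comparable and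
  of size at least \<open>M/2\<close>, and the cut-off kernels grow at most polynomially; if \<open>m\<close> is large enough, the
  supersolution pays for the kernels, the volumes of integration, the time integrals and the
  weight, and one factor \<open>1/p\<^sub>0 \<le> 2/M\<close> is left, which makes the contribution of \<open>|||f|||\<close> small.\<close>

section \<open>Integration over the unit sphere\<close>

text \<open>The obstacle behind the comparison: the norm gives decay only with the weight n =
  \<open>l * b / 2\<close>, while the remainder needs a larger power m. So the quotient of solution
  and supersolution is not known to be bounded, and it cannot be compared at its supremum. Therefore
  the supersolution carries an extra term with weight n that matches the known bound; as the
  collision operator uses only a quarter of the damping, every comparison halves this term. The
  smallness of K has two sources. The loss part has a factor exponentially small in p_0. In the gain
  part the post-collisional Maxwellian factors are, for large p_0, concentrated on two small caps of
  the sphere. A second obstacle: the solution is given up to null sets, but K evaluates it at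
  post-collisional momenta, and the remainder, estimated at every x and p, evaluates it at positions
  depending on \<open>q1\<close>. Both dependences are shown to be harmless by means of
  differentiable inverses.\<close>

lemma norm_integral_le_nn_integral:
  fixes f :: "'a \<Rightarrow> 'b::{banach, second_countable_topology}"
  shows "ennreal (norm (integral\<^sup>L M f)) \<le> (\<integral>\<^sup>+x. ennreal (norm (f x)) \<partial>M)"
proof (cases "integrable M f")
  case True
  then show ?thesis by (rule integral_norm_bound_ennreal)
\<comment> \<open>A non-integrable function has Bochner integral 0, so the bound persists. This lets
  the later estimates of \<open>K_op\<close>, \<open>k_cut\<close> and \<open>R1\<close> pass to
  nonnegative integrals at once.\<close>
qed (simp add: not_integrable_integral_eq)

lemma nn_integral_lborel_scale:
  fixes f :: "'a::euclidean_space \<Rightarrow> ennreal"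
  assumes [measurable]: "f \<in> borel_measurable borel" and "c > 0"
  shows "(\<integral>\<^sup>+x. f x \<partial>lborel) = ennreal (c ^ DIM('a)) * (\<integral>\<^sup>+x. f (c *\<^sub>R x) \<partial>lborel)"
  using \<open>c > 0\<close> by (subst lborel_affine[of c 0])
    (simp_all add: nn_integral_density nn_integral_distr nn_integral_cmult)

lemma nn_integral_lborel_translate:
  fixes f :: "'a::euclidean_space \<Rightarrow> ennreal"
  assumes [measurable]: "f \<in> borel_measurable borel"
  shows "(\<integral>\<^sup>+x. f (t + x) \<partial>lborel) = (\<integral>\<^sup>+x. f x \<partial>lborel)"
  by (subst (2) lborel_distr_plus[of t, symmetric]) (simp add: nn_integral_distr)

text \<open>Cylindrical splitting: the pair is the foot in the plane orthogonal to the third axis,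
  and its norm is the distance from that axis.\<close>

definition vec3_of :: "real \<times> real \<Rightarrow> real \<Rightarrow> vec3" where
  "vec3_of y z = fst y *\<^sub>R axis 1 1 + snd y *\<^sub>R axis 2 1 + z *\<^sub>R axis 3 1"

lemma vec3_of_nth [simp]:
  "vec3_of y z $ 1 = fst y" "vec3_of y z $ 2 = snd y" "vec3_of y z $ 3 = z"
  by (simp_all add: vec3_of_def axis_def)

lemma norm_vec3_of: "norm (vec3_of y z) = sqrt ((norm y)\<^sup>2 + z\<^sup>2)"
  by (simp add: norm_vec_def L2_set_def sum_3 norm_prod_def)

lemma measurable_vec3_of [measurable]:
  "(\<lambda>x. vec3_of (fst x) (snd x)) \<in> borel_measurable borel"
  unfolding vec3_of_def by (intro borel_measurable_continuous_onI continuous_intros)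

text \<open>Lebesgue measure is determined by its values on boxes, and the preimage of a box is
  again a product of intervals.\<close>

lemma distr_vec3_of:
  "distr (lborel \<Otimes>\<^sub>M lborel) borel (\<lambda>x. vec3_of (fst x) (snd x)) = lborel"
proof (rule lborel_eqI[symmetric])
  fix l u :: vec3 assume le: "\<And>b. b \<in> Basis \<Longrightarrow> l \<bullet> b \<le> u \<bullet> b"
  have le': "l $ i \<le> u $ i" for i
    using le[of "axis i 1"] by (simp add: inner_axis)
  have "(\<lambda>x. vec3_of (fst x) (snd x)) -` box l u
      = (box (l $ 1) (u $ 1) \<times> box (l $ 2) (u $ 2)) \<times> box (l $ 3) (u $ 3)"
    by (auto simp: mem_box_cart forall_3)
  then have "emeasure (distr (lborel \<Otimes>\<^sub>M lborel) borel (\<lambda>x. vec3_of (fst x) (snd x))) (box l u)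
      = emeasure ((lborel \<Otimes>\<^sub>M lborel) \<Otimes>\<^sub>M lborel)
          ((box (l $ 1) (u $ 1) \<times> box (l $ 2) (u $ 2)) \<times> box (l $ 3) (u $ 3))"
    by (subst emeasure_distr) (simp_all add: lborel_prod del: box_real)
  also have "\<dots> = ennreal (\<Prod>i\<in>UNIV. u $ i - l $ i)"
  proof -
    have "emeasure (lborel \<Otimes>\<^sub>M lborel) (box (l $ 1) (u $ 1) \<times> box (l $ 2) (u $ 2))
        = ennreal (u $ 1 - l $ 1) * ennreal (u $ 2 - l $ 2)"
      using le' by (subst lborel.emeasure_pair_measure_Times) simp_all
    moreover have "box (l $ 1) (u $ 1) \<times> box (l $ 2) (u $ 2) \<in> sets (lborel \<Otimes>\<^sub>M lborel)"
      by (intro pair_measureI) simp_all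
    moreover have "(\<Prod>i\<in>UNIV. u $ i - l $ i) = (u $ 1 - l $ 1) * (u $ 2 - l $ 2) * (u $ 3 - l $ 3)"
      unfolding UNIV_3 by simp
    ultimately show ?thesis
      using le' by (subst lborel.emeasure_pair_measure_Times) (simp_all add: ennreal_mult)
  qed
  also have "(\<Prod>i\<in>UNIV. u $ i - l $ i) = (\<Prod>b\<in>Basis. (u - l) \<bullet> b)"
  proof -
    have "(\<Prod>b\<in>Basis. (u - l) \<bullet> b) = (\<Prod>b\<in>range (\<lambda>i. axis i 1). (u - l) \<bullet> b)"
      by (rule prod.cong) (auto simp: Basis_vec_def)
    also have "\<dots> = (\<Prod>i\<in>UNIV. (u - l) \<bullet> axis i 1)"
      by (subst prod.reindex) (auto simp: inj_on_def axis_eq_axis)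
    finally show ?thesis by (simp add: inner_axis)
  qed
  finally show "emeasure (distr (lborel \<Otimes>\<^sub>M lborel) borel (\<lambda>x. vec3_of (fst x) (snd x))) (box l u)
      = ennreal (\<Prod>b\<in>Basis. (u - l) \<bullet> b)" .
qed simp

lemma nn_integral_vec3:
  fixes f :: "vec3 \<Rightarrow> ennreal"
  assumes [measurable]: "f \<in> borel_measurable borel"
  shows "(\<integral>\<^sup>+x. f x \<partial>lborel) = (\<integral>\<^sup>+y. \<integral>\<^sup>+z. f (vec3_of y z) \<partial>lborel \<partial>lborel)"
proof -
  have [measurable]: "(\<lambda>x. vec3_of (fst x) (snd x)) \<in> borel_measurable (lborel \<Otimes>\<^sub>M lborel)"
    unfolding lborel_prod by simp
  show ?thesis
    by (subst distr_vec3_of[symmetric], subst nn_integral_distr)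
       (simp_all add: lborel.nn_integral_fst[symmetric])
qed

section \<open>Surface measure of the unit sphere\<close>

lemma sets_sphere_measure [simp, measurable_cong]: "sets sphere_measure = sets borel"
  by (simp add: sphere_measure_def)

lemma space_sphere_measure [simp]: "space sphere_measure = UNIV"
  by (simp add: sphere_measure_def space_scale_measure)

lemma nn_integral_sphere:
  assumes [measurable]: "F \<in> borel_measurable borel"
  shows "(\<integral>\<^sup>+\<omega>. F \<omega> \<partial>sphere_measure)
    = 3 * (\<integral>\<^sup>+x. F (x /\<^sub>R norm x) * indicator (ball 0 1) x \<partial>lborel)"
  unfolding sphere_measure_def
  by (subst nn_integral_scale_measure)
     (simp_all add: nn_integral_distr nn_integral_restrict_space measurable_restrict_space1)

lemma emeasure_sphere_UNIV: "emeasure sphere_measure UNIV = ennreal (4 * pi)"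
proof -
  have "emeasure sphere_measure UNIV = (\<integral>\<^sup>+\<omega>. 1 \<partial>sphere_measure)"
    by simp
  also have "\<dots> = 3 * emeasure lborel (ball (0::vec3) 1)"
    by (subst nn_integral_sphere) simp_all
  also have "\<dots> = ennreal (4 * pi)"
    by (subst emeasure_ball) (simp_all add: unit_ball_vol_3 flip: ennreal_numeral ennreal_mult)
  finally show ?thesis .
qed

lemma finite_measure_sphere: "finite_measure sphere_measure"
  by (rule finite_measureI) (simp add: emeasure_sphere_UNIV)

lemma AE_sphere_norm: "AE \<omega> in sphere_measure. norm \<omega> = 1"
proof -
  have "(\<integral>\<^sup>+\<omega>. indicator {\<omega>. norm \<omega> \<noteq> 1} \<omega> \<partial>sphere_measure)
      = 3 * (\<integral>\<^sup>+x. indicator {\<omega>. norm \<omega> \<noteq> 1} (x /\<^sub>R norm x) * indicator (ball 0 1) x \<partial>(lborel :: vec3 measure))"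
    by (subst nn_integral_sphere) simp_all
  also have "(\<integral>\<^sup>+x. indicator {\<omega>. norm \<omega> \<noteq> 1} (x /\<^sub>R norm x) * indicator (ball 0 1) x \<partial>(lborel :: vec3 measure))
     = (\<integral>\<^sup>+x. 0 \<partial>(lborel :: vec3 measure))"
    by (rule nn_integral_cong_AE, rule AE_mp[OF AE_lborel_singleton[of 0]]) (auto simp: indicator_def)
  finally have "emeasure sphere_measure {\<omega>. norm \<omega> \<noteq> 1} = 0"
    by (simp add: nn_integral_indicator)
  then show ?thesis
    by (subst AE_iff_null) (auto simp: null_sets_def)
qed

text \<open>The preimage of a box is its image under the inverse map, which is again orthogonal and
  so keeps Lebesgue measure.\<close>

lemma distr_orthogonal_lborel:
  fixes f :: "vec3 \<Rightarrow> vec3"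
  assumes f: "orthogonal_transformation f"
  shows "distr lborel borel f = lborel"
proof (rule lborel_eqI[symmetric])
  fix l u :: vec3 assume le: "\<And>b. b \<in> Basis \<Longrightarrow> l \<bullet> b \<le> u \<bullet> b"
  have lin: "linear f" using f by (rule orthogonal_transformation_linear)
  have mf [measurable]: "f \<in> borel_measurable borel"
    using lin by (intro borel_measurable_continuous_onI linear_continuous_on) (simp add: linear_linear)
  define g where "g = inv f"
  have bij: "bij f" using f by (rule orthogonal_transformation_bij)
  have g: "orthogonal_transformation g" unfolding g_def using f by (rule orthogonal_transformation_inv)
  have eq: "f -` box l u = g ` box l u" unfolding g_def using bij by (rule bij_vimage_eq_inv_image)
  have L: "g ` box l u \<in> lmeasurable" using g by (intro measurable_orthogonal_image) auto
  have B: "g ` box l u \<in> sets lborel" using measurable_sets[OF mf, of "box l u"] eq by simp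
  have "emeasure (distr lborel borel f) (box l u) = emeasure lborel (g ` box l u)"
    by (subst emeasure_distr) (simp_all add: eq)
  also have "\<dots> = emeasure lebesgue (g ` box l u)" using B by simp
  also have "\<dots> = emeasure lebesgue (box l u)"
    using L g by (simp add: emeasure_eq_measure2 measure_orthogonal_image)
  also have "\<dots> = ennreal (\<Prod>b\<in>Basis. (u - l) \<bullet> b)"
    using le by simp
  finally show "emeasure (distr lborel borel f) (box l u) = ennreal (\<Prod>b\<in>Basis. (u - l) \<bullet> b)" .
qed simp

text \<open>An orthogonal map preserves the unit ball and commutes with normalisation, so it rotates
  cones together with their directions.\<close>

lemma nn_integral_sphere_rotate:
  assumes [measurable]: "F \<in> borel_measurable borel" and f: "orthogonal_transformation f"
  shows "(\<integral>\<^sup>+\<omega>. F (f \<omega>) \<partial>sphere_measure) = (\<integral>\<^sup>+\<omega>. F \<omega> \<partial>sphere_measure)"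
proof -
  have lin: "linear f" using f by (rule orthogonal_transformation_linear)
  have mf [measurable]: "f \<in> borel_measurable borel"
    using lin by (intro borel_measurable_continuous_onI linear_continuous_on) (simp add: linear_linear)
  have n: "norm (f x) = norm x" for x using f by (simp add: orthogonal_transformation)
  have "(\<integral>\<^sup>+\<omega>. F \<omega> \<partial>sphere_measure)
      = 3 * (\<integral>\<^sup>+x. F (x /\<^sub>R norm x) * indicator (ball 0 1) x \<partial>distr lborel borel f)"
    by (simp add: nn_integral_sphere distr_orthogonal_lborel[OF f])
  also have "\<dots> = 3 * (\<integral>\<^sup>+x. F (f (x /\<^sub>R norm x)) * indicator (ball 0 1) x \<partial>lborel)"
    by (subst nn_integral_distr)
       (auto simp: n linear_scale[OF lin] indicator_def intro!: nn_integral_cong)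
  also have "\<dots> = (\<integral>\<^sup>+\<omega>. F (f \<omega>) \<partial>sphere_measure)"
    by (subst nn_integral_sphere) simp_all
  finally show ?thesis by simp
qed

text \<open>The substitution is \<open>z = r u / sqrt (1 - u\<^sup>2)\<close>: at distance \<open>r\<close> from the third axis, \<open>u\<close> is the
  cosine of the angle to that axis.\<close>

lemma cone_slice:
  fixes G :: "real \<Rightarrow> real"
  assumes [measurable]: "G \<in> borel_measurable borel" and r: "r > 0"
  shows "(\<integral>\<^sup>+z. ennreal (G (z / sqrt (r\<^sup>2 + z\<^sup>2)) * of_bool (r\<^sup>2 + z\<^sup>2 < 1)) \<partial>lborel)
    = (\<integral>\<^sup>+u. ennreal (G u * (r / (sqrt (1 - u\<^sup>2))^3) * of_bool (r\<^sup>2 + u\<^sup>2 < 1)) \<partial>lborel)"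
proof (cases "r < 1")
  case False
  then have "1 \<le> r\<^sup>2" by (simp add: one_le_power)
  then have "\<not> r\<^sup>2 + z\<^sup>2 < 1" for z using zero_le_power2[of z] by linarith
  then show ?thesis by simp
next
  case True
  define c where "c = sqrt (1 - r\<^sup>2)"
  have r1: "r\<^sup>2 < 1" using True r by (simp add: abs_square_less_1)
  have c: "0 < c" "c\<^sup>2 = 1 - r\<^sup>2" using r1 by (simp_all add: c_def)
  let ?g = "\<lambda>u. r * u / sqrt (1 - u\<^sup>2)"
  have u1: "1 - u\<^sup>2 \<ge> r\<^sup>2" if "u \<in> {-c..c}" for u
  proof -
    have "\<bar>u\<bar> \<le> \<bar>c\<bar>" using that by auto
    then have "u\<^sup>2 \<le> c\<^sup>2" by (simp add: abs_le_square_iff)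
    then show ?thesis using c(2) by linarith
  qed
  have sq: "sqrt (1 - c\<^sup>2) = r" using c r by simp
  \<comment> \<open>The substitution fixes both end points and so maps [-c, c] onto itself; this is
    why the constraint reads the same in z and in u.\<close>
  have gc: "?g c = c" "?g (-c) = -c" using sq r by simp_all
  have der: "(?g has_real_derivative r / (sqrt (1 - u\<^sup>2))^3) (at u)" if "u \<in> {-c..c}" for u
  proof -
    have pos: "1 - u\<^sup>2 > 0" using u1[OF that] zero_less_power[OF r, of 2] by linarith
    define w where "w = sqrt (1 - u\<^sup>2)"
    have w: "w > 0" "w\<^sup>2 = 1 - u\<^sup>2" using pos by (auto simp: w_def)
    have D: "((\<lambda>u. sqrt (1 - u\<^sup>2)) has_real_derivative - (u / w)) (at u)"
      using pos by (auto intro!: derivative_eq_intros simp: w_def field_simps)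
    have D2: "((\<lambda>u. r * u) has_real_derivative r) (at u)"
      by (auto intro!: derivative_eq_intros)
    have "(?g has_real_derivative (r * w - r * u * - (u / w)) / (w * w)) (at u)"
      using DERIV_divide[OF D2 D] w by (simp add: w_def)
    moreover have "(r * w - r * u * - (u / w)) / (w * w) = r * (w\<^sup>2 + u\<^sup>2) / w^3"
      using w(1) by (simp add: field_simps power2_eq_square power3_eq_cube)
    moreover have "w\<^sup>2 + u\<^sup>2 = 1" using w by simp
    ultimately show ?thesis by (simp add: w_def[symmetric])
  qed
  have cont: "continuous_on {-c..c} (\<lambda>u. r / (sqrt (1 - u\<^sup>2))^3)"
  proof (intro continuous_intros ballI)
    fix u assume "u \<in> {-c..c}"
    then have "1 - u\<^sup>2 > 0" using u1[of u] zero_less_power[OF r, of 2] by linarith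
    then show "sqrt (1 - u\<^sup>2) ^ 3 \<noteq> 0" by simp
  qed
  have "(\<integral>\<^sup>+z. ennreal (G (z / sqrt (r\<^sup>2 + z\<^sup>2)) * of_bool (r\<^sup>2 + z\<^sup>2 < 1)) \<partial>lborel)
      = (\<integral>\<^sup>+z. ennreal (G (z / sqrt (r\<^sup>2 + z\<^sup>2)) * indicator {?g (-c)..?g c} z) \<partial>lborel)"
  \<comment> \<open>The constraint describes the open interval, the substitution rule the closed
    one; the two end points form a null set.\<close>
  proof (rule nn_integral_cong_AE, rule AE_mp[OF AE_lborel_singleton[of c]], rule AE_mp[OF AE_lborel_singleton[of "-c"]], rule AE_I2, intro impI)
    fix z assume z: "z \<noteq> -c" "z \<noteq> c"
    have "r\<^sup>2 + z\<^sup>2 < 1 \<longleftrightarrow> \<not> c\<^sup>2 \<le> z\<^sup>2" using c(2) by linarith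
    also have "\<dots> \<longleftrightarrow> \<bar>z\<bar> < c" using c(1) abs_le_square_iff[of c z] by linarith
    also have "\<dots> \<longleftrightarrow> z \<in> {-c..c}" using z by auto
    finally show "ennreal (G (z / sqrt (r\<^sup>2 + z\<^sup>2)) * of_bool (r\<^sup>2 + z\<^sup>2 < 1)) = ennreal (G (z / sqrt (r\<^sup>2 + z\<^sup>2)) * indicator {?g (-c)..?g c} z)"
      unfolding gc by (simp add: indicator_def)
  qed
  also have "\<dots> = (\<integral>\<^sup>+u. ennreal (G (?g u / sqrt (r\<^sup>2 + (?g u)\<^sup>2)) * (r / (sqrt (1 - u\<^sup>2))^3) * indicator {-c..c} u) \<partial>lborel)"
  proof (intro nn_integral_substitution der cont)
    show "set_borel_measurable borel {?g (-c)..?g c} (\<lambda>z. G (z / sqrt (r\<^sup>2 + z\<^sup>2)))"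
      unfolding set_borel_measurable_def by measurable
    show "0 \<le> r / sqrt (1 - u\<^sup>2) ^ 3" if "u \<in> {-c..c}" for u
    proof -
      have "u\<^sup>2 \<le> 1" using u1[OF that] zero_le_power2[of r] by linarith
      then show ?thesis using r by simp
    qed
  qed (use c in auto)
  also have "\<dots> = (\<integral>\<^sup>+u. ennreal (G u * (r / (sqrt (1 - u\<^sup>2))^3) * of_bool (r\<^sup>2 + u\<^sup>2 < 1)) \<partial>lborel)"
  proof (rule nn_integral_cong_AE, rule AE_mp[OF AE_lborel_singleton[of c]], rule AE_mp[OF AE_lborel_singleton[of "-c"]], rule AE_I2, intro impI)
    fix z assume z: "z \<noteq> -c" "z \<noteq> c"
    have "r\<^sup>2 + z\<^sup>2 < 1 \<longleftrightarrow> \<not> c\<^sup>2 \<le> z\<^sup>2" using c(2) by linarith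
    also have "\<dots> \<longleftrightarrow> \<bar>z\<bar> < c" using c(1) abs_le_square_iff[of c z] by linarith
    also have "\<dots> \<longleftrightarrow> z \<in> {-c..c}" using z by auto
    finally have e: "r\<^sup>2 + z\<^sup>2 < 1 \<longleftrightarrow> z \<in> {-c..c}" .
    have "?g z / sqrt (r\<^sup>2 + (?g z)\<^sup>2) = z" if "z \<in> {-c..c}"
    proof -
      have pos: "1 - z\<^sup>2 > 0" using u1[OF that] zero_less_power[OF r, of 2] by linarith
      have "r\<^sup>2 + (?g z)\<^sup>2 = r\<^sup>2 / (1 - z\<^sup>2)"
        using pos by (simp add: power_divide power_mult_distrib field_simps)
      then have "sqrt (r\<^sup>2 + (?g z)\<^sup>2) = r / sqrt (1 - z\<^sup>2)" using r by (simp add: real_sqrt_divide)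
      then show ?thesis using pos r by simp
    qed
    then show "ennreal (G (?g z / sqrt (r\<^sup>2 + (?g z)\<^sup>2)) * (r / (sqrt (1 - z\<^sup>2))^3) * indicator {-c..c} z) = ennreal (G z * (r / (sqrt (1 - z\<^sup>2))^3) * of_bool (r\<^sup>2 + z\<^sup>2 < 1))"
      using e by (auto simp: indicator_def)
  qed
  finally show ?thesis .
qed

text \<open>Archimedes: the projection of the sphere to an axis has constant density. The third axis
  is treated first, up to a constant; rotation invariance then covers every unit vector.\<close>

lemma nn_integral_sphere_inner:
  fixes G :: "real \<Rightarrow> real"
  assumes [measurable]: "G \<in> borel_measurable borel" and G: "\<And>u. G u \<ge> 0" and k: "norm k = 1"
  shows "(\<integral>\<^sup>+\<omega>. ennreal (G (k \<bullet> \<omega>)) \<partial>sphere_measure)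
    = ennreal (2 * pi) * (\<integral>\<^sup>+u. ennreal (G u) * indicator {-1<..<1} u \<partial>lborel)"
proof -
  \<comment> \<open>Left unevaluated: taking G = 1 and comparing with the total area 4 pi determines
    it below.\<close>
  define \<kappa> where "\<kappa> = (\<integral>\<^sup>+y. ennreal (norm y * of_bool (norm y < 1)) \<partial>(lborel :: (real \<times> real) measure))"
  have axis: "(\<integral>\<^sup>+\<omega>. ennreal (G (\<omega> $ 3)) \<partial>sphere_measure)
      = 3 * \<kappa> * (\<integral>\<^sup>+u. ennreal (G u) * indicator {-1<..<1} u \<partial>lborel)"
    if [measurable]: "G \<in> borel_measurable borel" and G: "\<And>u. G u \<ge> 0" for G :: "real \<Rightarrow> real"
  proof -
    have m3 [measurable]: "(\<lambda>x::vec3. x $ 3) \<in> borel_measurable borel"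
      by (intro borel_measurable_continuous_onI continuous_intros)
    have "(\<integral>\<^sup>+\<omega>. ennreal (G (\<omega> $ 3)) \<partial>sphere_measure)
       = 3 * (\<integral>\<^sup>+x. ennreal (G ((x /\<^sub>R norm x) $ 3)) * indicator (ball 0 1) x \<partial>(lborel :: vec3 measure))"
      by (subst nn_integral_sphere) simp_all
    also have "(\<integral>\<^sup>+x. ennreal (G ((x /\<^sub>R norm x) $ 3)) * indicator (ball 0 1) x \<partial>(lborel :: vec3 measure))
       = (\<integral>\<^sup>+y. \<integral>\<^sup>+z. ennreal (G (z / sqrt ((norm y)\<^sup>2 + z\<^sup>2)) * of_bool ((norm y)\<^sup>2 + z\<^sup>2 < 1)) \<partial>lborel \<partial>(lborel :: (real \<times> real) measure))"
      by (subst nn_integral_vec3)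
         (auto simp: norm_vec3_of divide_inverse mult.commute indicator_def of_bool_def intro!: nn_integral_cong)
    also have "\<dots> = (\<integral>\<^sup>+y. \<integral>\<^sup>+u. ennreal (G u * (norm y / (sqrt (1 - u\<^sup>2))^3) * of_bool ((norm y)\<^sup>2 + u\<^sup>2 < 1)) \<partial>lborel \<partial>(lborel :: (real \<times> real) measure))"
      by (rule nn_integral_cong_AE, rule AE_mp[OF AE_lborel_singleton[of 0]], rule AE_I2, intro impI, rule cone_slice)
         simp_all
    also have "\<dots> = (\<integral>\<^sup>+u. \<integral>\<^sup>+y. ennreal (G u * (norm y / (sqrt (1 - u\<^sup>2))^3) * of_bool ((norm y)\<^sup>2 + u\<^sup>2 < 1)) \<partial>(lborel :: (real \<times> real) measure) \<partial>lborel)"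
      by (rule lborel_pair.Fubini'[symmetric]) measurable
    also have "\<dots> = (\<integral>\<^sup>+u. \<kappa> * (ennreal (G u) * indicator {-1<..<1} u) \<partial>lborel)"
    proof (rule nn_integral_cong)
      fix u :: real
      show "(\<integral>\<^sup>+y. ennreal (G u * (norm y / (sqrt (1 - u\<^sup>2))^3) * of_bool ((norm y)\<^sup>2 + u\<^sup>2 < 1)) \<partial>(lborel :: (real \<times> real) measure))
        = \<kappa> * (ennreal (G u) * indicator {-1<..<1} u)"
      proof (cases "\<bar>u\<bar> < 1")
        case False
        then have "1 \<le> u\<^sup>2" using abs_le_square_iff[of 1 u] by simp
        then have "\<not> (norm y)\<^sup>2 + u\<^sup>2 < 1" for y :: "real \<times> real"
          using zero_le_power2[of "norm y"] by linarith
        then show ?thesis using False by (auto simp: indicator_def)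
      next
        case True
        then have u1: "u\<^sup>2 < 1" by (simp add: abs_square_less_1)
        \<comment> \<open>Dilation by w maps the unit disc to the disc that u allows. The Jacobian
          w^2 and the factor w from the norm cancel w^3, leaving \<open>G u\<close> times a
          constant.\<close>
        define w where "w = sqrt (1 - u\<^sup>2)"
        have w: "w > 0" "w\<^sup>2 = 1 - u\<^sup>2" using u1 by (simp_all add: w_def)
        have "(\<integral>\<^sup>+y. ennreal (G u * (norm y / w^3) * of_bool ((norm y)\<^sup>2 + u\<^sup>2 < 1)) \<partial>(lborel :: (real \<times> real) measure))
          = ennreal (w\<^sup>2) * (\<integral>\<^sup>+y. ennreal (G u * (norm (w *\<^sub>R y) / w^3) * of_bool ((norm (w *\<^sub>R y))\<^sup>2 + u\<^sup>2 < 1)) \<partial>(lborel :: (real \<times> real) measure))"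
          using w(1) by (subst nn_integral_lborel_scale[of _ w]) (simp_all add: power2_eq_square)
        also have "\<dots> = ennreal (w\<^sup>2) * (\<integral>\<^sup>+y. ennreal (G u / w\<^sup>2) * ennreal (norm y * of_bool (norm y < 1)) \<partial>(lborel :: (real \<times> real) measure))"
        proof (intro arg_cong2[where f="(*)"] refl nn_integral_cong)
          fix y :: "real \<times> real"
          have "(norm (w *\<^sub>R y))\<^sup>2 + u\<^sup>2 < 1 \<longleftrightarrow> w\<^sup>2 * (norm y)\<^sup>2 < w\<^sup>2 * 1"
            using w by (simp add: power_mult_distrib del: mult_less_cancel_left_pos) linarith
          also have "\<dots> \<longleftrightarrow> norm y < 1"
            using w(1) abs_square_less_1[of "norm y"] by (subst mult_less_cancel_left_pos) auto
          finally show "ennreal (G u * (norm (w *\<^sub>R y) / w^3) * of_bool ((norm (w *\<^sub>R y))\<^sup>2 + u\<^sup>2 < 1))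
            = ennreal (G u / w\<^sup>2) * ennreal (norm y * of_bool (norm y < 1))"
            using w(1) G[of u] by (simp add: ennreal_mult[symmetric] power3_eq_cube power2_eq_square)
        qed
        also have "\<dots> = ennreal (w\<^sup>2) * (ennreal (G u / w\<^sup>2) * \<kappa>)"
          unfolding \<kappa>_def by (subst nn_integral_cmult) simp_all
        also have "\<dots> = ennreal (w\<^sup>2 * (G u / w\<^sup>2)) * \<kappa>"
          using G[of u] by (subst ennreal_mult) (simp_all add: mult.assoc)
        also have "\<dots> = \<kappa> * ennreal (G u)" using w(1) by (simp add: mult.commute)
        also have "\<dots> = \<kappa> * (ennreal (G u) * indicator {-1<..<1} u)"
          using True by (auto simp: indicator_def abs_less_iff)
        finally show ?thesis unfolding w_def .
      qed
    qed
    finally show ?thesis by (simp add: nn_integral_cmult mult.assoc)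
  qed
  have "ennreal (4 * pi) = 3 * \<kappa> * (\<integral>\<^sup>+u. ennreal 1 * indicator {-1<..<1::real} u \<partial>lborel)"
    using axis[of "\<lambda>_. 1"] by (simp add: emeasure_sphere_UNIV)
  also have "(\<integral>\<^sup>+u. ennreal 1 * indicator {-1<..<1::real} u \<partial>lborel) = ennreal 2"
    by simp
  finally have *: "ennreal (4 * pi) = 3 * \<kappa> * ennreal 2" .
  \<comment> \<open>An infinite \<open>\<kappa>\<close> is excluded because it would make the total
    area infinite.\<close>
  have "3 * \<kappa> = ennreal (2 * pi)"
  proof (cases \<kappa>)
    case (real r)
    then have "ennreal (4 * pi) = ennreal (6 * r)"
      using * by (simp add: ennreal_mult[symmetric] flip: ennreal_numeral)
    then have "4 * pi = 6 * r" using real pi_ge_zero by (subst (asm) ennreal_inj) auto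
    then show ?thesis using real by (simp add: ennreal_mult[symmetric] flip: ennreal_numeral)
  next
    case top
    then show ?thesis using * by (simp add: ennreal_mult_top ennreal_top_mult)
  qed
  note \<kappa> = this
  obtain f :: "vec3 \<Rightarrow> vec3" where f: "orthogonal_transformation f" "f k = axis 3 1"
    using orthogonal_transformation_exists_1[of k "axis 3 1"] k by (auto simp: norm_axis_1)
  have m: "(\<lambda>\<omega>. ennreal (G (axis 3 1 \<bullet> \<omega>))) \<in> borel_measurable (borel :: vec3 measure)"
    by measurable
  have "k \<bullet> \<omega> = axis 3 1 \<bullet> f \<omega>" for \<omega>
    using f by (metis orthogonal_transformation_def)
  then have "(\<integral>\<^sup>+\<omega>. ennreal (G (k \<bullet> \<omega>)) \<partial>sphere_measure) = (\<integral>\<^sup>+\<omega>. ennreal (G (axis 3 1 \<bullet> \<omega>)) \<partial>sphere_measure)"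
    using nn_integral_sphere_rotate[OF m f(1)] by simp
  also have "\<dots> = (\<integral>\<^sup>+\<omega>. ennreal (G (\<omega> $ 3)) \<partial>sphere_measure)"
    by (simp add: inner_axis' )
  finally show ?thesis using axis[OF assms(1) G] \<kappa> by simp
qed

section \<open>Collision kinematics\<close>

lemma energy_ge_1: "energy p \<ge> 1" by (simp add: energy_def)
lemma energy_pos: "energy p > 0" using energy_ge_1[of p] by linarith
lemma energy_sq: "(energy p)\<^sup>2 = 1 + (norm p)\<^sup>2" by (simp add: energy_def)
lemma energy_sq_inner: "energy p * energy p = 1 + p \<bullet> p"
  by (metis energy_sq power2_eq_square power2_norm_eq_inner)
lemma norm_less_energy: "norm p < energy p"
  unfolding energy_def by (rule real_less_rsqrt) simp

text \<open>Cauchy-Schwarz for p and q, then for (1, |p|) and (1, |q|). It makes the radicand of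
  \<open>rel_mom\<close> nonnegative and gives s \<ge> 4.\<close>

lemma energy_mult_ge: "\<bar>p \<bullet> q\<bar> + 1 \<le> energy p * energy q"
proof (rule power2_le_imp_le)
  have "\<bar>p \<bullet> q\<bar> \<le> norm p * norm q" by (rule Cauchy_Schwarz_ineq2)
  then have "(\<bar>p \<bullet> q\<bar> + 1)\<^sup>2 \<le> (norm p * norm q + 1)\<^sup>2" by (intro power_mono) auto
  also have "\<dots> \<le> (1 + (norm p)\<^sup>2) * (1 + (norm q)\<^sup>2)"
    using zero_le_power2[of "norm p - norm q"] by (simp add: power2_eq_square algebra_simps)
  finally show "(\<bar>p \<bullet> q\<bar> + 1)\<^sup>2 \<le> (energy p * energy q)\<^sup>2"
    by (simp add: power_mult_distrib energy_sq)
qed (use energy_pos[of p] energy_pos[of q] in simp)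

lemma rel_mom_sq: "(rel_mom p q)\<^sup>2 = 2 * (energy p * energy q - p \<bullet> q - 1)"
  using energy_mult_ge[of p q] by (simp add: rel_mom_def)

lemma rel_mom_nonneg: "rel_mom p q \<ge> 0"
  using energy_mult_ge[of p q] by (simp add: rel_mom_def)

lemma mandel_s_eq: "mandel_s p q = (rel_mom p q)\<^sup>2 + 4"
  by (simp add: rel_mom_sq mandel_s_def)

lemma mandel_s_ge_4: "mandel_s p q \<ge> 4" by (simp add: mandel_s_eq)

lemma mandel_s_le: "mandel_s p q \<le> 4 * (energy p * energy q)"
  using energy_mult_ge[of p q] by (simp add: mandel_s_def)

lemma rel_mom_sq_le: "(rel_mom p q)\<^sup>2 \<le> 4 * (energy p * energy q)"
  using mandel_s_le[of p q] by (simp add: mandel_s_eq)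

lemma norm_diff_sq: "(norm (p - q))\<^sup>2 = (energy p - energy q)\<^sup>2 + (rel_mom p q)\<^sup>2"
  unfolding rel_mom_sq power2_diff energy_sq dot_norm_neg
  by (simp add: power2_norm_eq_inner inner_diff inner_commute algebra_simps)

lemma mandel_s_total: "mandel_s p q = (energy p + energy q)\<^sup>2 - (norm (p + q))\<^sup>2"
  unfolding mandel_s_def power2_sum energy_sq
  by (simp add: power2_norm_eq_inner inner_add inner_commute algebra_simps)

text \<open>Quantifies that g vanishes only at p = q: (p_0 q_0)^2 - (p . q + 1)^2 dominates |p -
  q|^2 and contains the factor g^2/2.\<close>

lemma norm_diff_sq_le: "(norm (p - q))\<^sup>2 \<le> (rel_mom p q)\<^sup>2 * (energy p * energy q)"
proof -
  define A where "A = energy p * energy q"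
  define x where "x = p \<bullet> q"
  have A2: "A\<^sup>2 = (1 + (norm p)\<^sup>2) * (1 + (norm q)\<^sup>2)"
    by (simp add: A_def power_mult_distrib energy_sq)
  have cs: "x\<^sup>2 \<le> (norm p)\<^sup>2 * (norm q)\<^sup>2"
    using Cauchy_Schwarz_ineq[of p q] by (simp add: x_def power2_norm_eq_inner)
  have n: "(norm (p - q))\<^sup>2 = (norm p)\<^sup>2 + (norm q)\<^sup>2 - 2 * x"
    by (simp add: x_def power2_norm_eq_inner inner_diff inner_commute)
  have "(norm (p - q))\<^sup>2 \<le> A\<^sup>2 - (x + 1)\<^sup>2"
    using A2 cs n by (simp add: power2_sum algebra_simps)
  also have "\<dots> = (A - x - 1) * (A + x + 1)" by (simp add: power2_eq_square algebra_simps)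
  also have "\<dots> \<le> (A - x - 1) * (2 * A)"
    using energy_mult_ge[of p q] by (intro mult_left_mono) (auto simp: A_def x_def)
  finally show ?thesis by (simp add: rel_mom_sq A_def x_def algebra_simps)
qed

lemma rel_mom_pos: "p \<noteq> q \<Longrightarrow> rel_mom p q > 0"
  using norm_diff_sq_le[of p q] rel_mom_nonneg[of p q] by (cases "rel_mom p q = 0") auto

text \<open>Useful when p_0 is much larger than q_0. It rests on q_0 - |q| = 1/(q_0 + |q|) \<ge>
  1/(2 q_0).\<close>

lemma rel_mom_sq_ge: "(rel_mom p q)\<^sup>2 \<ge> energy p / energy q - 2"
proof -
  have "p \<bullet> q \<le> norm p * norm q" by (rule norm_cauchy_schwarz)
  also have "\<dots> \<le> energy p * norm q" using norm_less_energy[of p] by (intro mult_right_mono) auto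
  finally have 1: "energy p * energy q - p \<bullet> q \<ge> energy p * (energy q - norm q)"
    by (simp add: algebra_simps)
  have "(energy q - norm q) * (energy q + norm q) = 1"
    using energy_sq[of q] by (simp add: power2_eq_square algebra_simps)
  moreover have "(energy q - norm q) * (energy q + norm q) \<le> (energy q - norm q) * (2 * energy q)"
    using norm_less_energy[of q] by (intro mult_left_mono) auto
  ultimately have "energy q - norm q \<ge> 1 / (2 * energy q)"
    using energy_pos[of q] by (simp add: field_simps)
  then have "energy p * (energy q - norm q) \<ge> energy p * (1 / (2 * energy q))"
    using energy_pos[of p] by (intro mult_left_mono) auto
  with 1 show ?thesis by (simp add: rel_mom_sq)
qed

lemma moller_velocity_nonneg: "moller_velocity p q \<ge> 0"
  using rel_mom_nonneg[of p q] energy_pos[of p] energy_pos[of q] mandel_s_ge_4[of p q]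
  by (simp add: moller_velocity_def)

lemma moller_velocity_le: "moller_velocity p q \<le> 4"
proof -
  define A where "A = energy p * energy q"
  have A: "A > 0" using energy_pos[of p] energy_pos[of q] by (simp add: A_def)
  have "sqrt (4 * A) = 2 * sqrt A" by (subst real_sqrt_mult) simp
  moreover have "rel_mom p q \<le> sqrt (4 * A)"
    unfolding A_def by (intro real_le_rsqrt rel_mom_sq_le)
  moreover have "sqrt (mandel_s p q) \<le> sqrt (4 * A)"
    unfolding A_def by (intro real_sqrt_le_mono mandel_s_le)
  ultimately have "rel_mom p q * sqrt (mandel_s p q) \<le> (2 * sqrt A) * (2 * sqrt A)"
    using A mandel_s_ge_4[of p q] rel_mom_nonneg[of p q] by (intro mult_mono) auto
  also have "(2 * sqrt A) * (2 * sqrt A) = 4 * A" using A by simp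
  finally show ?thesis using A by (simp add: moller_velocity_def A_def[symmetric] pos_divide_le_eq)
qed

lemma rel_mom_le_sqrt_mandel: "rel_mom p q \<le> sqrt (mandel_s p q)"
  by (rule real_le_rsqrt) (simp add: mandel_s_eq)

lemma quotient_cancel1: "a \<noteq> 0 \<Longrightarrow> S \<noteq> 0 \<Longrightarrow> c \<noteq> 0 \<Longrightarrow> (a / S) * (w / (a * c)) = w / (S * c)" for a S c w :: real
  by (simp add: field_simps)
lemma quotient_cancel2: "S \<noteq> 0 \<Longrightarrow> c \<noteq> 0 \<Longrightarrow> 1 / (S * c) * (a * c) = a / S" for a S c w :: real
  by (simp add: field_simps)

lemma quotient_cancel3: "S \<noteq> 0 \<Longrightarrow> c \<noteq> 0 \<Longrightarrow> 1 / (S * c) * (c / S) = 1 / S\<^sup>2" for S c :: real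
  by (simp add: power2_eq_square)

text \<open>As |p + q|^2 = (p_0 + q_0)^2 - s, the coefficient in the definition can be rationalised;
  the new denominator stays positive at p + q = 0.\<close>

lemma scatter_dir_eq:
  "scatter_dir p q \<omega> = \<omega> + ((p + q) \<bullet> \<omega> / (sqrt (mandel_s p q) * (energy p + energy q + sqrt (mandel_s p q)))) *\<^sub>R (p + q)"
proof (cases "p + q = 0")
  case False
  define E where "E = energy p + energy q"
  define S where "S = sqrt (mandel_s p q)"
  define n where "n = norm (p + q)"
  have S: "S > 0" using mandel_s_ge_4[of p q] by (simp add: S_def)
  have E: "E > 0" using energy_pos[of p] energy_pos[of q] by (simp add: E_def)
  have n: "n > 0" using False by (simp add: n_def)
  have S2: "S\<^sup>2 = E\<^sup>2 - n\<^sup>2" using mandel_s_ge_4[of p q] by (simp add: S_def E_def n_def mandel_s_total)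
  have "(E / S - 1) * (w / n\<^sup>2) = w / (S * (E + S))" for w
  proof -
    have n2: "n\<^sup>2 = (E - S) * (E + S)" using S2 by (simp add: power2_eq_square algebra_simps)
    then have "E - S \<noteq> 0" using n by auto
    moreover have "E / S - 1 = (E - S) / S" using S by (simp add: diff_divide_distrib)
    ultimately show ?thesis unfolding n2 using quotient_cancel1[of "E - S" S "E + S"] S E by simp
  qed
  then show ?thesis unfolding scatter_dir_def E_def S_def n_def by simp
qed (simp add: scatter_dir_def)

lemma post_add: "post_p p q \<omega> + post_q p q \<omega> = p + q"
  by (simp add: post_p_def post_q_def vec_eq_iff)

text \<open>Here \<open>\<sigma>\<close> is a sign that selects the outgoing particle, not the
  kernel. The right-hand side has the square demanded by the mass shell, and it is nonnegative
  because |(p + q) . \<omega>| \<le> p_0 + q_0 and g \<le> sqrt s.\<close>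

lemma energy_half_add_scatter:
  assumes \<omega>: "norm \<omega> = 1" and \<sigma>: "\<sigma> = 1 \<or> \<sigma> = (-1::real)"
  shows "energy ((1/2) *\<^sub>R (p + q) + (\<sigma> * (rel_mom p q / 2)) *\<^sub>R scatter_dir p q \<omega>)
    = (energy p + energy q) / 2 + \<sigma> * (rel_mom p q / (2 * sqrt (mandel_s p q))) * ((p + q) \<bullet> \<omega>)"
proof -
  define E where "E = energy p + energy q"
  define S where "S = sqrt (mandel_s p q)"
  define P where "P = p + q"
  define g where "g = rel_mom p q"
  define w where "w = P \<bullet> \<omega>"
  define \<kappa> where "\<kappa> = 1 / (S * (E + S))"
  define D where "D = scatter_dir p q \<omega>"
  have S: "S > 0" using mandel_s_ge_4[of p q] by (simp add: S_def)
  have E: "E > 0" using energy_pos[of p] energy_pos[of q] by (simp add: E_def)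
  have S2: "S\<^sup>2 = E\<^sup>2 - P \<bullet> P" using mandel_s_ge_4[of p q]
    by (simp add: S_def E_def P_def mandel_s_total power2_norm_eq_inner)
  have g2: "g\<^sup>2 = S\<^sup>2 - 4" using mandel_s_ge_4[of p q] by (simp add: S_def g_def mandel_s_eq)
  have g0: "g \<ge> 0" by (simp add: g_def rel_mom_nonneg)
  have gS: "g \<le> S" unfolding g_def S_def by (rule rel_mom_le_sqrt_mandel)
  have kP: "\<kappa> * (P \<bullet> P) = E / S - 1"
  proof -
    have "P \<bullet> P = (E - S) * (E + S)" using S2 by (simp add: power2_eq_square algebra_simps)
    then show ?thesis using quotient_cancel2[of S "E + S" "E - S"] S E by (simp add: \<kappa>_def diff_divide_distrib)
  qed
  have D: "D = \<omega> + (\<kappa> * w) *\<^sub>R P"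
    by (simp add: D_def scatter_dir_eq \<kappa>_def w_def P_def S_def E_def)
  have PD: "P \<bullet> D = w * (E / S)"
  proof -
    have "P \<bullet> D = w + w * (\<kappa> * (P \<bullet> P))" by (simp add: D inner_add_right w_def mult_ac)
    then show ?thesis using kP by (simp add: algebra_simps)
  qed
  have DD: "D \<bullet> D = 1 + w\<^sup>2 / S\<^sup>2"
  proof -
    have "D \<bullet> D = \<omega> \<bullet> \<omega> + 2 * \<kappa> * w\<^sup>2 + \<kappa> * w\<^sup>2 * (\<kappa> * (P \<bullet> P))"
      by (simp add: D inner_add_right inner_add_left w_def inner_commute power2_eq_square algebra_simps)
    also have "\<dots> = 1 + w\<^sup>2 * (\<kappa> * (E / S + 1))"
      unfolding kP using \<omega> by (simp add: algebra_simps norm_eq_1)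
    also have "\<kappa> * (E / S + 1) = 1 / S\<^sup>2"
    proof -
      have "E / S + 1 = (E + S) / S" using S by (simp add: add_divide_distrib)
      then show ?thesis using quotient_cancel3[of S "E + S"] S E by (simp add: \<kappa>_def)
    qed
    finally show ?thesis by simp
  qed
  have s2: "\<sigma>\<^sup>2 = 1" using \<sigma> by auto
  define c where "c = E / 2 + \<sigma> * (g / (2 * S)) * w"
  have wE: "\<bar>w\<bar> \<le> E"
  proof -
    have "\<bar>w\<bar> \<le> norm P" using Cauchy_Schwarz_ineq2[of P \<omega>] \<omega> by (simp add: w_def)
    also have "\<dots> \<le> E" 
      using norm_triangle_ineq[of p q] norm_less_energy[of p] norm_less_energy[of q] by (simp add: P_def E_def)
    finally show ?thesis .
  qed
  have "\<bar>\<sigma> * (g / (2 * S)) * w\<bar> \<le> 1 * (1/2) * E"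
    unfolding abs_mult using \<sigma> g0 gS S wE E by (intro mult_mono) (auto simp: field_simps)
  then have c0: "c \<ge> 0" unfolding c_def by linarith
  have "1 + (norm ((1/2) *\<^sub>R P + (\<sigma> * (g / 2)) *\<^sub>R D))\<^sup>2
      = 1 + (P \<bullet> P) / 4 + \<sigma> * g / 2 * (P \<bullet> D) + \<sigma>\<^sup>2 * g\<^sup>2 / 4 * (D \<bullet> D)"
    unfolding power2_norm_eq_inner
    by (simp add: inner_add_right inner_add_left inner_commute power2_eq_square algebra_simps)
  also have "\<dots> = c\<^sup>2"
  proof -
    have PP: "P \<bullet> P = E\<^sup>2 - S\<^sup>2" using S2 by simp
    have "c\<^sup>2 = E\<^sup>2 / 4 + E * (\<sigma> * (g / (2 * S)) * w) + \<sigma>\<^sup>2 * g\<^sup>2 / (4 * S\<^sup>2) * w\<^sup>2"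
      unfolding c_def using S by (simp add: power2_sum power_divide power_mult_distrib)
    moreover have "1 + (P \<bullet> P) / 4 + \<sigma> * g / 2 * (P \<bullet> D) + \<sigma>\<^sup>2 * g\<^sup>2 / 4 * (D \<bullet> D)
       = 1 + (E\<^sup>2 - S\<^sup>2) / 4 + g\<^sup>2 / 4 + E * (\<sigma> * (g / (2 * S)) * w) + \<sigma>\<^sup>2 * g\<^sup>2 / (4 * S\<^sup>2) * w\<^sup>2"
      unfolding PP PD DD using S s2 by (simp add: field_simps)
    moreover have "1 + (E\<^sup>2 - S\<^sup>2) / 4 + g\<^sup>2 / 4 = E\<^sup>2 / 4" using g2 by (simp add: field_simps)
    ultimately show ?thesis by simp
  qed
  finally have "energy ((1/2) *\<^sub>R P + (\<sigma> * (g / 2)) *\<^sub>R D) = c"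
    using c0 by (simp add: energy_def)
  then show ?thesis by (simp add: c_def P_def g_def S_def E_def D_def w_def)
qed

lemma energy_post_p:
  assumes "norm \<omega> = 1"
  shows "energy (post_p p q \<omega>) = (energy p + energy q) / 2 + rel_mom p q / (2 * sqrt (mandel_s p q)) * ((p + q) \<bullet> \<omega>)"
  using energy_half_add_scatter[OF assms, of 1 p q] by (simp add: post_p_def)

lemma energy_post_q:
  assumes "norm \<omega> = 1"
  shows "energy (post_q p q \<omega>) = (energy p + energy q) / 2 - rel_mom p q / (2 * sqrt (mandel_s p q)) * ((p + q) \<bullet> \<omega>)"
  using energy_half_add_scatter[OF assms, of "-1" p q] by (simp add: post_q_def)

lemma energy_post_add:
  "norm \<omega> = 1 \<Longrightarrow> energy (post_p p q \<omega>) + energy (post_q p q \<omega>) = energy p + energy q"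
  by (simp add: energy_post_p energy_post_q)

text \<open>The momentum \<open>p - q\<close>, boosted to the frame in which the total momentum vanishes.\<close>

definition com_mom :: "vec3 \<Rightarrow> vec3 \<Rightarrow> vec3" where
  "com_mom p q = (p - q) - ((energy p - energy q) / (energy p + energy q + sqrt (mandel_s p q))) *\<^sub>R (p + q)"

lemma norm_sq_diff_scaleR: "(norm (a - r *\<^sub>R b))\<^sup>2 = (norm a)\<^sup>2 - 2 * r * (a \<bullet> b) + r\<^sup>2 * (b \<bullet> b)"
  for a b :: "'a::real_inner"
  unfolding power2_norm_eq_inner by (simp add: inner_diff inner_commute power2_eq_square algebra_simps)

text \<open>In the centre-of-momentum frame both energies agree, so the invariant |p - q|^2 - (p_0 -
  q_0)^2 = g^2 is carried by the spatial part alone.\<close>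

lemma norm_com_mom: "norm (com_mom p q) = rel_mom p q"
proof (rule power2_eq_imp_eq)
  define E where "E = energy p + energy q"
  define S where "S = sqrt (mandel_s p q)"
  define P where "P = p + q"
  define d where "d = energy p - energy q"
  have S: "S > 0" using mandel_s_ge_4[of p q] by (simp add: S_def)
  have E: "E > 0" using energy_pos[of p] energy_pos[of q] by (simp add: E_def)
  have S2: "S\<^sup>2 = E\<^sup>2 - P \<bullet> P" using mandel_s_ge_4[of p q]
    by (simp add: S_def E_def P_def mandel_s_total power2_norm_eq_inner)
  have PP: "P \<bullet> P = (E - S) * (E + S)" using S2 by (simp add: power2_eq_square algebra_simps)
  have pq: "(p - q) \<bullet> P = E * d"
    using energy_sq_inner[of p] energy_sq_inner[of q]
    by (simp add: P_def E_def d_def inner_add_right inner_diff_left inner_commute algebra_simps)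
  define c where "c = E + S"
  define r where "r = d / c"
  have c: "c > 0" using E S by (simp add: c_def)
  have com: "com_mom p q = (p - q) - r *\<^sub>R P"
    by (simp add: com_mom_def r_def c_def E_def S_def P_def d_def)
  have "(norm (com_mom p q))\<^sup>2 = (norm (p - q))\<^sup>2 - 2 * r * ((p - q) \<bullet> P) + r\<^sup>2 * (P \<bullet> P)"
    unfolding com by (rule norm_sq_diff_scaleR)
  also have "r\<^sup>2 * (P \<bullet> P) = d\<^sup>2 / c * (E - S)"
    unfolding PP using c by (simp add: c_def[symmetric] r_def power2_eq_square)
  also have "2 * r * ((p - q) \<bullet> P) = d\<^sup>2 / c * (2 * E)"
    unfolding pq by (simp add: r_def power2_eq_square)
  also have "(norm (p - q))\<^sup>2 - d\<^sup>2 / c * (2 * E) + d\<^sup>2 / c * (E - S) = (norm (p - q))\<^sup>2 - d\<^sup>2 / c * c"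
  proof -
    define K where "K = d\<^sup>2 / c"
    show ?thesis unfolding K_def[symmetric] unfolding c_def by (simp add: algebra_simps)
  qed
  also have "\<dots> = (norm (p - q))\<^sup>2 - d\<^sup>2" using c by simp
  also have "\<dots> = (rel_mom p q)\<^sup>2" by (simp add: norm_diff_sq d_def)
  finally show "(norm (com_mom p q))\<^sup>2 = (rel_mom p q)\<^sup>2" .
qed (simp_all add: rel_mom_nonneg)

text \<open>Turns the invariant definition into the angle between \<omega> and a fixed axis, so that
  angular integrals become integrals over [-1, 1]. If g = 0, both sides are \<open>arccos 0\<close>,
  as division by zero gives zero.\<close>

lemma scatter_angle_eq:
  assumes "norm \<omega> = 1"
  shows "scatter_angle p q \<omega> = arccos ((com_mom p q /\<^sub>R rel_mom p q) \<bullet> \<omega>)"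
proof (cases "rel_mom p q = 0")
  case False
  define E where "E = energy p + energy q"
  define S where "S = sqrt (mandel_s p q)"
  define P where "P = p + q"
  define d where "d = energy p - energy q"
  define g where "g = rel_mom p q"
  define w where "w = P \<bullet> \<omega>"
  have g: "g \<noteq> 0" using False by (simp add: g_def)
  have S: "S > 0" using mandel_s_ge_4[of p q] by (simp add: S_def)
  have E: "E > 0" using energy_pos[of p] energy_pos[of q] by (simp add: E_def)
  have pq: "(p - q) \<bullet> P = E * d"
    using energy_sq_inner[of p] energy_sq_inner[of q]
    by (simp add: P_def E_def d_def inner_add_right inner_diff_left inner_commute algebra_simps)
  have en: "energy (post_p p q \<omega>) - energy (post_q p q \<omega>) = g / S * w"
    by (simp add: energy_post_p energy_post_q assms g_def S_def w_def P_def field_simps)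
  have "post_p p q \<omega> - post_q p q \<omega> = g *\<^sub>R scatter_dir p q \<omega>"
    by (simp add: post_p_def post_q_def g_def vec_eq_iff)
  also have "scatter_dir p q \<omega> = \<omega> + (w / (S * (E + S))) *\<^sub>R P"
    by (simp add: scatter_dir_eq w_def P_def S_def E_def)
  finally have "(p - q) \<bullet> (post_p p q \<omega> - post_q p q \<omega>) = g * ((p - q) \<bullet> \<omega> + w / (S * (E + S)) * (E * d))"
    by (simp add: inner_add_right pq)
  then have "- d * (g / S * w) + (p - q) \<bullet> (post_p p q \<omega> - post_q p q \<omega>)
      = g * ((p - q) \<bullet> \<omega> + (w / (S * (E + S)) * (E * d) - d * w / S))"
    by (simp add: algebra_simps)
  also have "w / (S * (E + S)) * (E * d) - d * w / S = - (d / (E + S) * w)"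
  proof -
    define c where "c = E + S"
    have c: "c > 0" and E: "E = c - S" using S E by (simp_all add: c_def)
    show ?thesis unfolding c_def[symmetric] unfolding E using S c by (simp add: field_simps)
  qed
  also have "(p - q) \<bullet> \<omega> + - (d / (E + S) * w) = (p - q) \<bullet> \<omega> - d / (E + S) * w" by simp
  also have "(p - q) \<bullet> \<omega> - d / (E + S) * w = com_mom p q \<bullet> \<omega>"
    by (simp add: com_mom_def inner_diff_left d_def E_def S_def w_def P_def)
  finally have num: "- (energy p - energy q) * (energy (post_p p q \<omega>) - energy (post_q p q \<omega>))
      + (p - q) \<bullet> (post_p p q \<omega> - post_q p q \<omega>) = g * (com_mom p q \<bullet> \<omega>)"
    by (simp add: en d_def)
  show ?thesis
    unfolding scatter_angle_def num using g by (simp add: g_def[symmetric] power2_eq_square inverse_eq_divide)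
qed (simp add: scatter_angle_def)

lemma norm_scatter_axis: "p \<noteq> q \<Longrightarrow> norm (com_mom p q /\<^sub>R rel_mom p q) = 1"
  using rel_mom_pos[of p q] by (simp add: norm_com_mom)

section \<open>Auxiliary integrals\<close>

lemma measurable_arccos [measurable]: "arccos \<in> borel_measurable borel"
proof -
  \<comment> \<open>Outside [-1, 1] the predicate that \<open>arccos\<close> describes is empty,
    hence the same for all arguments, so \<open>arccos\<close> has there one common unspecified
    value.\<close>
  have out: "arccos x = arccos 2" if "x \<notin> {-1..1}" for x :: real
  proof -
    have n1: "cos y \<noteq> x" for y
      using that cos_le_one[of y] cos_ge_minus_one[of y] by auto
    have n2: "cos y \<noteq> 2" for y :: real
      using cos_le_one[of y] by linarith
    have "(\<lambda>y. 0 \<le> y \<and> y \<le> pi \<and> cos y = x) = (\<lambda>y. 0 \<le> y \<and> y \<le> pi \<and> cos y = 2)"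
      by (rule ext) (simp add: n1 n2)
    then show ?thesis unfolding arccos_def by (rule arg_cong[where f=The])
  qed
  have "arccos = (\<lambda>x. indicator {-1..1} x *\<^sub>R arccos x + indicator (- {-1..1}) x * arccos 2)"
  proof
    fix x :: real
    show "arccos x = indicator {-1..1} x *\<^sub>R arccos x + indicator (- {-1..1}) x * arccos 2"
      using out[of x] by (cases "x \<in> {-1..1}") simp_all
  qed
  also have "\<dots> \<in> borel_measurable borel"
    by (intro borel_measurable_add borel_measurable_continuous_on_indicator continuous_on_arccos' borel_measurable_times) auto
  finally show ?thesis .
qed

section \<open>Measurability of the collision kinematics\<close>

lemma measurable_energy [measurable]: "energy \<in> borel_measurable borel"
  unfolding energy_def by measurable

lemma measurable_velocity [measurable]: "velocity \<in> borel_measurable borel"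
  unfolding velocity_def by measurable

lemma measurable_juttner [measurable]: "juttner \<in> borel_measurable borel"
  unfolding juttner_def by measurable

lemma measurable_rel_mom [measurable (raw)]:
  assumes [measurable]: "f \<in> borel_measurable M" "g \<in> borel_measurable M"
  shows "(\<lambda>x. rel_mom (f x) (g x)) \<in> borel_measurable M"
  unfolding rel_mom_def by measurable

lemma measurable_mandel_s [measurable (raw)]:
  assumes [measurable]: "f \<in> borel_measurable M" "g \<in> borel_measurable M"
  shows "(\<lambda>x. mandel_s (f x) (g x)) \<in> borel_measurable M"
  unfolding mandel_s_def by measurable

lemma measurable_moller [measurable (raw)]:
  assumes [measurable]: "f \<in> borel_measurable M" "g \<in> borel_measurable M"
  shows "(\<lambda>x. moller_velocity (f x) (g x)) \<in> borel_measurable M"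
  unfolding moller_velocity_def by measurable

lemma measurable_scatter_dir [measurable (raw)]:
  assumes [measurable]: "f \<in> borel_measurable M" "g \<in> borel_measurable M" "h \<in> borel_measurable M"
  shows "(\<lambda>x. scatter_dir (f x) (g x) (h x)) \<in> borel_measurable M"
  unfolding scatter_dir_def by measurable

lemma measurable_post_p [measurable (raw)]:
  assumes [measurable]: "f \<in> borel_measurable M" "g \<in> borel_measurable M" "h \<in> borel_measurable M"
  shows "(\<lambda>x. post_p (f x) (g x) (h x)) \<in> borel_measurable M"
  unfolding post_p_def by measurable

lemma measurable_post_q [measurable (raw)]:
  assumes [measurable]: "f \<in> borel_measurable M" "g \<in> borel_measurable M" "h \<in> borel_measurable M"
  shows "(\<lambda>x. post_q (f x) (g x) (h x)) \<in> borel_measurable M"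
  unfolding post_q_def by measurable

lemma measurable_scatter_angle [measurable (raw)]:
  assumes [measurable]: "f \<in> borel_measurable M" "g \<in> borel_measurable M" "h \<in> borel_measurable M"
  shows "(\<lambda>x. scatter_angle (f x) (g x) (h x)) \<in> borel_measurable M"
  unfolding scatter_angle_def by measurable

text \<open>Apply ln y \<le> y - 1 with y = \<delta> x / a; for a > 0 the constant is
  (a/\<delta>)^a, written as an exponential.\<close>

lemma powr_le_exp:
  fixes a \<delta> :: real
  assumes "a \<ge> 0" "\<delta> > 0"
  obtains C where "C > 0" "\<And>x. x > 0 \<Longrightarrow> x powr a \<le> C * exp (\<delta> * x)"
proof (cases "a = 0")
  case True
  show ?thesis by (rule that[of 1]) (use assms True in auto)
next
  case False
  then have a: "a > 0" using assms by simp
  show ?thesis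
  proof (rule that[of "exp (a * ln (a / \<delta>))"])
    fix x :: real assume x: "x > 0"
    have "ln (x * \<delta> / a) \<le> x * \<delta> / a - 1" using x a assms by (intro ln_le_minus_one) simp
    then have "a * ln (x * \<delta> / a) \<le> a * (x * \<delta> / a)" using a by (intro mult_left_mono) auto
    then have 1: "a * ln (x * \<delta> / a) \<le> \<delta> * x" using a by (simp add: mult.commute)
    have "ln x = ln (x * \<delta> / a) + ln (a / \<delta>)"
    proof -
      have "ln ((x * \<delta> / a) * (a / \<delta>)) = ln (x * \<delta> / a) + ln (a / \<delta>)"
        by (subst ln_mult) (use x a assms in auto)
      moreover have "(x * \<delta> / a) * (a / \<delta>) = x" using a assms by simp
      ultimately show ?thesis by (simp only:)
    qed
    then have "a * ln x \<le> a * ln (a / \<delta>) + \<delta> * x" using 1 by (simp add: distrib_left)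
    then show "x powr a \<le> exp (a * ln (a / \<delta>)) * exp (\<delta> * x)"
      using x by (simp add: powr_def mult_exp_exp)
  qed simp
qed

section \<open>Integrals of powers and exponentials\<close>

lemma nn_integral_abs_powr_finite:
  fixes a c :: real
  assumes a: "a > -1" and c: "c \<ge> 0"
  shows "(\<integral>\<^sup>+x. ennreal (\<bar>x\<bar> powr a) * indicator {-c..c} x \<partial>lborel) < \<infinity>"
proof -
  define h where "h = (\<lambda>x::real. ennreal (x powr a) * indicator {0..c} x)"
  have [measurable]: "h \<in> borel_measurable borel" unfolding h_def by measurable
  have h: "(\<integral>\<^sup>+x. h x \<partial>lborel) = ennreal (c powr (a+1) / (a+1))"
    unfolding h_def by (rule nn_integral_has_integral_lebesgue'[OF _ has_integral_powr_from_0[OF a c]]) simp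
  have h': "(\<integral>\<^sup>+x. h (- x) \<partial>lborel) = (\<integral>\<^sup>+x. h x \<partial>lborel)"
    by (subst (2) nn_integral_real_affine[where c="-1" and t=0]) simp_all
  have "(\<integral>\<^sup>+x. ennreal (\<bar>x\<bar> powr a) * indicator {-c..c} x \<partial>lborel) \<le> (\<integral>\<^sup>+x. h x + h (- x) \<partial>lborel)"
    by (rule nn_integral_mono) (auto simp: h_def indicator_def abs_if)
  also have "\<dots> = ennreal (c powr (a+1) / (a+1)) + ennreal (c powr (a+1) / (a+1))"
    by (subst nn_integral_add) (simp_all add: h h')
  finally show ?thesis by (simp add: order.strict_trans1)
qed

text \<open>The angular singularity in the variable u = cos \<theta>: since 1 - u^2 \<ge> 1 - |u|,
  it is controlled by the power a/2 > -1 of the distance to each end point.\<close>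

lemma nn_integral_sin_powr_finite:
  fixes a :: real
  assumes a: "-2 < a" "a \<le> 0"
  shows "(\<integral>\<^sup>+u. ennreal (sqrt (1 - u\<^sup>2) powr a) * indicator {-1<..<1} u \<partial>lborel) < \<infinity>"
proof -
  define h where "h = (\<lambda>x::real. ennreal (\<bar>x\<bar> powr (a/2)) * indicator {-2..2} x)"
  have [measurable]: "h \<in> borel_measurable borel" unfolding h_def by measurable
  have h: "(\<integral>\<^sup>+x. h x \<partial>lborel) < \<infinity>"
    unfolding h_def by (rule nn_integral_abs_powr_finite) (use a in auto)
  have h1: "(\<integral>\<^sup>+x. h (1 - x) \<partial>lborel) = (\<integral>\<^sup>+x. h x \<partial>lborel)"
    by (subst (2) nn_integral_real_affine[where c="-1" and t=1]) simp_all
  have h2: "(\<integral>\<^sup>+x. h (1 + x) \<partial>lborel) = (\<integral>\<^sup>+x. h x \<partial>lborel)"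
    by (subst (2) nn_integral_real_affine[where c="1" and t=1]) simp_all
  have "(\<integral>\<^sup>+u. ennreal (sqrt (1 - u\<^sup>2) powr a) * indicator {-1<..<1} u \<partial>lborel) \<le> (\<integral>\<^sup>+u. h (1 - u) + h (1 + u) \<partial>lborel)"
  proof (rule nn_integral_mono)
    fix u :: real
    show "ennreal (sqrt (1 - u\<^sup>2) powr a) * indicator {-1<..<1} u \<le> h (1 - u) + h (1 + u)"
    proof (cases "u \<in> {-1<..<1}")
      case u: True
      have pos: "1 - u\<^sup>2 > 0" using u by (auto simp: abs_square_less_1 abs_less_iff)
      have e: "sqrt (1 - u\<^sup>2) powr a = (1 - u\<^sup>2) powr (a / 2)"
        using pos by (simp add: powr_half_sqrt[symmetric] powr_powr)
      have f: "1 - u\<^sup>2 = (1 - u) * (1 + u)" by (simp add: power2_eq_square algebra_simps)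
      show ?thesis
      proof (cases "u \<ge> 0")
        case True
        have "(1 - u) * 1 \<le> 1 - u\<^sup>2" unfolding f using u True by (intro mult_left_mono) auto
        then have "(1 - u\<^sup>2) powr (a / 2) \<le> (1 - u) powr (a / 2)" using u a by (intro powr_mono2') auto
        then have "ennreal (sqrt (1 - u\<^sup>2) powr a) * indicator {-1<..<1} u \<le> h (1 - u)"
          using u by (auto simp: e h_def indicator_def intro!: ennreal_leI)
        then show ?thesis by (rule order_trans) simp
      next
        case False
        have "1 * (1 + u) \<le> 1 - u\<^sup>2" unfolding f using u False by (intro mult_right_mono) auto
        then have "(1 - u\<^sup>2) powr (a / 2) \<le> (1 + u) powr (a / 2)" using u a by (intro powr_mono2') auto
        then have "ennreal (sqrt (1 - u\<^sup>2) powr a) * indicator {-1<..<1} u \<le> h (1 + u)"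
          using u by (auto simp: e h_def indicator_def intro!: ennreal_leI)
        then show ?thesis by (rule order_trans) simp
      qed
    qed simp
  qed
  also have "\<dots> = (\<integral>\<^sup>+x. h x \<partial>lborel) + (\<integral>\<^sup>+x. h x \<partial>lborel)"
    by (subst nn_integral_add) (simp_all add: h1 h2)
  finally show ?thesis using h by (simp add: order.strict_trans1)
qed

lemma nn_integral_sphere_angle:
  fixes H :: "real \<Rightarrow> real"
  assumes [measurable]: "H \<in> borel_measurable borel" and H: "\<And>u. H u \<ge> 0" and k: "norm k = 1"
  shows "(\<integral>\<^sup>+\<omega>. ennreal (H (arccos (k \<bullet> \<omega>))) \<partial>sphere_measure)
    = ennreal (2 * pi) * (\<integral>\<^sup>+u. ennreal (H (arccos u)) * indicator {-1<..<1} u \<partial>lborel)"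
  by (rule nn_integral_sphere_inner[of "\<lambda>u. H (arccos u)"]) (simp_all add: H k)

lemma AE_sphere_inner:
  assumes k: "norm k = 1"
  shows "AE \<omega> in sphere_measure. norm \<omega> = 1 \<and> k \<bullet> \<omega> \<in> {-1<..<1}"
proof -
  have "(\<integral>\<^sup>+\<omega>. ennreal (indicator (- {-1<..<1}) (k \<bullet> \<omega>)) \<partial>sphere_measure) = 0"
    by (subst nn_integral_sphere_inner[OF _ _ k])
       (auto simp: nn_integral_0_iff_AE indicator_def)
  then have "AE \<omega> in sphere_measure. k \<bullet> \<omega> \<in> {-1<..<1}"
    by (subst (asm) nn_integral_0_iff_AE) (auto simp: indicator_def elim!: eventually_mono split: if_splits)
  then show ?thesis using AE_sphere_norm by eventually_elim simp
qed

text \<open>The exponential is concentrated on a cap of area of order 1/a around k. With a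
  proportional to the total energy this is the source of the smallness of the gain part.\<close>

lemma nn_integral_sphere_exp_le:
  assumes k: "norm k = 1" and a: "a > 0"
  shows "(\<integral>\<^sup>+\<omega>. ennreal (exp (- a * (1 - k \<bullet> \<omega>))) \<partial>sphere_measure) \<le> ennreal (2 * pi / a)"
proof -
  have "(\<integral>\<^sup>+\<omega>. ennreal (exp (- a * (1 - k \<bullet> \<omega>))) \<partial>sphere_measure)
     = ennreal (2 * pi) * (\<integral>\<^sup>+u. ennreal (exp (- a * (1 - u))) * indicator {-1<..<1} u \<partial>lborel)"
    by (rule nn_integral_sphere_inner[of "\<lambda>u. exp (- a * (1 - u))"]) (simp_all add: k)
  also have "(\<integral>\<^sup>+u. ennreal (exp (- a * (1 - u))) * indicator {-1<..<1} u \<partial>lborel)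
     \<le> (\<integral>\<^sup>+u. ennreal (exp (- a * (1 - u))) * indicator {-1..1} u \<partial>lborel)"
    by (rule nn_integral_mono) (auto simp: indicator_def)
  also have "\<dots> = ennreal (exp (- a * (1 - 1)) / a - exp (- a * (1 - (-1))) / a)"
    by (rule nn_integral_FTC_Icc) (use a in \<open>auto intro!: derivative_eq_intros\<close>)
  also have "\<dots> \<le> ennreal (1 / a)" using a by (intro ennreal_leI) simp
  also have "ennreal (2 * pi) * ennreal (1 / a) = ennreal (2 * pi / a)"
    using a by (simp add: ennreal_mult[symmetric])
  finally show ?thesis by (simp add: mult_left_mono)
qed

lemma vec3_prod_Basis: "(\<Prod>b\<in>Basis. f (x \<bullet> b)) = f (x $ 1) * f (x $ 2) * f (x $ 3)"
  for x :: vec3 and f :: "real \<Rightarrow> ennreal"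
proof -
  have "(\<Prod>b\<in>Basis. f (x \<bullet> b)) = (\<Prod>b\<in>range (\<lambda>i. axis i 1). f (x \<bullet> b))"
    by (rule prod.cong) (auto simp: Basis_vec_def)
  also have "\<dots> = (\<Prod>i\<in>UNIV. f (x \<bullet> axis i 1))"
    by (subst prod.reindex) (auto simp: inj_on_def axis_eq_axis)
  also have "\<dots> = f (x $ 1) * f (x $ 2) * f (x $ 3)"
    unfolding UNIV_3 by (simp add: inner_axis mult.assoc)
  finally show ?thesis .
qed

text \<open>The norm is at least the mean of the absolute coordinates, so a product of
  one-dimensional exponentials dominates.\<close>

lemma nn_integral_exp_norm_finite:
  assumes d: "d > 0"
  shows "(\<integral>\<^sup>+(x::vec3). ennreal (exp (- d * norm x)) \<partial>lborel) < \<infinity>"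
proof -
  define f where "f = (\<lambda>x::real. ennreal (exp (- (d / 3) * \<bar>x\<bar>)))"
  have [measurable]: "f \<in> borel_measurable borel" unfolding f_def by measurable
  define h where "h = (\<lambda>x::real. ennreal (exp (- (d / 3) * x)) * indicator {0..} x)"
  have [measurable]: "h \<in> borel_measurable borel" unfolding h_def by measurable
  have h: "(\<integral>\<^sup>+x. h x \<partial>lborel) = ennreal (0 - (- exp (- (d / 3) * 0) / (d / 3)))"
    unfolding h_def
  proof (rule nn_integral_FTC_atLeast)
    show "((\<lambda>x. - exp (- (d / 3) * x) / (d / 3)) \<longlongrightarrow> 0) at_top"
      using d by real_asymp
  qed (use d in \<open>auto intro!: derivative_eq_intros\<close>)
  have h': "(\<integral>\<^sup>+x. h (- x) \<partial>lborel) = (\<integral>\<^sup>+x. h x \<partial>lborel)"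
    by (subst (2) nn_integral_real_affine[where c="-1" and t=0]) simp_all
  have "(\<integral>\<^sup>+x. f x \<partial>lborel) \<le> (\<integral>\<^sup>+x. h x + h (- x) \<partial>lborel)"
    by (rule nn_integral_mono) (auto simp: h_def f_def indicator_def abs_if)
  also have "\<dots> = (\<integral>\<^sup>+x. h x \<partial>lborel) + (\<integral>\<^sup>+x. h x \<partial>lborel)"
    by (subst nn_integral_add) (simp_all add: h')
  finally have fin: "(\<integral>\<^sup>+x. f x \<partial>lborel) < \<infinity>" by (simp add: h order.strict_trans1)
  have "(\<integral>\<^sup>+(x::vec3). ennreal (exp (- d * norm x)) \<partial>lborel) \<le> (\<integral>\<^sup>+(x::vec3). (\<Prod>b\<in>Basis. f (x \<bullet> b)) \<partial>lborel)"
  proof (rule nn_integral_mono)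
    fix x :: vec3
    have "\<bar>x $ i\<bar> \<le> norm x" for i using component_le_norm_cart[of x i] by simp
    moreover have "(a + b + c) / 3 \<le> n" if "a \<le> n" "b \<le> n" "c \<le> n" for a b c n :: real
      using that by simp
    ultimately have "(\<bar>x $ 1\<bar> + \<bar>x $ 2\<bar> + \<bar>x $ 3\<bar>) / 3 \<le> norm x"
      by blast
    then have "d * ((\<bar>x $ 1\<bar> + \<bar>x $ 2\<bar> + \<bar>x $ 3\<bar>) / 3) \<le> d * norm x" using d by (intro mult_left_mono) auto
    then have "exp (- d * norm x) \<le> exp (- (d / 3) * \<bar>x $ 1\<bar>) * exp (- (d / 3) * \<bar>x $ 2\<bar>) * exp (- (d / 3) * \<bar>x $ 3\<bar>)"
      by (simp add: mult_exp_exp algebra_simps)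
    then show "ennreal (exp (- d * norm x)) \<le> (\<Prod>b\<in>Basis. f (x \<bullet> b))"
      unfolding vec3_prod_Basis[of f x] unfolding f_def by (simp add: ennreal_mult[symmetric] ennreal_leI)
  qed
  also have "\<dots> = (\<Prod>b\<in>(Basis :: vec3 set). \<integral>\<^sup>+x. f x \<partial>lborel)"
    by (rule nn_integral_lborel_prod) simp_all
  also have "\<dots> < \<infinity>" using fin by (simp add: power_less_top_ennreal)
  finally show ?thesis .
qed

text \<open>The norm dominates each coordinate, so the power \<beta> can be split into three powers
  \<beta>/3 < 1, each integrable in one variable.\<close>

lemma nn_integral_norm_powr_finite:
  assumes \<beta>: "0 \<le> \<beta>" "\<beta> < 3"
  shows "(\<integral>\<^sup>+(x::vec3). ennreal (norm x powr (- \<beta>)) * indicator (cball 0 1) x \<partial>lborel) < \<infinity>"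
proof -
  define f where "f = (\<lambda>x::real. ennreal (\<bar>x\<bar> powr (- \<beta> / 3)) * indicator {-1..1} x)"
  have [measurable]: "f \<in> borel_measurable borel" unfolding f_def by measurable
  have fin: "(\<integral>\<^sup>+x. f x \<partial>lborel) < \<infinity>"
    unfolding f_def by (rule nn_integral_abs_powr_finite) (use \<beta> in auto)
  \<comment> \<open>Coordinate planes are discarded: \<open>0 powr (- \<beta> / 3)\<close> is 0 by
    convention, which would spoil the domination there.\<close>
  have nz: "AE x in (lborel :: vec3 measure). x $ i \<noteq> 0" for i
  proof -
    have "{x::vec3. x $ i = 0} \<in> null_sets lebesgue"
      using negligible_standard_hyperplane_cart[of i] by (simp add: negligible_iff_null_sets)
    then have "AE x in lebesgue. x \<notin> {x::vec3. x $ i = 0}" by (rule AE_not_in)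
    then show ?thesis by (simp add: AE_completion_iff)
  qed
  have "(\<integral>\<^sup>+(x::vec3). ennreal (norm x powr (- \<beta>)) * indicator (cball 0 1) x \<partial>lborel) \<le> (\<integral>\<^sup>+(x::vec3). (\<Prod>b\<in>Basis. f (x \<bullet> b)) \<partial>lborel)"
  proof (rule nn_integral_mono_AE)
    show "AE x in (lborel :: vec3 measure). ennreal (norm x powr (- \<beta>)) * indicator (cball 0 1) x \<le> (\<Prod>b\<in>Basis. f (x \<bullet> b))"
      using nz[of 1] nz[of 2] nz[of 3]
    proof eventually_elim
      case (elim x)
      have c: "\<bar>x $ i\<bar> \<le> norm x" for i using component_le_norm_cart[of x i] by simp
      have m: "norm x powr (- \<beta> / 3) \<le> \<bar>x $ i\<bar> powr (- \<beta> / 3)" if "x $ i \<noteq> 0" for i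
        using c[of i] that \<beta> by (intro powr_mono2') auto
      show ?case
      proof (cases "norm x \<le> 1")
        case True
        have "norm x powr (- \<beta>) = norm x powr (- \<beta> / 3) * norm x powr (- \<beta> / 3) * norm x powr (- \<beta> / 3)"
          by (simp add: powr_add[symmetric])
        also have "\<dots> \<le> \<bar>x $ 1\<bar> powr (- \<beta> / 3) * \<bar>x $ 2\<bar> powr (- \<beta> / 3) * \<bar>x $ 3\<bar> powr (- \<beta> / 3)"
          using m elim by (intro mult_mono) auto
        finally show ?thesis
          using True c[of 1] c[of 2] c[of 3] unfolding vec3_prod_Basis[of f x] unfolding f_def
          by (auto simp: ennreal_mult[symmetric] indicator_def ennreal_leI)
      qed simp
    qed
  qed
  also have "\<dots> = (\<Prod>b\<in>(Basis :: vec3 set). \<integral>\<^sup>+x. f x \<partial>lborel)"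
    by (rule nn_integral_lborel_prod) simp_all
  also have "\<dots> < \<infinity>" using fin by (simp add: power_less_top_ennreal)
  finally show ?thesis .
qed

section \<open>Estimates for the collision kernel\<close>

text \<open>The exponent \<open>\<gamma>\<close> may be taken nonpositive, because \<open>sin \<theta>\<close> is at most one.\<close>

locale soft_kernel =
  fixes b \<gamma> Csig csig :: real and \<sigma>0 :: "real \<Rightarrow> real" and \<sigma> :: "real \<Rightarrow> real \<Rightarrow> real"
  assumes kernel_measurable: "(\<lambda>(g, \<theta>). \<sigma> g \<theta>) \<in> borel_measurable borel"
    and b: "0 < b" "b < 4" and \<gamma>: "-2 < \<gamma>" "\<gamma> \<le> 0" and Csig: "Csig > 0" and csig: "csig > 0"
    and kernel_nonneg: "\<And>g \<theta>. g > 0 \<Longrightarrow> 0 \<le> \<theta> \<Longrightarrow> \<theta> \<le> pi \<Longrightarrow> 0 \<le> \<sigma> g \<theta>"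
    and kernel_le: "\<And>g \<theta>. g > 0 \<Longrightarrow> 0 < \<theta> \<Longrightarrow> \<theta> < pi \<Longrightarrow> \<sigma> g \<theta> \<le> Csig * g powr (- b) * sin \<theta> powr \<gamma>"
    and kernel_ge: "\<And>g \<theta>. g > 0 \<Longrightarrow> 0 < \<theta> \<Longrightarrow> \<theta> < pi \<Longrightarrow>
        csig * (g / sqrt (g\<^sup>2 + 4) * g powr (- b) * \<sigma>0 \<theta>) \<le> \<sigma> g \<theta>"
    and \<sigma>0_measurable [measurable]: "\<sigma>0 \<in> borel_measurable borel"
    and \<sigma>0_nonneg: "\<And>\<theta>. 0 \<le> \<theta> \<Longrightarrow> \<theta> \<le> pi \<Longrightarrow> 0 \<le> \<sigma>0 \<theta>"
    and \<sigma>0_nonzero: "emeasure lborel {\<theta> \<in> {0..pi}. \<sigma>0 \<theta> \<noteq> 0} > 0"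

lemma soft_potential_kernel:
  assumes "soft_potential b \<sigma>"
  obtains \<gamma> Csig csig \<sigma>0 where "soft_kernel b \<gamma> Csig csig \<sigma>0 \<sigma>"
proof -
  obtain \<sigma>0 \<gamma> C1 C2 c where *: "(\<lambda>(g, \<theta>). \<sigma> g \<theta>) \<in> borel_measurable borel"
    "\<forall>g>0. \<forall>\<theta>\<in>{0..pi}. \<sigma> g \<theta> \<ge> 0" "\<sigma>0 \<in> borel_measurable borel"
    "\<forall>\<theta>\<in>{0..pi}. \<sigma>0 \<theta> \<ge> 0" "emeasure lborel {\<theta> \<in> {0..pi}. \<sigma>0 \<theta> \<noteq> 0} > 0"
    "\<gamma> > -2" "0 < b" "b < min 4 (4 + \<gamma>)"
    "C1 > 0" "\<forall>\<theta>\<in>{0<..<pi}. \<sigma>0 \<theta> \<le> C1 * sin \<theta> powr \<gamma>"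
    "C2 > 0" "\<forall>g>0. \<forall>\<theta>\<in>{0<..<pi}. \<sigma> g \<theta> \<le> C2 * (g powr (- b) * \<sigma>0 \<theta>)"
    "c > 0" "\<forall>g>0. \<forall>\<theta>\<in>{0<..<pi}. \<sigma> g \<theta> \<ge> c * (g / sqrt (g\<^sup>2 + 4) * g powr (- b) * \<sigma>0 \<theta>)"
    using assms unfolding soft_potential_def by (elim exE conjE) (rule that; assumption)
  have "soft_kernel b (min \<gamma> 0) (C2 * C1) c \<sigma>0 \<sigma>"
  proof
    fix g \<theta> :: real assume g: "g > 0" and \<theta>: "0 < \<theta>" "\<theta> < pi"
    have s: "0 < sin \<theta>" using \<theta> by (rule sin_gt_zero)
    have "sin \<theta> powr \<gamma> \<le> sin \<theta> powr (min \<gamma> 0)"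
      using s by (intro powr_mono') auto
    then have "C1 * sin \<theta> powr \<gamma> \<le> C1 * sin \<theta> powr (min \<gamma> 0)"
      using *(9) by (intro mult_left_mono) auto
    moreover have "\<sigma>0 \<theta> \<le> C1 * sin \<theta> powr \<gamma>" using *(10) \<theta> by auto
    ultimately have "\<sigma>0 \<theta> \<le> C1 * sin \<theta> powr (min \<gamma> 0)" by (rule order_trans[rotated])
    then have "C2 * (g powr (- b) * \<sigma>0 \<theta>) \<le> C2 * (g powr (- b) * (C1 * sin \<theta> powr (min \<gamma> 0)))"
      using *(11) by (intro mult_left_mono) auto
    moreover have "\<sigma> g \<theta> \<le> C2 * (g powr (- b) * \<sigma>0 \<theta>)" using *(12) g \<theta> by auto
    ultimately show "\<sigma> g \<theta> \<le> C2 * C1 * g powr (- b) * sin \<theta> powr (min \<gamma> 0)" by (simp add: mult_ac)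
  qed (use * in auto)
  then show ?thesis by (rule that)
qed

lemma sigma_finite_sphere: "sigma_finite_measure sphere_measure"
  using finite_measure_sphere by (rule finite_measure.axioms)

lemma sin_arccos_inner: "\<bar>u\<bar> \<le> 1 \<Longrightarrow> sin (arccos u) = sqrt (1 - u\<^sup>2)"
  by (simp add: sin_arccos_abs)

text \<open>The outgoing particles share the energy p_0 + q_0, and the share is affine in the cosine
  of the angle to p + q. Each energy is large except near one pole, and the two poles are opposite.
  If p + q = 0, any axis serves.\<close>

lemma post_energy_axis:
  obtains k where "norm k = 1"
    "\<And>\<omega>. norm \<omega> = 1 \<Longrightarrow> energy (post_q p q \<omega>) \<ge> (energy p + energy q) / 4 * (1 - k \<bullet> \<omega>)"
    "\<And>\<omega>. norm \<omega> = 1 \<Longrightarrow> energy (post_p p q \<omega>) \<ge> (energy p + energy q) / 4 * (1 - (- k) \<bullet> \<omega>)"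
proof -
  define E where "E = energy p + energy q"
  define P where "P = p + q"
  define k where "k = (if P = 0 then axis 1 1 else P /\<^sub>R norm P)"
  define c where "c = rel_mom p q / (2 * sqrt (mandel_s p q))"
  have k: "norm k = 1" by (simp add: k_def norm_axis_1)
  have Pk: "P = norm P *\<^sub>R k" by (simp add: k_def)
  have E: "E > 0" using energy_pos[of p] energy_pos[of q] by (simp add: E_def)
  have PE: "norm P \<le> E"
    using norm_triangle_ineq[of p q] norm_less_energy[of p] norm_less_energy[of q] by (simp add: P_def E_def)
  have c: "0 \<le> c" "c \<le> 1/2"
    using rel_mom_nonneg[of p q] rel_mom_le_sqrt_mandel[of p q] mandel_s_ge_4[of p q]
    by (auto simp: c_def field_simps)
  have m: "0 \<le> c * norm P" "c * norm P \<le> E / 2"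
    using c PE E mult_mono[of c "1/2" "norm P" E] by auto
  \<comment> \<open>The slope c |P| is only known to lie between 0 and E/2; the factor 1/4 instead
    of 1/2 makes the bound valid for both signs of u.\<close>
  have key: "E / 2 - c * norm P * u \<ge> E / 4 * (1 - u)" if "\<bar>u\<bar> \<le> 1" for u
  proof (cases "u \<ge> 0")
    case True
    have "c * norm P * u \<le> E / 2 * u" using m True by (intro mult_right_mono) auto
    moreover have "E / 4 * (1 - u) \<le> E / 2 * (1 - u)" using E that by (intro mult_right_mono) auto
    moreover have "E / 2 * (1 - u) = E / 2 - E / 2 * u" by (simp add: right_diff_distrib)
    ultimately show ?thesis by linarith
  next
    case False
    have "c * norm P * u \<le> 0" using m False by (intro mult_nonneg_nonpos) auto
    moreover have "E / 4 * (1 - u) \<le> E / 4 * 2" using E that by (intro mult_left_mono) auto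
    ultimately show ?thesis by linarith
  qed
  have u: "\<bar>k \<bullet> \<omega>\<bar> \<le> 1" if "norm \<omega> = 1" for \<omega>
    using Cauchy_Schwarz_ineq2[of k \<omega>] that k by simp
  have Pw: "c * ((p + q) \<bullet> \<omega>) = c * norm P * (k \<bullet> \<omega>)" for \<omega>
    by (subst P_def[symmetric], subst Pk) simp
  show ?thesis
  proof (rule that[OF k])
    fix \<omega> :: vec3 assume w: "norm \<omega> = 1"
    show "energy (post_q p q \<omega>) \<ge> (energy p + energy q) / 4 * (1 - k \<bullet> \<omega>)"
    proof -
      have "energy (post_q p q \<omega>) = E / 2 - c * norm P * (k \<bullet> \<omega>)"
        unfolding energy_post_q[OF w] Pw[symmetric] by (simp add: E_def c_def)
      then show ?thesis using key[OF u[OF w]] unfolding E_def by simp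
    qed
    show "energy (post_p p q \<omega>) \<ge> (energy p + energy q) / 4 * (1 - (- k) \<bullet> \<omega>)"
    proof -
      have "energy (post_p p q \<omega>) = E / 2 - c * norm P * (- (k \<bullet> \<omega>))"
        unfolding energy_post_p[OF w] using Pw[of \<omega>] by (simp add: E_def c_def)
      then show ?thesis using key[of "- (k \<bullet> \<omega>)"] u[OF w] unfolding E_def by simp
    qed
  qed
qed

text \<open>A form of Young's inequality in which the power falls on the singular angular factor only,
  so that the bounded factor can still contribute its decay.\<close>

lemma mult_le_powr_split:
  fixes x y \<epsilon> \<tau> :: real
  assumes "x > 0" "0 \<le> y" "y \<le> 1" "\<epsilon> > 0" "\<tau> > 1"
  shows "x * y \<le> \<epsilon> * x powr \<tau> + (1 / \<epsilon>) powr (1 / (\<tau> - 1)) * y"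
proof (cases "x \<le> (1 / \<epsilon>) powr (1 / (\<tau> - 1))")
  case True
  then have "x * y \<le> (1 / \<epsilon>) powr (1 / (\<tau> - 1)) * y" using assms by (intro mult_right_mono) auto
  moreover have "0 \<le> \<epsilon> * x powr \<tau>" using assms by simp
  ultimately show ?thesis by linarith
next
  case False
  then have "((1 / \<epsilon>) powr (1 / (\<tau> - 1))) powr (\<tau> - 1) \<le> x powr (\<tau> - 1)"
    using assms by (intro powr_mono2) auto
  then have "1 / \<epsilon> \<le> x powr (\<tau> - 1)" using assms by (simp add: powr_powr)
  then have "1 \<le> \<epsilon> * x powr (\<tau> - 1)" using assms by (simp add: field_simps)
  then have "x * 1 \<le> x * (\<epsilon> * x powr (\<tau> - 1))" using assms by (intro mult_left_mono) auto
  also have "\<dots> = \<epsilon> * (x powr 1 * x powr (\<tau> - 1))" using assms by simp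
  also have "\<dots> = \<epsilon> * x powr \<tau>" by (simp only: powr_add[symmetric]) simp
  finally have "x \<le> \<epsilon> * x powr \<tau>" by simp
  moreover have "x * y \<le> x" using assms by (simp add: mult_left_le)
  moreover have "0 \<le> (1 / \<epsilon>) powr (1 / (\<tau> - 1)) * y" using assms by simp
  ultimately show ?thesis by linarith
qed

context soft_kernel
begin

lemma measurable_kernel [measurable (raw)]:
  assumes [measurable]: "f \<in> borel_measurable M" "g \<in> borel_measurable M"
  shows "(\<lambda>x. \<sigma> (f x) (g x)) \<in> borel_measurable M"
  using measurable_compose[of "\<lambda>x. (f x, g x)" M "borel \<Otimes>\<^sub>M borel", OF _ kernel_measurable[unfolded borel_prod[symmetric]]]
  by simp

text \<open>The kernel bounds concern angles strictly between 0 and pi, so the two poles of the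
  scattering axis are discarded.\<close>

lemma kernel_angle_le:
  assumes "p \<noteq> q"
  shows "AE \<omega> in sphere_measure. norm \<omega> = 1 \<and> 0 \<le> \<sigma> (rel_mom p q) (scatter_angle p q \<omega>) \<and>
     \<sigma> (rel_mom p q) (scatter_angle p q \<omega>) \<le> Csig * rel_mom p q powr (- b) *
        sin (arccos ((com_mom p q /\<^sub>R rel_mom p q) \<bullet> \<omega>)) powr \<gamma> \<and>
     0 < sin (arccos ((com_mom p q /\<^sub>R rel_mom p q) \<bullet> \<omega>)) \<and>
     csig * (rel_mom p q / sqrt ((rel_mom p q)\<^sup>2 + 4) * rel_mom p q powr (- b) *
       \<sigma>0 (arccos ((com_mom p q /\<^sub>R rel_mom p q) \<bullet> \<omega>))) \<le> \<sigma> (rel_mom p q) (scatter_angle p q \<omega>)"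
  using AE_sphere_inner[OF norm_scatter_axis[OF assms]]
proof eventually_elim
  case (elim \<omega>)
  define u where "u = (com_mom p q /\<^sub>R rel_mom p q) \<bullet> \<omega>"
  have u: "-1 < u" "u < 1" using elim by (auto simp: u_def)
  have a: "0 < arccos u" "arccos u < pi" using arccos_lt_bounded[of u] u by auto
  have g: "rel_mom p q > 0" using assms by (rule rel_mom_pos)
  have e: "scatter_angle p q \<omega> = arccos u" using elim by (simp add: scatter_angle_eq u_def)
  show ?case unfolding e u_def[symmetric]
    using kernel_nonneg[OF g, of "arccos u"] kernel_le[OF g a] kernel_ge[OF g a] sin_gt_zero[OF a] a elim by simp
qed

text \<open>Any exponent \<open>\<tau> > 1\<close> with \<open>\<gamma> \<tau> > -2\<close> would do.\<close>

definition \<tau> :: real where "\<tau> = 4 / (2 - \<gamma>)"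

lemma \<tau>: "\<tau> > 1" "-2 < \<gamma> * \<tau>" "\<gamma> * \<tau> \<le> 0"
  using \<gamma> by (auto simp: \<tau>_def field_simps mult_nonneg_nonpos)

lemma sin_powr_sphere:
  assumes a: "-2 < a" "a \<le> 0"
  obtains S where "S > 0" "\<And>k. norm k = 1 \<Longrightarrow>
    (\<integral>\<^sup>+\<omega>. ennreal (sin (arccos (k \<bullet> \<omega>)) powr a) \<partial>sphere_measure) \<le> ennreal S"
proof -
  define I where "I = (\<integral>\<^sup>+u. ennreal (sqrt (1 - u\<^sup>2) powr a) * indicator {-1<..<1} u \<partial>lborel)"
  have "I < \<infinity>" unfolding I_def by (rule nn_integral_sin_powr_finite[OF a])
  then obtain r where r: "I = ennreal r" "r \<ge> 0" by (cases I) auto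
  show ?thesis
  proof (rule that[of "2 * pi * r + 1"])
    show "0 < 2 * pi * r + 1" using r by (simp add: add_nonneg_pos)
    fix k :: vec3 assume k: "norm k = 1"
    have "(\<integral>\<^sup>+\<omega>. ennreal (sin (arccos (k \<bullet> \<omega>)) powr a) \<partial>sphere_measure)
      = ennreal (2 * pi) * (\<integral>\<^sup>+u. ennreal (sin (arccos u) powr a) * indicator {-1<..<1} u \<partial>lborel)"
      by (rule nn_integral_sphere_angle[of "\<lambda>t. sin t powr a"]) (simp_all add: k)
    also have "(\<integral>\<^sup>+u. ennreal (sin (arccos u) powr a) * indicator {-1<..<1} u \<partial>lborel) = I"
      unfolding I_def by (rule nn_integral_cong) (auto simp: indicator_def sin_arccos_inner)
    also have "ennreal (2 * pi) * I = ennreal (2 * pi * r)"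
      using r by (simp add: ennreal_mult)
    also have "\<dots> \<le> ennreal (2 * pi * r + 1)" by (intro ennreal_leI) simp
    finally show "(\<integral>\<^sup>+\<omega>. ennreal (sin (arccos (k \<bullet> \<omega>)) powr a) \<partial>sphere_measure) \<le> ennreal (2 * pi * r + 1)" .
  qed
qed

lemma angular_total:
  obtains S where "S > 0" "\<And>p q. p \<noteq> q \<Longrightarrow>
    (\<integral>\<^sup>+\<omega>. ennreal (\<sigma> (rel_mom p q) (scatter_angle p q \<omega>)) \<partial>sphere_measure) \<le> ennreal (rel_mom p q powr (- b) * S)"
proof -
  obtain S where S: "S > 0" "\<And>k. norm k = 1 \<Longrightarrow>
    (\<integral>\<^sup>+\<omega>. ennreal (sin (arccos (k \<bullet> \<omega>)) powr \<gamma>) \<partial>sphere_measure) \<le> ennreal S"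
    using sin_powr_sphere[OF \<gamma>] by blast
  show ?thesis
  proof (rule that[of "Csig * S"])
    show "Csig * S > 0" using S Csig by simp
    fix p q :: vec3 assume pq: "p \<noteq> q"
    define k where "k = com_mom p q /\<^sub>R rel_mom p q"
    have k: "norm k = 1" unfolding k_def by (rule norm_scatter_axis[OF pq])
    have "(\<integral>\<^sup>+\<omega>. ennreal (\<sigma> (rel_mom p q) (scatter_angle p q \<omega>)) \<partial>sphere_measure)
       \<le> (\<integral>\<^sup>+\<omega>. ennreal (Csig * rel_mom p q powr (- b)) * ennreal (sin (arccos (k \<bullet> \<omega>)) powr \<gamma>) \<partial>sphere_measure)"
      by (rule nn_integral_mono_AE, rule AE_mp[OF kernel_angle_le[OF pq]], rule AE_I2)
         (use Csig in \<open>auto simp: k_def ennreal_mult[symmetric] intro!: ennreal_leI\<close>)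
    also have "\<dots> = ennreal (Csig * rel_mom p q powr (- b)) * (\<integral>\<^sup>+\<omega>. ennreal (sin (arccos (k \<bullet> \<omega>)) powr \<gamma>) \<partial>sphere_measure)"
      by (rule nn_integral_cmult) simp
    also have "\<dots> \<le> ennreal (Csig * rel_mom p q powr (- b)) * ennreal S"
      by (intro mult_left_mono S k) simp
    also have "\<dots> = ennreal (rel_mom p q powr (- b) * (Csig * S))"
      using S Csig by (simp add: ennreal_mult[symmetric] mult_ac)
    finally show "(\<integral>\<^sup>+\<omega>. ennreal (\<sigma> (rel_mom p q) (scatter_angle p q \<omega>)) \<partial>sphere_measure) \<le> ennreal (rel_mom p q powr (- b) * (Csig * S))" .
  qed
qed

text \<open>The kernel is singular along \<open>com_mom p q\<close>, while the Maxwellian factors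
  are concentrated along p + q. \<open>mult_le_powr_split\<close> separates the two effects: the
  singular part gets a small coefficient, and the bounded part keeps its decay 1/p_0.\<close>

lemma angular_gain:
  assumes \<epsilon>: "\<epsilon> > 0"
  obtains D where "D > 0" "\<And>p q. p \<noteq> q \<Longrightarrow>
    (\<integral>\<^sup>+\<omega>. ennreal (\<sigma> (rel_mom p q) (scatter_angle p q \<omega>) *
        (exp (- energy (post_q p q \<omega>) / 4) + exp (- energy (post_p p q \<omega>) / 4))) \<partial>sphere_measure)
     \<le> ennreal (rel_mom p q powr (- b) * (\<epsilon> + D / energy p))"
proof -
  obtain S where S: "S > 0" "\<And>k. norm k = 1 \<Longrightarrow>
    (\<integral>\<^sup>+\<omega>. ennreal (sin (arccos (k \<bullet> \<omega>)) powr (\<gamma> * \<tau>)) \<partial>sphere_measure) \<le> ennreal S"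
    using sin_powr_sphere[OF \<tau>(2,3)] by blast
  \<comment> \<open>Makes the contribution \<open>2 * Csig * \<delta> * S\<close> of the singular
    part equal to \<epsilon>.\<close>
  define \<delta> where "\<delta> = \<epsilon> / (2 * Csig * S)"
  have \<delta>: "\<delta> > 0" using \<epsilon> Csig S by (simp add: \<delta>_def)
  define B where "B = (1 / \<delta>) powr (1 / (\<tau> - 1))"
  have B: "B > 0" using \<delta> by (simp add: B_def)
  show ?thesis
  \<comment> \<open>64 pi / E is twice 2 pi / (E/16): one cap for each outgoing particle, with rate
    E/16 = (E/4)/4.\<close>
  proof (rule that[of "Csig * B * (64 * pi)"])
    show "Csig * B * (64 * pi) > 0" using Csig B by simp
    fix p q :: vec3 assume pq: "p \<noteq> q"
    define k where "k = com_mom p q /\<^sub>R rel_mom p q"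
    have k: "norm k = 1" unfolding k_def by (rule norm_scatter_axis[OF pq])
    define E where "E = energy p + energy q"
    have E: "E > 0" "energy p \<le> E" using energy_pos[of p] energy_pos[of q] by (simp_all add: E_def)
    obtain k' where k': "norm k' = 1"
      "\<And>\<omega>. norm \<omega> = 1 \<Longrightarrow> energy (post_q p q \<omega>) \<ge> E / 4 * (1 - k' \<bullet> \<omega>)"
      "\<And>\<omega>. norm \<omega> = 1 \<Longrightarrow> energy (post_p p q \<omega>) \<ge> E / 4 * (1 - (- k') \<bullet> \<omega>)"
      unfolding E_def by (rule post_energy_axis[of p q]) blast
    define G where "G = Csig * rel_mom p q powr (- b)"
    have G: "G \<ge> 0" using Csig by (simp add: G_def)
    let ?s = "\<lambda>\<omega>. sin (arccos (k \<bullet> \<omega>))"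
    let ?e1 = "\<lambda>\<omega>. exp (- (E / 16) * (1 - k' \<bullet> \<omega>))"
    let ?e2 = "\<lambda>\<omega>. exp (- (E / 16) * (1 - (- k') \<bullet> \<omega>))"
    have "(\<integral>\<^sup>+\<omega>. ennreal (\<sigma> (rel_mom p q) (scatter_angle p q \<omega>) *
        (exp (- energy (post_q p q \<omega>) / 4) + exp (- energy (post_p p q \<omega>) / 4))) \<partial>sphere_measure)
      \<le> (\<integral>\<^sup>+\<omega>. ennreal (2 * G * \<delta>) * ennreal (?s \<omega> powr (\<gamma> * \<tau>)) + ennreal (G * B) * (ennreal (?e1 \<omega>) + ennreal (?e2 \<omega>)) \<partial>sphere_measure)"
    proof (rule nn_integral_mono_AE, rule AE_mp[OF kernel_angle_le[OF pq]], rule AE_I2, intro impI, goal_cases)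
      case (1 \<omega>)
      then have w: "norm \<omega> = 1" and s0: "0 \<le> \<sigma> (rel_mom p q) (scatter_angle p q \<omega>)"
        and s1: "\<sigma> (rel_mom p q) (scatter_angle p q \<omega>) \<le> G * ?s \<omega> powr \<gamma>" and sp: "0 < ?s \<omega>"
        by (simp_all add: k_def G_def)
      define a1 where "a1 = exp (- energy (post_q p q \<omega>) / 4)"
      define a2 where "a2 = exp (- energy (post_p p q \<omega>) / 4)"
      have a: "0 \<le> a1" "0 \<le> a2" "a1 \<le> 1" "a2 \<le> 1"
        using energy_pos[of "post_q p q \<omega>"] energy_pos[of "post_p p q \<omega>"] by (simp_all add: a1_def a2_def)
      have a': "a1 \<le> ?e1 \<omega>" "a2 \<le> ?e2 \<omega>" using k'(2)[OF w] k'(3)[OF w] by (simp_all add: a1_def a2_def)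
      define y where "y = (a1 + a2) / 2"
      have y2': "2 * y = a1 + a2" by (simp add: y_def)
      have y0: "0 \<le> y" using a y2' by linarith
      have y1: "y \<le> 1" using a y2' by linarith
      have y2: "2 * y \<le> ?e1 \<omega> + ?e2 \<omega>" using a' y2' by linarith
      have "?s \<omega> powr \<gamma> * y \<le> \<delta> * (?s \<omega> powr \<gamma>) powr \<tau> + B * y"
        unfolding B_def using sp y0 y1 \<delta> \<tau>(1) by (intro mult_le_powr_split) auto
      then have *: "?s \<omega> powr \<gamma> * y \<le> \<delta> * ?s \<omega> powr (\<gamma> * \<tau>) + B * y" by (simp add: powr_powr)
      have "\<sigma> (rel_mom p q) (scatter_angle p q \<omega>) * (2 * y) \<le> (G * ?s \<omega> powr \<gamma>) * (2 * y)"
        using s1 y0 by (intro mult_right_mono) auto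
      also have "\<dots> = 2 * G * (?s \<omega> powr \<gamma> * y)" by simp
      also have "\<dots> \<le> 2 * G * (\<delta> * ?s \<omega> powr (\<gamma> * \<tau>) + B * y)" using * G by (intro mult_left_mono) auto
      also have "\<dots> = 2 * G * \<delta> * ?s \<omega> powr (\<gamma> * \<tau>) + G * B * (2 * y)" by (simp add: algebra_simps)
      also have "\<dots> \<le> 2 * G * \<delta> * ?s \<omega> powr (\<gamma> * \<tau>) + G * B * (?e1 \<omega> + ?e2 \<omega>)"
        using y2 G B by (intro add_left_mono mult_left_mono) auto
      finally have "\<sigma> (rel_mom p q) (scatter_angle p q \<omega>) * (exp (- energy (post_q p q \<omega>) / 4) + exp (- energy (post_p p q \<omega>) / 4))
         \<le> 2 * G * \<delta> * ?s \<omega> powr (\<gamma> * \<tau>) + G * B * (?e1 \<omega> + ?e2 \<omega>)" unfolding y2' a1_def a2_def .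
      from ennreal_leI[OF this] show ?case
        using G \<delta> B by (simp add: ennreal_mult[symmetric] ennreal_plus[symmetric] del: ennreal_plus)
    qed
    also have "\<dots> = ennreal (2 * G * \<delta>) * (\<integral>\<^sup>+\<omega>. ennreal (?s \<omega> powr (\<gamma> * \<tau>)) \<partial>sphere_measure)
       + ennreal (G * B) * ((\<integral>\<^sup>+\<omega>. ennreal (?e1 \<omega>) \<partial>sphere_measure) + (\<integral>\<^sup>+\<omega>. ennreal (?e2 \<omega>) \<partial>sphere_measure))"
      by (simp add: nn_integral_add nn_integral_cmult)
    also have "\<dots> \<le> ennreal (2 * G * \<delta>) * ennreal S + ennreal (G * B) * (ennreal (2 * pi / (E / 16)) + ennreal (2 * pi / (E / 16)))"
      using E k' by (intro add_mono mult_left_mono S k nn_integral_sphere_exp_le) auto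
    also have "\<dots> = ennreal (2 * G * \<delta> * S + G * B * (64 * pi / E))"
      using G \<delta> B S E by (simp add: ennreal_mult[symmetric] ennreal_plus[symmetric] del: ennreal_plus)
    also have "2 * G * \<delta> * S + G * B * (64 * pi / E) = rel_mom p q powr (- b) * (\<epsilon> + Csig * B * (64 * pi) / E)"
      using Csig S by (simp add: G_def \<delta>_def field_simps)
    also have "ennreal \<dots> \<le> ennreal (rel_mom p q powr (- b) * (\<epsilon> + Csig * B * (64 * pi) / energy p))"
      using E Csig B energy_pos[of p] by (intro ennreal_leI mult_left_mono add_left_mono divide_left_mono) auto
    finally show "(\<integral>\<^sup>+\<omega>. ennreal (\<sigma> (rel_mom p q) (scatter_angle p q \<omega>) *
        (exp (- energy (post_q p q \<omega>) / 4) + exp (- energy (post_p p q \<omega>) / 4))) \<partial>sphere_measure)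
     \<le> ennreal (rel_mom p q powr (- b) * (\<epsilon> + Csig * B * (64 * pi) / energy p))" .
  qed
qed

end

section \<open>Integration over the momentum of the collision partner\<close>

lemma energy_powr_exp_bound:
  assumes a: "a \<ge> 0" and d: "\<delta> > 0"
  obtains C where "C \<ge> 1" "\<And>p. energy p powr a \<le> C * exp (\<delta> * energy p)"
proof -
  obtain C where C: "C > 0" "\<And>x. x > 0 \<Longrightarrow> x powr a \<le> C * exp (\<delta> * x)" using powr_le_exp[OF a d] by blast
  show ?thesis
  proof (rule that[of "C + 1"])
    fix p :: vec3
    have "energy p powr a \<le> C * exp (\<delta> * energy p)" using C energy_pos by blast
    also have "\<dots> \<le> (C + 1) * exp (\<delta> * energy p)" by (intro mult_right_mono) auto
    finally show "energy p powr a \<le> (C + 1) * exp (\<delta> * energy p)" .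
  qed (use C in simp)
qed

lemma nn_integral_exp_energy_finite:
  assumes "d > 0"
  shows "(\<integral>\<^sup>+(q::vec3). ennreal (exp (- d * energy q)) \<partial>lborel) < \<infinity>"
proof -
  have "(\<integral>\<^sup>+(q::vec3). ennreal (exp (- d * energy q)) \<partial>lborel) \<le> (\<integral>\<^sup>+(q::vec3). ennreal (exp (- d * norm q)) \<partial>lborel)"
    using assms norm_less_energy by (intro nn_integral_mono ennreal_leI) (simp add: less_imp_le)
  also have "\<dots> < \<infinity>" by (rule nn_integral_exp_norm_finite[OF assms])
  finally show ?thesis .
qed

context soft_kernel
begin

text \<open>The order of the singularity at \<open>p = q\<close> of \<open>v g\<^bsup>-b\<^esup>\<close>, where \<open>v \<lesssim> g\<close>.\<close>

definition \<beta> :: real where "\<beta> = max 0 (b - 1)"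

lemma \<beta>: "0 \<le> \<beta>" "\<beta> < 3" using b by (auto simp: \<beta>_def)

text \<open>As p_0/q_0 \<ge> 4 absorbs the -2 in \<open>rel_mom_sq_ge\<close>, g^2 \<ge> p_0/(2
  q_0). With v \<le> 4 and b < 4 this yields the rate p_0^(-b/2) at the price of two powers of
  q_0.\<close>

lemma moller_powr_far:
  assumes "4 * energy q \<le> energy p"
  shows "moller_velocity p q * rel_mom p q powr (- b) \<le> 16 * energy p powr (- b / 2) * (energy q)\<^sup>2"
proof -
  define x where "x = energy p"
  define y where "y = energy q"
  have xy: "1 \<le> y" "4 * y \<le> x" using assms energy_ge_1[of q] by (simp_all add: x_def y_def)
  have "x / (2 * y) \<le> x / y - 2"
  proof -
    have "x / y \<ge> 4" using xy by (simp add: field_simps)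
    moreover have "x / (2 * y) = (x / y) / 2" by simp
    ultimately show ?thesis by linarith
  qed
  also have "\<dots> \<le> (rel_mom p q)\<^sup>2" unfolding x_def y_def by (rule rel_mom_sq_ge)
  finally have g2: "x / (2 * y) \<le> (rel_mom p q)\<^sup>2" .
  have pos: "0 < x / (2 * y)" using xy by simp
  have g: "rel_mom p q > 0" using g2 pos rel_mom_nonneg[of p q] by (cases "rel_mom p q = 0") auto
  have "rel_mom p q powr (- b) = ((rel_mom p q)\<^sup>2) powr (- b / 2)"
    using g by (simp add: powr_powr flip: powr_numeral)
  also have "\<dots> \<le> (x / (2 * y)) powr (- b / 2)"
    using g2 pos b by (intro powr_mono2') auto
  also have "\<dots> = x powr (- b / 2) * (2 * y) powr (b / 2)"
    using xy by (simp add: powr_divide powr_minus_divide)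
  also have "\<dots> \<le> x powr (- b / 2) * (2 * y) powr 2"
    using xy b by (intro mult_left_mono powr_mono) auto
  also have "(2 * y) powr 2 = 4 * y\<^sup>2" using xy by (simp add: power_mult_distrib)
  finally have "rel_mom p q powr (- b) \<le> x powr (- b / 2) * (4 * y\<^sup>2)" .
  then have "moller_velocity p q * rel_mom p q powr (- b) \<le> 4 * (x powr (- b / 2) * (4 * y\<^sup>2))"
    using moller_velocity_le[of p q] moller_velocity_nonneg[of p q] by (intro mult_mono) auto
  then show ?thesis by (simp add: x_def y_def mult_ac)
qed

text \<open>If q_0 is not small compared with p_0, powers of q_0 are cheap, since an exponential in
  q_0 will multiply them. Only the singularity at q = p is kept, and one power of g from the
  relative velocity lowers its order to \<beta>.\<close>

lemma moller_powr_near: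
  assumes "p \<noteq> q" "energy p \<le> 4 * energy q"
  shows "moller_velocity p q * rel_mom p q powr (- b) \<le> 16 * (energy q)\<^sup>2 * (1 + norm (p - q) powr (- \<beta>) * indicator (cball p 1) q)"
proof -
  define g where "g = rel_mom p q"
  define A where "A = energy p * energy q"
  have g: "g > 0" using rel_mom_pos[OF assms(1)] by (simp add: g_def)
  have A1: "A \<ge> 1" using energy_ge_1[of p] energy_ge_1[of q] mult_mono[of 1 "energy p" 1 "energy q"] by (simp add: A_def)
  have A4: "A \<le> 4 * (energy q)\<^sup>2"
    using mult_right_mono[OF assms(2), of "energy q"] energy_pos[of q] by (simp add: A_def power2_eq_square)
  have q1: "(energy q)\<^sup>2 \<ge> 1" using energy_ge_1[of q] by (simp add: one_le_power)
  have n: "norm (p - q) > 0" using assms by simp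
  define N where "N = norm (p - q) powr (- \<beta>)"
  have N: "N \<ge> 0" by (simp add: N_def)
  have N1: "N \<le> 1 + N * indicator (cball p 1) q"
  proof (cases "norm (p - q) \<le> 1")
    case False
    then have "N \<le> 1" unfolding N_def using \<beta> powr_mono2'[of "- \<beta>" 1 "norm (p - q)"] by simp
    then show ?thesis using N by (simp add: indicator_def dist_norm)
  qed (use N in \<open>simp add: indicator_def dist_norm\<close>)
  \<comment> \<open>The factors \<open>/ A * A\<close> cancel; the bound meant is 4 A max(1,
    N).\<close>
  have *: "moller_velocity p q * g powr (- b) \<le> 4 * A * max 1 N / A * A"
  proof (cases "g \<ge> 1")
    case True
    then have "g powr (- b) \<le> 1" using b powr_mono2'[of "- b" 1 g] by simp
    then have "moller_velocity p q * g powr (- b) \<le> 4 * 1"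
      using moller_velocity_le[of p q] moller_velocity_nonneg[of p q] by (intro mult_mono) auto
    also have "\<dots> \<le> 4 * (A * max 1 N)" using A1 mult_mono[of 1 A 1 "max 1 N"] by simp
    also have "\<dots> = 4 * A * max 1 N / A * A" using A1 by simp
    finally show ?thesis .
  next
    case False
    have "mandel_s p q \<le> 9" using False g power_le_one[of g 2] by (simp add: mandel_s_eq g_def)
    then have s: "sqrt (mandel_s p q) \<le> 3" using real_sqrt_le_mono[of "mandel_s p q" 9] by simp
    have mv: "moller_velocity p q * g powr (- b) = g powr (1 - b) * sqrt (mandel_s p q) / A"
    proof -
      have "g * g powr (- b) = g powr 1 * g powr (- b)" using g by simp
      also have "\<dots> = g powr (1 - b)" by (simp only: powr_add[symmetric]) simp
      finally show ?thesis by (simp add: moller_velocity_def g_def[symmetric] A_def[symmetric] mult_ac)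
    qed
    \<comment> \<open>For b > 1, g \<ge> |p - q| / sqrt A turns the power of g into N times (sqrt
      A)^\<beta>, and \<beta> < 3 bounds the latter by A^2. For b \<le> 1 nothing is
      singular.\<close>
    have gN: "g powr (1 - b) \<le> A\<^sup>2 * max 1 N"
    proof (cases "b \<le> 1")
      case True
      then have "g powr (1 - b) \<le> 1" using False g powr_le1[of "1 - b" g] by simp
      also have "\<dots> \<le> A\<^sup>2 * max 1 N" using A1 mult_mono[of 1 "A\<^sup>2" 1 "max 1 N"] by (simp add: one_le_power)
      finally show ?thesis .
    next
      case b1: False
      then have be: "1 - b = - \<beta>" by (simp add: \<beta>_def)
      have "norm (p - q) / sqrt A \<le> g"
      proof -
        have "norm (p - q) \<le> sqrt (g\<^sup>2 * A)"
          using norm_diff_sq_le[of p q] by (intro real_le_rsqrt) (simp add: g_def A_def)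
        also have "\<dots> = g * sqrt A" using g by (simp add: real_sqrt_mult)
        finally show ?thesis using A1 by (simp add: pos_divide_le_eq)
      qed
      then have "g powr (- \<beta>) \<le> (norm (p - q) / sqrt A) powr (- \<beta>)"
        using n A1 \<beta> by (intro powr_mono2') auto
      also have "\<dots> = N * sqrt A powr \<beta>"
        using n A1 by (simp add: N_def powr_divide powr_minus_divide)
      also have "sqrt A powr \<beta> \<le> sqrt A powr 4"
        using A1 \<beta> by (intro powr_mono) auto
      also have "sqrt A powr 4 = A\<^sup>2"
      proof -
        have "sqrt A powr 4 = sqrt A ^ 4" using A1 by (subst powr_numeral) simp_all
        also have "\<dots> = (sqrt A ^ 2) ^ 2" by (simp only: power_mult[symmetric]) simp
        finally show ?thesis using A1 by simp
      qed
      also have "N * A\<^sup>2 \<le> A\<^sup>2 * max 1 N" by (subst mult.commute) (intro mult_left_mono, auto)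
      finally show ?thesis using N by (simp add: be mult_left_mono)
    qed
    have "moller_velocity p q * g powr (- b) \<le> (A\<^sup>2 * max 1 N) * 3 / A"
      unfolding mv using gN s A1 mandel_s_ge_4[of p q] by (intro divide_right_mono mult_mono) auto
    also have "\<dots> = 3 * (A * max 1 N)" using A1 by (simp add: power2_eq_square)
    also have "\<dots> \<le> 4 * (A * max 1 N)" using A1 by (intro mult_right_mono) auto
    also have "\<dots> = 4 * A * max 1 N / A * A" using A1 by simp
    finally show ?thesis .
  qed
  have mN: "max 1 N \<le> 1 + N * indicator (cball p 1) q" using N1 N by (simp add: indicator_def)
  have "moller_velocity p q * g powr (- b) \<le> 4 * (A * max 1 N)" using * A1 by (simp add: mult_ac)
  also have "\<dots> \<le> 4 * ((4 * (energy q)\<^sup>2) * (1 + N * indicator (cball p 1) q))"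
    using A1 A4 mN by (intro mult_left_mono mult_mono) auto
  finally show ?thesis by (simp add: g_def N_def)
qed

text \<open>The rate p_0^(-b/2) arises in two ways: from g^(-b) if p_0 \<ge> 4 q_0, and otherwise
  from exp(- q_0/8) \<le> exp(- p_0/32).\<close>

lemma moller_integral:
  obtains C where "C > 0" "\<And>p. (\<integral>\<^sup>+q. ennreal (moller_velocity p q * rel_mom p q powr (- b) * exp (- energy q / 4)) \<partial>lborel)
     \<le> ennreal (C * energy p powr (- b / 2))"
proof -
  obtain C1 where C1: "C1 \<ge> 1" "\<And>p. energy p powr 2 \<le> C1 * exp (1/16 * energy p)"
    using energy_powr_exp_bound[of 2 "1/16"] by auto
  obtain C2 where C2: "C2 \<ge> 1" "\<And>p. energy p powr (b/2) \<le> C2 * exp (1/32 * energy p)"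
    using energy_powr_exp_bound[of "b/2" "1/32"] b by auto
  define I1 where "I1 = (\<integral>\<^sup>+(q::vec3). ennreal (exp (- (1/16) * energy q)) \<partial>lborel)"
  define I2 where "I2 = (\<integral>\<^sup>+(x::vec3). ennreal (norm x powr (- \<beta>)) * indicator (cball 0 1) x \<partial>lborel)"
  have "I1 < \<infinity>" "I2 < \<infinity>"
    unfolding I1_def I2_def using nn_integral_exp_energy_finite[of "1/16"] nn_integral_norm_powr_finite[OF \<beta>] by auto
  then obtain r1 r2 where r: "I1 = ennreal r1" "r1 \<ge> 0" "I2 = ennreal r2" "r2 \<ge> 0" by (cases I1; cases I2) auto
  \<comment> \<open>16 is the constant of the two pointwise estimates, \<open>C1\<close> absorbs
    q_0^2, and \<open>C2\<close> converts exp(- p_0/32) into p_0^(-b/2).\<close>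
  define K where "K = 16 * C1 * C2"
  have K: "K > 0" using C1 C2 by (simp add: K_def)
  show ?thesis
  proof (rule that[of "K * (r1 + r2) + 1"])
    show "0 < K * (r1 + r2) + 1" using r K by (simp add: add_nonneg_pos)
    fix p :: vec3
    let ?x = "energy p powr (- b / 2)"
    have pw: "moller_velocity p q * rel_mom p q powr (- b) * exp (- energy q / 4)
        \<le> ?x * K * (exp (- (1/16) * energy q) + norm (p - q) powr (- \<beta>) * indicator (cball p 1) q)" if pq: "q \<noteq> p" for q
    proof -
      let ?N = "norm (p - q) powr (- \<beta>) * indicator (cball p 1) q :: real"
      have q2: "(energy q)\<^sup>2 \<le> C1 * exp (1/16 * energy q)" using C1(2)[of q] energy_pos[of q] by (simp add: powr_numeral)
      have x1: "1 \<le> ?x * (C2 * exp (1/32 * energy p))"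
      proof -
        have "1 = ?x * energy p powr (b / 2)" using energy_pos[of p] by (simp add: powr_add[symmetric])
        also have "\<dots> \<le> ?x * (C2 * exp (1/32 * energy p))" using C2(2)[of p] by (intro mult_left_mono) auto
        finally show ?thesis .
      qed
      have main: "moller_velocity p q * rel_mom p q powr (- b) * exp (- energy q / 4) \<le> ?x * K * (exp (- (1/16) * energy q) * (1 + ?N))"
      proof (cases "4 * energy q \<le> energy p")
        case True
        have "moller_velocity p q * rel_mom p q powr (- b) * exp (- energy q / 4) \<le> (16 * ?x * (energy q)\<^sup>2) * exp (- energy q / 4)"
          using moller_powr_far[OF True] by (intro mult_right_mono) auto
        also have "\<dots> \<le> (16 * ?x * (C1 * exp (1/16 * energy q))) * exp (- energy q / 4)"
          using q2 by (intro mult_right_mono mult_left_mono) auto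
        also have "\<dots> = 16 * ?x * C1 * (exp (1/16 * energy q) * exp (- energy q / 4))" by simp
        also have "exp (1/16 * energy q) * exp (- energy q / 4) = exp (- (3/16) * energy q)" by (simp add: mult_exp_exp)
        also have "exp (- (3/16) * energy q) \<le> exp (- (1/16) * energy q)" using energy_pos[of q] by simp
        also have "16 * ?x * C1 * exp (- (1/16) * energy q) \<le> 16 * ?x * C1 * (C2 * (exp (- (1/16) * energy q) * (1 + ?N)))"
        proof -
          have "1 * (exp (- (1/16) * energy q) * 1) \<le> C2 * (exp (- (1/16) * energy q) * (1 + ?N))"
            using C2 by (intro mult_mono mult_left_mono) auto
          then show ?thesis using C1 by (intro mult_left_mono) auto
        qed
        also have "\<dots> = ?x * K * (exp (- (1/16) * energy q) * (1 + ?N))" by (simp add: K_def)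
        finally show ?thesis using C1 by (simp add: mult_left_mono)
      next
        case False
        then have le: "energy p \<le> 4 * energy q" by simp
        have "moller_velocity p q * rel_mom p q powr (- b) * exp (- energy q / 4)
          \<le> (16 * (energy q)\<^sup>2 * (1 + ?N)) * exp (- energy q / 4)"
          using moller_powr_near[OF _ le] pq by (intro mult_right_mono) auto
        also have "\<dots> \<le> (16 * (C1 * exp (1/16 * energy q)) * (1 + ?N)) * exp (- energy q / 4)"
          using q2 by (intro mult_right_mono mult_left_mono) auto
        also have "\<dots> = 16 * C1 * (1 + ?N) * (exp (1/16 * energy q) * exp (- energy q / 4))" by simp
        \<comment> \<open>Budget for the exponent 4/16: one part has absorbed q_0^2, one is kept for
          the integration, and two, worth q_0/8 \<ge> p_0/32, become decay in p_0.\<close>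
        also have "exp (1/16 * energy q) * exp (- energy q / 4) = exp (- (1/16) * energy q) * exp (- (1/8) * energy q)" by (simp add: mult_exp_exp)
        also have "16 * C1 * (1 + ?N) * (exp (- (1/16) * energy q) * exp (- (1/8) * energy q))
          \<le> 16 * C1 * (1 + ?N) * (exp (- (1/16) * energy q) * exp (- (1/32) * energy p))"
          using le C1 by (intro mult_left_mono) auto
        also have "\<dots> = 16 * C1 * (1 + ?N) * exp (- (1/16) * energy q) * (1 * exp (- (1/32) * energy p))" by simp
        also have "\<dots> \<le> 16 * C1 * (1 + ?N) * exp (- (1/16) * energy q) * ((?x * (C2 * exp (1/32 * energy p))) * exp (- (1/32) * energy p))"
          using x1 C1 by (intro mult_left_mono mult_right_mono) auto
        also have "\<dots> = ?x * K * (exp (- (1/16) * energy q) * (1 + ?N)) * (exp (1/32 * energy p) * exp (- (1/32) * energy p))"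
          by (simp add: K_def)
        also have "exp (1/32 * energy p) * exp (- (1/32) * energy p) = 1" by (simp add: mult_exp_exp)
        finally show ?thesis by simp
      qed
      have "exp (- (1/16) * energy q) * ?N \<le> 1 * ?N" using energy_pos[of q] by (intro mult_right_mono) auto
      then have "exp (- (1/16) * energy q) * (1 + ?N) \<le> exp (- (1/16) * energy q) + ?N" by (simp add: distrib_left)
      then have "?x * K * (exp (- (1/16) * energy q) * (1 + ?N)) \<le> ?x * K * (exp (- (1/16) * energy q) + ?N)"
        using K by (intro mult_left_mono) auto
      with main show ?thesis by linarith
    qed
    have "(\<integral>\<^sup>+q. ennreal (moller_velocity p q * rel_mom p q powr (- b) * exp (- energy q / 4)) \<partial>lborel)
      \<le> (\<integral>\<^sup>+q. ennreal (?x * K) * (ennreal (exp (- (1/16) * energy q)) + ennreal (norm (p - q) powr (- \<beta>)) * indicator (cball p 1) q) \<partial>lborel)"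
    proof (rule nn_integral_mono_AE, rule AE_mp[OF AE_lborel_singleton[of p]], rule AE_I2, intro impI)
      fix q assume q: "q \<noteq> p"
      have "ennreal (norm (p - q) powr (- \<beta>)) * indicator (cball p 1) q = ennreal (norm (p - q) powr (- \<beta>) * indicator (cball p 1) q)"
        by (simp add: indicator_def)
      then show "ennreal (moller_velocity p q * rel_mom p q powr (- b) * exp (- energy q / 4))
        \<le> ennreal (?x * K) * (ennreal (exp (- (1/16) * energy q)) + ennreal (norm (p - q) powr (- \<beta>)) * indicator (cball p 1) q)"
        using ennreal_leI[OF pw[OF q]] K by (simp add: ennreal_mult[symmetric] ennreal_plus[symmetric] del: ennreal_plus)
    qed
    also have "\<dots> = ennreal (?x * K) * (I1 + (\<integral>\<^sup>+q. ennreal (norm (p - q) powr (- \<beta>)) * indicator (cball p 1) q \<partial>lborel))"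
    proof -
      have [measurable]: "cball p 1 \<in> sets borel" by simp
      have [measurable]: "(\<lambda>q. ennreal (norm (p - q) powr (- \<beta>)) * indicator (cball p 1) q) \<in> borel_measurable lborel"
        by measurable
      have [measurable]: "(\<lambda>q::vec3. ennreal (exp (- (1/16) * energy q))) \<in> borel_measurable lborel"
        by measurable
      show ?thesis unfolding I1_def
        by (subst nn_integral_cmult, measurable, subst nn_integral_add) simp_all
    qed
    also have "(\<integral>\<^sup>+q. ennreal (norm (p - q) powr (- \<beta>)) * indicator (cball p 1) q \<partial>lborel) = I2"
      unfolding I2_def
      by (subst nn_integral_lborel_translate[symmetric, of _ p])
         (auto simp: indicator_def dist_norm intro!: nn_integral_cong)
    also have "ennreal (?x * K) * (I1 + I2) = ennreal (?x * K * (r1 + r2))"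
      using r K by (simp add: ennreal_mult[symmetric] ennreal_plus[symmetric] del: ennreal_plus)
    also have "\<dots> \<le> ennreal ((K * (r1 + r2) + 1) * ?x)"
      by (intro ennreal_leI) (simp add: algebra_simps)
    finally show "(\<integral>\<^sup>+q. ennreal (moller_velocity p q * rel_mom p q powr (- b) * exp (- energy q / 4)) \<partial>lborel)
     \<le> ennreal ((K * (r1 + r2) + 1) * ?x)" .
  qed
qed

end

section \<open>The loss and gain integrals\<close>

lemma sphere_nn_integral_fst:
  fixes F :: "vec3 \<times> vec3 \<Rightarrow> ennreal"
  assumes "F \<in> borel_measurable (lborel \<Otimes>\<^sub>M sphere_measure)"
  shows "(\<integral>\<^sup>+x. F x \<partial>(lborel \<Otimes>\<^sub>M sphere_measure)) = (\<integral>\<^sup>+q. \<integral>\<^sup>+\<omega>. F (q, \<omega>) \<partial>sphere_measure \<partial>lborel)"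
  using sigma_finite_measure.nn_integral_fst[OF sigma_finite_sphere assms] by simp

lemma sqrt_juttner_le: "sqrt (juttner q) \<le> exp (- energy q / 2)"
proof (rule real_le_lsqrt)
  have "exp (- energy q) / (4 * pi) \<le> exp (- energy q) / 1" using pi_gt3 by (intro divide_left_mono) auto
  also have "\<dots> = (exp (- energy q / 2))\<^sup>2" by (simp add: power2_eq_square mult_exp_exp)
  finally show "juttner q \<le> (exp (- energy q / 2))\<^sup>2" by (simp add: juttner_def)
qed (simp_all add: juttner_def)

lemma juttner_nonneg: "juttner q \<ge> 0" by (simp add: juttner_def)

text \<open>Energy conservation and x + y \<le> 2 x y for x, y \<ge> 1. Each ratio of energies
  before and after a collision is thus bounded by an energy whose exponential stands in the
  integrand.\<close>

lemma energy_post_product: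
  assumes "norm \<omega> = 1"
  shows "energy p \<le> 2 * energy (post_p p q \<omega>) * energy (post_q p q \<omega>)"
    "energy (post_p p q \<omega>) \<le> 2 * energy q * energy p" "energy (post_q p q \<omega>) \<le> 2 * energy q * energy p"
proof -
  have sum: "x + y \<le> 2 * x * y" if "x \<ge> 1" "y \<ge> 1" for x y :: real
  proof -
    have "x * 1 \<le> x * y" "1 * y \<le> x * y" using that by (intro mult_mono; simp)+
    then show ?thesis by simp
  qed
  note e = energy_post_add[OF assms, of p q]
  show "energy p \<le> 2 * energy (post_p p q \<omega>) * energy (post_q p q \<omega>)"
    using sum[OF energy_ge_1[of "post_p p q \<omega>"] energy_ge_1[of "post_q p q \<omega>"]] e energy_pos[of q] by linarith
  show "energy (post_p p q \<omega>) \<le> 2 * energy q * energy p"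
    using sum[OF energy_ge_1[of q] energy_ge_1[of p]] e energy_pos[of "post_q p q \<omega>"] by linarith
  show "energy (post_q p q \<omega>) \<le> 2 * energy q * energy p"
    using sum[OF energy_ge_1[of q] energy_ge_1[of p]] e energy_pos[of "post_p p q \<omega>"] by linarith
qed

context soft_kernel
begin

lemma AE_collision: "AE (q, \<omega>) in lborel \<Otimes>\<^sub>M sphere_measure. norm \<omega> = 1 \<and> 0 \<le> \<sigma> (rel_mom p q) (scatter_angle p q \<omega>)"
proof (rule pair_sigma_finite.AE_pair_measure[OF pair_sigma_finite.intro[OF sigma_finite_lborel sigma_finite_sphere]])
  show "{x \<in> space (lborel \<Otimes>\<^sub>M sphere_measure). case x of (q, \<omega>) \<Rightarrow> norm \<omega> = 1 \<and> 0 \<le> \<sigma> (rel_mom p q) (scatter_angle p q \<omega>)}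
    \<in> sets (lborel \<Otimes>\<^sub>M sphere_measure)" by measurable
  show "AE q in lborel. AE \<omega> in sphere_measure. case (q, \<omega>) of (q, \<omega>) \<Rightarrow> norm \<omega> = 1 \<and> 0 \<le> \<sigma> (rel_mom p q) (scatter_angle p q \<omega>)"
  proof (rule AE_mp[OF AE_lborel_singleton[of p]], rule AE_I2, intro impI)
    fix q assume "q \<noteq> p"
    then have "p \<noteq> q" by simp
    from kernel_angle_le[OF this] show "AE \<omega> in sphere_measure. case (q, \<omega>) of (q, \<omega>) \<Rightarrow> norm \<omega> = 1 \<and> 0 \<le> \<sigma> (rel_mom p q) (scatter_angle p q \<omega>)"
      by (rule eventually_mono) simp
  qed
qed

text \<open>The weight exp(- q_0/4) is weaker than the Juttner factor, so that one bound serves both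
  the collision frequency and the loss part of K.\<close>

lemma freq_upper:
  obtains C where "C > 0" "\<And>p. (\<integral>\<^sup>+(q, \<omega>). ennreal (moller_velocity p q * \<sigma> (rel_mom p q) (scatter_angle p q \<omega>) * exp (- energy q / 4))
      \<partial>(lborel \<Otimes>\<^sub>M sphere_measure)) \<le> ennreal (C * energy p powr (- b / 2))"
proof -
  obtain S where S: "S > 0" "\<And>p q. p \<noteq> q \<Longrightarrow>
    (\<integral>\<^sup>+\<omega>. ennreal (\<sigma> (rel_mom p q) (scatter_angle p q \<omega>)) \<partial>sphere_measure) \<le> ennreal (rel_mom p q powr (- b) * S)"
    using angular_total by blast
  obtain C where C: "C > 0" "\<And>p. (\<integral>\<^sup>+q. ennreal (moller_velocity p q * rel_mom p q powr (- b) * exp (- energy q / 4)) \<partial>lborel)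
     \<le> ennreal (C * energy p powr (- b / 2))" using moller_integral by blast
  show ?thesis
  proof (rule that[of "S * C"])
    fix p
    have "(\<integral>\<^sup>+(q, \<omega>). ennreal (moller_velocity p q * \<sigma> (rel_mom p q) (scatter_angle p q \<omega>) * exp (- energy q / 4)) \<partial>(lborel \<Otimes>\<^sub>M sphere_measure))
      = (\<integral>\<^sup>+q. \<integral>\<^sup>+\<omega>. ennreal (moller_velocity p q * \<sigma> (rel_mom p q) (scatter_angle p q \<omega>) * exp (- energy q / 4)) \<partial>sphere_measure \<partial>lborel)"
      by (subst sphere_nn_integral_fst) simp_all
    also have "\<dots> \<le> (\<integral>\<^sup>+q. ennreal S * ennreal (moller_velocity p q * rel_mom p q powr (- b) * exp (- energy q / 4)) \<partial>lborel)"
    proof (rule nn_integral_mono_AE, rule AE_mp[OF AE_lborel_singleton[of p]], rule AE_I2, intro impI)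
      fix q assume q: "q \<noteq> p"
      have "(\<integral>\<^sup>+\<omega>. ennreal (moller_velocity p q * \<sigma> (rel_mom p q) (scatter_angle p q \<omega>) * exp (- energy q / 4)) \<partial>sphere_measure)
        = (\<integral>\<^sup>+\<omega>. ennreal (moller_velocity p q * exp (- energy q / 4)) * ennreal (\<sigma> (rel_mom p q) (scatter_angle p q \<omega>)) \<partial>sphere_measure)"
        by (rule nn_integral_cong, subst ennreal_mult'[symmetric]) (simp_all only: mult_ac, simp add: moller_velocity_nonneg)
      also have "\<dots> = ennreal (moller_velocity p q * exp (- energy q / 4)) * (\<integral>\<^sup>+\<omega>. ennreal (\<sigma> (rel_mom p q) (scatter_angle p q \<omega>)) \<partial>sphere_measure)"
        by (rule nn_integral_cmult) simp
      also have "\<dots> \<le> ennreal (moller_velocity p q * exp (- energy q / 4)) * ennreal (rel_mom p q powr (- b) * S)"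
        using q by (intro mult_left_mono S) auto
      also have "\<dots> = ennreal S * ennreal (moller_velocity p q * rel_mom p q powr (- b) * exp (- energy q / 4))"
        using S(1) by (simp add: ennreal_mult[symmetric] moller_velocity_nonneg mult_ac)
      finally show "(\<integral>\<^sup>+\<omega>. ennreal (moller_velocity p q * \<sigma> (rel_mom p q) (scatter_angle p q \<omega>) * exp (- energy q / 4)) \<partial>sphere_measure)
        \<le> ennreal S * ennreal (moller_velocity p q * rel_mom p q powr (- b) * exp (- energy q / 4))" .
    qed
    also have "\<dots> = ennreal S * (\<integral>\<^sup>+q. ennreal (moller_velocity p q * rel_mom p q powr (- b) * exp (- energy q / 4)) \<partial>lborel)"
      by (rule nn_integral_cmult) simp
    also have "\<dots> \<le> ennreal S * ennreal (C * energy p powr (- b / 2))"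
      by (intro mult_left_mono C) simp
    also have "\<dots> = ennreal (S * C * energy p powr (- b / 2))"
      using S C by (simp add: ennreal_mult[symmetric] mult_ac)
    finally show "(\<integral>\<^sup>+(q, \<omega>). ennreal (moller_velocity p q * \<sigma> (rel_mom p q) (scatter_angle p q \<omega>) * exp (- energy q / 4))
      \<partial>(lborel \<Otimes>\<^sub>M sphere_measure)) \<le> ennreal (S * C * energy p powr (- b / 2))" .
  qed (use S C in simp)
qed

text \<open>In \<open>angular_gain\<close>, the small parameter is chosen first; the other term
  D/p_0 then falls below it once p_0 \<ge> D/\<delta>.\<close>

lemma gain_small:
  assumes \<epsilon>: "\<epsilon> > 0"
  obtains R where "R > 0" "\<And>p. energy p \<ge> R \<Longrightarrow>
    (\<integral>\<^sup>+(q, \<omega>). ennreal (moller_velocity p q * \<sigma> (rel_mom p q) (scatter_angle p q \<omega>) * exp (- energy q / 4) *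
       (exp (- energy (post_q p q \<omega>) / 4) + exp (- energy (post_p p q \<omega>) / 4)))
      \<partial>(lborel \<Otimes>\<^sub>M sphere_measure)) \<le> ennreal (\<epsilon> * energy p powr (- b / 2))"
proof -
  obtain C where C: "C > 0" "\<And>p. (\<integral>\<^sup>+q. ennreal (moller_velocity p q * rel_mom p q powr (- b) * exp (- energy q / 4)) \<partial>lborel)
     \<le> ennreal (C * energy p powr (- b / 2))" using moller_integral by blast
  define \<delta> where "\<delta> = \<epsilon> / (2 * C)"
  have \<delta>: "\<delta> > 0" using \<epsilon> C by (simp add: \<delta>_def)
  let ?e = "\<lambda>p q \<omega>. exp (- energy (post_q p q \<omega>) / 4) + exp (- energy (post_p p q \<omega>) / 4)"
  obtain D where D: "D > 0" "\<And>p q. p \<noteq> q \<Longrightarrow>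
    (\<integral>\<^sup>+\<omega>. ennreal (\<sigma> (rel_mom p q) (scatter_angle p q \<omega>) * ?e p q \<omega>) \<partial>sphere_measure)
     \<le> ennreal (rel_mom p q powr (- b) * (\<delta> + D / energy p))"
    using angular_gain[OF \<delta>] by blast
  show ?thesis
  proof (rule that[of "D / \<delta>"])
    fix p assume p: "energy p \<ge> D / \<delta>"
    have Dp: "D / energy p \<le> \<delta>" using p \<delta> energy_pos[of p] by (simp add: field_simps)
    have "(\<integral>\<^sup>+(q, \<omega>). ennreal (moller_velocity p q * \<sigma> (rel_mom p q) (scatter_angle p q \<omega>) * exp (- energy q / 4) * ?e p q \<omega>) \<partial>(lborel \<Otimes>\<^sub>M sphere_measure))
      = (\<integral>\<^sup>+q. \<integral>\<^sup>+\<omega>. ennreal (moller_velocity p q * \<sigma> (rel_mom p q) (scatter_angle p q \<omega>) * exp (- energy q / 4) * ?e p q \<omega>) \<partial>sphere_measure \<partial>lborel)"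
      by (subst sphere_nn_integral_fst) simp_all
    also have "\<dots> \<le> (\<integral>\<^sup>+q. ennreal (2 * \<delta>) * ennreal (moller_velocity p q * rel_mom p q powr (- b) * exp (- energy q / 4)) \<partial>lborel)"
    proof (rule nn_integral_mono_AE, rule AE_mp[OF AE_lborel_singleton[of p]], rule AE_I2, intro impI)
      fix q assume q: "q \<noteq> p"
      have "(\<integral>\<^sup>+\<omega>. ennreal (moller_velocity p q * \<sigma> (rel_mom p q) (scatter_angle p q \<omega>) * exp (- energy q / 4) * ?e p q \<omega>) \<partial>sphere_measure)
        = (\<integral>\<^sup>+\<omega>. ennreal (moller_velocity p q * exp (- energy q / 4)) * ennreal (\<sigma> (rel_mom p q) (scatter_angle p q \<omega>) * ?e p q \<omega>) \<partial>sphere_measure)"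
        by (rule nn_integral_cong, subst ennreal_mult'[symmetric]) (simp_all only: mult_ac, simp add: moller_velocity_nonneg)
      also have "\<dots> = ennreal (moller_velocity p q * exp (- energy q / 4)) * (\<integral>\<^sup>+\<omega>. ennreal (\<sigma> (rel_mom p q) (scatter_angle p q \<omega>) * ?e p q \<omega>) \<partial>sphere_measure)"
        by (rule nn_integral_cmult) simp
      also have "\<dots> \<le> ennreal (moller_velocity p q * exp (- energy q / 4)) * ennreal (rel_mom p q powr (- b) * (\<delta> + D / energy p))"
        using q by (intro mult_left_mono D) auto
      also have "\<dots> \<le> ennreal (moller_velocity p q * exp (- energy q / 4)) * ennreal (rel_mom p q powr (- b) * (2 * \<delta>))"
        using Dp by (intro mult_left_mono ennreal_leI) auto
      also have "\<dots> = ennreal (2 * \<delta>) * ennreal (moller_velocity p q * rel_mom p q powr (- b) * exp (- energy q / 4))"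
        using \<delta> by (simp add: ennreal_mult[symmetric] moller_velocity_nonneg mult_ac)
      finally show "(\<integral>\<^sup>+\<omega>. ennreal (moller_velocity p q * \<sigma> (rel_mom p q) (scatter_angle p q \<omega>) * exp (- energy q / 4) * ?e p q \<omega>) \<partial>sphere_measure)
        \<le> ennreal (2 * \<delta>) * ennreal (moller_velocity p q * rel_mom p q powr (- b) * exp (- energy q / 4))" .
    qed
    also have "\<dots> = ennreal (2 * \<delta>) * (\<integral>\<^sup>+q. ennreal (moller_velocity p q * rel_mom p q powr (- b) * exp (- energy q / 4)) \<partial>lborel)"
      by (rule nn_integral_cmult) simp
    also have "\<dots> \<le> ennreal (2 * \<delta>) * ennreal (C * energy p powr (- b / 2))"
      by (intro mult_left_mono C) simp
    also have "\<dots> = ennreal (\<epsilon> * energy p powr (- b / 2))"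
      using \<delta> C by (simp add: ennreal_mult[symmetric] \<delta>_def)
    finally show "(\<integral>\<^sup>+(q, \<omega>). ennreal (moller_velocity p q * \<sigma> (rel_mom p q) (scatter_angle p q \<omega>) * exp (- energy q / 4) * ?e p q \<omega>)
      \<partial>(lborel \<Otimes>\<^sub>M sphere_measure)) \<le> ennreal (\<epsilon> * energy p powr (- b / 2))" .
  qed (use D \<delta> in simp)
qed

text \<open>The integrand of \<open>K\<^sub>2 + K\<^sub>1\<close>, which dominates \<open>K = K\<^sub>2 - K\<^sub>1\<close>.\<close>

definition collision_integrand :: "(vec3 \<Rightarrow> real) \<Rightarrow> vec3 \<Rightarrow> vec3 \<times> vec3 \<Rightarrow> real" where
  "collision_integrand \<Phi> p = (\<lambda>(q, \<omega>). moller_velocity p q * \<sigma> (rel_mom p q) (scatter_angle p q \<omega>) *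
     (sqrt (juttner q) * (sqrt (juttner (post_q p q \<omega>)) * \<Phi> (post_p p q \<omega>) + sqrt (juttner (post_p p q \<omega>)) * \<Phi> (post_q p q \<omega>))
      + sqrt (juttner q * juttner p) * \<Phi> q))"

text \<open>The growth condition on \<open>\<Phi>\<close> allows powers of the energies; since \<open>p\<^sub>0 \<le> 2 p\<^sub>0\<^bsup>\<prime>\<^esup> q\<^sub>0\<^bsup>\<prime>\<^esup>\<close>, the
  exponential factors of the integrand absorb them.\<close>

lemma collision_small:
  assumes r: "r \<ge> 0" and \<kappa>: "\<kappa> \<ge> 0" and \<epsilon>: "\<epsilon> > 0"
  obtains R where "R \<ge> 1" "\<And>p \<Phi>. energy p \<ge> R \<Longrightarrow> (\<And>q. 0 \<le> \<Phi> q) \<Longrightarrow>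
    (\<And>q. \<Phi> q \<le> \<Phi> p * (max 1 (energy q / energy p)) powr \<kappa> * (energy p / energy q) powr r) \<Longrightarrow>
    (\<integral>\<^sup>+x. ennreal (collision_integrand \<Phi> p x) \<partial>(lborel \<Otimes>\<^sub>M sphere_measure)) \<le> ennreal (\<epsilon> * energy p powr (- b / 2) * \<Phi> p)"
proof -
  obtain C1 where C1: "C1 \<ge> 1" "\<And>p. energy p powr \<kappa> \<le> C1 * exp (1/4 * energy p)"
    using energy_powr_exp_bound[OF \<kappa>, of "1/4"] by auto
  obtain C2 where C2: "C2 \<ge> 1" "\<And>p. energy p powr r \<le> C2 * exp (1/4 * energy p)"
    using energy_powr_exp_bound[OF r, of "1/4"] by auto
  obtain C3 where C3: "C3 > 0" "\<And>p. (\<integral>\<^sup>+(q, \<omega>). ennreal (moller_velocity p q * \<sigma> (rel_mom p q) (scatter_angle p q \<omega>) * exp (- energy q / 4))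
      \<partial>(lborel \<Otimes>\<^sub>M sphere_measure)) \<le> ennreal (C3 * energy p powr (- b / 2))" using freq_upper by blast
  \<comment> \<open>Constants for the two ratios of the growth condition: z_0/p_0 is at most 2 q_0,
    and p_0/z_0 is at most twice the energy of the other outgoing particle.\<close>
  define K where "K = 2 powr \<kappa> * C1 * (2 powr r * C2)"
  have K: "K > 0" using C1 C2 by (simp add: K_def)
  \<comment> \<open>One half of \<epsilon> is for the gain part, the other for the loss
    part.\<close>
  define \<delta> where "\<delta> = \<epsilon> / (2 * K)"
  have \<delta>: "\<delta> > 0" using \<epsilon> K by (simp add: \<delta>_def)
  obtain R1 where R1: "R1 > 0" "\<And>p. energy p \<ge> R1 \<Longrightarrow>
    (\<integral>\<^sup>+(q, \<omega>). ennreal (moller_velocity p q * \<sigma> (rel_mom p q) (scatter_angle p q \<omega>) * exp (- energy q / 4) *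
       (exp (- energy (post_q p q \<omega>) / 4) + exp (- energy (post_p p q \<omega>) / 4)))
      \<partial>(lborel \<Otimes>\<^sub>M sphere_measure)) \<le> ennreal (\<delta> * energy p powr (- b / 2))"
    using gain_small[OF \<delta>] by blast
  \<comment> \<open>The last entry makes C3 exp(- p_0/4) \<le> \<delta>, because x \<le> exp
    x.\<close>
  define R where "R = max (max 1 R1) (4 * (C3 / \<delta>))"
  show ?thesis
  proof (rule that[of R])
    fix p and \<Phi> :: "vec3 \<Rightarrow> real"
    assume p: "energy p \<ge> R" and \<Phi>0: "\<And>q. 0 \<le> \<Phi> q"
      and \<Phi>: "\<And>q. \<Phi> q \<le> \<Phi> p * (max 1 (energy q / energy p)) powr \<kappa> * (energy p / energy q) powr r"
    let ?G = "\<lambda>(q, \<omega>). moller_velocity p q * \<sigma> (rel_mom p q) (scatter_angle p q \<omega>) * exp (- energy q / 4) *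
       (exp (- energy (post_q p q \<omega>) / 4) + exp (- energy (post_p p q \<omega>) / 4))"
    let ?F = "\<lambda>(q, \<omega>). moller_velocity p q * \<sigma> (rel_mom p q) (scatter_angle p q \<omega>) * exp (- energy q / 4)"
    let ?c = "exp (- energy p / 4)"
    have gainb: "exp (- energy q / 2) * (exp (- y / 2) * \<Phi> z) \<le> K * \<Phi> p * (exp (- energy q / 4) * exp (- y / 4))"
      if z: "energy z \<le> 2 * energy q * energy p" "energy p \<le> 2 * energy z * y" and y: "y = energy y'" for q z y y'
    proof -
      have y1: "y \<ge> 1" using y energy_ge_1 by simp
      have "max 1 (energy z / energy p) \<le> 2 * energy q"
        using z(1) energy_pos[of p] energy_ge_1[of q] by (simp add: pos_divide_le_eq)
      then have "max 1 (energy z / energy p) powr \<kappa> \<le> (2 * energy q) powr \<kappa>" using \<kappa> by (intro powr_mono2) auto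
      also have "\<dots> = 2 powr \<kappa> * energy q powr \<kappa>" using energy_pos[of q] by (simp add: powr_mult)
      also have "\<dots> \<le> 2 powr \<kappa> * (C1 * exp (1/4 * energy q))" using C1(2)[of q] by (intro mult_left_mono) auto
      finally have a: "max 1 (energy z / energy p) powr \<kappa> \<le> 2 powr \<kappa> * (C1 * exp (1/4 * energy q))" .
      have "energy p / energy z \<le> 2 * y" using z(2) energy_pos[of z] by (simp add: pos_divide_le_eq mult_ac)
      then have "(energy p / energy z) powr r \<le> (2 * y) powr r"
        using r energy_pos[of p] energy_pos[of z] by (intro powr_mono2) auto
      also have "\<dots> = 2 powr r * y powr r" using y1 by (simp add: powr_mult)
      also have "\<dots> \<le> 2 powr r * (C2 * exp (1/4 * y))" using C2(2)[of y'] y by (intro mult_left_mono) auto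
      finally have b': "(energy p / energy z) powr r \<le> 2 powr r * (C2 * exp (1/4 * y))" .
      have "\<Phi> z \<le> \<Phi> p * (max 1 (energy z / energy p) powr \<kappa> * (energy p / energy z) powr r)"
        using \<Phi>[of z] by (simp add: mult.assoc)
      also have "\<dots> \<le> \<Phi> p * ((2 powr \<kappa> * (C1 * exp (1/4 * energy q))) * (2 powr r * (C2 * exp (1/4 * y))))"
        using a b' \<Phi>0[of p] C1 by (intro mult_left_mono mult_mono) auto
      also have "\<dots> = K * \<Phi> p * (exp (1/4 * energy q) * exp (1/4 * y))" by (simp add: K_def)
      finally have "exp (- energy q / 2) * (exp (- y / 2) * \<Phi> z) \<le> exp (- energy q / 2) * (exp (- y / 2) * (K * \<Phi> p * (exp (1/4 * energy q) * exp (1/4 * y))))"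
        by (intro mult_left_mono) auto
      also have "\<dots> = K * \<Phi> p * ((exp (- energy q / 2) * exp (1/4 * energy q)) * (exp (- y / 2) * exp (1/4 * y)))" by simp
      also have "exp (- energy q / 2) * exp (1/4 * energy q) = exp (- energy q / 4)" by (simp add: mult_exp_exp)
      also have "exp (- y / 2) * exp (1/4 * y) = exp (- y / 4)" by (simp add: mult_exp_exp)
      finally show ?thesis .
    qed
    \<comment> \<open>The loss part is the degenerate case of \<open>gainb\<close> in which the two
      particles come out unchanged.\<close>
    have lossb: "exp (- energy q / 2) * exp (- energy p / 2) * \<Phi> q \<le> K * \<Phi> p * (exp (- energy q / 4) * ?c)" for q
    proof -
      have "energy q * 1 \<le> energy q * (2 * energy p)" "1 * energy p \<le> 2 * energy q * energy p"
        using energy_ge_1[of p] energy_ge_1[of q] by (intro mult_left_mono mult_right_mono; simp)+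
      then show ?thesis using gainb[of q q "energy p" p] by (simp add: mult_ac)
    qed
    have "(\<integral>\<^sup>+x. ennreal (collision_integrand \<Phi> p x) \<partial>(lborel \<Otimes>\<^sub>M sphere_measure))
      \<le> (\<integral>\<^sup>+x. ennreal (K * \<Phi> p) * (ennreal (?G x) + ennreal ?c * ennreal (?F x)) \<partial>(lborel \<Otimes>\<^sub>M sphere_measure))"
    proof (rule nn_integral_mono_AE, rule AE_mp[OF AE_collision[of p]], rule AE_I2, intro impI)
      fix x :: "vec3 \<times> vec3"
      assume A: "case x of (q, \<omega>) \<Rightarrow> norm \<omega> = 1 \<and> 0 \<le> \<sigma> (rel_mom p q) (scatter_angle p q \<omega>)"
      obtain q \<omega> where x: "x = (q, \<omega>)" by (cases x)
      from A have w: "norm \<omega> = 1" and s0: "0 \<le> \<sigma> (rel_mom p q) (scatter_angle p q \<omega>)" by (simp_all add: x)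
      define V where "V = moller_velocity p q * \<sigma> (rel_mom p q) (scatter_angle p q \<omega>)"
      have V: "V \<ge> 0" using s0 by (simp add: V_def moller_velocity_nonneg)
      let ?p' = "post_p p q \<omega>" and ?q' = "post_q p q \<omega>"
      have 1: "sqrt (juttner q) * (sqrt (juttner ?q') * \<Phi> ?p') \<le> K * \<Phi> p * (exp (- energy q / 4) * exp (- energy ?q' / 4))"
      proof -
        have "sqrt (juttner q) * (sqrt (juttner ?q') * \<Phi> ?p') \<le> exp (- energy q / 2) * (exp (- energy ?q' / 2) * \<Phi> ?p')"
          using sqrt_juttner_le[of q] sqrt_juttner_le[of ?q'] \<Phi>0 juttner_nonneg by (intro mult_mono mult_nonneg_nonneg) auto
        also have "\<dots> \<le> K * \<Phi> p * (exp (- energy q / 4) * exp (- energy ?q' / 4))"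
          using gainb[of ?p' q "energy ?q'" ?q'] energy_post_product[OF w, of p q] by (simp add: mult_ac)
        finally show ?thesis .
      qed
      have 2: "sqrt (juttner q) * (sqrt (juttner ?p') * \<Phi> ?q') \<le> K * \<Phi> p * (exp (- energy q / 4) * exp (- energy ?p' / 4))"
      proof -
        have "sqrt (juttner q) * (sqrt (juttner ?p') * \<Phi> ?q') \<le> exp (- energy q / 2) * (exp (- energy ?p' / 2) * \<Phi> ?q')"
          using sqrt_juttner_le[of q] sqrt_juttner_le[of ?p'] \<Phi>0 juttner_nonneg by (intro mult_mono mult_nonneg_nonneg) auto
        also have "\<dots> \<le> K * \<Phi> p * (exp (- energy q / 4) * exp (- energy ?p' / 4))"
          using gainb[of ?q' q "energy ?p'" ?p'] energy_post_product[OF w, of p q] by (simp add: mult_ac)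
        finally show ?thesis .
      qed
      have 3: "sqrt (juttner q * juttner p) * \<Phi> q \<le> K * \<Phi> p * (exp (- energy q / 4) * ?c)"
      proof -
        have "sqrt (juttner q * juttner p) * \<Phi> q \<le> exp (- energy q / 2) * exp (- energy p / 2) * \<Phi> q"
          unfolding real_sqrt_mult
          using sqrt_juttner_le[of q] sqrt_juttner_le[of p] \<Phi>0 juttner_nonneg by (intro mult_right_mono mult_mono) auto
        also note lossb[of q]
        finally show ?thesis .
      qed
      have "collision_integrand \<Phi> p (q, \<omega>) = V * (sqrt (juttner q) * (sqrt (juttner ?q') * \<Phi> ?p') + sqrt (juttner q) * (sqrt (juttner ?p') * \<Phi> ?q') + sqrt (juttner q * juttner p) * \<Phi> q)"
        by (simp add: collision_integrand_def V_def distrib_left)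
      also have "\<dots> \<le> V * (K * \<Phi> p * (exp (- energy q / 4) * exp (- energy ?q' / 4)) + K * \<Phi> p * (exp (- energy q / 4) * exp (- energy ?p' / 4)) + K * \<Phi> p * (exp (- energy q / 4) * ?c))"
        using 1 2 3 V by (intro mult_left_mono add_mono) auto
      also have "\<dots> = K * \<Phi> p * (V * exp (- energy q / 4) * (exp (- energy ?q' / 4) + exp (- energy ?p' / 4)) + ?c * (V * exp (- energy q / 4)))"
        by (simp only: distrib_left distrib_right mult_ac)
      also have "\<dots> = K * \<Phi> p * (?G (q, \<omega>) + ?c * ?F (q, \<omega>))" by (simp add: V_def)
      finally have "collision_integrand \<Phi> p (q, \<omega>) \<le> K * \<Phi> p * (?G (q, \<omega>) + ?c * ?F (q, \<omega>))" .
      moreover have "0 \<le> ?G (q, \<omega>)" "0 \<le> ?F (q, \<omega>)" using V by (simp_all add: V_def)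
      moreover have "0 \<le> K * \<Phi> p" using K \<Phi>0 by simp
      ultimately show "ennreal (collision_integrand \<Phi> p x) \<le> ennreal (K * \<Phi> p) * (ennreal (?G x) + ennreal ?c * ennreal (?F x))"
        unfolding x
        by (simp only: ennreal_mult[symmetric] ennreal_plus[symmetric] ennreal_leI exp_ge_zero mult_nonneg_nonneg add_nonneg_nonneg)
    qed
    also have "\<dots> = ennreal (K * \<Phi> p) * ((\<integral>\<^sup>+x. ennreal (?G x) \<partial>(lborel \<Otimes>\<^sub>M sphere_measure)) + ennreal ?c * (\<integral>\<^sup>+x. ennreal (?F x) \<partial>(lborel \<Otimes>\<^sub>M sphere_measure)))"
      by (simp add: nn_integral_cmult nn_integral_add)
    also have "\<dots> \<le> ennreal (K * \<Phi> p) * (ennreal (\<delta> * energy p powr (- b / 2)) + ennreal ?c * ennreal (C3 * energy p powr (- b / 2)))"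
      using R1(2)[of p] C3(2)[of p] p by (intro mult_left_mono add_mono) (auto simp: R_def case_prod_unfold)
    also have "\<dots> = ennreal (K * \<Phi> p * (\<delta> * energy p powr (- b / 2) + ?c * (C3 * energy p powr (- b / 2))))"
      using K \<Phi>0 \<delta> C3 by (simp add: ennreal_mult[symmetric] ennreal_plus[symmetric] del: ennreal_plus)
    also have "\<dots> \<le> ennreal (K * \<Phi> p * (\<delta> * energy p powr (- b / 2) + \<delta> * energy p powr (- b / 2)))"
    proof (intro ennreal_leI mult_left_mono add_left_mono)
      have "energy p / 4 \<ge> C3 / \<delta>" using p by (simp add: R_def mult.commute)
      moreover have "energy p / 4 \<le> exp (energy p / 4)" using exp_ge_add_one_self[of "energy p / 4"] by linarith
      ultimately have "C3 / \<delta> \<le> exp (energy p / 4)" by linarith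
      then have "C3 \<le> exp (energy p / 4) * \<delta>" using \<delta> by (simp add: pos_divide_le_eq)
      then have "?c * C3 \<le> ?c * (exp (energy p / 4) * \<delta>)" by (intro mult_left_mono) auto
      also have "\<dots> = \<delta>" by (simp add: mult.assoc[symmetric] mult_exp_exp)
      finally have "?c * C3 * energy p powr (- b / 2) \<le> \<delta> * energy p powr (- b / 2)" by (intro mult_right_mono) auto
      then show "?c * (C3 * energy p powr (- b / 2)) \<le> \<delta> * energy p powr (- b / 2)" by (simp add: mult.assoc)
      show "0 \<le> K * \<Phi> p" using K \<Phi>0 by simp
    qed
    also have "K * \<Phi> p * (\<delta> * energy p powr (- b / 2) + \<delta> * energy p powr (- b / 2)) = \<epsilon> * energy p powr (- b / 2) * \<Phi> p"
      using K by (simp add: \<delta>_def)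
    finally show "(\<integral>\<^sup>+x. ennreal (collision_integrand \<Phi> p x) \<partial>(lborel \<Otimes>\<^sub>M sphere_measure)) \<le> ennreal (\<epsilon> * energy p powr (- b / 2) * \<Phi> p)" .
  qed (simp add: R_def)
qed

end

section \<open>The collision frequency from below\<close>

lemma juttner_le: "juttner q \<le> exp (- energy q / 4)"
proof -
  have "juttner q = (sqrt (juttner q))\<^sup>2" by (simp add: juttner_nonneg)
  also have "\<dots> \<le> (exp (- energy q / 2))\<^sup>2" by (intro power_mono sqrt_juttner_le) (simp add: juttner_nonneg)
  also have "\<dots> \<le> exp (- energy q / 4)" using energy_pos[of q] by (simp add: power2_eq_square mult_exp_exp)
  finally show ?thesis .
qed

lemma juttner_le': "juttner q \<le> exp (- (energy q / 4))" using juttner_le[of q] by simp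

context soft_kernel
begin

text \<open>The relevant angles have positive measure, and \<open>arccos\<close> maps null sets
  inside (-1, 1) to null sets, so in the variable u = cos \<theta> they still have positive measure.
  A real lower bound also covers an infinite integral.\<close>

lemma \<sigma>0_sphere_pos:
  obtains s where "s > 0" "\<And>k. norm k = 1 \<Longrightarrow> ennreal s \<le> (\<integral>\<^sup>+\<omega>. ennreal (\<sigma>0 (arccos (k \<bullet> \<omega>))) \<partial>sphere_measure)"
proof -
  \<comment> \<open>\<open>nn_integral_sphere_angle\<close> asks for a function that is nonnegative
    everywhere, while \<open>\<sigma>0\<close> is so on [0, pi]; truncating at 0 leaves the
    \<open>ennreal\<close> integrand unchanged.\<close>
  have max0: "ennreal (max 0 x) = ennreal x" for x :: real by (simp add: max_def ennreal_neg)
  define I where "I = (\<integral>\<^sup>+u. ennreal (\<sigma>0 (arccos u)) * indicator {-1<..<1} u \<partial>lborel)"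
  have "I \<noteq> 0"
  proof
    assume "I = 0"
    then have ae: "AE u in lborel. ennreal (\<sigma>0 (arccos u)) * indicator {-1<..<1} u = 0"
      unfolding I_def by (subst (asm) nn_integral_0_iff_AE) simp_all
    define N where "N = {u \<in> {-1<..<1}. \<sigma>0 (arccos u) > 0}"
    have Nm: "N \<in> sets borel" unfolding N_def by measurable
    have "AE u in lborel. u \<notin> N"
      using ae by eventually_elim (auto simp: N_def ennreal_eq_0_iff)
    then have "N \<in> null_sets lborel" using Nm by (subst (asm) AE_iff_null_sets[symmetric]) auto
    then have "negligible N" by (simp add: negligible_iff_null_sets null_sets_completionI)
    then have neg: "negligible (arccos ` N)"
    proof (rule negligible_differentiable_image_negligible[OF order_refl])
      show "arccos differentiable_on N"
        unfolding differentiable_on_def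
      proof
        fix u assume "u \<in> N"
        then have "(arccos has_real_derivative inverse (- sqrt (1 - u\<^sup>2))) (at u)"
          by (intro DERIV_arccos) (auto simp: N_def)
        then show "arccos differentiable at u within N"
          by (meson has_field_derivative_imp_has_derivative differentiableI has_derivative_at_withinI)
      qed
    qed
    have "{\<theta> \<in> {0..pi}. \<sigma>0 \<theta> \<noteq> 0} \<subseteq> arccos ` N \<union> {0, pi}"
    proof
      fix \<theta> assume t: "\<theta> \<in> {\<theta> \<in> {0..pi}. \<sigma>0 \<theta> \<noteq> 0}"
      show "\<theta> \<in> arccos ` N \<union> {0, pi}"
      proof (cases "\<theta> = 0 \<or> \<theta> = pi")
        case False
        then have b: "0 < \<theta>" "\<theta> < pi" using t by auto
        have c: "arccos (cos \<theta>) = \<theta>" using b by (intro arccos_cos) auto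
        have "cos \<theta> < cos 0" using b by (intro cos_monotone_0_pi) auto
        moreover have "cos pi < cos \<theta>" using b by (intro cos_monotone_0_pi) auto
        ultimately have "cos \<theta> \<in> {-1<..<1}" by simp
        moreover have "\<sigma>0 \<theta> > 0" using t \<sigma>0_nonneg[of \<theta>] by auto
        ultimately have "cos \<theta> \<in> N" unfolding N_def by (simp add: c)
        then have "arccos (cos \<theta>) \<in> arccos ` N" by (rule imageI)
        then show ?thesis by (simp add: c)
      qed auto
    qed
    moreover have "negligible (arccos ` N \<union> {0, pi})" using neg by simp
    ultimately have "negligible {\<theta> \<in> {0..pi}. \<sigma>0 \<theta> \<noteq> 0}" by (rule negligible_subset[rotated])
    moreover have "{\<theta> \<in> {0..pi}. \<sigma>0 \<theta> \<noteq> 0} \<in> sets lborel" by measurable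
    ultimately have "emeasure lborel {\<theta> \<in> {0..pi}. \<sigma>0 \<theta> \<noteq> 0} = 0"
      by (simp add: negligible_iff_emeasure0)
    then show False using \<sigma>0_nonzero by simp
  qed
  then obtain r where r: "r > 0" "ennreal r \<le> I"
  proof (cases I)
    case (real x)
    then show ?thesis using \<open>I \<noteq> 0\<close> that[of x] by (auto simp: less_le)
  next
    case top
    then show ?thesis using that[of 1] by simp
  qed
  show ?thesis
  proof (rule that[of "2 * pi * r"])
    fix k :: vec3 assume k: "norm k = 1"
    have "ennreal (2 * pi * r) = ennreal (2 * pi) * ennreal r" using r by (simp add: ennreal_mult)
    also have "\<dots> \<le> ennreal (2 * pi) * I" using r by (intro mult_left_mono) auto
    also have "\<dots> = (\<integral>\<^sup>+\<omega>. ennreal (\<sigma>0 (arccos (k \<bullet> \<omega>))) \<partial>sphere_measure)"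
      using nn_integral_sphere_angle[of "\<lambda>\<theta>. max 0 (\<sigma>0 \<theta>)", OF _ _ k] by (simp add: max0 I_def)
    finally show "ennreal (2 * pi * r) \<le> (\<integral>\<^sup>+\<omega>. ennreal (\<sigma>0 (arccos (k \<bullet> \<omega>))) \<partial>sphere_measure)" .
  qed (use r in simp)
qed

text \<open>For a slow partner, g^2 lies between p_0/4 and 6 p_0. The constant is 1/6 * 1/36: the
  first factor bounds v g / sqrt s = g^2/(p_0 q_0), the second bounds 6^(-b/2) for b < 4.\<close>

lemma moller_lower:
  assumes p: "8 \<le> energy p" and q: "norm q \<le> 1"
  shows "p \<noteq> q" "1/216 * energy p powr (- b / 2) \<le> moller_velocity p q * (rel_mom p q / sqrt ((rel_mom p q)\<^sup>2 + 4) * rel_mom p q powr (- b))"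
proof -
  define g where "g = rel_mom p q"
  define x where "x = energy p"
  define y where "y = energy q"
  have "y\<^sup>2 \<le> (3/2)\<^sup>2" using power_le_one[of "norm q" 2] q by (simp add: y_def energy_sq power_divide)
  then have y: "y \<le> 3/2" by (rule power2_le_imp_le) simp
  have y1: "1 \<le> y" by (simp add: y_def energy_ge_1)
  have x: "8 \<le> x" using p by (simp add: x_def)
  have "x < y" if "p = q" using that x y by (simp add: x_def y_def)
  then show pq: "p \<noteq> q" using x y by (auto simp: x_def y_def)
  have g: "g > 0" using rel_mom_pos[OF pq] by (simp add: g_def)
  have "x / (3/2) \<le> x / y" using x y y1 by (intro divide_left_mono) auto
  moreover have "g\<^sup>2 \<ge> x / y - 2" unfolding g_def x_def y_def by (rule rel_mom_sq_ge)
  ultimately have g1: "g\<^sup>2 \<ge> x / 4" using x by simp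
  have "g\<^sup>2 \<le> 4 * (x * y)" unfolding g_def x_def y_def by (rule rel_mom_sq_le)
  also have "\<dots> \<le> 4 * (x * (3/2))" using x y by (intro mult_left_mono) auto
  finally have g2: "g\<^sup>2 \<le> 6 * x" by simp
  have "1/36 * x powr (- b / 2) \<le> 6 powr (- b / 2) * x powr (- b / 2)"
  proof (rule mult_right_mono)
    have "6 powr (-2) \<le> 6 powr (- b / 2)" using b by (intro powr_mono) auto
    then show "1/36 \<le> (6::real) powr (- b / 2)" by (simp add: powr_minus_divide)
  qed simp
  also have "\<dots> = (6 * x) powr (- b / 2)" using x by (simp add: powr_mult)
  also have "\<dots> \<le> (g\<^sup>2) powr (- b / 2)" using g g2 b by (intro powr_mono2') auto
  also have "\<dots> = g powr (- b)" using g by (simp add: powr_powr flip: powr_numeral)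
  finally have gb: "1/36 * x powr (- b / 2) \<le> g powr (- b)" .
  have s: "mandel_s p q = g\<^sup>2 + 4" by (simp add: mandel_s_eq g_def)
  have s0: "sqrt (g\<^sup>2 + 4) > 0" using g by (simp add: add_nonneg_pos)
  have "moller_velocity p q * (g / sqrt (g\<^sup>2 + 4)) = g\<^sup>2 / (x * y)"
    using s0 by (simp add: moller_velocity_def g_def[symmetric] s x_def y_def power2_eq_square)
  also have "\<dots> \<ge> (x / 4) / (x * (3/2))"
    using x y y1 g1 by (intro frac_le) auto
  finally have "1/6 \<le> moller_velocity p q * (g / sqrt (g\<^sup>2 + 4))" using x by simp
  then have "1/6 * (1/36 * x powr (- b / 2)) \<le> (moller_velocity p q * (g / sqrt (g\<^sup>2 + 4))) * g powr (- b)"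
    using gb g by (intro mult_mono) (auto simp: moller_velocity_nonneg)
  then show "1/216 * energy p powr (- b / 2) \<le> moller_velocity p q * (rel_mom p q / sqrt ((rel_mom p q)\<^sup>2 + 4) * rel_mom p q powr (- b))"
    by (simp add: x_def g_def mult.assoc)
qed

lemma coll_freq_nn_integral:
  "(\<integral>\<^sup>+(q, \<omega>). ennreal (moller_velocity p q * \<sigma> (rel_mom p q) (scatter_angle p q \<omega>) * juttner q) \<partial>(lborel \<Otimes>\<^sub>M sphere_measure))
     = ennreal (coll_freq \<sigma> p)"
  and coll_freq_nonneg: "0 \<le> coll_freq \<sigma> p"
proof -
  let ?F = "\<lambda>(q, \<omega>). moller_velocity p q * \<sigma> (rel_mom p q) (scatter_angle p q \<omega>) * juttner q"
  obtain C where C: "C > 0" "\<And>p. (\<integral>\<^sup>+(q, \<omega>). ennreal (moller_velocity p q * \<sigma> (rel_mom p q) (scatter_angle p q \<omega>) * exp (- energy q / 4))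
      \<partial>(lborel \<Otimes>\<^sub>M sphere_measure)) \<le> ennreal (C * energy p powr (- b / 2))" using freq_upper by blast
  have nn: "AE x in lborel \<Otimes>\<^sub>M sphere_measure. 0 \<le> ?F x"
    using AE_collision[of p] by eventually_elim (auto simp: moller_velocity_nonneg juttner_nonneg)
  have m: "?F \<in> borel_measurable (lborel \<Otimes>\<^sub>M sphere_measure)" by measurable
  have "(\<integral>\<^sup>+x. ennreal (norm (?F x)) \<partial>(lborel \<Otimes>\<^sub>M sphere_measure))
     \<le> (\<integral>\<^sup>+(q, \<omega>). ennreal (moller_velocity p q * \<sigma> (rel_mom p q) (scatter_angle p q \<omega>) * exp (- energy q / 4)) \<partial>(lborel \<Otimes>\<^sub>M sphere_measure))"
    by (rule nn_integral_mono_AE, rule AE_mp[OF AE_collision[of p]], rule AE_I2)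
       (auto simp: moller_velocity_nonneg juttner_nonneg intro!: ennreal_leI mult_left_mono juttner_le')
  also have "\<dots> < \<infinity>" using C(2)[of p] by (simp add: order.strict_trans1)
  finally have "integrable (lborel \<Otimes>\<^sub>M sphere_measure) ?F"
    using m by (intro integrableI_bounded) auto
  from nn_integral_eq_integral[OF this nn]
  show "(\<integral>\<^sup>+(q, \<omega>). ennreal (moller_velocity p q * \<sigma> (rel_mom p q) (scatter_angle p q \<omega>) * juttner q) \<partial>(lborel \<Otimes>\<^sub>M sphere_measure))
     = ennreal (coll_freq \<sigma> p)"
    unfolding coll_freq_def by (simp add: case_prod_unfold)
  show "0 \<le> coll_freq \<sigma> p" unfolding coll_freq_def using nn by (rule integral_nonneg_AE)
qed

text \<open>For the lower bound, partners in the unit ball already contribute the full rate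
  p_0^(-b/2), since g^2 is comparable to p_0 there.\<close>

lemma coll_freq_bounds:
  obtains c C where "c > 0" "C > 0" "\<And>p. 8 \<le> energy p \<Longrightarrow> c * energy p powr (- b / 2) \<le> coll_freq \<sigma> p"
    "\<And>p. coll_freq \<sigma> p \<le> C * energy p powr (- b / 2)"
proof -
  obtain C where C: "C > 0" "\<And>p. (\<integral>\<^sup>+(q, \<omega>). ennreal (moller_velocity p q * \<sigma> (rel_mom p q) (scatter_angle p q \<omega>) * exp (- energy q / 4))
      \<partial>(lborel \<Otimes>\<^sub>M sphere_measure)) \<le> ennreal (C * energy p powr (- b / 2))" using freq_upper by blast
  obtain s where s: "s > 0" "\<And>k. norm k = 1 \<Longrightarrow> ennreal s \<le> (\<integral>\<^sup>+\<omega>. ennreal (\<sigma>0 (arccos (k \<bullet> \<omega>))) \<partial>sphere_measure)"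
    using \<sigma>0_sphere_pos by blast
  define v where "v = measure lborel (ball (0::vec3) 1)"
  have v: "v > 0" "emeasure lborel (ball (0::vec3) 1) = ennreal v"
    using emeasure_bounded_finite[of "ball (0::vec3) 1"]
    by (simp_all add: v_def content_ball_pos emeasure_eq_ennreal_measure less_top)
  \<comment> \<open>Product of the lower kernel constant, the constant of
    \<open>moller_lower\<close>, and the Juttner factor at energy 2, a bound for
    \<open>energy q\<close> on the unit ball.\<close>
  define c0 where "c0 = csig * (1/216) * (exp (- 2) / (4 * pi))"
  have c0: "c0 > 0" using csig by (simp add: c0_def)
  show ?thesis
  proof (rule that[of "c0 * s * v" C])
    show "c0 * s * v > 0" using c0 s(1) v by simp
    fix p :: vec3
    have "ennreal (coll_freq \<sigma> p) \<le> (\<integral>\<^sup>+(q, \<omega>). ennreal (moller_velocity p q * \<sigma> (rel_mom p q) (scatter_angle p q \<omega>) * exp (- energy q / 4)) \<partial>(lborel \<Otimes>\<^sub>M sphere_measure))"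
      unfolding coll_freq_nn_integral[symmetric]
      by (rule nn_integral_mono_AE, rule AE_mp[OF AE_collision[of p]], rule AE_I2)
         (auto simp: moller_velocity_nonneg intro!: ennreal_leI mult_left_mono juttner_le')
    also have "\<dots> \<le> ennreal (C * energy p powr (- b / 2))" by (rule C)
    finally show "coll_freq \<sigma> p \<le> C * energy p powr (- b / 2)" using C by (simp add: ennreal_le_iff)
    assume p: "8 \<le> energy p"
    let ?x = "energy p powr (- b / 2)"
    have "ennreal (c0 * s * v * ?x) = (\<integral>\<^sup>+q. ennreal (c0 * s * ?x) * indicator (ball (0::vec3) 1) q \<partial>lborel)"
      using c0 s(1) v by (subst nn_integral_cmult_indicator) (simp_all add: ennreal_mult[symmetric] mult_ac)
    also have "\<dots> \<le> (\<integral>\<^sup>+q. \<integral>\<^sup>+\<omega>. ennreal (moller_velocity p q * \<sigma> (rel_mom p q) (scatter_angle p q \<omega>) * juttner q) \<partial>sphere_measure \<partial>lborel)"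
    proof (rule nn_integral_mono)
      fix q :: vec3
      show "ennreal (c0 * s * ?x) * indicator (ball 0 1) q \<le> (\<integral>\<^sup>+\<omega>. ennreal (moller_velocity p q * \<sigma> (rel_mom p q) (scatter_angle p q \<omega>) * juttner q) \<partial>sphere_measure)"
      proof (cases "q \<in> ball 0 1")
        case True
        then have q: "norm q \<le> 1" by simp
        note pq = moller_lower(1)[OF p q] and low = moller_lower(2)[OF p q]
        define k where "k = com_mom p q /\<^sub>R rel_mom p q"
        have k: "norm k = 1" unfolding k_def by (rule norm_scatter_axis[OF pq])
        have "energy q \<le> 2"
        proof (rule power2_le_imp_le)
          show "(energy q)\<^sup>2 \<le> 2\<^sup>2" using q power_le_one[of "norm q" 2] by (simp add: energy_sq)
        qed simp
        then have j: "juttner q \<ge> exp (- 2) / (4 * pi)" by (simp add: juttner_def divide_right_mono)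
        have "ennreal (c0 * s * ?x) = ennreal (c0 * ?x) * ennreal s"
          using c0 s(1) by (simp add: ennreal_mult[symmetric] mult_ac)
        also have "\<dots> \<le> ennreal (c0 * ?x) * (\<integral>\<^sup>+\<omega>. ennreal (\<sigma>0 (arccos (k \<bullet> \<omega>))) \<partial>sphere_measure)"
          by (intro mult_left_mono s k) simp
        also have "\<dots> = (\<integral>\<^sup>+\<omega>. ennreal (c0 * ?x) * ennreal (\<sigma>0 (arccos (k \<bullet> \<omega>))) \<partial>sphere_measure)"
          by (rule nn_integral_cmult[symmetric]) simp
        also have "\<dots> \<le> (\<integral>\<^sup>+\<omega>. ennreal (moller_velocity p q * \<sigma> (rel_mom p q) (scatter_angle p q \<omega>) * juttner q) \<partial>sphere_measure)"
        proof (rule nn_integral_mono_AE, rule AE_mp[OF kernel_angle_le[OF pq]], rule AE_mp[OF AE_sphere_inner[OF k]], rule AE_I2, intro impI)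
          fix \<omega>
          assume u: "norm \<omega> = 1 \<and> k \<bullet> \<omega> \<in> {-1<..<1}"
          assume A: "norm \<omega> = 1 \<and> 0 \<le> \<sigma> (rel_mom p q) (scatter_angle p q \<omega>) \<and>
             \<sigma> (rel_mom p q) (scatter_angle p q \<omega>) \<le> Csig * rel_mom p q powr (- b) *
                sin (arccos ((com_mom p q /\<^sub>R rel_mom p q) \<bullet> \<omega>)) powr \<gamma> \<and>
             0 < sin (arccos ((com_mom p q /\<^sub>R rel_mom p q) \<bullet> \<omega>)) \<and>
             csig * (rel_mom p q / sqrt ((rel_mom p q)\<^sup>2 + 4) * rel_mom p q powr (- b) *
               \<sigma>0 (arccos ((com_mom p q /\<^sub>R rel_mom p q) \<bullet> \<omega>))) \<le> \<sigma> (rel_mom p q) (scatter_angle p q \<omega>)"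
          define t where "t = \<sigma>0 (arccos (k \<bullet> \<omega>))"
          have t: "t \<ge> 0" unfolding t_def using u by (intro \<sigma>0_nonneg arccos_lbound arccos_ubound) auto
          define G where "G = rel_mom p q / sqrt ((rel_mom p q)\<^sup>2 + 4) * rel_mom p q powr (- b)"
          have "csig * (G * t) \<le> \<sigma> (rel_mom p q) (scatter_angle p q \<omega>)" using A by (simp add: G_def t_def k_def)
          then have "(moller_velocity p q * (csig * (G * t))) * (exp (- 2) / (4 * pi)) \<le> (moller_velocity p q * \<sigma> (rel_mom p q) (scatter_angle p q \<omega>)) * juttner q"
            using A j by (intro mult_mono mult_left_mono mult_nonneg_nonneg) (auto simp: moller_velocity_nonneg)
          moreover have "csig * (1/216 * ?x) * t * (exp (- 2) / (4 * pi)) \<le> csig * (moller_velocity p q * G) * t * (exp (- 2) / (4 * pi))"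
            using low csig t by (intro mult_right_mono mult_left_mono) (auto simp: G_def)
          ultimately have "c0 * ?x * t \<le> moller_velocity p q * \<sigma> (rel_mom p q) (scatter_angle p q \<omega>) * juttner q"
            by (simp add: c0_def mult_ac)
          then show "ennreal (c0 * ?x) * ennreal (\<sigma>0 (arccos (k \<bullet> \<omega>))) \<le> ennreal (moller_velocity p q * \<sigma> (rel_mom p q) (scatter_angle p q \<omega>) * juttner q)"
            using c0 t by (simp add: t_def[symmetric] ennreal_mult[symmetric] ennreal_leI)
        qed
        finally show ?thesis using True by simp
      qed simp
    qed
    also have "\<dots> = ennreal (coll_freq \<sigma> p)"
      unfolding coll_freq_nn_integral[symmetric] by (subst sphere_nn_integral_fst) simp_all
    finally show "c0 * s * v * ?x \<le> coll_freq \<sigma> p"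
      by (simp add: ennreal_le_iff coll_freq_nonneg)
  qed (rule C)
qed

lemma measurable_coll_freq [measurable]: "coll_freq \<sigma> \<in> borel_measurable borel"
proof -
  have "coll_freq \<sigma> p = enn2real (\<integral>\<^sup>+x. ennreal (moller_velocity p (fst x) * \<sigma> (rel_mom p (fst x)) (scatter_angle p (fst x) (snd x)) * juttner (fst x)) \<partial>(lborel \<Otimes>\<^sub>M sphere_measure))" for p
    using coll_freq_nn_integral[of p] coll_freq_nonneg[of p] by (simp add: case_prod_unfold)
  moreover have "(\<lambda>p. \<integral>\<^sup>+x. ennreal (moller_velocity p (fst x) * \<sigma> (rel_mom p (fst x)) (scatter_angle p (fst x) (snd x)) * juttner (fst x)) \<partial>(lborel \<Otimes>\<^sub>M sphere_measure)) \<in> borel_measurable borel"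
    by (rule sigma_finite_measure.borel_measurable_nn_integral[OF sigma_finite_pair_measure[OF sigma_finite_lborel sigma_finite_sphere]]) measurable
  ultimately show ?thesis by (simp add: fun_eq_iff[symmetric] cong: measurable_cong)
qed

end

section \<open>Collisions and null sets\<close>

lemma has_derivative_sqrt_pos:
  assumes "(f has_derivative f') (at x within s)" "f x > (0::real)"
  shows "((\<lambda>x. sqrt (f x)) has_derivative (\<lambda>h. f' h * (inverse (sqrt (f x)) / 2))) (at x within s)"
  using assms by (intro has_derivative_real_sqrt)

lemma has_derivative_energy [derivative_intros]:
  assumes "(f has_derivative f') (at x within s)"
  shows "((\<lambda>x. energy (f x)) has_derivative (\<lambda>h. (f x \<bullet> f' h) / energy (f x))) (at x within s)"
proof -
  have e: "energy p = sqrt (1 + p \<bullet> p)" for p by (simp add: energy_def power2_norm_eq_inner)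
  have pos: "1 + f x \<bullet> f x > 0" using inner_ge_zero[of "f x"] by linarith
  have "((\<lambda>x. sqrt (1 + f x \<bullet> f x)) has_derivative (\<lambda>h. (0 + (f x \<bullet> f' h + f' h \<bullet> f x)) * (inverse (sqrt (1 + f x \<bullet> f x)) / 2))) (at x within s)"
    by (rule has_derivative_sqrt_pos, rule has_derivative_add, rule has_derivative_const, rule has_derivative_inner, rule assms, rule assms, rule pos)
  moreover have "(\<lambda>h. (0 + (f x \<bullet> f' h + f' h \<bullet> f x)) * (inverse (sqrt (1 + f x \<bullet> f x)) / 2)) = (\<lambda>h. (f x \<bullet> f' h) / energy (f x))"
  proof
    fix h
    have *: "(0 + (a + c)) * (inverse r / 2) = a / r" if "c = a" for a c r :: real
      using that by (simp add: inverse_eq_divide)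
    show "(0 + (f x \<bullet> f' h + f' h \<bullet> f x)) * (inverse (sqrt (1 + f x \<bullet> f x)) / 2) = (f x \<bullet> f' h) / energy (f x)"
      unfolding e by (rule *) (rule inner_commute)
  qed
  ultimately show ?thesis unfolding e by (simp only:)
qed

text \<open>The pair of momenta in terms of the total momentum and the momentum in the centre-of-momentum frame.
  A collision only rotates the second component (\<open>com_split_scatter\<close>), which reduces the
  nonsingularity of the collision map to that of polar coordinates.\<close>

definition com_split :: "vec3 \<times> vec3 \<Rightarrow> vec3 \<times> vec3" where
  "com_split z = (fst z + snd z, (1/2) *\<^sub>R com_mom (fst z) (snd z))"

text \<open>The boost from the centre-of-momentum frame back to total momentum P. As |\<xi>| = g/2,
  the term 4 + 4 |\<xi>|^2 is s, and s + |P|^2 is the square of the total energy, so P and \<xi>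
  determine everything.\<close>

definition com_boost :: "vec3 \<Rightarrow> vec3 \<Rightarrow> vec3" where
  "com_boost P \<xi> = \<xi> + ((P \<bullet> \<xi>) / (sqrt (4 + 4 * (\<xi> \<bullet> \<xi>)) *
     (sqrt (4 + 4 * (\<xi> \<bullet> \<xi>) + P \<bullet> P) + sqrt (4 + 4 * (\<xi> \<bullet> \<xi>))))) *\<^sub>R P"

definition com_join :: "vec3 \<times> vec3 \<Rightarrow> vec3 \<times> vec3" where
  "com_join y = ((1/2) *\<^sub>R fst y + com_boost (fst y) (snd y), (1/2) *\<^sub>R fst y - com_boost (fst y) (snd y))"

lemma differentiable_com_split: "com_split differentiable (at z within S)"
proof -
  have pos: "2 * (energy (fst z) * energy (snd z) - fst z \<bullet> snd z + 1) > 0"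
    using mandel_s_ge_4[of "fst z" "snd z"] by (simp add: mandel_s_def)
  have nz: "energy (fst z) + energy (snd z) + sqrt (2 * (energy (fst z) * energy (snd z) - fst z \<bullet> snd z + 1)) \<noteq> 0"
    using real_sqrt_gt_zero[OF pos] energy_pos[of "fst z"] energy_pos[of "snd z"] by linarith
  show ?thesis
    unfolding com_split_def com_mom_def mandel_s_def differentiable_def
    by (rule exI, (rule derivative_intros has_derivative_sqrt_pos | rule pos nz)+)
qed

lemma differentiable_com_join: "com_join differentiable (at z within S)"
proof -
  have p1: "4 + 4 * (snd z \<bullet> snd z) > 0" using inner_ge_zero[of "snd z"] by linarith
  have p2: "4 + 4 * (snd z \<bullet> snd z) + fst z \<bullet> fst z > 0" using p1 inner_ge_zero[of "fst z"] by linarith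
  have nz: "sqrt (4 + 4 * (snd z \<bullet> snd z)) * (sqrt (4 + 4 * (snd z \<bullet> snd z) + fst z \<bullet> fst z) + sqrt (4 + 4 * (snd z \<bullet> snd z))) \<noteq> 0"
  proof -
    have "sqrt (4 + 4 * (snd z \<bullet> snd z)) * (sqrt (4 + 4 * (snd z \<bullet> snd z) + fst z \<bullet> fst z) + sqrt (4 + 4 * (snd z \<bullet> snd z))) > 0"
      by (intro mult_pos_pos add_pos_pos real_sqrt_gt_zero p1 p2)
    then show ?thesis by linarith
  qed
  show ?thesis
    unfolding com_join_def com_boost_def differentiable_def
    by (rule exI, (rule derivative_intros has_derivative_sqrt_pos | rule p1 p2 nz)+)
qed

text \<open>The energy difference is what the boost back has to recover; it is read off from the
  inner product of P and \<xi>.\<close>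

lemma com_mom_inner: "(p + q) \<bullet> com_mom p q = (energy p - energy q) * sqrt (mandel_s p q)"
proof -
  define E where "E = energy p + energy q"
  define S where "S = sqrt (mandel_s p q)"
  define d where "d = energy p - energy q"
  have S: "S > 0" using mandel_s_ge_4[of p q] by (simp add: S_def)
  have E: "E > 0" using energy_pos[of p] energy_pos[of q] by (simp add: E_def)
  have S2: "S\<^sup>2 = E\<^sup>2 - (p + q) \<bullet> (p + q)" using mandel_s_ge_4[of p q]
    by (simp add: S_def E_def mandel_s_total power2_norm_eq_inner)
  have PP: "(p + q) \<bullet> (p + q) = (E - S) * (E + S)" using S2 by (simp add: power2_eq_square algebra_simps)
  have pq: "(p + q) \<bullet> (p - q) = E * d"
    using energy_sq_inner[of p] energy_sq_inner[of q]
    by (simp add: E_def d_def inner_add_left inner_diff_right inner_commute algebra_simps)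
  have "(p + q) \<bullet> com_mom p q = E * d - d / (E + S) * ((E - S) * (E + S))"
  proof -
    have "com_mom p q = (p - q) - (d / (E + S)) *\<^sub>R (p + q)"
      by (simp add: com_mom_def E_def S_def d_def)
    then have "(p + q) \<bullet> com_mom p q = (p + q) \<bullet> (p - q) - d / (E + S) * ((p + q) \<bullet> (p + q))"
      by (simp only: inner_diff_right[of "p + q" "p - q"] inner_scaleR_right)
    then show ?thesis unfolding pq PP .
  qed
  also have "d / (E + S) * ((E - S) * (E + S)) = d * (E - S)" using S E by simp
  finally show ?thesis by (simp add: S_def d_def algebra_simps)
qed

text \<open>With s and the energy difference expressed by P and \<xi>, the multiple of P added by
  \<open>com_boost\<close> is the one subtracted in \<open>com_mom\<close>, up to the common factor
  1/2.\<close>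

lemma com_join_split: "com_join (com_split (p, q)) = (p, q)"
proof -
  define E where "E = energy p + energy q"
  define S where "S = sqrt (mandel_s p q)"
  define d where "d = energy p - energy q"
  have S: "S > 0" using mandel_s_ge_4[of p q] by (simp add: S_def)
  have E: "E > 0" using energy_pos[of p] energy_pos[of q] by (simp add: E_def)
  define \<xi> where "\<xi> = (1/2) *\<^sub>R com_mom p q"
  have "\<xi> \<bullet> \<xi> = (norm \<xi>)\<^sup>2" by (simp add: power2_norm_eq_inner)
  also have "\<dots> = (rel_mom p q)\<^sup>2 / 4" by (simp add: \<xi>_def norm_com_mom power_divide)
  finally have s: "4 + 4 * (\<xi> \<bullet> \<xi>) = mandel_s p q" by (simp add: mandel_s_eq)
  have Ee: "sqrt (mandel_s p q + (p + q) \<bullet> (p + q)) = E"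
    using energy_pos[of p] energy_pos[of q] by (simp add: mandel_s_total power2_norm_eq_inner E_def)
  have i: "(p + q) \<bullet> \<xi> = d * S / 2" using com_mom_inner[of p q] by (simp add: \<xi>_def d_def S_def)
  have "com_boost (p + q) \<xi> = \<xi> + (d * S / 2 / (S * (E + S))) *\<^sub>R (p + q)"
    unfolding com_boost_def s Ee i S_def[symmetric] ..
  also have "d * S / 2 / (S * (E + S)) = d / (E + S) / 2" using S by simp
  finally have c: "com_boost (p + q) \<xi> = \<xi> + (d / (E + S) / 2) *\<^sub>R (p + q)" .
  have "\<xi> = (1/2) *\<^sub>R (p - q) - (d / (E + S) / 2) *\<^sub>R (p + q)"
    by (simp add: \<xi>_def com_mom_def E_def S_def d_def scaleR_diff_right)
  then have "\<xi> + (d / (E + S) / 2) *\<^sub>R (p + q) = (1/2) *\<^sub>R (p - q)" by (simp only: diff_add_cancel)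
  with c have "com_boost (p + q) \<xi> = (1/2) *\<^sub>R (p - q)" by (simp only:)
  then show ?thesis
    by (simp add: com_join_def com_split_def \<xi>_def[symmetric]) (simp add: vec_eq_iff field_simps)
qed

text \<open>Total momentum and energy are conserved, hence s is, and the multiple of p + q that
  \<open>scatter_dir\<close> adds to \<omega> is the one that \<open>com_mom\<close>
  removes.\<close>

lemma com_split_scatter:
  assumes w: "norm \<omega> = 1"
  shows "com_split (post_p p q \<omega>, post_q p q \<omega>) = (p + q, (rel_mom p q / 2) *\<^sub>R \<omega>)"
proof -
  define E where "E = energy p + energy q"
  define S where "S = sqrt (mandel_s p q)"
  define g where "g = rel_mom p q"
  define w' where "w' = (p + q) \<bullet> \<omega>"
  have S: "S > 0" using mandel_s_ge_4[of p q] by (simp add: S_def)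
  have E: "E > 0" using energy_pos[of p] energy_pos[of q] by (simp add: E_def)
  have m: "mandel_s (post_p p q \<omega>) (post_q p q \<omega>) = mandel_s p q"
    unfolding mandel_s_total energy_post_add[OF w] post_add ..
  have d: "energy (post_p p q \<omega>) - energy (post_q p q \<omega>) = g / S * w'"
    by (simp add: energy_post_p[OF w] energy_post_q[OF w] g_def S_def w'_def)
  have "post_p p q \<omega> - post_q p q \<omega> = g *\<^sub>R scatter_dir p q \<omega>"
    by (simp add: post_p_def post_q_def g_def vec_eq_iff)
  also have "\<dots> = g *\<^sub>R \<omega> + (g / S * w' / (E + S)) *\<^sub>R (p + q)"
    by (simp add: scatter_dir_eq w'_def S_def E_def scaleR_add_right)
  finally have "com_mom (post_p p q \<omega>) (post_q p q \<omega>) = g *\<^sub>R \<omega>"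
    unfolding com_mom_def m energy_post_add[OF w] post_add d by (simp add: E_def S_def)
  then show ?thesis by (simp add: com_split_def post_add g_def)
qed

text \<open>Fubini: for each fixed \<rho> > 0 the dilated set is null, so for almost every x the ray
  through x meets V in a null set of radii.\<close>

lemma nn_integral_ray_null:
  fixes V :: "vec3 set"
  assumes V: "V \<in> null_sets lborel"
  shows "AE x in lborel. (\<integral>\<^sup>+\<rho>. indicator {0<..} \<rho> * indicator V (\<rho> *\<^sub>R x) \<partial>lborel) = 0"
proof -
  have [measurable]: "V \<in> sets borel" using V by auto
  have "(\<integral>\<^sup>+x. \<integral>\<^sup>+\<rho>. indicator {0<..} \<rho> * indicator V (\<rho> *\<^sub>R x) \<partial>lborel \<partial>lborel)
      = (\<integral>\<^sup>+\<rho>. \<integral>\<^sup>+x. indicator {0<..} \<rho> * indicator V (\<rho> *\<^sub>R x) \<partial>lborel \<partial>(lborel :: real measure))"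
    by (rule lborel_pair.Fubini'[symmetric]) measurable
  also have "\<dots> = (\<integral>\<^sup>+\<rho>. 0 \<partial>(lborel :: real measure))"
  proof (rule nn_integral_cong)
    fix \<rho> :: real
    show "(\<integral>\<^sup>+x. indicator {0<..} \<rho> * indicator V (\<rho> *\<^sub>R x) \<partial>lborel) = 0"
    proof (cases "\<rho> > 0")
      case True
      have "(\<integral>\<^sup>+x. indicator V x \<partial>lborel) = ennreal (\<rho> ^ DIM(vec3)) * (\<integral>\<^sup>+x. indicator V (\<rho> *\<^sub>R x) \<partial>lborel)"
        by (rule nn_integral_lborel_scale[OF _ True]) simp
      moreover have "(\<integral>\<^sup>+x. indicator V x \<partial>lborel) = 0" using V by auto
      ultimately show ?thesis using True by simp
    qed simp
  qed
  also have "\<dots> = 0" by simp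
  finally show ?thesis by (subst (asm) nn_integral_0_iff_AE) simp_all
qed

text \<open>The ray integral is homogeneous of degree -1, so its vanishing at almost every point of
  the ball passes to almost every direction.\<close>

lemma AE_sphere_ray:
  assumes V: "V \<in> null_sets lborel"
  shows "AE \<omega> in sphere_measure. (\<integral>\<^sup>+\<rho>. indicator {0<..} \<rho> * indicator V (\<rho> *\<^sub>R \<omega>) \<partial>lborel) = 0"
proof -
  have [measurable]: "V \<in> sets borel" using V by auto
  define m where "m = (\<lambda>x. \<integral>\<^sup>+\<rho>. indicator {0<..} \<rho> * indicator V (\<rho> *\<^sub>R x) \<partial>lborel)"
  have [measurable]: "m \<in> borel_measurable borel" unfolding m_def by measurable
  have m0: "AE x in lborel. m x = 0" unfolding m_def by (rule nn_integral_ray_null[OF V])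
  have m_scale: "m (x /\<^sub>R norm x) = ennreal (norm x) * m x" if x: "x \<noteq> 0" for x
  proof -
    have "m (x /\<^sub>R norm x) = ennreal (norm x) * (\<integral>\<^sup>+c. indicator {0<..} (norm x * c) * indicator V ((norm x * c) *\<^sub>R (x /\<^sub>R norm x)) \<partial>lborel)"
      unfolding m_def using x by (subst nn_integral_real_affine[where c="norm x" and t=0]) simp_all
    also have "(\<integral>\<^sup>+c. indicator {0<..} (norm x * c) * indicator V ((norm x * c) *\<^sub>R (x /\<^sub>R norm x)) \<partial>lborel) = m x"
      unfolding m_def
    proof (rule nn_integral_cong)
      fix c :: real
      have "(norm x * c) *\<^sub>R (x /\<^sub>R norm x) = c *\<^sub>R x" using x by simp
      then show "indicator {0<..} (norm x * c) * indicator V ((norm x * c) *\<^sub>R (x /\<^sub>R norm x)) = (indicator {0<..} c * indicator V (c *\<^sub>R x) :: ennreal)"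
        using x by (simp only:) (simp add: indicator_def zero_less_mult_iff)
    qed
    finally show ?thesis .
  qed
  have [measurable]: "(\<lambda>x. m (x /\<^sub>R norm x)) \<in> borel_measurable borel" by measurable
  have "AE x in lborel. m (x /\<^sub>R norm x) = 0"
    using m0 AE_lborel_singleton[of 0] by eventually_elim (simp add: m_scale)
  then have "(\<integral>\<^sup>+x. m (x /\<^sub>R norm x) * indicator (ball 0 1) x \<partial>lborel) = 0"
    by (subst nn_integral_0_iff_AE) (measurable, auto elim: eventually_mono)
  then have "(\<integral>\<^sup>+\<omega>. m \<omega> \<partial>sphere_measure) = 0" by (simp add: nn_integral_sphere)
  then have "AE \<omega> in sphere_measure. m \<omega> = 0" by (subst (asm) nn_integral_0_iff_AE) simp_all
  then show ?thesis unfolding m_def .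
qed

text \<open>The integral is averaged over dilations by c in [1, 2], each of which costs at most the
  factor 8. After the order of integration is exchanged, c |x| runs over an interval of radii, where
  f vanishes almost everywhere.\<close>

lemma nn_integral_norm_null:
  fixes f :: "real \<Rightarrow> ennreal"
  assumes [measurable]: "f \<in> borel_measurable borel"
    and f: "(\<integral>\<^sup>+\<rho>. indicator {0<..} \<rho> * f \<rho> \<partial>lborel) = 0"
  shows "(\<integral>\<^sup>+x. f (norm (x::vec3)) \<partial>lborel) = 0"
proof -
  define I where "I = (\<integral>\<^sup>+x. f (norm (x::vec3)) \<partial>lborel)"
  have "I = (\<integral>\<^sup>+c. I * indicator {1..2::real} c \<partial>lborel)"
    by (subst nn_integral_cmult_indicator) simp_all
  also have "\<dots> \<le> (\<integral>\<^sup>+c. 8 * (\<integral>\<^sup>+x. indicator {1..2} c * f (c * norm (x::vec3)) \<partial>lborel) \<partial>lborel)"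
  proof (rule nn_integral_mono)
    fix c :: real
    show "I * indicator {1..2} c \<le> 8 * (\<integral>\<^sup>+x. indicator {1..2} c * f (c * norm (x::vec3)) \<partial>lborel)"
    proof (cases "c \<in> {1..2}")
      case True
      have "I = ennreal (c ^ DIM(vec3)) * (\<integral>\<^sup>+x. f (norm (c *\<^sub>R (x::vec3))) \<partial>lborel)"
        unfolding I_def using True by (intro nn_integral_lborel_scale) auto
      also have "\<dots> \<le> 8 * (\<integral>\<^sup>+x. f (norm (c *\<^sub>R (x::vec3))) \<partial>lborel)"
      proof (rule mult_right_mono)
        have "c ^ 3 \<le> 2 ^ 3" using True by (intro power_mono) auto
        then show "ennreal (c ^ DIM(vec3)) \<le> 8" by (simp flip: ennreal_numeral)
      qed simp
      finally show ?thesis using True by simp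
    qed simp
  qed
  also have "\<dots> = 8 * (\<integral>\<^sup>+c. \<integral>\<^sup>+x. indicator {1..2} c * f (c * norm (x::vec3)) \<partial>lborel \<partial>lborel)"
    by (rule nn_integral_cmult) measurable
  also have "(\<integral>\<^sup>+c. \<integral>\<^sup>+x. indicator {1..2} c * f (c * norm (x::vec3)) \<partial>lborel \<partial>lborel)
     = (\<integral>\<^sup>+x. \<integral>\<^sup>+c. indicator {1..2} c * f (c * norm (x::vec3)) \<partial>lborel \<partial>lborel)"
    by (rule lborel_pair.Fubini') measurable
  also have "\<dots> = (\<integral>\<^sup>+(x::vec3). 0 \<partial>lborel)"
  proof (rule nn_integral_cong_AE, rule AE_mp[OF AE_lborel_singleton[of 0]], rule AE_I2, intro impI)
    fix x :: vec3 assume x: "x \<noteq> 0"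
    have "0 = (\<integral>\<^sup>+\<rho>. indicator {0<..} \<rho> * f \<rho> \<partial>lborel)" using f by simp
    also have "\<dots> = ennreal (norm x) * (\<integral>\<^sup>+c. indicator {0<..} (norm x * c) * f (norm x * c) \<partial>lborel)"
      using x by (subst nn_integral_real_affine[where c="norm x" and t=0]) simp_all
    finally have z: "(\<integral>\<^sup>+c. indicator {0<..} (norm x * c) * f (norm x * c) \<partial>lborel) = 0" using x by simp
    have "(\<integral>\<^sup>+c. indicator {1..2} c * f (c * norm x) \<partial>lborel) \<le> (\<integral>\<^sup>+c. indicator {0<..} (norm x * c) * f (norm x * c) \<partial>lborel)"
      using x by (intro nn_integral_mono) (auto simp: indicator_def mult.commute zero_less_mult_iff)
    then show "(\<integral>\<^sup>+c. indicator {1..2} c * f (c * norm x) \<partial>lborel) = 0" using z by simp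
  qed
  finally show ?thesis by (simp add: I_def)
qed

lemma null_set_Pair:
  assumes N: "N \<in> null_sets (lborel :: ('a::euclidean_space \<times> 'b::euclidean_space) measure)"
  shows "AE x in lborel. Pair x -` N \<in> null_sets lborel"
proof -
  have [measurable]: "N \<in> sets borel" using N by auto
  have Nb: "N \<in> sets (lborel \<Otimes>\<^sub>M lborel)" unfolding lborel_prod using N by auto
  have "0 = emeasure (lborel \<Otimes>\<^sub>M lborel) N" using null_setsD1[OF N] by (simp add: lborel_prod)
  also have "\<dots> = (\<integral>\<^sup>+x. emeasure lborel (Pair x -` N) \<partial>lborel)"
    using Nb by (rule lborel.emeasure_pair_measure_alt)
  finally have "AE x in lborel. emeasure lborel (Pair x -` N) = 0"
    using Nb by (subst nn_integral_0_iff_AE[symmetric]) (auto intro: lborel.measurable_emeasure_Pair)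
  then show ?thesis
    by eventually_elim (use sets_Pair1[OF Nb] in \<open>auto simp: null_sets_def\<close>)
qed

text \<open>In centre-of-momentum coordinates a collision is (P, \<xi>) -> (P, |\<xi>| \<omega>).
  For fixed \<omega> the image is lower dimensional, so null sets are controlled only for almost
  every \<omega>: along the ray of \<omega> by \<open>AE_sphere_ray\<close>, and then back in (p, q)
  through the differentiable map \<open>com_join\<close>.\<close>

lemma AE_post_null:
  assumes Z: "Z \<in> null_sets lborel"
  shows "AE p in lborel. AE (q, \<omega>) in lborel \<Otimes>\<^sub>M sphere_measure. post_p p q \<omega> \<notin> Z \<and> post_q p q \<omega> \<notin> Z"
proof -
  have [measurable]: "Z \<in> sets borel" using Z by auto
  define W where "W = {z. fst z \<in> Z \<or> snd z \<in> Z}"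
  have "Z \<times> UNIV \<in> null_sets (lborel \<Otimes>\<^sub>M lborel)" "UNIV \<times> Z \<in> null_sets (lborel \<Otimes>\<^sub>M lborel)"
    using Z by (auto simp: null_sets_def lborel.emeasure_pair_measure_Times)
  then have "Z \<times> UNIV \<union> UNIV \<times> Z \<in> null_sets (lborel \<Otimes>\<^sub>M lborel)" by (rule null_sets.Un)
  moreover have "W = Z \<times> UNIV \<union> UNIV \<times> Z" by (auto simp: W_def)
  ultimately have "W \<in> null_sets lborel" by (simp add: lborel_prod)
  then have "negligible W" by (simp add: negligible_iff_null_sets null_sets_completionI)
  then have "negligible (com_split ` W)"
    by (rule negligible_differentiable_image_negligible[OF order_refl])
       (simp add: differentiable_on_def differentiable_com_split)
  then have "com_split ` W \<in> null_sets (completion lborel)" by (simp add: negligible_iff_null_sets)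
  \<comment> \<open>The image under \<open>com_split\<close> need not be Borel; it is enclosed in a
    Borel null set.\<close>
  then obtain N where N: "N \<in> null_sets lborel" "com_split ` W \<subseteq> N"
    by (auto simp: null_sets_completion_iff2)
  have [measurable]: "N \<in> sets borel" using N by auto
  have [measurable]: "N \<in> sets (borel \<Otimes>\<^sub>M borel)" unfolding borel_prod by measurable
  have "(\<integral>\<^sup>+P. \<integral>\<^sup>+\<omega>. \<integral>\<^sup>+\<xi>. indicator N (P, norm (\<xi>::vec3) *\<^sub>R \<omega>) \<partial>lborel \<partial>sphere_measure \<partial>lborel) = (\<integral>\<^sup>+P. 0 \<partial>(lborel :: vec3 measure))"
  proof (rule nn_integral_cong_AE, rule AE_mp[OF null_set_Pair[OF N(1)]], rule AE_I2, intro impI)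
    fix P :: vec3 assume V: "Pair P -` N \<in> null_sets lborel"
    have [measurable]: "Pair P -` N \<in> sets borel" using V by auto
    have "(\<integral>\<^sup>+\<omega>. \<integral>\<^sup>+\<xi>. indicator N (P, norm (\<xi>::vec3) *\<^sub>R \<omega>) \<partial>lborel \<partial>sphere_measure) = (\<integral>\<^sup>+\<omega>. 0 \<partial>sphere_measure)"
    proof (rule nn_integral_cong_AE, rule AE_mp[OF AE_sphere_ray[OF V]], rule AE_I2, intro impI)
      fix \<omega> :: vec3
      assume A: "(\<integral>\<^sup>+\<rho>. indicator {0<..} \<rho> * indicator (Pair P -` N) (\<rho> *\<^sub>R \<omega>) \<partial>lborel) = 0"
      have "(\<integral>\<^sup>+\<xi>. indicator (Pair P -` N) (norm (\<xi>::vec3) *\<^sub>R \<omega>) \<partial>lborel) = 0"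
        using A by (intro nn_integral_norm_null[where f="\<lambda>\<rho>. indicator (Pair P -` N) (\<rho> *\<^sub>R \<omega>)"]) measurable
      then show "(\<integral>\<^sup>+\<xi>. indicator N (P, norm (\<xi>::vec3) *\<^sub>R \<omega>) \<partial>lborel) = 0"
        by (simp add: indicator_def)
    qed
    then show "(\<integral>\<^sup>+\<omega>. \<integral>\<^sup>+\<xi>. indicator N (P, norm (\<xi>::vec3) *\<^sub>R \<omega>) \<partial>lborel \<partial>sphere_measure) = 0" by simp
  qed
  also have "\<dots> = 0" by simp
  also have "(\<integral>\<^sup>+P. \<integral>\<^sup>+\<omega>. \<integral>\<^sup>+\<xi>. indicator N (P, norm (\<xi>::vec3) *\<^sub>R \<omega>) \<partial>lborel \<partial>sphere_measure \<partial>lborel)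
     = (\<integral>\<^sup>+\<omega>. \<integral>\<^sup>+P. \<integral>\<^sup>+\<xi>. indicator N (P, norm (\<xi>::vec3) *\<^sub>R \<omega>) \<partial>lborel \<partial>lborel \<partial>sphere_measure)"
    by (rule pair_sigma_finite.Fubini'[OF pair_sigma_finite.intro[OF sigma_finite_sphere sigma_finite_lborel]]) measurable
  finally have "AE \<omega> in sphere_measure. (\<integral>\<^sup>+P. \<integral>\<^sup>+\<xi>. indicator N (P, norm (\<xi>::vec3) *\<^sub>R \<omega>) \<partial>lborel \<partial>lborel) = 0"
    by (subst (asm) nn_integral_0_iff_AE) simp_all
  then have "AE \<omega> in sphere_measure. AE z in lborel \<Otimes>\<^sub>M lborel. post_p (fst z) (snd z) \<omega> \<notin> Z \<and> post_q (fst z) (snd z) \<omega> \<notin> Z"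
    using AE_sphere_norm
  proof eventually_elim
    case (elim \<omega>)
    define X where "X = {y :: vec3 \<times> vec3. (fst y, norm (snd y) *\<^sub>R \<omega>) \<in> N}"
    have "(\<lambda>y :: vec3 \<times> vec3. (fst y, norm (snd y) *\<^sub>R \<omega>)) \<in> borel \<Otimes>\<^sub>M borel \<rightarrow>\<^sub>M borel \<Otimes>\<^sub>M borel" by measurable
    from measurable_sets[OF this, of N] have X': "X \<in> sets (borel \<Otimes>\<^sub>M borel)"
      by (simp add: X_def vimage_def space_pair_measure)
    then have Xb: "X \<in> sets borel" by (simp only: borel_prod)
    have Xm: "X \<in> sets (lborel \<Otimes>\<^sub>M lborel)" using X' by simp
    have "emeasure (lborel \<Otimes>\<^sub>M lborel) X = (\<integral>\<^sup>+y. indicator X y \<partial>(lborel \<Otimes>\<^sub>M lborel))" using Xm by simp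
    also have "\<dots> = (\<integral>\<^sup>+P. \<integral>\<^sup>+\<xi>. indicator X (P, \<xi>) \<partial>lborel \<partial>lborel)"
      using Xm by (intro lborel.nn_integral_fst[symmetric]) simp
    also have "\<dots> = 0" using elim(1) by (simp add: X_def indicator_def)
    finally have "X \<in> null_sets lborel" using Xb by (simp add: null_sets_def lborel_prod)
    then have "negligible X" by (simp add: negligible_iff_null_sets null_sets_completionI)
    then have neg: "negligible (com_join ` X)"
      by (rule negligible_differentiable_image_negligible[OF order_refl])
         (simp add: differentiable_on_def differentiable_com_join)
    have "{z. \<not> (post_p (fst z) (snd z) \<omega> \<notin> Z \<and> post_q (fst z) (snd z) \<omega> \<notin> Z)} \<subseteq> com_join ` X"
    proof
      fix z assume z: "z \<in> {z. \<not> (post_p (fst z) (snd z) \<omega> \<notin> Z \<and> post_q (fst z) (snd z) \<omega> \<notin> Z)}"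
      obtain p q where pq: "z = (p, q)" by (cases z)
      have "(post_p p q \<omega>, post_q p q \<omega>) \<in> W" using z by (auto simp: W_def pq)
      then have "com_split (post_p p q \<omega>, post_q p q \<omega>) \<in> N" using N(2) by blast
      then have "(p + q, (rel_mom p q / 2) *\<^sub>R \<omega>) \<in> N" by (simp add: com_split_scatter[OF elim(2)])
      then have "com_split (p, q) \<in> X" by (simp add: X_def com_split_def norm_com_mom rel_mom_nonneg)
      then have "com_join (com_split (p, q)) \<in> com_join ` X" by (rule imageI)
      then show "z \<in> com_join ` X" by (simp add: com_join_split pq)
    qed
    then have "{z. \<not> (post_p (fst z) (snd z) \<omega> \<notin> Z \<and> post_q (fst z) (snd z) \<omega> \<notin> Z)} \<in> null_sets lebesgue"
      using neg negligible_subset by (blast intro: negligible_iff_null_sets[THEN iffD1])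
    then have "AE z in lebesgue. post_p (fst z) (snd z) \<omega> \<notin> Z \<and> post_q (fst z) (snd z) \<omega> \<notin> Z"
      by (rule AE_I') auto
    then show ?case unfolding lborel_prod by (simp only: AE_completion_iff)
  qed
  then have "AE z in lborel \<Otimes>\<^sub>M lborel. AE \<omega> in sphere_measure. post_p (fst z) (snd z) \<omega> \<notin> Z \<and> post_q (fst z) (snd z) \<omega> \<notin> Z"
    by (subst pair_sigma_finite.AE_commute[OF pair_sigma_finite.intro[OF sigma_finite_pair_measure[OF sigma_finite_lborel sigma_finite_lborel] sigma_finite_sphere]])
       measurable
  from lborel_pair.AE_pair[OF this]
  have "AE p in lborel. AE q in lborel. AE \<omega> in sphere_measure. post_p p q \<omega> \<notin> Z \<and> post_q p q \<omega> \<notin> Z" by simp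
  then show ?thesis
  proof eventually_elim
    case (elim p)
    show ?case
    proof (rule pair_sigma_finite.AE_pair_measure[OF pair_sigma_finite.intro[OF sigma_finite_lborel sigma_finite_sphere]])
      show "{x \<in> space (lborel \<Otimes>\<^sub>M sphere_measure). case x of (q, \<omega>) \<Rightarrow> post_p p q \<omega> \<notin> Z \<and> post_q p q \<omega> \<notin> Z}
        \<in> sets (lborel \<Otimes>\<^sub>M sphere_measure)" by measurable
    qed (use elim in simp)
  qed
qed

section \<open>Comparison along characteristics\<close>

lemma set_integral_subinterval:
  fixes w :: "real \<Rightarrow> real"
  assumes w [measurable]: "w \<in> borel_measurable borel" and B: "\<And>s. s \<ge> 0 \<Longrightarrow> \<bar>w s\<bar> \<le> B" and st: "0 \<le> s" "s \<le> t"
  shows "(LBINT x:{0..t}. w x) - (LBINT x:{0..s}. w x) = (LBINT x:{s<..t}. w x)"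
    and "set_integrable lborel {s<..t} w"
proof -
  have int: "set_integrable lborel A w" if "A \<in> sets borel" "A \<subseteq> {0..t}" for A
    unfolding set_integrable_def
  proof (rule integrableI_bounded_set[where A="{0..t}" and B=B])
    show "(\<lambda>x. indicat_real A x *\<^sub>R w x) \<in> borel_measurable lborel" using that by measurable
    have B0: "B \<ge> 0" using B[of 0] by simp
    show "AE x in lborel. x \<in> {0..t} \<longrightarrow> norm (indicat_real A x *\<^sub>R w x) \<le> B"
      using B B0 by (intro AE_I2) (auto simp: indicator_def)
    show "AE x in lborel. x \<notin> {0..t} \<longrightarrow> indicat_real A x *\<^sub>R w x = 0"
      using that by (intro AE_I2) (auto simp: indicator_def)
  qed (auto simp: emeasure_lborel_Icc_eq)
  show "set_integrable lborel {s<..t} w" using st by (intro int) auto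
  have "(LBINT x:{0..s} \<union> {s<..t}. w x) = (LBINT x:{0..s}. w x) + (LBINT x:{s<..t}. w x)"
    using st by (intro set_integral_Un int) auto
  moreover have "{0..s} \<union> {s<..t} = {0..t}" using st by auto
  ultimately show "(LBINT x:{0..t}. w x) - (LBINT x:{0..s}. w x) = (LBINT x:{s<..t}. w x)" by simp
qed

text \<open>Between the last time at which \<open>u \<le> \<Phi>\<close> and a time with \<open>u > \<Phi>\<close>, the function \<open>u - \<Phi>\<close> cannot increase.\<close>

lemma damped_comparison_upper:
  fixes u w \<Phi> \<Phi>' :: "real \<Rightarrow> real"
  assumes u: "AE t in lborel. t \<ge> 0 \<longrightarrow> u t = f0 - (LBINT s:{0..t}. w s)"
    and wm [measurable]: "w \<in> borel_measurable borel" and wB: "\<And>s. s \<ge> 0 \<Longrightarrow> \<bar>w s\<bar> \<le> B"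
    and \<Phi>: "\<And>t. t \<ge> 0 \<Longrightarrow> (\<Phi> has_real_derivative \<Phi>' t) (at t)" and \<Phi>c: "continuous_on {0..} \<Phi>'"
    and above: "AE s in lborel. s \<ge> 0 \<longrightarrow> u s > \<Phi> s \<longrightarrow> w s \<ge> - \<Phi>' s"
    and init: "f0 \<le> \<Phi> 0"
  shows "AE t in lborel. t \<ge> 0 \<longrightarrow> u t \<le> \<Phi> t"
proof -
  \<comment> \<open>The Lipschitz representative of \<open>u\<close>, equal to it at almost every
    nonnegative time.\<close>
  define U where "U t = f0 - (LBINT s:{0..t}. w s)" for t
  have Udiff: "U s - U t = (LBINT x:{s<..t}. w x)" if "0 \<le> s" "s \<le> t" for s t
    using set_integral_subinterval(1)[OF wm wB that] by (simp add: U_def)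
  have B0: "B \<ge> 0" using wB[of 0] by simp
  have lip: "\<bar>U s - U t\<bar> \<le> B * (t - s)" if st: "0 \<le> s" "s \<le> t" for s t
  proof -
    have "\<bar>U s - U t\<bar> \<le> (LBINT x:{s<..t}. B)"
      unfolding Udiff[OF st] set_lebesgue_integral_def
    proof (rule order_trans[OF integral_abs_bound], rule integral_mono)
      show "integrable lborel (\<lambda>x. \<bar>indicat_real {s<..t} x *\<^sub>R w x\<bar>)"
        using set_integral_subinterval(2)[OF wm wB st] unfolding set_integrable_def by (rule integrable_abs)
      show "integrable lborel (\<lambda>x. indicat_real {s<..t} x *\<^sub>R B)" using st by simp
      show "\<bar>indicat_real {s<..t} x *\<^sub>R w x\<bar> \<le> indicat_real {s<..t} x *\<^sub>R B" for x
        using wB st by (auto simp: indicator_def)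
    qed
    also have "\<dots> = B * (t - s)" using st by (simp add: set_lebesgue_integral_def)
    finally show ?thesis .
  qed
  have Ucont: "continuous_on {0..} U"
  proof (rule continuous_on_iff[THEN iffD2], intro ballI allI impI)
    fix x e :: real assume x: "x \<in> {0..}" and e: "e > 0"
    show "\<exists>d>0. \<forall>x'\<in>{0..}. dist x' x < d \<longrightarrow> dist (U x') (U x) < e"
    proof (intro exI[of _ "e / (B + 1)"] conjI ballI impI)
      show "e / (B + 1) > 0" using e B0 by simp
      fix y :: real assume y: "y \<in> {0..}" and d: "dist y x < e / (B + 1)"
      have "\<bar>U y - U x\<bar> \<le> B * \<bar>y - x\<bar>"
        using lip[of x y] lip[of y x] x y by (cases "x \<le> y") (auto simp: abs_minus_commute)
      also have "\<dots> \<le> (B + 1) * \<bar>y - x\<bar>" by (intro mult_right_mono) auto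
      also have "\<dots> < e" using d B0 by (simp add: dist_real_def field_simps)
      finally show "dist (U y) (U x) < e" by (simp add: dist_real_def)
    qed
  qed
  have \<Phi>cont: "continuous_on {0..} \<Phi>"
    using \<Phi> by (intro continuous_at_imp_continuous_on ballI) (auto intro: DERIV_isCont)
  have "U t1 \<le> \<Phi> t1" if t1: "t1 \<ge> 0" for t1
  proof (rule ccontr)
    assume "\<not> U t1 \<le> \<Phi> t1"
    then have pos: "U t1 > \<Phi> t1" by simp
    \<comment> \<open>The maximum of this compact set is the last time up to \<open>t1\<close> with
      U \<le> \<Phi>; the initial condition puts 0 into it.\<close>
    define S where "S = {t \<in> {0..t1}. U t \<le> \<Phi> t}"
    have "closed S"
      unfolding S_def
      by (intro continuous_on_closed_Collect_le continuous_on_subset[OF Ucont] continuous_on_subset[OF \<Phi>cont]) auto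
    moreover have "bounded S" by (rule bounded_subset[of "{0..t1}"]) (auto simp: S_def)
    ultimately have "compact S" by (simp add: compact_eq_bounded_closed)
    moreover have "(LBINT s:{0..0}. w s) = 0"
      unfolding set_lebesgue_integral_def
      by (rule integral_eq_zero_AE, rule AE_mp[OF AE_lborel_singleton[of 0]], rule AE_I2) simp
    then have "U 0 = f0" by (simp only: U_def)
    then have "0 \<in> S" using init t1 by (simp add: S_def)
    ultimately obtain t0 where t0: "t0 \<in> S" and max: "\<And>t. t \<in> S \<Longrightarrow> t \<le> t0"
      using compact_attains_sup[of S] by blast
    have t01: "0 \<le> t0" "t0 \<le> t1" "U t0 \<le> \<Phi> t0" using t0 by (auto simp: S_def)
    have gt: "U t > \<Phi> t" if "t \<in> {t0<..t1}" for t
      using max[of t] that t01 by (force simp: S_def)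
    have fint: "has_bochner_integral lborel (\<lambda>x. indicator {t0..t1} x *\<^sub>R \<Phi>' x) (\<Phi> t1 - \<Phi> t0)"
    proof (intro has_bochner_integral_FTC_Icc continuous_on_subset[OF \<Phi>c])
      show "(\<Phi> has_vector_derivative \<Phi>' x) (at x within {t0..t1})" if "t0 \<le> x" "x \<le> t1" for x
        by (rule has_vector_derivative_at_within, rule has_real_derivative_iff_has_vector_derivative[THEN iffD1], rule \<Phi>)
           (use that t01 in linarith)
    qed (use t01 in auto)
    have "\<Phi> t0 - \<Phi> t1 = integral\<^sup>L lborel (\<lambda>x. - (indicator {t0..t1} x *\<^sub>R \<Phi>' x))"
      using has_bochner_integral_integral_eq[OF fint] by simp
    also have "\<dots> \<le> integral\<^sup>L lborel (\<lambda>x. indicator {t0<..t1} x *\<^sub>R w x)"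
    proof (rule integral_mono_AE)
      show "integrable lborel (\<lambda>x. - (indicator {t0..t1} x *\<^sub>R \<Phi>' x))"
        using fint by (intro integrable_minus) (rule integrable.intros)
      show "integrable lborel (\<lambda>x. indicator {t0<..t1} x *\<^sub>R w x)"
        using set_integral_subinterval(2)[OF wm wB t01(1,2)] unfolding set_integrable_def .
      show "AE x in lborel. - (indicator {t0..t1} x *\<^sub>R \<Phi>' x) \<le> indicator {t0<..t1} x *\<^sub>R w x"
        using u above AE_lborel_singleton[of t0]
      proof eventually_elim
        case (elim x)
        show ?case
        proof (cases "x \<in> {t0<..t1}")
          case True
          then have "u x = U x" "x \<ge> 0" using elim t01 by (auto simp: U_def)
          then have "w x \<ge> - \<Phi>' x" using elim gt[OF True] by simp
          then show ?thesis using True by simp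
        qed (use elim in \<open>auto simp: indicator_def\<close>)
      qed
    qed
    also have "\<dots> = U t0 - U t1" using Udiff[OF t01(1,2)] by (simp add: set_lebesgue_integral_def)
    finally show False using pos t01 by linarith
  qed
  then show ?thesis using u by (auto simp: U_def elim: eventually_mono)
qed

text \<open>Where u > \<Phi>, \<nu> u - \<kappa> \<ge> \<nu> \<Phi> - (\<nu>/2) \<Phi> \<ge> -
  \<Phi>'. One half of the damping pays for the source, the other for the decrease of the barrier;
  -u is treated in the same way.\<close>

lemma damped_comparison:
  fixes u \<kappa> \<Phi> \<Phi>' :: "real \<Rightarrow> real"
  assumes u: "AE t in lborel. t \<ge> 0 \<longrightarrow> u t = f0 - (LBINT s:{0..t}. \<nu> * u s - \<kappa> s)"
    and m [measurable]: "u \<in> borel_measurable borel" "\<kappa> \<in> borel_measurable borel"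
    and B: "AE s in lborel. s \<ge> 0 \<longrightarrow> \<bar>\<nu> * u s - \<kappa> s\<bar> \<le> B"
    and \<Phi>: "\<And>t. t \<ge> 0 \<Longrightarrow> (\<Phi> has_real_derivative \<Phi>' t) (at t)" and \<Phi>c: "continuous_on {0..} \<Phi>'"
    and \<nu>: "\<nu> \<ge> 0" and \<Phi>': "\<And>t. t \<ge> 0 \<Longrightarrow> - \<Phi>' t \<le> \<nu> / 2 * \<Phi> t"
    and \<kappa>: "AE s in lborel. s \<ge> 0 \<longrightarrow> \<bar>\<kappa> s\<bar> \<le> \<nu> / 2 * \<Phi> s"
    and init: "\<bar>f0\<bar> \<le> \<Phi> 0"
  shows "AE t in lborel. t \<ge> 0 \<longrightarrow> \<bar>u t\<bar> \<le> \<Phi> t"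
proof -
  \<comment> \<open>Truncation changes the integrand only on a null set of nonnegative times and
    makes its bound hold at every time.\<close>
  define w where "w s = max (- \<bar>B\<bar>) (min \<bar>B\<bar> (\<nu> * u s - \<kappa> s))" for s
  have wm [measurable]: "w \<in> borel_measurable borel" unfolding w_def by measurable
  have wB: "\<bar>w s\<bar> \<le> \<bar>B\<bar>" for s by (auto simp: w_def)
  have ww: "AE s in lborel. s \<ge> 0 \<longrightarrow> w s = \<nu> * u s - \<kappa> s"
    using B by eventually_elim (auto simp: w_def)
  have int: "(LBINT s:{0..t}. \<nu> * u s - \<kappa> s) = (LBINT s:{0..t}. w s)" for t
    unfolding set_lebesgue_integral_def
    by (rule integral_cong_AE) (use ww in \<open>auto elim!: eventually_mono simp: indicator_def\<close>)
  have up: "AE t in lborel. t \<ge> 0 \<longrightarrow> u t \<le> \<Phi> t"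
  proof (rule damped_comparison_upper[OF _ wm wB \<Phi> \<Phi>c])
    show "AE t in lborel. t \<ge> 0 \<longrightarrow> u t = f0 - (LBINT s:{0..t}. w s)" using u by (simp add: int)
    show "AE s in lborel. s \<ge> 0 \<longrightarrow> u s > \<Phi> s \<longrightarrow> w s \<ge> - \<Phi>' s"
      using \<kappa> ww
    proof eventually_elim
      case (elim s)
      show ?case
      proof (intro impI)
        assume s: "s \<ge> 0" "u s > \<Phi> s"
        have "\<nu> * \<Phi> s \<le> \<nu> * u s" using \<nu> s by (intro mult_left_mono) auto
        then show "w s \<ge> - \<Phi>' s" using elim s \<Phi>'[of s] by (simp add: abs_le_iff)
      qed
    qed
    show "f0 \<le> \<Phi> 0" using init by simp
  qed auto
  have um: "AE t in lborel. t \<ge> 0 \<longrightarrow> - u t \<le> \<Phi> t"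
  proof (rule damped_comparison_upper[where w="\<lambda>s. - w s" and u="\<lambda>s. - u s", OF _ _ _ \<Phi> \<Phi>c])
    show "AE t in lborel. t \<ge> 0 \<longrightarrow> - u t = - f0 - (LBINT s:{0..t}. - w s)"
    proof -
      have neg: "(LBINT s:{0..t}. - w s) = - (LBINT s:{0..t}. w s)" for t
        by (simp add: set_lebesgue_integral_def)
      show ?thesis using u by eventually_elim (simp add: int neg)
    qed
    show "AE s in lborel. s \<ge> 0 \<longrightarrow> - u s > \<Phi> s \<longrightarrow> - w s \<ge> - \<Phi>' s"
      using \<kappa> ww
    proof eventually_elim
      case (elim s)
      show ?case
      proof (intro impI)
        assume s: "s \<ge> 0" "- u s > \<Phi> s"
        have "\<nu> * \<Phi> s \<le> \<nu> * (- u s)" using \<nu> s by (intro mult_left_mono) auto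
        then show "- w s \<ge> - \<Phi>' s" using elim s \<Phi>'[of s] by (simp add: abs_le_iff)
      qed
    qed
    show "\<bar>- w s\<bar> \<le> \<bar>B\<bar>" for s using wB[of s] by simp
    show "- f0 \<le> \<Phi> 0" using init by simp
  qed auto
  show ?thesis using up um by eventually_elim auto
qed

section \<open>Null sets under translation and periodicity\<close>

lemma AE_lborel_translate:
  fixes t :: "'a::euclidean_space"
  assumes "AE x in lborel. P x"
  shows "AE x in lborel. P (t + x)"
proof -
  obtain N where N: "N \<in> null_sets lborel" "{x \<in> space lborel. \<not> P x} \<subseteq> N"
    using assms unfolding eventually_ae_filter by blast
  have [measurable]: "N \<in> sets borel" using N by auto
  have "(\<integral>\<^sup>+x. indicator N (t + x) \<partial>lborel) = (\<integral>\<^sup>+x. indicator N x \<partial>lborel)"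
    by (rule nn_integral_lborel_translate) simp
  also have "\<dots> = 0" using N(1) by auto
  finally have "AE x in lborel. indicator N (t + x) = (0::ennreal)"
    by (subst (asm) nn_integral_0_iff_AE) simp_all
  then show ?thesis
  proof eventually_elim
    case (elim x)
    then have "t + x \<notin> N" by (simp add: indicator_def split: if_splits)
    then show ?case using N(2) by auto
  qed
qed

lemma AE_lborel_Pair:
  assumes "AE z in lborel. P z"
  shows "AE x in lborel. AE y in lborel. P (x, y)"
  using assms unfolding lborel_prod[symmetric] by (rule lborel_pair.AE_pair)

lemma AE_lborel_PairI:
  assumes "AE x in lborel. AE y in lborel. P (x, y)" and [measurable]: "Measurable.pred (borel \<Otimes>\<^sub>M borel) P"
  shows "AE z in lborel. P z"
  unfolding lborel_prod[symmetric]
  by (rule lborel_pair.AE_pair_measure[OF _ assms(1)]) measurable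

lemma AE_lborel_swap:
  fixes P :: "'a::euclidean_space \<Rightarrow> 'b::euclidean_space \<Rightarrow> bool"
  assumes "AE x in lborel. AE y in lborel. P x y"
    and [measurable]: "Measurable.pred (borel \<Otimes>\<^sub>M borel) (\<lambda>z. P (fst z) (snd z))"
  shows "AE y in lborel. AE x in lborel. P x y"
  by (subst lborel_pair.AE_commute[symmetric]) (use assms(1) in measurable)

lemma periodic_shift:
  fixes Q :: "vec3 \<Rightarrow> bool"
  assumes per: "\<And>x i. Q (x + axis i 1) = Q x"
  shows "Q (x + of_int n *\<^sub>R axis i 1) = Q x"
proof -
  have nat: "Q (x + of_nat m *\<^sub>R axis i 1) = Q x" for x m
  proof (induction m)
    case (Suc m)
    have "x + of_nat (Suc m) *\<^sub>R axis i 1 = (x + of_nat m *\<^sub>R axis i 1) + axis i 1"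
      by (simp add: scaleR_add_left)
    then show ?case using per Suc by (simp only:)
  qed simp
  show ?thesis
  proof (cases "n \<ge> 0")
    case True
    then show ?thesis using nat[of x "nat n"] by simp
  next
    case False
    then have "Q (x + of_int n *\<^sub>R axis i 1 + of_nat (nat (- n)) *\<^sub>R axis i 1) = Q (x + of_int n *\<^sub>R axis i 1)"
      by (intro nat)
    moreover have "x + of_int n *\<^sub>R axis i 1 + of_nat (nat (- n)) *\<^sub>R axis i 1 = x"
      using False by (simp add: scaleR_add_left[symmetric] add.assoc)
    ultimately show ?thesis by simp
  qed
qed

text \<open>There are only countably many integer translates, so their exceptional sets form one
  null set; subtracting the integer parts of its coordinates moves any point into the cube.\<close>

lemma AE_periodic:
  fixes Q :: "vec3 \<Rightarrow> bool"
  assumes per: "\<And>x i. Q (x + axis i 1) = Q x" and ae: "AE x in lborel. x \<in> cbox 0 1 \<longrightarrow> Q x"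
  shows "AE x in lborel. Q x"
proof -
  define e where "e = (\<lambda>(a, b, c). of_int a *\<^sub>R axis 1 1 + of_int b *\<^sub>R axis 2 1 + of_int c *\<^sub>R axis 3 1 :: vec3)"
  have en: "e (a, b, c) $ 1 = of_int a" "e (a, b, c) $ 2 = of_int b" "e (a, b, c) $ 3 = of_int c" for a b c
    by (simp_all add: e_def axis_def)
  have Qe: "Q (e z + x) = Q x" for z x
  proof -
    obtain a b c where z: "z = (a, b, c)" by (cases z)
    have "e z + x = ((x + of_int a *\<^sub>R axis 1 1) + of_int b *\<^sub>R axis 2 1) + of_int c *\<^sub>R axis 3 1"
      by (simp add: e_def z)
    then show ?thesis by (simp only: periodic_shift[of Q, OF per])
  qed
  have "AE x in lborel. \<forall>z. e z + x \<in> cbox 0 1 \<longrightarrow> Q (e z + x)"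
    unfolding AE_all_countable using AE_lborel_translate[OF ae] by blast
  then show ?thesis
  proof eventually_elim
    case (elim x)
    let ?z = "(- \<lfloor>x $ 1\<rfloor>, - \<lfloor>x $ 2\<rfloor>, - \<lfloor>x $ 3\<rfloor>)"
    have fl: "0 \<le> - of_int \<lfloor>r\<rfloor> + r" "- of_int \<lfloor>r\<rfloor> + r \<le> 1" for r :: real
      using of_int_floor_le[of r] floor_less_cancel[of r] by (linarith)+
    have "e ?z + x \<in> cbox 0 1"
      unfolding mem_box_cart forall_3 using fl by (simp add: en)
    then show ?case using elim Qe by blast
  qed
qed

text \<open>Passing from the unit cube to the whole space permits translations along
  characteristics, which leave the cube.\<close>

lemma phase_measure_AE:
  assumes ae: "AE (x, p) in phase_measure. P x p" and per: "\<And>x p i. P (x + axis i 1) p = P x p"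
  shows "AE x in lborel. AE p in lborel. P x p"
proof -
  have sf: "sigma_finite_measure (restrict_space lborel (cbox 0 1 :: vec3 set))"
    by (rule sigma_finite_measure_restrict_space[OF sigma_finite_lborel]) simp
  have "AE x in restrict_space lborel (cbox 0 1). AE p in lborel. P x p"
    using pair_sigma_finite.AE_pair[OF pair_sigma_finite.intro[OF sf sigma_finite_lborel] ae[unfolded phase_measure_def]] by simp
  then have "AE x in lborel. x \<in> cbox 0 1 \<longrightarrow> (AE p in lborel. P x p)"
    by (subst (asm) AE_restrict_space_iff) auto
  then show ?thesis
    by (rule AE_periodic[rotated]) (simp add: per)
qed

lemma measurable_compose3:
  assumes F: "(\<lambda>z. F (fst z) (fst (snd z)) (snd (snd z))) \<in> A \<Otimes>\<^sub>M (B \<Otimes>\<^sub>M C) \<rightarrow>\<^sub>M N"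
    and [measurable]: "u \<in> M \<rightarrow>\<^sub>M A" "v \<in> M \<rightarrow>\<^sub>M B" "w \<in> M \<rightarrow>\<^sub>M C"
  shows "(\<lambda>x. F (u x) (v x) (w x)) \<in> M \<rightarrow>\<^sub>M N"
  using measurable_compose[of "\<lambda>x. (u x, v x, w x)" M "A \<Otimes>\<^sub>M (B \<Otimes>\<^sub>M C)", OF _ F] by simp

text \<open>For soft potentials the relaxation time at energy \<open>p\<^sub>0\<close> is of order \<open>p\<^sub>0\<^bsup>b/2\<^esup>\<close>.\<close>

definition slow :: "real \<Rightarrow> real \<Rightarrow> real \<Rightarrow> real \<Rightarrow> vec3 \<Rightarrow> real" where
  "slow b k a s p = (1 + a * s * energy p powr (- b / 2)) powr (- k)"

lemma slow_pos: "0 \<le> slow b k a s p" by (simp add: slow_def)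

lemma measurable_slow [measurable (raw)]:
  assumes [measurable]: "f \<in> borel_measurable M" "g \<in> borel_measurable M"
  shows "(\<lambda>x. slow b k a (f x) (g x)) \<in> borel_measurable M"
  unfolding slow_def by measurable

section \<open>Growth of the barriers in the momentum\<close>

lemma energy_ratio_powr:
  assumes "0 \<le> c"
  shows "energy q powr c \<le> energy p powr c * (max 1 (energy q / energy p)) powr c"
proof -
  have "energy q = energy p * (energy q / energy p)" using energy_pos[of p] by simp
  also have "\<dots> \<le> energy p * max 1 (energy q / energy p)" using energy_pos[of p] by (intro mult_left_mono) auto
  finally have "energy q powr c \<le> (energy p * max 1 (energy q / energy p)) powr c"
    using assms energy_pos[of q] by (intro powr_mono2) auto
  also have "\<dots> = energy p powr c * (max 1 (energy q / energy p)) powr c"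
    using energy_pos[of p] by (intro powr_mult)
  finally show ?thesis .
qed

text \<open>Raising the energy by a factor lowers the rate energy^(-b/2) by the power b/2 of that
  factor. The bracket loses at most as much, and its power -k gives the exponent k b / 2.\<close>

lemma slow_growth:
  assumes "0 \<le> a" "0 \<le> s" "0 \<le> k" "0 < b"
  shows "slow b k a s q \<le> slow b k a s p * (max 1 (energy q / energy p)) powr (k * b / 2)"
proof -
  define M where "M = (max 1 (energy q / energy p)) powr (b / 2)"
  define x where "x = energy p powr (- b / 2)"
  define y where "y = energy q powr (- b / 2)"
  have M: "M \<ge> 1" using assms powr_mono2[of "b / 2" 1 "max 1 (energy q / energy p)"] by (simp add: M_def)
  have xy: "0 < x" "0 < y" using energy_pos[of p] energy_pos[of q] by (auto simp: x_def y_def)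
  have "x * y * energy q powr (b / 2) \<le> x * y * (energy p powr (b / 2) * M)"
    using energy_ratio_powr[of "b / 2" q p] assms xy by (intro mult_left_mono) (auto simp: M_def)
  moreover have "y * energy q powr (b / 2) = 1" "x * energy p powr (b / 2) = 1"
    using energy_pos[of p] energy_pos[of q] by (simp_all add: x_def y_def flip: powr_add)
  moreover have "x * y * energy q powr (b / 2) = x * (y * energy q powr (b / 2))" by (simp only: mult.assoc)
  moreover have "x * y * (energy p powr (b / 2) * M) = (x * energy p powr (b / 2)) * (y * M)" by (simp only: mult_ac)
  ultimately have "x \<le> y * M" by (simp only: mult_1_left mult_1_right)
  then have "a * s * x \<le> a * s * (y * M)" using assms by (intro mult_left_mono) auto
  then have "1 + a * s * x \<le> M * (1 + a * s * y)" using M by (simp add: distrib_left mult_ac)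
  then have "(M * (1 + a * s * y)) powr (- k) \<le> (1 + a * s * x) powr (- k)"
    using assms xy by (intro powr_mono2') (auto intro!: add_pos_nonneg)
  then have "M powr k * (M * (1 + a * s * y)) powr (- k) \<le> M powr k * (1 + a * s * x) powr (- k)"
    by (intro mult_left_mono) auto
  also have "(M * (1 + a * s * y)) powr (- k) = M powr (- k) * (1 + a * s * y) powr (- k)"
    using M assms xy by (intro powr_mult)
  also have "M powr k * (M powr (- k) * (1 + a * s * y) powr (- k)) = (1 + a * s * y) powr (- k)"
    using M by (simp add: mult.assoc[symmetric] flip: powr_add)
  also have "M powr k = (max 1 (energy q / energy p)) powr (k * b / 2)"
    by (simp add: M_def powr_powr mult.commute)
  finally show ?thesis by (simp add: slow_def x_def y_def mult.commute)
qed

text \<open>Puts both weights n and m of the barrier under the single exponent m. If q_0 \<ge> p_0,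
  the two factors on the right have product 1; otherwise p_0/q_0 > 1 and the larger exponent
  dominates.\<close>

lemma weight_growth:
  assumes "0 \<le> n" "n \<le> m"
  shows "energy q powr (- n) \<le> energy p powr (- n) * ((max 1 (energy q / energy p)) powr m * (energy p / energy q) powr m)"
proof -
  have e: "energy q powr (- n) = energy p powr (- n) * (energy p / energy q) powr n"
    using energy_pos[of p] energy_pos[of q] by (simp add: powr_divide powr_minus_divide)
  have "(energy p / energy q) powr n \<le> (max 1 (energy q / energy p)) powr m * (energy p / energy q) powr m"
  proof (cases "energy q \<ge> energy p")
    case True
    then have "(energy p / energy q) powr n \<le> 1" using energy_pos[of p] energy_pos[of q] assms
      by (intro powr_le1) auto
    also have "1 = ((energy q / energy p) * (energy p / energy q)) powr m"
      using energy_pos[of p] energy_pos[of q] by simp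
    also have "\<dots> = (energy q / energy p) powr m * (energy p / energy q) powr m"
      using energy_pos[of p] energy_pos[of q] by (intro powr_mult)
    also have "\<dots> = (max 1 (energy q / energy p)) powr m * (energy p / energy q) powr m"
      using True energy_pos[of p] by (simp add: max_def)
    finally show ?thesis .
  next
    case False
    then have "(energy p / energy q) powr n \<le> (energy p / energy q) powr m"
      using energy_pos[of q] assms by (intro powr_mono) (auto simp: field_simps)
    moreover have "max 1 (energy q / energy p) = 1" using False energy_pos[of p] by (simp add: max_def)
    ultimately show ?thesis by simp
  qed
  then show ?thesis unfolding e by (intro mult_left_mono) auto
qed

lemma slow_deriv:
  assumes "0 \<le> a" "0 \<le> t"
  shows "((\<lambda>t. slow b k a t p) has_real_derivative
     - k * (a * energy p powr (- b / 2)) * (1 + a * t * energy p powr (- b / 2)) powr (- k - 1)) (at t)"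
proof -
  have pos: "1 + a * t * energy p powr (- b / 2) > 0" using assms by (intro add_pos_nonneg) auto
  show ?thesis unfolding slow_def
    by (rule derivative_eq_intros refl pos | simp)+
qed

context soft_kernel
begin

section \<open>The collision operator on functions bounded almost everywhere\<close>

lemma sigma_finite_collision: "sigma_finite_measure ((lborel :: vec3 measure) \<Otimes>\<^sub>M sphere_measure)"
  by (rule sigma_finite_pair_measure[OF sigma_finite_lborel sigma_finite_sphere])

lemma measurable_K_op:
  assumes H [measurable]: "(\<lambda>z. H (fst z) (snd z)) \<in> borel_measurable (M \<Otimes>\<^sub>M borel)"
    and g [measurable]: "g \<in> borel_measurable M"
  shows "(\<lambda>z. K_op \<sigma> (H z) (g z)) \<in> borel_measurable M"
proof -
  have H' [measurable (raw)]: "(\<lambda>x. H (f x) (h x)) \<in> borel_measurable N" if [measurable]: "f \<in> N \<rightarrow>\<^sub>M M" "h \<in> borel_measurable N" for N f h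
    using measurable_compose[of "\<lambda>x. (f x, h x)" N "M \<Otimes>\<^sub>M borel", OF _ H] by simp
  have "(\<lambda>z. K1_op \<sigma> (H z) (g z)) \<in> borel_measurable M"
    unfolding K1_op_def case_prod_unfold
    by (rule sigma_finite_measure.borel_measurable_lebesgue_integral[OF sigma_finite_collision]) measurable
  moreover have "(\<lambda>z. K2_op \<sigma> (H z) (g z)) \<in> borel_measurable M"
    unfolding K2_op_def case_prod_unfold
    by (rule sigma_finite_measure.borel_measurable_lebesgue_integral[OF sigma_finite_collision]) measurable
  ultimately show ?thesis unfolding K_op_def by measurable
qed

lemma measurable_collision_bound:
  assumes H [measurable]: "(\<lambda>z. H (fst z) (snd z)) \<in> borel_measurable (M \<Otimes>\<^sub>M borel)"
    and g [measurable]: "g \<in> borel_measurable M"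
  shows "(\<lambda>z. \<integral>\<^sup>+x. ennreal (collision_integrand (H z) (g z) x) \<partial>(lborel \<Otimes>\<^sub>M sphere_measure)) \<in> borel_measurable M"
proof -
  have H' [measurable (raw)]: "(\<lambda>x. H (f x) (h x)) \<in> borel_measurable N" if [measurable]: "f \<in> N \<rightarrow>\<^sub>M M" "h \<in> borel_measurable N" for N f h
    using measurable_compose[of "\<lambda>x. (f x, h x)" N "M \<Otimes>\<^sub>M borel", OF _ H] by simp
  show ?thesis
    unfolding collision_integrand_def case_prod_unfold
    by (rule sigma_finite_measure.borel_measurable_nn_integral[OF sigma_finite_collision]) measurable
qed

text \<open>The two parts of K are estimated by the sum of their absolute values; the bound on h is
  asked only at the momenta of almost every collision, since \<open>h\<close> is later a solution
  known up to null sets.\<close>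

lemma K_op_bound:
  assumes [measurable]: "\<Phi> \<in> borel_measurable borel"
    and ae: "AE (q, \<omega>) in lborel \<Otimes>\<^sub>M sphere_measure. \<bar>h q\<bar> \<le> \<Phi> q \<and>
       \<bar>h (post_p p q \<omega>)\<bar> \<le> \<Phi> (post_p p q \<omega>) \<and> \<bar>h (post_q p q \<omega>)\<bar> \<le> \<Phi> (post_q p q \<omega>)"
  shows "ennreal \<bar>K_op \<sigma> h p\<bar> \<le> (\<integral>\<^sup>+x. ennreal (collision_integrand \<Phi> p x) \<partial>(lborel \<Otimes>\<^sub>M sphere_measure))"
proof -
  let ?M = "lborel \<Otimes>\<^sub>M sphere_measure"
  let ?V = "\<lambda>q \<omega>. moller_velocity p q * \<sigma> (rel_mom p q) (scatter_angle p q \<omega>)"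
  let ?A = "\<lambda>(q, \<omega>). ?V q \<omega> * sqrt (juttner q) * (sqrt (juttner (post_q p q \<omega>)) * \<Phi> (post_p p q \<omega>)
           + sqrt (juttner (post_p p q \<omega>)) * \<Phi> (post_q p q \<omega>))"
  let ?B = "\<lambda>(q, \<omega>). ?V q \<omega> * sqrt (juttner q * juttner p) * \<Phi> q"
  have 2: "ennreal \<bar>K2_op \<sigma> h p\<bar> \<le> (\<integral>\<^sup>+x. ennreal (?A x) \<partial>?M)"
    unfolding K2_op_def real_norm_def[symmetric]
  proof (rule order_trans[OF norm_integral_le_nn_integral], rule nn_integral_mono_AE, rule AE_mp[OF ae], rule AE_mp[OF AE_collision[of p]], rule AE_I2, intro impI)
    fix x :: "vec3 \<times> vec3"
    assume a: "case x of (q, \<omega>) \<Rightarrow> norm \<omega> = 1 \<and> 0 \<le> \<sigma> (rel_mom p q) (scatter_angle p q \<omega>)"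
      and c: "case x of (q, \<omega>) \<Rightarrow> \<bar>h q\<bar> \<le> \<Phi> q \<and> \<bar>h (post_p p q \<omega>)\<bar> \<le> \<Phi> (post_p p q \<omega>) \<and> \<bar>h (post_q p q \<omega>)\<bar> \<le> \<Phi> (post_q p q \<omega>)"
    obtain q \<omega> where x: "x = (q, \<omega>)" by (cases x)
    have V: "?V q \<omega> \<ge> 0" using a by (simp add: x moller_velocity_nonneg)
    have V': "?V q \<omega> * sqrt (juttner q) \<ge> 0" by (rule mult_nonneg_nonneg[OF V]) (simp add: juttner_nonneg)
    have "\<bar>sqrt (juttner (post_q p q \<omega>)) * h (post_p p q \<omega>) + sqrt (juttner (post_p p q \<omega>)) * h (post_q p q \<omega>)\<bar>
      \<le> \<bar>sqrt (juttner (post_q p q \<omega>)) * h (post_p p q \<omega>)\<bar> + \<bar>sqrt (juttner (post_p p q \<omega>)) * h (post_q p q \<omega>)\<bar>" by (rule abs_triangle_ineq)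
    also have "\<dots> \<le> sqrt (juttner (post_q p q \<omega>)) * \<Phi> (post_p p q \<omega>) + sqrt (juttner (post_p p q \<omega>)) * \<Phi> (post_q p q \<omega>)"
      using c unfolding abs_mult x by (intro add_mono mult_mono) (auto simp: juttner_nonneg)
    finally have "(?V q \<omega> * sqrt (juttner q)) * \<bar>sqrt (juttner (post_q p q \<omega>)) * h (post_p p q \<omega>) + sqrt (juttner (post_p p q \<omega>)) * h (post_q p q \<omega>)\<bar>
      \<le> (?V q \<omega> * sqrt (juttner q)) * (sqrt (juttner (post_q p q \<omega>)) * \<Phi> (post_p p q \<omega>) + sqrt (juttner (post_p p q \<omega>)) * \<Phi> (post_q p q \<omega>))"
      by (rule mult_left_mono[OF _ V'])
    moreover have "\<bar>?V q \<omega> * sqrt (juttner q)\<bar> = ?V q \<omega> * sqrt (juttner q)" by (rule abs_of_nonneg[OF V'])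
    ultimately show "ennreal (norm (case x of (q, \<omega>) \<Rightarrow> ?V q \<omega> * sqrt (juttner q) * (sqrt (juttner (post_q p q \<omega>)) * h (post_p p q \<omega>)
           + sqrt (juttner (post_p p q \<omega>)) * h (post_q p q \<omega>)))) \<le> ennreal (?A x)"
      unfolding x prod.case real_norm_def abs_mult[of "?V q \<omega> * sqrt (juttner q)"] by (intro ennreal_leI) (simp only:)
  qed
  have 1: "ennreal \<bar>K1_op \<sigma> h p\<bar> \<le> (\<integral>\<^sup>+x. ennreal (?B x) \<partial>?M)"
    unfolding K1_op_def real_norm_def[symmetric]
  proof (rule order_trans[OF norm_integral_le_nn_integral], rule nn_integral_mono_AE, rule AE_mp[OF ae], rule AE_mp[OF AE_collision[of p]], rule AE_I2, intro impI)
    fix x :: "vec3 \<times> vec3"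
    assume a: "case x of (q, \<omega>) \<Rightarrow> norm \<omega> = 1 \<and> 0 \<le> \<sigma> (rel_mom p q) (scatter_angle p q \<omega>)"
      and c: "case x of (q, \<omega>) \<Rightarrow> \<bar>h q\<bar> \<le> \<Phi> q \<and> \<bar>h (post_p p q \<omega>)\<bar> \<le> \<Phi> (post_p p q \<omega>) \<and> \<bar>h (post_q p q \<omega>)\<bar> \<le> \<Phi> (post_q p q \<omega>)"
    obtain q \<omega> where x: "x = (q, \<omega>)" by (cases x)
    have V: "?V q \<omega> * sqrt (juttner q * juttner p) \<ge> 0" using a by (simp add: x moller_velocity_nonneg juttner_nonneg)
    then have "(?V q \<omega> * sqrt (juttner q * juttner p)) * \<bar>h q\<bar> \<le> (?V q \<omega> * sqrt (juttner q * juttner p)) * \<Phi> q"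
      using c by (intro mult_left_mono) (auto simp: x)
    then show "ennreal (norm (case x of (q, \<omega>) \<Rightarrow> ?V q \<omega> * sqrt (juttner q * juttner p) * h q)) \<le> ennreal (?B x)"
      unfolding x prod.case real_norm_def abs_mult[of "?V q \<omega> * sqrt (juttner q * juttner p)"] abs_of_nonneg[OF V] by (intro ennreal_leI)
  qed
  have "ennreal \<bar>K_op \<sigma> h p\<bar> \<le> ennreal (\<bar>K2_op \<sigma> h p\<bar> + \<bar>K1_op \<sigma> h p\<bar>)"
    unfolding K_op_def by (intro ennreal_leI) simp
  also have "\<dots> \<le> (\<integral>\<^sup>+x. ennreal (?A x) \<partial>?M) + (\<integral>\<^sup>+x. ennreal (?B x) \<partial>?M)"
    using add_mono[OF 2 1] by (simp add: ennreal_plus)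
  also have "\<dots> = (\<integral>\<^sup>+x. ennreal (?A x) + ennreal (?B x) \<partial>?M)"
    by (rule nn_integral_add[symmetric]) measurable
  also have "\<dots> = (\<integral>\<^sup>+x. ennreal (collision_integrand \<Phi> p x) \<partial>?M)"
  proof (rule nn_integral_cong_AE, rule AE_mp[OF ae], rule AE_mp[OF AE_collision[of p]], rule AE_I2, intro impI)
    fix x :: "vec3 \<times> vec3"
    assume a: "case x of (q, \<omega>) \<Rightarrow> norm \<omega> = 1 \<and> 0 \<le> \<sigma> (rel_mom p q) (scatter_angle p q \<omega>)"
      and c: "case x of (q, \<omega>) \<Rightarrow> \<bar>h q\<bar> \<le> \<Phi> q \<and> \<bar>h (post_p p q \<omega>)\<bar> \<le> \<Phi> (post_p p q \<omega>) \<and> \<bar>h (post_q p q \<omega>)\<bar> \<le> \<Phi> (post_q p q \<omega>)"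
    obtain q \<omega> where x: "x = (q, \<omega>)" by (cases x)
    have V: "?V q \<omega> \<ge> 0" using a by (simp add: x moller_velocity_nonneg)
    have P: "0 \<le> \<Phi> q" "0 \<le> \<Phi> (post_p p q \<omega>)" "0 \<le> \<Phi> (post_q p q \<omega>)"
      using c abs_ge_zero[of "h q"] abs_ge_zero[of "h (post_p p q \<omega>)"] abs_ge_zero[of "h (post_q p q \<omega>)"] unfolding x by auto
    have s0: "0 \<le> \<sigma> (rel_mom p q) (scatter_angle p q \<omega>)" using a by (simp add: x)
    have "0 \<le> ?A x" unfolding x prod.case
      by (intro mult_nonneg_nonneg add_nonneg_nonneg; simp add: juttner_nonneg moller_velocity_nonneg s0 P)
    moreover have "0 \<le> ?B x" unfolding x prod.case
      by (intro mult_nonneg_nonneg; simp add: juttner_nonneg moller_velocity_nonneg s0 P)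
    moreover have "?A x + ?B x = collision_integrand \<Phi> p x" by (simp add: x collision_integrand_def algebra_simps)
    ultimately show "ennreal (?A x) + ennreal (?B x) = ennreal (collision_integrand \<Phi> p x)" by (simp only: ennreal_plus[symmetric])
  qed
  finally show ?thesis .
qed

text \<open>For fixed time and position the bad momenta form a null set, and by
  \<open>AE_post_null\<close> almost every p meets it in almost no collision. For fixed p the shift
  by \<open>s *\<^sub>R velocity p\<close> is a translation, so null sets of positions stay
  null.\<close>

lemma K_op_bound_AE:
  fixes F :: "real \<Rightarrow> vec3 \<Rightarrow> vec3 \<Rightarrow> real" and \<Psi> :: "real \<Rightarrow> vec3 \<Rightarrow> real"
  assumes F: "(\<lambda>z. F (fst z) (fst (snd z)) (snd (snd z))) \<in> borel_measurable (borel \<Otimes>\<^sub>M (borel \<Otimes>\<^sub>M borel))"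
    and \<Psi>: "(\<lambda>z. \<Psi> (fst z) (snd z)) \<in> borel_measurable (borel \<Otimes>\<^sub>M borel)"
    and bd: "AE s in lborel. AE y in lborel. AE q in lborel. s \<ge> 0 \<longrightarrow> \<bar>F s y q\<bar> \<le> \<Psi> s q"
  shows "AE s in lborel. AE x in lborel. AE p in lborel. s \<ge> 0 \<longrightarrow>
      ennreal \<bar>K_op \<sigma> (F s (x + s *\<^sub>R velocity p)) p\<bar> \<le> (\<integral>\<^sup>+z. ennreal (collision_integrand (\<Psi> s) p z) \<partial>(lborel \<Otimes>\<^sub>M sphere_measure))"
  using bd
proof eventually_elim
  case (elim s)
  note [measurable (raw)] = measurable_compose3[OF F]
  have Pm [measurable]: "\<Psi> s \<in> borel_measurable borel"
    using measurable_compose[of "\<lambda>x. (s, x)" borel "borel \<Otimes>\<^sub>M borel", OF _ \<Psi>] by simp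
  define Bd where "Bd p = (\<integral>\<^sup>+z. ennreal (collision_integrand (\<Psi> s) p z) \<partial>(lborel \<Otimes>\<^sub>M sphere_measure))" for p
  have Bm [measurable]: "Bd \<in> borel_measurable borel"
    unfolding Bd_def by (rule measurable_collision_bound[where H="\<lambda>_. \<Psi> s"]) measurable
  have Km1 [measurable]: "(\<lambda>z. K_op \<sigma> (F s (fst z)) (snd z)) \<in> borel_measurable (borel \<Otimes>\<^sub>M borel)"
    by (rule measurable_K_op[where H="\<lambda>z. F s (fst z)" and g=snd]) measurable
  have Km2 [measurable]: "(\<lambda>z. K_op \<sigma> (F s (snd z + s *\<^sub>R velocity (fst z))) (fst z)) \<in> borel_measurable (borel \<Otimes>\<^sub>M borel)"
    by (rule measurable_K_op[where H="\<lambda>z. F s (snd z + s *\<^sub>R velocity (fst z))" and g=fst]) measurable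
  show ?case
  proof (cases "s \<ge> 0")
    case s: True
    have "AE y in lborel. AE p in lborel. ennreal \<bar>K_op \<sigma> (F s y) p\<bar> \<le> Bd p"
      using elim
    proof eventually_elim
      case (elim y)
      define Z where "Z = {q. \<not> \<bar>F s y q\<bar> \<le> \<Psi> s q}"
      have Zm [measurable]: "Z \<in> sets borel" unfolding Z_def by measurable
      have "AE q in lborel. q \<notin> Z" using elim by eventually_elim (use s in \<open>simp add: Z_def\<close>)
      then have Z: "Z \<in> null_sets lborel" by (subst AE_iff_null_sets) auto
      have "Z \<times> UNIV \<in> null_sets (lborel \<Otimes>\<^sub>M sphere_measure)"
        using Z by (auto simp: null_sets_def sigma_finite_measure.emeasure_pair_measure_Times[OF sigma_finite_sphere])
      then have q: "AE (q, \<omega>) in lborel \<Otimes>\<^sub>M sphere_measure. q \<notin> Z"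
        by (rule AE_I') auto
      show ?case using AE_post_null[OF Z]
      proof eventually_elim
        case (elim p)
        show ?case unfolding Bd_def
          by (rule K_op_bound) (measurable, use elim q in eventually_elim, auto simp: Z_def)
      qed
    qed
    then have "AE p in lborel. AE y in lborel. ennreal \<bar>K_op \<sigma> (F s y) p\<bar> \<le> Bd p"
      by (rule AE_lborel_swap) measurable
    then have "AE p in lborel. AE x in lborel. ennreal \<bar>K_op \<sigma> (F s (x + s *\<^sub>R velocity p)) p\<bar> \<le> Bd p"
    proof eventually_elim
      case (elim p)
      from AE_lborel_translate[OF elim, of "s *\<^sub>R velocity p"] show ?case by (simp add: add.commute)
    qed
    then have "AE x in lborel. AE p in lborel. ennreal \<bar>K_op \<sigma> (F s (x + s *\<^sub>R velocity p)) p\<bar> \<le> Bd p"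
      by (rule AE_lborel_swap) measurable
    then show ?thesis by (simp add: Bd_def s)
  qed simp
qed

end

section \<open>The cut-off kernel\<close>

text \<open>The cut-off is constant on either side of [\<epsilon>, 2 \<epsilon>] and continuous on
  this compact interval.\<close>

lemma smooth_cutoff_bounded:
  assumes "smooth_cutoff \<epsilon> chi"
  obtains X where "X > 0" "\<And>g. \<bar>chi g\<bar> \<le> X" "\<And>g. g \<le> \<epsilon> \<Longrightarrow> chi g = 0"
proof -
  have d: "chi differentiable_on UNIV" using assms unfolding smooth_cutoff_def by (metis funpow_0)
  have one: "\<And>g. g \<ge> 2 * \<epsilon> \<Longrightarrow> chi g = 1" and zero: "\<And>g. g \<le> \<epsilon> \<Longrightarrow> chi g = 0"
    using assms unfolding smooth_cutoff_def by auto
  have "continuous_on {\<epsilon>..2*\<epsilon>} chi"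
    using differentiable_imp_continuous_on[OF d] continuous_on_subset by blast
  then have "compact (chi ` {\<epsilon>..2*\<epsilon>})" by (intro compact_continuous_image) auto
  then have "bounded (chi ` {\<epsilon>..2*\<epsilon>})" by (rule compact_imp_bounded)
  then obtain B where "\<forall>x\<in>chi ` {\<epsilon>..2*\<epsilon>}. norm x \<le> B" unfolding bounded_iff by blast
  then have B: "\<And>g. g \<in> {\<epsilon>..2*\<epsilon>} \<Longrightarrow> \<bar>chi g\<bar> \<le> B" by simp
  show ?thesis
  proof (rule that[of "max B 1"])
    fix g
    show "\<bar>chi g\<bar> \<le> max B 1"
    proof (cases "g \<le> \<epsilon> \<or> g \<ge> 2 * \<epsilon>")
      case True
      then show ?thesis using one[of g] zero[of g] by (auto simp: max_def)
    next
      case False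
      then have "\<bar>chi g\<bar> \<le> B" by (intro B) auto
      then show ?thesis by simp
    qed
  qed (use zero in auto)
qed

lemma abs_bessel_I0_le: "\<bar>bessel_I0 y\<bar> \<le> exp \<bar>y\<bar>"
proof -
  let ?I = "LBINT \<phi>:{0..2 * pi}. exp (y * cos \<phi>)"
  have "ennreal \<bar>?I\<bar> \<le> (\<integral>\<^sup>+\<phi>. ennreal (norm (indicator {0..2*pi} \<phi> *\<^sub>R exp (y * cos \<phi>))) \<partial>lborel)"
    unfolding set_lebesgue_integral_def real_norm_def[symmetric] by (rule norm_integral_le_nn_integral)
  also have "\<dots> \<le> (\<integral>\<^sup>+\<phi>. ennreal (exp \<bar>y\<bar>) * indicator {0..2*pi} \<phi> \<partial>lborel)"
  proof (rule nn_integral_mono)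
    fix \<phi> :: real
    have "y * cos \<phi> \<le> \<bar>y * cos \<phi>\<bar>" by simp
    also have "\<dots> \<le> \<bar>y\<bar> * 1" unfolding abs_mult by (intro mult_left_mono) auto
    finally have "exp (y * cos \<phi>) \<le> exp \<bar>y\<bar>" by simp
    then show "ennreal (norm (indicator {0..2*pi} \<phi> *\<^sub>R exp (y * cos \<phi>))) \<le> ennreal (exp \<bar>y\<bar>) * indicator {0..2*pi} \<phi>"
      by (auto simp: indicator_def intro!: ennreal_leI)
  qed
  also have "\<dots> = ennreal (exp \<bar>y\<bar> * (2 * pi))"
    by (subst nn_integral_cmult_indicator) (simp_all add: ennreal_mult)
  finally have "\<bar>?I\<bar> \<le> exp \<bar>y\<bar> * (2 * pi)" by (simp add: ennreal_le_iff)
  then show ?thesis unfolding bessel_I0_def abs_mult by (simp add: field_simps)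
qed

text \<open>The gap \<open>l - j\<close> is the rate at which the integrand of \<open>k\<^sub>2\<^sup>\<chi>\<close> decays.\<close>

lemma bessel_exponent_gap:
  assumes "p \<noteq> q" and P: "energy p \<le> P" "energy q \<le> P"
  shows "norm (cross3 p q) / rel_mom p q + 1 / (2 * P) \<le> (energy p + energy q) / 2"
proof -
  define a where "a = energy p"
  define e where "e = energy q"
  define x where "x = p \<bullet> q"
  define g where "g = rel_mom p q"
  define l where "l = (a + e) / 2"
  define j where "j = norm (cross3 p q) / g"
  have g: "g > 0" using rel_mom_pos[OF assms(1)] by (simp add: g_def)
  have l: "l \<ge> 1" "l \<le> P" using energy_ge_1[of p] energy_ge_1[of q] P by (auto simp: l_def a_def e_def)
  have np: "(norm p)\<^sup>2 = a\<^sup>2 - 1" "(norm q)\<^sup>2 = e\<^sup>2 - 1" by (simp_all add: a_def e_def energy_sq)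
  have g2: "g\<^sup>2 = 2 * (a * e - x - 1)" by (simp add: g_def a_def e_def x_def rel_mom_sq)
  have c2: "(norm (cross3 p q))\<^sup>2 = (a\<^sup>2 - 1) * (e\<^sup>2 - 1) - x\<^sup>2"
    using norm_cross[of p q] by (simp add: np x_def power_mult_distrib)
  \<comment> \<open>Thus the next identity has right-hand side s |p - q|^2, so that l^2 - j^2 = s |p
    - q|^2 / (4 g^2); this is at least 1, as s \<ge> 4 and |p - q| \<ge> g.\<close>
  have n2: "(norm (p - q))\<^sup>2 = (a - e)\<^sup>2 + g\<^sup>2" by (simp add: norm_diff_sq a_def e_def g_def)
  have "g\<^sup>2 * (a + e)\<^sup>2 - 4 * (norm (cross3 p q))\<^sup>2 = (g\<^sup>2 + 4) * ((a - e)\<^sup>2 + g\<^sup>2)"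
    unfolding c2 g2 by (simp add: power2_eq_square algebra_simps)
  also have "\<dots> \<ge> 4 * g\<^sup>2" by (intro mult_mono) auto
  finally have *: "4 * g\<^sup>2 \<le> g\<^sup>2 * (a + e)\<^sup>2 - 4 * (norm (cross3 p q))\<^sup>2" .
  have **: "4 * g\<^sup>2 * (l\<^sup>2 - j\<^sup>2) = g\<^sup>2 * (a + e)\<^sup>2 - 4 * (norm (cross3 p q))\<^sup>2"
    using g by (simp add: l_def j_def power_divide right_diff_distrib)
  have "4 * g\<^sup>2 * 1 \<le> 4 * g\<^sup>2 * (l\<^sup>2 - j\<^sup>2)" unfolding ** using * by (simp only: mult_1_right)
  moreover have "0 < 4 * g\<^sup>2" using g by simp
  ultimately have lj: "1 \<le> l\<^sup>2 - j\<^sup>2" by (rule mult_left_le_imp_le)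
  have j0: "j \<ge> 0" using g by (simp add: j_def)
  have jl: "j \<le> l" by (rule power2_le_imp_le) (use lj l in auto)
  have "1 \<le> (l - j) * (l + j)" using lj by (simp add: power2_eq_square algebra_simps)
  also have "\<dots> \<le> (l - j) * (2 * P)" using jl l by (intro mult_left_mono) auto
  finally have "1 / (2 * P) \<le> l - j" using l by (simp add: pos_divide_le_eq)
  then have "j + 1 / (2 * P) \<le> l" by linarith
  then show ?thesis unfolding l_def j_def a_def e_def g_def .
qed

text \<open>With \<gamma> \<le> 0, the kernel may blow up where sin \<psi> vanishes: for y near 0,
  where \<psi> is near pi, and for large y, where \<psi> is near 0. The last bound measures both
  rates.\<close>

lemma sin_psi_bounds:
  assumes g: "g > 0" and y: "y > 0"
  defines "Y \<equiv> sqrt (1 + y\<^sup>2)"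
  shows "0 < psi_angle g y" "psi_angle g y < pi" "g \<le> g / sin (psi_angle g y / 2)"
    "g * y / (sqrt (g\<^sup>2 + 4) * Y\<^sup>2) \<le> sin (psi_angle g y)"
proof -
  define s where "s = g\<^sup>2 + 4"
  define Q where "Q = g\<^sup>2 - 4 + (g\<^sup>2 + 4) * Y"
  define h where "h = sin_half_psi g y"
  have s: "s > 0" by (simp add: s_def add_nonneg_pos)
  have Y1: "Y > 1" using y by (simp add: Y_def)
  have Y2: "Y\<^sup>2 = 1 + y\<^sup>2" by (simp add: Y_def)
  have Qe: "Q = 2 * g\<^sup>2 + s * (Y - 1)" by (simp add: Q_def s_def algebra_simps)
  have sY: "s * (Y - 1) > 0" using s Y1 by simp
  have Qg: "Q > 2 * g\<^sup>2" using Qe sY by simp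
  have Q0: "Q > 0" using Qg g zero_less_power[of g 2] by linarith
  have he: "h = sqrt 2 * g / sqrt Q" by (simp add: h_def sin_half_psi_def Q_def Y_def)
  have h2: "h\<^sup>2 = 2 * g\<^sup>2 / Q" using Q0 by (simp add: he power_divide power_mult_distrib)
  have h0: "h > 0" using g Q0 by (simp add: he)
  have h21: "h\<^sup>2 < 1" using Qg Q0 by (simp add: h2)
  have h1: "h < 1" using h21 h0 by (simp add: abs_square_less_1)
  have psi: "psi_angle g y = 2 * arcsin h" by (simp add: psi_angle_def h_def)
  have ab: "0 < arcsin h" "arcsin h < pi / 2"
    using h0 h1 arcsin_less_arcsin[of 0 h] arcsin_less_arcsin[of h 1] by simp_all
  show "0 < psi_angle g y" "psi_angle g y < pi" using ab by (simp_all add: psi)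
  have sh: "sin (psi_angle g y / 2) = h" using h0 h1 by (simp add: psi)
  show "g \<le> g / sin (psi_angle g y / 2)" unfolding sh using g h0 h1 by (simp add: pos_le_divide_eq mult_left_le)
  have sp: "sin (psi_angle g y) = 2 * h * sqrt (1 - h\<^sup>2)"
    unfolding psi sin_double using h0 h1 by (simp add: cos_arcsin)
  \<comment> \<open>Double angle formula in h = sin(\<psi>/2); then 1 - h^2 = s (Y - 1)/Q is bounded
    below by means of Q \<le> 2 s Y and Y - 1 \<ge> y^2/(2 Y^2).\<close>
  have "(sin (psi_angle g y))\<^sup>2 = 4 * h\<^sup>2 * (1 - h\<^sup>2)"
    unfolding sp using h21 by (simp add: power_mult_distrib)
  also have "1 - h\<^sup>2 = s * (Y - 1) / Q" using Q0 by (simp add: h2 Qe diff_divide_distrib[symmetric] field_simps)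
  also have "4 * h\<^sup>2 * (s * (Y - 1) / Q) = 8 * g\<^sup>2 * (s * (Y - 1)) / Q\<^sup>2"
    unfolding h2 by (simp add: power2_eq_square)
  also have "\<dots> \<ge> 8 * g\<^sup>2 * (s * (Y - 1)) / (2 * s * Y)\<^sup>2"
  proof (rule divide_left_mono)
    have "Q \<le> 2 * s * Y"
    proof -
      have "Q \<le> s * 1 + s * Y" by (simp add: Q_def s_def)
      also have "\<dots> \<le> s * Y + s * Y" using s Y1 by (intro add_right_mono mult_left_mono) auto
      finally show ?thesis by (simp add: mult_ac)
    qed
    then show "Q\<^sup>2 \<le> (2 * s * Y)\<^sup>2" using Q0 by (intro power_mono) auto
    show "0 \<le> 8 * g\<^sup>2 * (s * (Y - 1))" by (rule mult_nonneg_nonneg[OF _ less_imp_le[OF sY]]) simp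
    show "0 < (2 * s * Y)\<^sup>2 * Q\<^sup>2" using s Y1 Q0 by simp
  qed
  also have "8 * g\<^sup>2 * (s * (Y - 1)) / (2 * s * Y)\<^sup>2 = 2 * g\<^sup>2 / (s * Y\<^sup>2) * (Y - 1)"
    using s Y1 by (simp add: power2_eq_square field_simps)
  also have "\<dots> \<ge> 2 * g\<^sup>2 / (s * Y\<^sup>2) * (y\<^sup>2 / (2 * Y\<^sup>2))"
  proof (rule mult_left_mono)
    have "y\<^sup>2 = (Y - 1) * (Y + 1)" using Y2 by (simp add: power2_eq_square algebra_simps)
    also have "\<dots> \<le> (Y - 1) * (2 * Y\<^sup>2)"
    proof (rule mult_left_mono)
      have "Y * 1 \<le> Y * Y" using Y1 by (intro mult_left_mono) auto
      then show "Y + 1 \<le> 2 * Y\<^sup>2" unfolding power2_eq_square using Y1 by linarith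
    qed (use Y1 in simp)
    finally show "y\<^sup>2 / (2 * Y\<^sup>2) \<le> Y - 1" using Y1 by (simp add: pos_divide_le_eq)
    show "0 \<le> 2 * g\<^sup>2 / (s * Y\<^sup>2)" using s by simp
  qed
  also have "2 * g\<^sup>2 / (s * Y\<^sup>2) * (y\<^sup>2 / (2 * Y\<^sup>2)) = (g * y / (sqrt s * Y\<^sup>2))\<^sup>2"
    using s by (simp add: power_divide power_mult_distrib power2_eq_square[of "Y\<^sup>2"])
  finally have "(g * y / (sqrt s * Y\<^sup>2))\<^sup>2 \<le> (sin (psi_angle g y))\<^sup>2" .
  moreover have "0 \<le> sin (psi_angle g y)" unfolding sp using h0 h21 by simp
  ultimately have "g * y / (sqrt s * Y\<^sup>2) \<le> sin (psi_angle g y)" by (rule power2_le_imp_le)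
  then show "g * y / (sqrt (g\<^sup>2 + 4) * Y\<^sup>2) \<le> sin (psi_angle g y)" by (simp add: s_def)
qed

text \<open>Uniform in \<delta> because 1 + y \<le> (1 + \<delta> y)/\<delta>. Half of the power 8
  will cancel the growth of sin^\<gamma>, the other half will make the y-integral converge.\<close>

lemma exp_polynomial_decay:
  obtains C :: real where "C > 0" "\<And>\<delta> y :: real. 0 < \<delta> \<Longrightarrow> \<delta> \<le> 1 \<Longrightarrow> 0 \<le> y \<Longrightarrow> exp (- \<delta> * y) * (1 + y) ^ 8 \<le> C * (1 / \<delta>) ^ 8"
proof -
  obtain C :: real where C: "C > 0" "\<And>x. x > 0 \<Longrightarrow> x powr 8 \<le> C * exp (1 * x)"
    by (rule powr_le_exp[of 8 1]) auto
  show ?thesis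
  proof (rule that[of "C * exp 1"])
    fix \<delta> y :: real assume d: "0 < \<delta>" "\<delta> \<le> 1" and y: "0 \<le> y"
    have "1 \<le> 1 / \<delta>" using d by simp
    then have "1 + y \<le> 1 / \<delta> * (1 + \<delta> * y)" using d by (simp add: distrib_left)
    then have "(1 + y) ^ 8 \<le> (1 / \<delta> * (1 + \<delta> * y)) ^ 8" using y by (intro power_mono) auto
    also have "\<dots> = (1 / \<delta>) ^ 8 * (1 + \<delta> * y) ^ 8" by (rule power_mult_distrib)
    also have "(1 + \<delta> * y) ^ 8 = (1 + \<delta> * y) powr 8"
      using d y by (subst powr_numeral) (auto simp: add_pos_nonneg)
    also have "\<dots> \<le> C * exp (1 * (1 + \<delta> * y))" using d y by (intro C) (auto simp: add_pos_nonneg)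
    also have "exp (1 * (1 + \<delta> * y)) = exp 1 * exp (\<delta> * y)" by (simp add: exp_add)
    finally have "(1 + y) ^ 8 \<le> (1 / \<delta>) ^ 8 * (C * (exp 1 * exp (\<delta> * y)))" using d by (simp add: mult_left_mono)
    then have "exp (- \<delta> * y) * (1 + y) ^ 8 \<le> exp (- \<delta> * y) * ((1 / \<delta>) ^ 8 * (C * (exp 1 * exp (\<delta> * y))))"
      by (intro mult_left_mono) auto
    also have "\<dots> = (C * exp 1) * (1 / \<delta>) ^ 8 * (exp (- \<delta> * y) * exp (\<delta> * y))" by (simp only: mult_ac)
    also have "exp (- \<delta> * y) * exp (\<delta> * y) = 1" by (simp add: mult_exp_exp)
    finally show "exp (- \<delta> * y) * (1 + y) ^ 8 \<le> C * exp 1 * (1 / \<delta>) ^ 8" by simp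
  qed (use C in simp)
qed

context soft_kernel
begin

text \<open>Where the cut-off does not vanish, g > \<epsilon>, so g^(-b) is bounded, and
  \<open>angular_total\<close> bounds the angular integral.\<close>

lemma k1_cut_bound:
  assumes \<epsilon>: "\<epsilon> > 0" and chi: "smooth_cutoff \<epsilon> chi"
  obtains C where "C > 0" "\<And>p q. \<bar>k1_cut \<sigma> chi p q\<bar> \<le> C"
proof -
  obtain X where X: "X > 0" "\<And>g. \<bar>chi g\<bar> \<le> X" "\<And>g. g \<le> \<epsilon> \<Longrightarrow> chi g = 0" using smooth_cutoff_bounded[OF chi] by blast
  obtain S where S: "S > 0" "\<And>p q. p \<noteq> q \<Longrightarrow>
    (\<integral>\<^sup>+\<omega>. ennreal (\<sigma> (rel_mom p q) (scatter_angle p q \<omega>)) \<partial>sphere_measure) \<le> ennreal (rel_mom p q powr (- b) * S)"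
    using angular_total by blast
  define C where "C = X * (4 * (\<epsilon> powr (- b) * S))"
  have C: "C > 0" using X S \<epsilon> by (simp add: C_def)
  show ?thesis
  proof (rule that[OF C])
    fix p q
    show "\<bar>k1_cut \<sigma> chi p q\<bar> \<le> C"
    proof (cases "rel_mom p q \<le> \<epsilon>")
      case True
      then show ?thesis using X C by (simp add: k1_cut_def)
    next
      case False
      then have pq: "p \<noteq> q" using \<epsilon> by (auto simp: rel_mom_def energy_sq_inner)
      let ?I = "LINT \<omega>|sphere_measure. moller_velocity p q * \<sigma> (rel_mom p q) (scatter_angle p q \<omega>)"
      have "ennreal \<bar>?I\<bar> \<le> (\<integral>\<^sup>+\<omega>. ennreal (norm (moller_velocity p q * \<sigma> (rel_mom p q) (scatter_angle p q \<omega>))) \<partial>sphere_measure)"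
        unfolding real_norm_def[symmetric] by (rule norm_integral_le_nn_integral)
      also have "\<dots> = (\<integral>\<^sup>+\<omega>. ennreal (moller_velocity p q) * ennreal (\<sigma> (rel_mom p q) (scatter_angle p q \<omega>)) \<partial>sphere_measure)"
        by (rule nn_integral_cong_AE, rule AE_mp[OF kernel_angle_le[OF pq]], rule AE_I2)
           (simp add: abs_mult moller_velocity_nonneg ennreal_mult)
      also have "\<dots> = ennreal (moller_velocity p q) * (\<integral>\<^sup>+\<omega>. ennreal (\<sigma> (rel_mom p q) (scatter_angle p q \<omega>)) \<partial>sphere_measure)"
        by (rule nn_integral_cmult) simp
      also have "\<dots> \<le> ennreal 4 * ennreal (rel_mom p q powr (- b) * S)"
        by (intro mult_mono S pq ennreal_leI moller_velocity_le) auto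
      also have "\<dots> \<le> ennreal 4 * ennreal (\<epsilon> powr (- b) * S)"
        using False \<epsilon> b S by (intro mult_left_mono ennreal_leI mult_right_mono powr_mono2') auto
      also have "\<dots> = ennreal (4 * (\<epsilon> powr (- b) * S))" using S(1) by (subst ennreal_mult[symmetric]) auto
      finally have I: "\<bar>?I\<bar> \<le> 4 * (\<epsilon> powr (- b) * S)" using S by (simp add: ennreal_le_iff)
      have j: "sqrt (juttner q * juttner p) \<le> 1"
      proof -
        have "juttner x \<le> 1" for x
        proof -
          have "exp (- energy x / 4) \<le> 1" using energy_pos[of x] by simp
          with juttner_le[of x] show ?thesis by (rule order_trans)
        qed
        then have "juttner q * juttner p \<le> 1 * 1" by (intro mult_mono) (auto simp: juttner_nonneg)
        then show ?thesis by simp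
      qed
      have "\<bar>k1_cut \<sigma> chi p q\<bar> = sqrt (juttner q * juttner p) * \<bar>chi (rel_mom p q)\<bar> * \<bar>?I\<bar>"
        by (simp add: k1_cut_def abs_mult juttner_nonneg)
      also have "\<dots> \<le> 1 * X * (4 * (\<epsilon> powr (- b) * S))"
        using j X I by (intro mult_mono) (auto simp: juttner_nonneg)
      finally show ?thesis by (simp add: C_def)
    qed
  qed
qed

text \<open>At 0 the exponent 1 + \<gamma> exceeds -1; for y > 1, y^(1 + \<gamma>) \<le> 1 + y
  leaves the majorant (1 + y)^(-2).\<close>

lemma y_integral_finite:
  "(\<integral>\<^sup>+y. ennreal (y powr (1 + \<gamma>) / (1 + y) ^ 4) * indicator {0<..} y \<partial>lborel) < \<infinity>"
proof -
  define h where "h = (\<lambda>y::real. ennreal (1 / (1 + y) ^ 2) * indicator {0..} y)"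
  have h: "(\<integral>\<^sup>+y. h y \<partial>lborel) = ennreal (0 - (- inverse (1 + 0)))"
    unfolding h_def
  proof (rule nn_integral_FTC_atLeast)
    show "((\<lambda>y::real. - inverse (1 + y)) \<longlongrightarrow> 0) at_top" by real_asymp
    show "DERIV (\<lambda>y. - inverse (1 + y)) x :> 1 / (1 + x) ^ 2" if "0 \<le> x" for x :: real
      using that by (auto intro!: derivative_eq_intros simp: power2_eq_square inverse_eq_divide)
  qed auto
  have fin: "(\<integral>\<^sup>+y. ennreal (\<bar>y\<bar> powr (1 + \<gamma>)) * indicator {-1..1} y \<partial>lborel) < \<infinity>"
    by (rule nn_integral_abs_powr_finite) (use \<gamma> in auto)
  have "(\<integral>\<^sup>+y. ennreal (y powr (1 + \<gamma>) / (1 + y) ^ 4) * indicator {0<..} y \<partial>lborel)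
     \<le> (\<integral>\<^sup>+y. ennreal (\<bar>y\<bar> powr (1 + \<gamma>)) * indicator {-1..1} y + h y \<partial>lborel)"
  proof (rule nn_integral_mono)
    fix y :: real
    show "ennreal (y powr (1 + \<gamma>) / (1 + y) ^ 4) * indicator {0<..} y \<le> ennreal (\<bar>y\<bar> powr (1 + \<gamma>)) * indicator {-1..1} y + h y"
    proof (cases "y > 0")
      case y: True
      show ?thesis
      proof (cases "y \<le> 1")
        case True
        have "y powr (1 + \<gamma>) / (1 + y) ^ 4 \<le> y powr (1 + \<gamma>) / 1"
          using y by (intro divide_left_mono) (auto simp: one_le_power)
        then have "ennreal (y powr (1 + \<gamma>) / (1 + y) ^ 4) * indicator {0<..} y \<le> ennreal (\<bar>y\<bar> powr (1 + \<gamma>)) * indicator {-1..1} y"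
          using y True by (auto intro!: ennreal_leI)
        then show ?thesis by (rule order_trans) simp
      next
        case False
        have "y powr (1 + \<gamma>) \<le> y powr 1" using False \<gamma> by (intro powr_mono) auto
        also have "\<dots> \<le> 1 + y" using y by simp
        finally have "y powr (1 + \<gamma>) / (1 + y) ^ 4 \<le> (1 + y) / (1 + y) ^ 4" using y by (intro divide_right_mono) auto
        also have "\<dots> \<le> 1 / (1 + y) ^ 2"
        proof -
          have "(1 + y) ^ 4 = (1 + y) * (1 + y) ^ 3" by (simp add: eval_nat_numeral)
          then have "(1 + y) / (1 + y) ^ 4 = 1 / (1 + y) ^ 3" using y by (subst \<open>(1 + y) ^ 4 = _\<close>) simp
          also have "\<dots> \<le> 1 / (1 + y) ^ 2" using y by (intro divide_left_mono power_increasing) auto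
          finally show ?thesis .
        qed
        finally have "ennreal (y powr (1 + \<gamma>) / (1 + y) ^ 4) * indicator {0<..} y \<le> h y"
          using y by (auto simp: h_def intro!: ennreal_leI)
        then show ?thesis by (rule order_trans) simp
      qed
    qed simp
  qed
  also have "\<dots> = (\<integral>\<^sup>+y. ennreal (\<bar>y\<bar> powr (1 + \<gamma>)) * indicator {-1..1} y \<partial>lborel) + (\<integral>\<^sup>+y. h y \<partial>lborel)"
    by (rule nn_integral_add) (simp_all add: h_def)
  also have "\<dots> < \<infinity>" using fin by (simp add: h)
  finally show ?thesis .
qed

text \<open>The exponent is 13 = 3 + 8 + 2: s^(3/2) \<le> 8 P^3, the gap l - j \<ge> 1/(2 P) to the
  power -8, and P^2 from the lower bound of sin \<psi>.\<close>

lemma k2_cut_bound: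
  assumes \<epsilon>: "\<epsilon> > 0" and chi: "smooth_cutoff \<epsilon> chi" and c2: "c2 > 0"
  obtains C where "C > 0" "\<And>p q P. energy p \<le> P \<Longrightarrow> energy q \<le> P \<Longrightarrow> \<bar>k2_cut \<sigma> chi c2 p q\<bar> \<le> C * P ^ 13"
proof -
  obtain X where X: "X > 0" "\<And>g. \<bar>chi g\<bar> \<le> X" "\<And>g. g \<le> \<epsilon> \<Longrightarrow> chi g = 0" using smooth_cutoff_bounded[OF chi] by blast
  obtain D :: real where D: "D > 0" "\<And>\<delta> y :: real. 0 < \<delta> \<Longrightarrow> \<delta> \<le> 1 \<Longrightarrow> 0 \<le> y \<Longrightarrow> exp (- \<delta> * y) * (1 + y) ^ 8 \<le> D * (1 / \<delta>) ^ 8"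
    using exp_polynomial_decay by blast
  define I where "I = (\<integral>\<^sup>+y. ennreal (y powr (1 + \<gamma>) / (1 + y) ^ 4) * indicator {0<..} y \<partial>lborel)"
  obtain r where r: "I = ennreal r" "r \<ge> 0" using y_integral_finite unfolding I_def[symmetric] by (cases I) auto
  \<comment> \<open>A lower bound for g that is at most 1, so that 2 P Y^2 / e1 \<ge> 1 and the
    exponent -\<gamma> may be raised to 2.\<close>
  define e1 where "e1 = min \<epsilon> 1"
  have e1: "0 < e1" "e1 \<le> \<epsilon>" "e1 \<le> 1" using \<epsilon> by (auto simp: e1_def)
  define B where "B = Csig * \<epsilon> powr (- b) * (2 / e1) ^ 2 * 2 * (D * 2 ^ 8)"
  have B: "B > 0" using Csig \<epsilon> e1 D by (simp add: B_def)
  define C where "C = c2 * (8 / \<epsilon>) * X * (B * r) + 1"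
  have C: "C > 0" using c2 X B r \<epsilon> by (auto simp: C_def intro!: add_nonneg_pos mult_nonneg_nonneg)
  show ?thesis
  proof (rule that[OF C])
    fix p q P assume P: "energy p \<le> P" "energy q \<le> P"
    have P1: "P \<ge> 1" using P energy_ge_1[of p] by simp
    show "\<bar>k2_cut \<sigma> chi c2 p q\<bar> \<le> C * P ^ 13"
    proof (cases "rel_mom p q \<le> \<epsilon>")
      case True
      then show ?thesis using X C P1 by (simp add: k2_cut_def Let_def)
    next
      case False
      then have pq: "p \<noteq> q" using \<epsilon> by (auto simp: rel_mom_def energy_sq_inner)
      define g where "g = rel_mom p q"
      define l where "l = (energy p + energy q) / 2"
      define j where "j = norm (cross3 p q) / g"
      define F where "F y = exp (- l * sqrt (1 + y\<^sup>2)) * \<sigma> (g / sin (psi_angle g y / 2)) (psi_angle g y)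
            * (y * (1 + sqrt (1 + y\<^sup>2)) / sqrt (1 + y\<^sup>2)) * bessel_I0 (j * y)" for y
      have g: "g > \<epsilon>" "g > 0" using False \<epsilon> by (auto simp: g_def)
      have j0: "j \<ge> 0" using g by (simp add: j_def)
      have lj: "j + 1 / (2 * P) \<le> l" using bessel_exponent_gap[OF pq P] by (simp add: j_def l_def g_def)
      have l0: "l \<ge> 0" using energy_pos[of p] energy_pos[of q] by (simp add: l_def)
      have s: "mandel_s p q = g\<^sup>2 + 4" by (simp add: mandel_s_eq g_def)
      have "mandel_s p q \<le> 4 * (energy p * energy q)" by (rule mandel_s_le)
      also have "\<dots> \<le> 4 * (P * P)" using P P1 energy_pos[of p] energy_pos[of q] by (intro mult_left_mono mult_mono) auto
      finally have sP: "mandel_s p q \<le> (2 * P)\<^sup>2" by (simp add: power2_eq_square)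
      then have ssP: "sqrt (mandel_s p q) \<le> 2 * P" using P1 by (intro real_le_lsqrt) auto
      have Fb: "\<bar>F y\<bar> \<le> B * P ^ 10 * (y powr (1 + \<gamma>) / (1 + y) ^ 4)" if y: "y > 0" for y
      proof -
        define Y where "Y = sqrt (1 + y\<^sup>2)"
        have Y1: "Y \<ge> 1" using y by (simp add: Y_def)
        have Yy: "y \<le> Y" unfolding Y_def using y by (intro real_le_rsqrt) simp
        have Y1y: "Y \<le> 1 + y" unfolding Y_def using y by (intro real_le_lsqrt) (auto simp: power2_sum)
        note sb = sin_psi_bounds[OF g(2) y, folded Y_def]
        define m where "m = e1 * y / (2 * P * Y\<^sup>2)"
        have m: "m > 0" using e1 y P1 Y1 by (simp add: m_def)
        have "m \<le> g * y / (sqrt (g\<^sup>2 + 4) * Y\<^sup>2)"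
          unfolding m_def using e1 g y P1 Y1 ssP[unfolded s]
          by (intro frac_le mult_right_mono) (auto simp: add_nonneg_pos intro!: mult_pos_pos)
        then have ms: "m \<le> sin (psi_angle g y)" using sb(4) by linarith
        have "sin (psi_angle g y) powr \<gamma> \<le> m powr \<gamma>" using ms m \<gamma> by (intro powr_mono2') auto
        also have "m powr \<gamma> = (e1 / (2 * P * Y\<^sup>2)) powr \<gamma> * y powr \<gamma>"
          using e1 y P1 Y1 by (simp add: m_def powr_mult[symmetric])
        also have "(e1 / (2 * P * Y\<^sup>2)) powr \<gamma> = (2 * P * Y\<^sup>2 / e1) powr (- \<gamma>)"
          using e1 P1 Y1 by (simp add: powr_divide powr_minus_divide)
        also have "\<dots> \<le> (2 * P * Y\<^sup>2 / e1) powr 2"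
        proof (rule powr_mono)
          have "1 * 1 \<le> (2 * P) * Y\<^sup>2" using P1 Y1 by (intro mult_mono) (auto simp: one_le_power)
          then have "e1 \<le> 2 * P * Y\<^sup>2" using e1 by simp
          then show "1 \<le> 2 * P * Y\<^sup>2 / e1" using e1 by simp
        qed (use \<gamma> in auto)
        also have "\<dots> = (2 / e1)\<^sup>2 * P\<^sup>2 * Y ^ 4"
          using e1 P1 Y1 by (subst powr_numeral) (auto simp: power_divide power_mult_distrib simp flip: power_mult)
        also have "(2 / e1)\<^sup>2 * P\<^sup>2 * Y ^ 4 * y powr \<gamma> \<le> (2 / e1)\<^sup>2 * P\<^sup>2 * (1 + y) ^ 4 * y powr \<gamma>"
          using Y1y Y1 by (intro mult_right_mono mult_left_mono power_mono) auto
        finally have sg: "sin (psi_angle g y) powr \<gamma> \<le> (2 / e1)\<^sup>2 * P\<^sup>2 * (1 + y) ^ 4 * y powr \<gamma>" by (simp add: mult_right_mono)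
        define G where "G = g / sin (psi_angle g y / 2)"
        have G: "G \<ge> \<epsilon>" "G > 0" using sb(3) g \<epsilon> by (auto simp: G_def)
        have "\<bar>\<sigma> G (psi_angle g y)\<bar> = \<sigma> G (psi_angle g y)"
          using kernel_nonneg[OF G(2), of "psi_angle g y"] sb(1,2) by simp
        also have "\<dots> \<le> Csig * G powr (- b) * sin (psi_angle g y) powr \<gamma>" by (rule kernel_le[OF G(2) sb(1,2)])
        also have "\<dots> \<le> Csig * \<epsilon> powr (- b) * ((2 / e1)\<^sup>2 * P\<^sup>2 * (1 + y) ^ 4 * y powr \<gamma>)"
          using Csig G \<epsilon> b sg by (intro mult_mono mult_left_mono powr_mono2') auto
        finally have sigb: "\<bar>\<sigma> G (psi_angle g y)\<bar> \<le> Csig * \<epsilon> powr (- b) * ((2 / e1)\<^sup>2 * P\<^sup>2 * (1 + y) ^ 4 * y powr \<gamma>)" .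
        have yY: "y * (1 + Y) / Y \<le> 2 * y" using y Y1 by (simp add: pos_divide_le_eq)
        have "\<bar>bessel_I0 (j * y)\<bar> \<le> exp (j * y)" using abs_bessel_I0_le[of "j * y"] j0 y by simp
        then have "exp (- l * Y) * \<bar>bessel_I0 (j * y)\<bar> \<le> exp (- l * Y) * exp (j * y)" by (intro mult_left_mono) auto
        also have "\<dots> \<le> exp (- (1 / (2 * P)) * y)"
        proof -
          have "l * y \<le> l * Y" using l0 Yy by (intro mult_left_mono)
          moreover have "(j + 1 / (2 * P)) * y \<le> l * y" using lj y by (intro mult_right_mono) auto
          ultimately have "- l * Y + j * y \<le> - (1 / (2 * P)) * y" by (simp add: distrib_right)
          then show ?thesis by (simp only: mult_exp_exp exp_le_cancel_iff)
        qed
        also have "\<dots> \<le> D * 2 ^ 8 * P ^ 8 / (1 + y) ^ 8"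
        proof -
          have "exp (- (1 / (2 * P)) * y) * (1 + y) ^ 8 \<le> D * (1 / (1 / (2 * P))) ^ 8"
            using P1 y by (intro D) auto
          also have "(1 / (1 / (2 * P))) ^ 8 = 2 ^ 8 * P ^ 8" by (simp add: power_mult_distrib)
          finally show ?thesis using y by (simp add: pos_le_divide_eq)
        qed
        finally have eb: "exp (- l * Y) * \<bar>bessel_I0 (j * y)\<bar> \<le> D * 2 ^ 8 * P ^ 8 / (1 + y) ^ 8" .
        have "\<bar>F y\<bar> = (exp (- l * Y) * \<bar>bessel_I0 (j * y)\<bar>) * (\<bar>\<sigma> G (psi_angle g y)\<bar> * (y * (1 + Y) / Y))"
          using y Y1 by (simp add: F_def Y_def[symmetric] G_def abs_mult)
        also have "\<dots> \<le> (D * 2 ^ 8 * P ^ 8 / (1 + y) ^ 8) * ((Csig * \<epsilon> powr (- b) * ((2 / e1)\<^sup>2 * P\<^sup>2 * (1 + y) ^ 4 * y powr \<gamma>)) * (2 * y))"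
          using eb sigb yY y Y1 D P1 Csig by (intro mult_mono mult_nonneg_nonneg) auto
        also have "\<dots> = B * (P ^ 8 * P\<^sup>2) * ((1 + y) ^ 4 / (1 + y) ^ 8 * (y powr 1 * y powr \<gamma>))"
          using y by (simp add: B_def)
        also have "P ^ 8 * P\<^sup>2 = P ^ 10" by (simp flip: power_add)
        also have "(1 + y) ^ 4 / (1 + y) ^ 8 = 1 / (1 + y) ^ 4"
        proof -
          have e8: "(1 + y) ^ 8 = (1 + y) ^ 4 * (1 + y) ^ 4" by (simp flip: power_add)
          have "u / (u * u) = 1 / u" for u :: real by (cases "u = 0") auto
          then show ?thesis unfolding e8 .
        qed
        also have "y powr 1 * y powr \<gamma> = y powr (1 + \<gamma>)" by (simp only: powr_add)
        finally show ?thesis by simp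
      qed
      have "ennreal \<bar>LBINT y:{0..}. F y\<bar> \<le> (\<integral>\<^sup>+y. ennreal (norm (indicator {0..} y *\<^sub>R F y)) \<partial>lborel)"
        unfolding set_lebesgue_integral_def real_norm_def[symmetric] by (rule norm_integral_le_nn_integral)
      also have "\<dots> \<le> (\<integral>\<^sup>+y. ennreal (B * P ^ 10) * (ennreal (y powr (1 + \<gamma>) / (1 + y) ^ 4) * indicator {0<..} y) \<partial>lborel)"
      proof (rule nn_integral_mono_AE, rule AE_mp[OF AE_lborel_singleton[of 0]], rule AE_I2, intro impI)
        fix y :: real assume y0: "y \<noteq> 0"
        show "ennreal (norm (indicator {0..} y *\<^sub>R F y)) \<le> ennreal (B * P ^ 10) * (ennreal (y powr (1 + \<gamma>) / (1 + y) ^ 4) * indicator {0<..} y)"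
        proof (cases "y > 0")
          case True
          have BP: "0 \<le> B * P ^ 10" using B P1 by simp
          show ?thesis
            using ennreal_leI[OF Fb[OF True]] True by (simp add: ennreal_mult'[OF BP] del: times_divide_eq_right)
        qed (use y0 in simp)
      qed
      also have "\<dots> = ennreal (B * P ^ 10) * I" unfolding I_def by (rule nn_integral_cmult) simp
      also have "\<dots> = ennreal (B * P ^ 10 * r)" using r B P1 by (simp add: ennreal_mult)
      finally have Int: "\<bar>LBINT y:{0..}. F y\<bar> \<le> B * P ^ 10 * r" using B P1 r by (simp add: ennreal_le_iff)
      have pre: "mandel_s p q powr (3/2) / (g * energy p * energy q) \<le> 8 / \<epsilon> * P ^ 3"
      proof -
        have "mandel_s p q powr (3/2) \<le> ((2 * P)\<^sup>2) powr (3/2)"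
          using sP mandel_s_ge_4[of p q] by (intro powr_mono2) auto
        also have "((2 * P)\<^sup>2) powr (3/2) = ((2 * P) powr 2) powr (3/2)" using P1 by (simp add: powr_numeral)
        also have "\<dots> = (2 * P) powr 3" by (simp only: powr_powr) simp
        also have "\<dots> = (2 * P) ^ 3" using P1 by (subst powr_numeral) auto
        finally have 1: "mandel_s p q powr (3/2) \<le> 8 * P ^ 3" by (simp add: power_mult_distrib)
        have "\<epsilon> * 1 * 1 \<le> g * energy p * energy q"
          using g \<epsilon> energy_ge_1[of p] energy_ge_1[of q] by (intro mult_mono) auto
        then have "mandel_s p q powr (3/2) / (g * energy p * energy q) \<le> 8 * P ^ 3 / \<epsilon>"
          using 1 \<epsilon> P1 by (intro frac_le) auto
        then show ?thesis by simp
      qed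
      have "\<bar>k2_cut \<sigma> chi c2 p q\<bar> = c2 * (mandel_s p q powr (3/2) / (g * energy p * energy q)) * \<bar>chi g\<bar> * \<bar>LBINT y:{0..}. F y\<bar>"
      proof -
        have "k2_cut \<sigma> chi c2 p q = c2 * (mandel_s p q powr (3/2) / (g * energy p * energy q)) * chi g * (LBINT y:{0..}. F y)"
          unfolding k2_cut_def Let_def g_def[symmetric] l_def[symmetric] j_def[symmetric] F_def[symmetric] ..
        then show ?thesis using c2 g energy_pos[of p] energy_pos[of q] by (simp add: abs_mult)
      qed
      also have "\<dots> \<le> c2 * (8 / \<epsilon> * P ^ 3) * X * (B * P ^ 10 * r)"
        using c2 pre X Int g \<epsilon> P1 energy_pos[of p] energy_pos[of q] by (intro mult_mono mult_nonneg_nonneg) auto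
      also have "\<dots> = c2 * (8 / \<epsilon>) * X * (B * r) * (P ^ 3 * P ^ 10)" by simp
      also have "P ^ 3 * P ^ 10 = P ^ 13" by (simp flip: power_add)
      also have "c2 * (8 / \<epsilon>) * X * (B * r) * P ^ 13 \<le> C * P ^ 13" using P1 by (intro mult_right_mono) (auto simp: C_def)
      finally show ?thesis .
    qed
  qed
qed

lemma k_cut_bound:
  assumes \<epsilon>: "\<epsilon> > 0" and chi: "smooth_cutoff \<epsilon> chi" and c2: "c2 > 0"
  obtains C where "C > 0" "\<And>p q P. energy p \<le> P \<Longrightarrow> energy q \<le> P \<Longrightarrow> \<bar>k_cut \<sigma> chi c2 p q\<bar> \<le> C * P ^ 13"
proof -
  obtain C1 where C1: "C1 > 0" "\<And>p q. \<bar>k1_cut \<sigma> chi p q\<bar> \<le> C1" using k1_cut_bound[OF \<epsilon> chi] by blast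
  obtain C2 where C2: "C2 > 0" "\<And>p q P. energy p \<le> P \<Longrightarrow> energy q \<le> P \<Longrightarrow> \<bar>k2_cut \<sigma> chi c2 p q\<bar> \<le> C2 * P ^ 13"
    using k2_cut_bound[OF \<epsilon> chi c2] by blast
  show ?thesis
  proof (rule that[of "C1 + C2"])
    fix p q P assume P: "energy p \<le> P" "energy q \<le> P"
    have "1 \<le> P ^ 13" using P energy_ge_1[of p] by (intro one_le_power) auto
    then have "C1 * 1 \<le> C1 * P ^ 13" using C1 by (intro mult_left_mono) auto
    then show "\<bar>k_cut \<sigma> chi c2 p q\<bar> \<le> (C1 + C2) * P ^ 13"
      using C1(2)[of p q] C2(2)[OF P] by (simp add: k_cut_def distrib_right)
  qed (use C1 C2 in simp)
qed

end

section \<open>Decay for large momenta\<close>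

text \<open>The solution is only measurable for \<open>t \<ge> 0\<close>; \<open>max 0\<close> extends it to all times.\<close>

lemma measurable_extend_time:
  assumes "(\<lambda>(t, x, p). f t x p) \<in> borel_measurable (restrict_space borel ({0..} \<times> UNIV))"
  shows "(\<lambda>z. f (max 0 (fst z)) (fst (snd z)) (snd (snd z)))
    \<in> borel_measurable ((borel :: real measure) \<Otimes>\<^sub>M ((borel :: vec3 measure) \<Otimes>\<^sub>M (borel :: vec3 measure)))"
proof -
  have "(\<lambda>z. (max 0 (fst z), fst (snd z), snd (snd z)))
     \<in> (borel :: real measure) \<Otimes>\<^sub>M ((borel :: vec3 measure) \<Otimes>\<^sub>M (borel :: vec3 measure)) \<rightarrow>\<^sub>M borel \<Otimes>\<^sub>M (borel \<Otimes>\<^sub>M borel)"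
    by measurable
  then have "(\<lambda>z. (max 0 (fst z), fst (snd z), snd (snd z)))
     \<in> (borel :: real measure) \<Otimes>\<^sub>M ((borel :: vec3 measure) \<Otimes>\<^sub>M (borel :: vec3 measure)) \<rightarrow>\<^sub>M restrict_space borel ({0..} \<times> UNIV)"
    by (intro measurable_restrict_space2) (auto simp: borel_prod)
  from measurable_compose[OF this assms] show ?thesis by (simp add: case_prod_unfold)
qed

lemma pred_AE_lborel:
  fixes P :: "'a \<Rightarrow> 'b :: euclidean_space \<Rightarrow> bool"
  assumes "Measurable.pred (N \<Otimes>\<^sub>M borel) (\<lambda>z. P (fst z) (snd z))"
  shows "Measurable.pred N (\<lambda>z. AE t in lborel. P z t)"
proof -
  let ?Q = "{z \<in> space (N \<Otimes>\<^sub>M (lborel :: 'b measure)). \<not> P (fst z) (snd z)}"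
  have [measurable]: "?Q \<in> sets (N \<Otimes>\<^sub>M lborel)" using assms by measurable
  have "(\<lambda>z. emeasure lborel (Pair z -` ?Q)) \<in> borel_measurable N"
    by (rule lborel.measurable_emeasure_Pair) measurable
  then have "Measurable.pred N (\<lambda>z. emeasure lborel (Pair z -` ?Q) = 0)" by measurable
  moreover have "(AE t in lborel. P z t) \<longleftrightarrow> emeasure lborel (Pair z -` ?Q) = 0" if "z \<in> space N" for z
  proof (rule AE_iff_measurable)
    show "Pair z -` ?Q \<in> sets lborel" by (rule sets_Pair1) measurable
    show "{x \<in> space lborel. \<not> P z x} = Pair z -` ?Q" using that by (auto simp: space_pair_measure)
  qed
  ultimately show ?thesis by (simp cong: measurable_cong)
qed

text \<open>The bound on K f holds at almost every time for almost every (x, p), whereas the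
  comparison runs in time for fixed (x, p); this exchange links the two.\<close>

lemma AE_swap3:
  fixes Q :: "real \<Rightarrow> vec3 \<Rightarrow> vec3 \<Rightarrow> bool"
  assumes m [measurable]: "Measurable.pred (borel \<Otimes>\<^sub>M (borel \<Otimes>\<^sub>M borel)) (\<lambda>z. Q (fst z) (fst (snd z)) (snd (snd z)))"
  shows "(AE t in lborel. AE x in lborel. AE p in lborel. Q t x p) \<longleftrightarrow> (AE x in lborel. AE p in lborel. AE t in lborel. Q t x p)"
proof -
  note [measurable (raw)] = measurable_compose3[OF m]
  have m2': "Measurable.pred (borel \<Otimes>\<^sub>M borel) (\<lambda>z. Q (fst z) (fst (snd z)) (snd (snd z)))"
    using m by (simp only: borel_prod)
  have m3: "Measurable.pred ((borel \<Otimes>\<^sub>M borel) \<Otimes>\<^sub>M borel) (\<lambda>z. Q (snd z) (fst (fst z)) (snd (fst z)))" by measurable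
  then have m3': "Measurable.pred (borel \<Otimes>\<^sub>M borel) (\<lambda>z. Q (snd z) (fst (fst z)) (snd (fst z)))"
    by (simp only: borel_prod)
  show ?thesis
  proof
    assume "AE t in lborel. AE x in lborel. AE p in lborel. Q t x p"
    then have "AE t in lborel. AE z in lborel. Q t (fst z) (snd z)"
      by eventually_elim (rule AE_lborel_PairI, simp, measurable)
    then have "AE z in lborel. AE t in lborel. Q t (fst z) (snd z)"
      by (rule AE_lborel_swap) (rule m2')
    from AE_lborel_Pair[OF this] show "AE x in lborel. AE p in lborel. AE t in lborel. Q t x p" by simp
  next
    assume A: "AE x in lborel. AE p in lborel. AE t in lborel. Q t x p"
    have "AE z in lborel. AE t in lborel. Q t (fst z) (snd z)"
    proof (rule AE_lborel_PairI)
      show "AE x in lborel. AE p in lborel. AE t in lborel. Q t (fst (x, p)) (snd (x, p))" using A by simp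
      show "Measurable.pred (borel \<Otimes>\<^sub>M borel) (\<lambda>z. AE t in lborel. Q t (fst z) (snd z))"
        by (rule pred_AE_lborel) (rule m3)
    qed
    then have "AE t in lborel. AE z in lborel. Q t (fst z) (snd z)"
      by (rule AE_lborel_swap) (rule m3')
    then show "AE t in lborel. AE x in lborel. AE p in lborel. Q t x p"
    proof eventually_elim
      case (elim t)
      from AE_lborel_Pair[OF elim] show ?case by simp
    qed
  qed
qed

text \<open>For fixed p the map is a translation in x; Fubini then carries the exceptional set
  over.\<close>

lemma AE_shift:
  fixes Q :: "vec3 \<Rightarrow> vec3 \<Rightarrow> bool"
  assumes ae: "AE y in lborel. AE p in lborel. Q y p"
    and m: "Measurable.pred (borel \<Otimes>\<^sub>M borel) (\<lambda>z. Q (fst z) (snd z))"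
  shows "AE x in lborel. AE p in lborel. Q (x + t *\<^sub>R velocity p) p"
proof -
  have "AE p in lborel. AE y in lborel. Q y p" using ae m by (rule AE_lborel_swap)
  then have "AE p in lborel. AE x in lborel. Q (x + t *\<^sub>R velocity p) p"
  proof eventually_elim
    case (elim p)
    from AE_lborel_translate[OF elim, of "t *\<^sub>R velocity p"] show ?case by (simp add: add.commute)
  qed
  then show ?thesis
  proof (rule AE_lborel_swap)
    have "(\<lambda>z :: vec3 \<times> vec3. (snd z + t *\<^sub>R velocity (fst z), fst z)) \<in> borel \<Otimes>\<^sub>M borel \<rightarrow>\<^sub>M borel \<Otimes>\<^sub>M borel" by measurable
    from measurable_compose[OF this m]
    show "Measurable.pred (borel \<Otimes>\<^sub>M borel) (\<lambda>z. Q (snd z + t *\<^sub>R velocity (fst z)) (fst z))" by simp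
  qed
qed

section \<open>Elementary bounds for the barriers\<close>

lemma slow_le_1: "0 \<le> a \<Longrightarrow> 0 \<le> s \<Longrightarrow> 0 \<le> k \<Longrightarrow> slow b k a s p \<le> 1"
  unfolding slow_def using powr_mono2'[of "- k" 1 "1 + a * s * energy p powr (- b / 2)"] by simp

lemma energy_powr_neg_le_1: "0 \<le> n \<Longrightarrow> energy p powr (- n) \<le> 1"
  using powr_mono2'[of "- n" 1 "energy p"] energy_ge_1[of p] by simp

text \<open>As a \<le> 1 and energies are at least 1, the barrier never decays faster than the time
  weight of \<open>decay_norm\<close> permits.\<close>

lemma slow_ge:
  assumes "0 \<le> a" "a \<le> 1" "0 \<le> s" "0 \<le> k" "0 \<le> b"
  shows "(1 + s) powr (- k) \<le> slow b k a s p"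
proof -
  have "a * s * energy p powr (- (b / 2)) \<le> 1 * s * 1"
    using assms by (intro mult_mono energy_powr_neg_le_1) auto
  then have "1 + a * s * energy p powr (- b / 2) \<le> 1 + s" by simp
  then show ?thesis unfolding slow_def using assms by (intro powr_mono2') (auto intro!: add_pos_nonneg)
qed

context soft_kernel
begin

text \<open>For \<open>j = 0\<close> the barrier lies above the solution by the a priori bound, and each
  comparison along characteristics improves \<open>j\<close> to \<open>j + 1\<close>. In the limit the barrier decays
  like \<open>energy q powr (- m)\<close>.\<close>

definition barrier :: "real \<Rightarrow> real \<Rightarrow> real \<Rightarrow> real \<Rightarrow> real \<Rightarrow> nat \<Rightarrow> real \<Rightarrow> vec3 \<Rightarrow> real" where
  "barrier k a m n A j s q = A * slow b k a s q * (energy q powr (- m) + (1/2) ^ j * energy q powr (- n))"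

lemma barrier_nonneg: "0 \<le> A \<Longrightarrow> 0 \<le> barrier k a m n A j s q"
  by (simp add: barrier_def slow_pos)

lemma barrier_growth:
  assumes "0 \<le> A" "0 \<le> a" "0 \<le> s" "0 \<le> k" "0 \<le> n" "n \<le> m"
  shows "barrier k a m n A j s q \<le> barrier k a m n A j s p * (max 1 (energy q / energy p)) powr (k * b / 2 + m) * (energy p / energy q) powr m"
proof -
  let ?M = "max 1 (energy q / energy p)" and ?r = "(energy p / energy q) powr m"
  define W where "W x = energy x powr (- m) + (1/2) ^ j * energy x powr (- n)" for x
  have "W q \<le> energy p powr (- m) * (?M powr m * ?r) + (1/2) ^ j * (energy p powr (- n) * (?M powr m * ?r))"
    unfolding W_def using assms by (intro add_mono mult_left_mono weight_growth) auto
  also have "\<dots> = W p * (?M powr m * ?r)" by (simp add: W_def distrib_right mult.assoc)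
  finally have W: "W q \<le> W p * (?M powr m * ?r)" .
  have "barrier k a m n A j s q = A * (slow b k a s q * W q)" by (simp add: barrier_def W_def mult.assoc)
  also have "\<dots> \<le> A * ((slow b k a s p * ?M powr (k * b / 2)) * (W p * (?M powr m * ?r)))"
    using assms b W by (intro mult_left_mono mult_mono slow_growth) (auto simp: slow_pos W_def)
  also have "\<dots> = barrier k a m n A j s p * (?M powr (k * b / 2) * ?M powr m) * ?r"
    by (simp add: barrier_def W_def mult_ac)
  also have "?M powr (k * b / 2) * ?M powr m = ?M powr (k * b / 2 + m)" by (rule powr_add[symmetric])
  finally show ?thesis .
qed

text \<open>The price of replacing j by j + 1 is the factor 2, which the smallness of K
  pays.\<close>

lemma barrier_Suc: "0 \<le> A \<Longrightarrow> barrier k a m n A j s q \<le> 2 * barrier k a m n A (Suc j) s q"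
proof -
  assume A: "0 \<le> A"
  have "energy q powr (- m) + (1/2) ^ j * energy q powr (- n) \<le> 2 * (energy q powr (- m) + (1/2) ^ Suc j * energy q powr (- n))"
    by simp
  then have "A * slow b k a s q * (energy q powr (- m) + (1/2) ^ j * energy q powr (- n))
     \<le> A * slow b k a s q * (2 * (energy q powr (- m) + (1/2) ^ Suc j * energy q powr (- n)))"
    using A slow_pos by (intro mult_left_mono mult_nonneg_nonneg) auto
  then show ?thesis unfolding barrier_def by (simp only: mult_ac)
qed

lemma barrier_le:
  assumes "0 \<le> A" "0 \<le> a" "0 \<le> s" "0 \<le> k" "0 \<le> n" "n \<le> m"
  shows "barrier k a m n A j s q \<le> 2 * A"
proof -
  have "(1/2::real) ^ j * energy q powr (- n) \<le> 1 * 1"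
    using assms by (intro mult_mono energy_powr_neg_le_1 power_le_one) auto
  moreover have "energy q powr (- m) \<le> 1" using assms by (intro energy_powr_neg_le_1) auto
  ultimately have "energy q powr (- m) + (1/2) ^ j * energy q powr (- n) \<le> 2" by linarith
  moreover have "A * slow b k a s q \<le> A * 1" using assms by (intro mult_left_mono slow_le_1) auto
  ultimately have "A * slow b k a s q * (energy q powr (- m) + (1/2) ^ j * energy q powr (- n)) \<le> (A * 1) * 2"
    using assms slow_pos[of b k a s q] by (rule_tac mult_mono) auto
  then show ?thesis by (simp add: barrier_def mult.commute)
qed

text \<open>The relative rate of decrease of the time factor is at most k a p_0^(-b/2), which the
  assumption puts below \<nu>/2.\<close>

lemma barrier_deriv:
  assumes "0 \<le> A" "0 \<le> a" "0 \<le> k" and \<nu>: "2 * k * a * energy p powr (- b / 2) \<le> \<nu>"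
  obtains \<Phi>' where "\<And>t. t \<ge> 0 \<Longrightarrow> ((\<lambda>t. barrier k a m n A j t p) has_real_derivative \<Phi>' t) (at t)"
    "continuous_on {0..} \<Phi>'" "\<And>t. t \<ge> 0 \<Longrightarrow> - \<Phi>' t \<le> \<nu> / 2 * barrier k a m n A j t p"
proof -
  define W where "W = energy p powr (- m) + (1/2) ^ j * energy p powr (- n)"
  define x where "x = energy p powr (- b / 2)"
  have W: "W \<ge> 0" by (simp add: W_def)
  have x: "x \<ge> 0" by (simp add: x_def)
  define \<Phi>' where "\<Phi>' t = A * (- k * (a * x) * (1 + a * t * x) powr (- k - 1)) * W" for t
  have pos: "1 + a * t * x > 0" if "t \<ge> 0" for t using that assms x by (intro add_pos_nonneg) auto
  show ?thesis
  proof (rule that[of \<Phi>'])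
    fix t :: real assume t: "t \<ge> 0"
    show "((\<lambda>t. barrier k a m n A j t p) has_real_derivative \<Phi>' t) (at t)"
      unfolding barrier_def W_def[symmetric] \<Phi>'_def
      by (intro DERIV_cmult_right DERIV_cmult slow_deriv[OF assms(2) t, of b k p, folded x_def])
    have "(1 + a * t * x) powr (- k - 1) \<le> (1 + a * t * x) powr (- k)"
      using assms t x by (intro powr_mono) auto
    moreover have "0 \<le> \<nu>" using order_trans[OF _ \<nu>, of 0] assms by simp
    ultimately have "(k * (a * x)) * (1 + a * t * x) powr (- k - 1) \<le> (\<nu> / 2) * (1 + a * t * x) powr (- k)"
      using assms x \<nu> by (intro mult_mono) (auto simp: x_def)
    then have "A * ((k * (a * x)) * (1 + a * t * x) powr (- k - 1)) * W \<le> A * ((\<nu> / 2) * (1 + a * t * x) powr (- k)) * W"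
      using assms W by (intro mult_right_mono mult_left_mono) auto
    then show "- \<Phi>' t \<le> \<nu> / 2 * barrier k a m n A j t p"
      unfolding \<Phi>'_def barrier_def slow_def W_def[symmetric] x_def[symmetric] by (simp add: mult_ac)
  next
    show "continuous_on {0..} \<Phi>'"
      unfolding \<Phi>'_def using pos by (intro continuous_intros) (auto simp: less_imp_neq[symmetric])
  qed
qed

text \<open>Each pass inserts the bound of index j, at all momenta, into K and proves index j + 1:
  above energy R by comparison, below R directly from the norm. The constant A is the same in all
  passes, which makes the limit possible.\<close>

lemma high_momentum_decay:
  assumes k: "k \<ge> 1" and nm: "0 \<le> n" "n \<le> m"
  obtains a R where "0 < a" "a \<le> 1" "R \<ge> 8"
    "\<And>p. 8 \<le> energy p \<Longrightarrow> 2 * k * a * energy p powr (- b / 2) \<le> coll_freq \<sigma> p"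
    "\<And>f0 f N F0. semigroup_solution \<sigma> f0 f \<Longrightarrow> 0 \<le> N \<Longrightarrow> 0 \<le> F0 \<Longrightarrow>
       (\<And>s. s \<ge> 0 \<Longrightarrow> AE (x, p) in phase_measure. \<bar>f s x p\<bar> \<le> N * (1 + s) powr (- k) * energy p powr (- n)) \<Longrightarrow>
       (AE (x, p) in phase_measure. \<bar>f0 x p\<bar> \<le> F0 * energy p powr (- m)) \<Longrightarrow>
       AE s in lborel. AE y in lborel. AE q in lborel. s \<ge> 0 \<longrightarrow>
         \<bar>f (max 0 s) y q\<bar> \<le> (F0 + N * R powr m) * slow b k a s q * energy q powr (- m)"
proof -
  obtain c C where c: "c > 0" "\<And>p. 8 \<le> energy p \<Longrightarrow> c * energy p powr (- b / 2) \<le> coll_freq \<sigma> p"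
    by (rule coll_freq_bounds) (rule that)
  \<comment> \<open>Slow enough for the decrease of the barrier to use at most half of the collision
    frequency; a \<le> 1 keeps it above the time weight of the norm.\<close>
  define a where "a = min 1 (c / (2 * k))"
  have a: "0 < a" "a \<le> 1" "2 * k * a \<le> c"
  proof -
    show "0 < a" "a \<le> 1" using c k by (auto simp: a_def)
    have "2 * k * a \<le> 2 * k * (c / (2 * k))" using k by (intro mult_left_mono) (auto simp: a_def)
    then show "2 * k * a \<le> c" using k by simp
  qed
  define \<kappa> where "\<kappa> = k * b / 2 + m"
  have \<kappa>: "\<kappa> \<ge> 0" using k b nm by (simp add: \<kappa>_def)
  have m0: "m \<ge> 0" using nm by simp
  \<comment> \<open>A quarter of the lower bound of \<nu>: the step from j to j + 1 costs a factor
    2, and \<open>damped_comparison\<close> allows one half.\<close>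
  have c4: "c / 4 > 0" using c by simp
  obtain R1 where R1: "R1 \<ge> 1" "\<And>p \<Phi>. energy p \<ge> R1 \<Longrightarrow> (\<And>q. 0 \<le> \<Phi> q) \<Longrightarrow>
    (\<And>q. \<Phi> q \<le> \<Phi> p * (max 1 (energy q / energy p)) powr \<kappa> * (energy p / energy q) powr m) \<Longrightarrow>
    (\<integral>\<^sup>+x. ennreal (collision_integrand \<Phi> p x) \<partial>(lborel \<Otimes>\<^sub>M sphere_measure)) \<le> ennreal (c / 4 * energy p powr (- b / 2) * \<Phi> p)"
    using collision_small[OF m0 \<kappa> c4] by blast
  define R where "R = max 8 R1"
  have R: "R \<ge> 8" "R \<ge> R1" by (simp_all add: R_def)
  have freq: "2 * k * a * energy p powr (- b / 2) \<le> coll_freq \<sigma> p" if "8 \<le> energy p" for p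
    using c(2)[OF that] mult_right_mono[OF a(3), of "energy p powr (- b / 2)"] by simp
  show ?thesis
  proof (rule that[OF a(1,2) R(1) freq])
    fix f0 f N F0
    assume sol: "semigroup_solution \<sigma> f0 f" and N: "0 \<le> N" and F0: "0 \<le> F0"
      and fN: "\<And>s. s \<ge> 0 \<Longrightarrow> AE (x, p) in phase_measure. \<bar>f s x p\<bar> \<le> N * (1 + s) powr (- k) * energy p powr (- n)"
      and f0F: "AE (x, p) in phase_measure. \<bar>f0 x p\<bar> \<le> F0 * energy p powr (- m)"
    define F where "F s x p = f (max 0 s) x p" for s x p
    have per: "periodic (f t)" if "t \<ge> 0" for t using sol that by (auto simp: semigroup_solution_def phase_L2_def)
    have per0: "periodic f0" using sol by (auto simp: semigroup_solution_def phase_L2_def)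
    have f0m: "(\<lambda>(x, p). f0 x p) \<in> borel_measurable borel" using sol by (auto simp: semigroup_solution_def phase_L2_def)
    have f0m' [measurable]: "(\<lambda>z. f0 (fst z) (snd z)) \<in> borel_measurable (borel \<Otimes>\<^sub>M borel)"
      using f0m by (simp add: case_prod_unfold borel_prod)
    have Fm: "(\<lambda>z. F (fst z) (fst (snd z)) (snd (snd z))) \<in> borel_measurable (borel \<Otimes>\<^sub>M (borel \<Otimes>\<^sub>M borel))"
      unfolding F_def by (rule measurable_extend_time) (use sol in \<open>simp add: semigroup_solution_def\<close>)
    note [measurable (raw)] = measurable_compose3[OF Fm]
    define u where "u t x p = F t (x + t *\<^sub>R velocity p) p" for t x p
    define \<kappa>' where "\<kappa>' t x p = K_op \<sigma> (F t (x + t *\<^sub>R velocity p)) p" for t x p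
    have Km [measurable]: "(\<lambda>z. \<kappa>' (fst z) (fst (snd z)) (snd (snd z))) \<in> borel_measurable (borel \<Otimes>\<^sub>M (borel \<Otimes>\<^sub>M borel))"
      unfolding \<kappa>'_def
      by (rule measurable_K_op[where H="\<lambda>z. F (fst z) (fst (snd z) + fst z *\<^sub>R velocity (snd (snd z)))" and g="\<lambda>z. snd (snd z)"]) measurable
    have um [measurable]: "(\<lambda>z. u (fst z) (fst (snd z)) (snd (snd z))) \<in> borel_measurable (borel \<Otimes>\<^sub>M (borel \<Otimes>\<^sub>M borel))"
      unfolding u_def by measurable
    define A where "A = F0 + N * R powr m"
    have RN: "N \<le> N * R powr m" using N R m0 mult_left_mono[of 1 "R powr m" N] by (simp add: ge_one_powr_ge_zero)
    have A: "0 \<le> A" "F0 \<le> A" "N * R powr m \<le> A" "N \<le> A" using N F0 RN by (auto simp: A_def)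
    let ?B = "barrier k a m n A"
    have Bm [measurable]: "(\<lambda>z. ?B j (fst z) (snd z)) \<in> borel_measurable (borel \<Otimes>\<^sub>M borel)" for j
      unfolding barrier_def by measurable
    have Bm3 [measurable]: "(\<lambda>z. ?B j (fst z) (snd (snd z))) \<in> borel_measurable (borel \<Otimes>\<^sub>M (borel \<Otimes>\<^sub>M borel))" for j
      unfolding barrier_def by measurable
    have Bms [measurable]: "(\<lambda>z. ?B j s (snd z)) \<in> borel_measurable (borel \<Otimes>\<^sub>M borel)" for j s
      unfolding barrier_def by measurable
    have base0: "N * (1 + s) powr (- k) * energy q powr (- n) \<le> ?B 0 s q" if s: "s \<ge> 0" for s q
    proof -
      have "N * (1 + s) powr (- k) * energy q powr (- n) \<le> A * slow b k a s q * (energy q powr (- m) + (1/2) ^ 0 * energy q powr (- n))"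
        using A N s a k b by (intro mult_mono slow_ge) (auto simp: slow_pos)
      then show ?thesis by (simp add: barrier_def)
    qed
    \<comment> \<open>Up to energy R the norm alone yields every barrier, because 1 \<le> R^m
      q_0^(-m). This is the origin of the term \<open>N * R powr m\<close> in A.\<close>
    have low: "N * (1 + s) powr (- k) * energy q powr (- n) \<le> ?B j s q" if s: "s \<ge> 0" and q: "energy q \<le> R" for s q j
    proof -
      have "1 \<le> (R / energy q) powr m" using q m0 energy_pos[of q] by (intro ge_one_powr_ge_zero) (auto simp: pos_le_divide_eq)
      also have "\<dots> = R powr m * energy q powr (- m)" using R energy_pos[of q] by (simp add: powr_divide powr_minus_divide)
      finally have 1: "1 \<le> R powr m * energy q powr (- m)" .
      have "N * (1 + s) powr (- k) * energy q powr (- n) \<le> N * slow b k a s q * 1"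
        using N s a k b nm by (intro mult_mono slow_ge energy_powr_neg_le_1) (auto simp: slow_pos)
      also have "\<dots> \<le> N * slow b k a s q * (R powr m * energy q powr (- m))"
        using 1 N slow_pos by (intro mult_left_mono) auto
      also have "\<dots> = N * R powr m * slow b k a s q * energy q powr (- m)" by simp
      also have "\<dots> \<le> A * slow b k a s q * (energy q powr (- m) + (1/2) ^ j * energy q powr (- n))"
        using A by (intro mult_mono) (auto simp: slow_pos)
      finally show ?thesis by (simp add: barrier_def)
    qed
    have H1: "AE s in lborel. AE y in lborel. AE q in lborel. s \<ge> 0 \<longrightarrow> \<bar>F s y q\<bar> \<le> N * (1 + s) powr (- k) * energy q powr (- n)"
    proof (rule AE_I2)
      fix s :: real
      show "AE y in lborel. AE q in lborel. s \<ge> 0 \<longrightarrow> \<bar>F s y q\<bar> \<le> N * (1 + s) powr (- k) * energy q powr (- n)"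
      proof (cases "s \<ge> 0")
        case True
        have "AE y in lborel. AE q in lborel. \<bar>f s y q\<bar> \<le> N * (1 + s) powr (- k) * energy q powr (- n)"
          by (rule phase_measure_AE[OF fN[OF True]]) (use per[OF True] in \<open>simp add: periodic_def\<close>)
        then show ?thesis using True by (simp add: F_def max_def)
      qed simp
    qed
    have H0: "AE x in lborel. AE p in lborel. \<bar>f0 x p\<bar> \<le> F0 * energy p powr (- m)"
      by (rule phase_measure_AE[OF f0F]) (use per0 in \<open>simp add: periodic_def\<close>)
    have shiftF: "AE x in lborel. AE p in lborel. AE t in lborel. t \<ge> 0 \<longrightarrow> \<bar>u t x p\<bar> \<le> G t p"
      if G [measurable]: "(\<lambda>z. G (fst z) (snd z)) \<in> borel_measurable (borel \<Otimes>\<^sub>M borel)"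
        and ae: "AE s in lborel. AE y in lborel. AE q in lborel. s \<ge> 0 \<longrightarrow> \<bar>F s y q\<bar> \<le> G s q" for G
    proof -
      have [measurable]: "(\<lambda>z. G s (snd z)) \<in> borel_measurable (borel \<Otimes>\<^sub>M borel)" for s
        using measurable_compose[of "\<lambda>z. (s, snd z)" "borel \<Otimes>\<^sub>M borel" "borel \<Otimes>\<^sub>M borel", OF _ G] by simp
      have [measurable]: "(\<lambda>z. G (fst z) (snd (snd z))) \<in> borel_measurable (borel \<Otimes>\<^sub>M (borel \<Otimes>\<^sub>M borel))"
        using measurable_compose[of "\<lambda>z. (fst z, snd (snd z))" "borel \<Otimes>\<^sub>M (borel \<Otimes>\<^sub>M borel)" "borel \<Otimes>\<^sub>M borel", OF _ G] by simp
      have "AE s in lborel. AE x in lborel. AE p in lborel. s \<ge> 0 \<longrightarrow> \<bar>u s x p\<bar> \<le> G s p"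
        using ae unfolding u_def
        by eventually_elim (rule AE_shift[where Q="\<lambda>y q. _ \<ge> 0 \<longrightarrow> \<bar>F _ y q\<bar> \<le> G _ q"], simp, measurable)
      then show ?thesis by (subst (asm) AE_swap3) measurable
    qed
    define Jn where "Jn t x p = (LBINT s:{0..t}. coll_freq \<sigma> p * u s x p - \<kappa>' s x p)" for t x p
    have Jnm [measurable]: "(\<lambda>z. Jn (fst z) (fst (snd z)) (snd (snd z))) \<in> borel_measurable (borel \<Otimes>\<^sub>M (borel \<Otimes>\<^sub>M borel))"
    proof -
      have [measurable]: "(\<lambda>y. u (snd y) (fst (snd (fst y))) (snd (snd (fst y)))) \<in> borel_measurable ((borel \<Otimes>\<^sub>M (borel \<Otimes>\<^sub>M borel)) \<Otimes>\<^sub>M borel)"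
        using measurable_compose[of "\<lambda>y. (snd y, fst (snd (fst y)), snd (snd (fst y)))" "(borel \<Otimes>\<^sub>M (borel \<Otimes>\<^sub>M borel)) \<Otimes>\<^sub>M borel" "borel \<Otimes>\<^sub>M (borel \<Otimes>\<^sub>M borel)", OF _ um] by simp
      have [measurable]: "(\<lambda>y. \<kappa>' (snd y) (fst (snd (fst y))) (snd (snd (fst y)))) \<in> borel_measurable ((borel \<Otimes>\<^sub>M (borel \<Otimes>\<^sub>M borel)) \<Otimes>\<^sub>M borel)"
        using measurable_compose[of "\<lambda>y. (snd y, fst (snd (fst y)), snd (snd (fst y)))" "(borel \<Otimes>\<^sub>M (borel \<Otimes>\<^sub>M borel)) \<Otimes>\<^sub>M borel" "borel \<Otimes>\<^sub>M (borel \<Otimes>\<^sub>M borel)", OF _ Km] by simp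
      show ?thesis
        unfolding Jn_def set_lebesgue_integral_def indicator_def atLeastAtMost_iff
        by (rule lborel.borel_measurable_lebesgue_integral) measurable
    qed
    \<comment> \<open>The equation is given for each time at almost every (x, p); the exchange
      yields it on almost every characteristic at almost every time.\<close>
    have duh: "AE x in lborel. AE p in lborel. AE t in lborel. t \<ge> 0 \<longrightarrow> u t x p = f0 x p - Jn t x p"
    proof -
      have "AE t in lborel. AE x in lborel. AE p in lborel. t \<ge> 0 \<longrightarrow> u t x p = f0 x p - Jn t x p"
      proof (rule AE_I2)
        fix t :: real
        show "AE x in lborel. AE p in lborel. t \<ge> 0 \<longrightarrow> u t x p = f0 x p - Jn t x p"
        proof (cases "t \<ge> 0")
          case t: True
          have eq: "u t x p = f t (x + t *\<^sub>R velocity p) p"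
            "Jn t x p = (LBINT s:{0..t}. L_op \<sigma> (f s (x + s *\<^sub>R velocity p)) p)" for x p
          proof -
            show "u t x p = f t (x + t *\<^sub>R velocity p) p" using t by (simp add: u_def F_def max_def)
            show "Jn t x p = (LBINT s:{0..t}. L_op \<sigma> (f s (x + s *\<^sub>R velocity p)) p)"
              unfolding Jn_def
              by (rule set_lebesgue_integral_cong) (auto simp: u_def \<kappa>'_def F_def[abs_def] L_op_def max_def)
          qed
          have "AE (x, p) in phase_measure. u t x p = f0 x p - Jn t x p"
            unfolding eq using sol t by (simp add: semigroup_solution_def)
          then have "AE x in lborel. AE p in lborel. u t x p = f0 x p - Jn t x p"
          proof (rule phase_measure_AE)
            fix x p i
            have sh: "f s (x + axis i 1 + s *\<^sub>R velocity p) = f s (x + s *\<^sub>R velocity p)" if "s \<ge> 0" for s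
            proof
              fix q
              have "x + axis i 1 + s *\<^sub>R velocity p = (x + s *\<^sub>R velocity p) + axis i 1" by simp
              then show "f s (x + axis i 1 + s *\<^sub>R velocity p) q = f s (x + s *\<^sub>R velocity p) q"
                using per[OF that] by (simp only: periodic_def)
            qed
            have "(LBINT s:{0..t}. L_op \<sigma> (f s (x + axis i 1 + s *\<^sub>R velocity p)) p) = (LBINT s:{0..t}. L_op \<sigma> (f s (x + s *\<^sub>R velocity p)) p)"
              by (rule set_lebesgue_integral_cong) (auto simp: sh)
            then show "(u t (x + axis i 1) p = f0 (x + axis i 1) p - Jn t (x + axis i 1) p) = (u t x p = f0 x p - Jn t x p)"
              unfolding eq using sh[OF t] per0 by (simp add: periodic_def)
          qed
          then show ?thesis using t by simp
        qed simp
      qed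
      then show ?thesis by (subst (asm) AE_swap3) measurable
    qed
    have step: "AE s in lborel. AE y in lborel. AE q in lborel. s \<ge> 0 \<longrightarrow> \<bar>F s y q\<bar> \<le> ?B j s q" for j
    proof (induction j)
      case 0
      show ?case using H1
      proof eventually_elim
        case (elim s)
        then show ?case
        proof eventually_elim
          case (elim y)
          then show ?case by eventually_elim (use base0 order_trans in blast)
        qed
      qed
    next
      case (Suc j)
      have "AE s in lborel. AE x in lborel. AE p in lborel. s \<ge> 0 \<longrightarrow> R \<le> energy p \<longrightarrow> \<bar>\<kappa>' s x p\<bar> \<le> coll_freq \<sigma> p / 2 * ?B (Suc j) s p"
        using K_op_bound_AE[OF Fm Bm Suc]
      proof eventually_elim
        case (elim s)
        then show ?case
        proof eventually_elim
          case (elim x)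
          then show ?case
          proof eventually_elim
            case (elim p)
            show ?case
            proof (intro impI)
              assume s: "s \<ge> 0" and p: "R \<le> energy p"
              have "ennreal \<bar>\<kappa>' s x p\<bar> \<le> (\<integral>\<^sup>+z. ennreal (collision_integrand (?B j s) p z) \<partial>(lborel \<Otimes>\<^sub>M sphere_measure))"
                using elim s by (simp add: \<kappa>'_def)
              also have "\<dots> \<le> ennreal (c / 4 * energy p powr (- b / 2) * ?B j s p)"
                unfolding \<kappa>_def[symmetric]
                using p R A a s k nm by (intro R1(2)) (auto intro!: barrier_nonneg barrier_growth simp: \<kappa>_def)
              finally have "\<bar>\<kappa>' s x p\<bar> \<le> c / 4 * energy p powr (- b / 2) * ?B j s p"
                using c A by (subst (asm) ennreal_le_iff) (auto intro!: mult_nonneg_nonneg barrier_nonneg)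
              also have "\<dots> = (c * energy p powr (- b / 2)) / 4 * ?B j s p" by simp
              also have "\<dots> \<le> coll_freq \<sigma> p / 4 * (2 * ?B (Suc j) s p)"
                using c(2)[of p] p R A coll_freq_nonneg[of p]
                by (intro mult_mono barrier_Suc) (auto intro!: barrier_nonneg divide_right_mono)
              finally show "\<bar>\<kappa>' s x p\<bar> \<le> coll_freq \<sigma> p / 2 * ?B (Suc j) s p" by simp
            qed
          qed
        qed
      qed
      then have kap: "AE x in lborel. AE p in lborel. AE s in lborel. s \<ge> 0 \<longrightarrow> R \<le> energy p \<longrightarrow> \<bar>\<kappa>' s x p\<bar> \<le> coll_freq \<sigma> p / 2 * ?B (Suc j) s p"
        by (subst (asm) AE_swap3) measurable
      have uj: "AE x in lborel. AE p in lborel. AE t in lborel. t \<ge> 0 \<longrightarrow> \<bar>u t x p\<bar> \<le> ?B j t p"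
        by (rule shiftF[OF Bm Suc])
      have uN: "AE x in lborel. AE p in lborel. AE t in lborel. t \<ge> 0 \<longrightarrow> \<bar>u t x p\<bar> \<le> N * (1 + t) powr (- k) * energy p powr (- n)"
        by (rule shiftF[OF _ H1]) measurable
      have "AE x in lborel. AE p in lborel. AE t in lborel. t \<ge> 0 \<longrightarrow> \<bar>u t x p\<bar> \<le> ?B (Suc j) t p"
        using kap uj uN duh H0
      proof eventually_elim
        case (elim x)
        then show ?case
        proof eventually_elim
          case (elim p)
          show ?case
          proof (cases "R \<le> energy p")
            case False
            then show ?thesis using elim(3) 
            proof eventually_elim
              case (elim t)
              show ?case using elim low[of t p "Suc j"] False by linarith
            qed
          next
            case p: True
            then have p8: "8 \<le> energy p" using R by simp
            obtain \<Phi>' where \<Phi>': "\<And>t. t \<ge> 0 \<Longrightarrow> ((\<lambda>t. ?B (Suc j) t p) has_real_derivative \<Phi>' t) (at t)"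
              "continuous_on {0..} \<Phi>'" "\<And>t. t \<ge> 0 \<Longrightarrow> - \<Phi>' t \<le> coll_freq \<sigma> p / 2 * ?B (Suc j) t p"
              using barrier_deriv[OF A(1) _ _ freq[OF p8], of m n "Suc j"] a k by auto
            have init: "\<bar>f0 x p\<bar> \<le> ?B (Suc j) 0 p"
            proof -
              have "\<bar>f0 x p\<bar> \<le> F0 * energy p powr (- m)" by (rule elim(5))
              also have "\<dots> \<le> A * (energy p powr (- m) + (1/2) ^ Suc j * energy p powr (- n))" using A F0 by (intro mult_mono) auto
              also have "\<dots> = ?B (Suc j) 0 p" by (simp add: barrier_def slow_def)
              finally show ?thesis .
            qed
            have kp: "AE s in lborel. s \<ge> 0 \<longrightarrow> \<bar>\<kappa>' s x p\<bar> \<le> coll_freq \<sigma> p / 2 * ?B (Suc j) s p"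
              using elim(1) p by (auto elim: eventually_mono)
            \<comment> \<open>The comparison needs a bounded integrand: the barrier of index j
              bounds u, that of index j + 1 bounds the source, and both are at most 2 A.\<close>
            have bdd: "AE s in lborel. s \<ge> 0 \<longrightarrow> \<bar>coll_freq \<sigma> p * u s x p - \<kappa>' s x p\<bar> \<le> coll_freq \<sigma> p * (2 * A) + coll_freq \<sigma> p / 2 * (2 * A)"
              using kp elim(2)
            proof eventually_elim
              case (elim s)
              show ?case
              proof
                assume s: "s \<ge> 0"
                have "\<bar>coll_freq \<sigma> p * u s x p\<bar> \<le> coll_freq \<sigma> p * (2 * A)"
                  unfolding abs_mult using elim(2) s coll_freq_nonneg[of p] barrier_le[of A a s k n m j p] A a k nm
                  by (intro mult_mono) auto
                moreover have "\<bar>\<kappa>' s x p\<bar> \<le> coll_freq \<sigma> p / 2 * (2 * A)"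
                  using elim(1) s mult_left_mono[of "?B (Suc j) s p" "2 * A" "coll_freq \<sigma> p / 2"] coll_freq_nonneg[of p] barrier_le[of A a s k n m "Suc j" p] A a k nm
                  by auto
                ultimately show "\<bar>coll_freq \<sigma> p * u s x p - \<kappa>' s x p\<bar> \<le> coll_freq \<sigma> p * (2 * A) + coll_freq \<sigma> p / 2 * (2 * A)"
                  by linarith
              qed
            qed
            have um1: "(\<lambda>t. u t x p) \<in> borel_measurable borel"
              using measurable_compose[of "\<lambda>t. (t, x, p)" borel "borel \<Otimes>\<^sub>M (borel \<Otimes>\<^sub>M borel)", OF _ um] by simp
            have km1: "(\<lambda>t. \<kappa>' t x p) \<in> borel_measurable borel"
              using measurable_compose[of "\<lambda>t. (t, x, p)" borel "borel \<Otimes>\<^sub>M (borel \<Otimes>\<^sub>M borel)", OF _ Km] by simp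
            show ?thesis
              by (rule damped_comparison[OF elim(4)[unfolded Jn_def] um1 km1 bdd \<Phi>'(1,2) coll_freq_nonneg \<Phi>'(3) kp init])
          qed
        qed
      qed
      then have "AE t in lborel. AE x in lborel. AE p in lborel. t \<ge> 0 \<longrightarrow> \<bar>u t x p\<bar> \<le> ?B (Suc j) t p"
        by (subst AE_swap3) measurable
      then show ?case
      proof eventually_elim
        case (elim t)
        have [measurable]: "(\<lambda>z. u t (fst z) (snd z)) \<in> borel_measurable (borel \<Otimes>\<^sub>M borel)"
          unfolding u_def by measurable
        \<comment> \<open>Undoes the shift along characteristics at the fixed time t.\<close>
        have "AE y in lborel. AE p in lborel. t \<ge> 0 \<longrightarrow> \<bar>u t (y + (- t) *\<^sub>R velocity p) p\<bar> \<le> ?B (Suc j) t p"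
          by (rule AE_shift[where Q="\<lambda>x p. t \<ge> 0 \<longrightarrow> \<bar>u t x p\<bar> \<le> ?B (Suc j) t p"], rule elim) measurable
        then show ?case by (simp add: u_def)
      qed
    qed
    \<comment> \<open>Countably many indices j share one exceptional set, so the limit in j may be
      taken pointwise.\<close>
    have "AE s in lborel. \<forall>j. AE y in lborel. AE q in lborel. s \<ge> 0 \<longrightarrow> \<bar>F s y q\<bar> \<le> ?B j s q"
      by (rule iffD2[OF AE_all_countable]) (use step in blast)
    then show "AE s in lborel. AE y in lborel. AE q in lborel. s \<ge> 0 \<longrightarrow>
         \<bar>f (max 0 s) y q\<bar> \<le> (F0 + N * R powr m) * slow b k a s q * energy q powr (- m)"
    proof eventually_elim
      case (elim s)
      then have "AE y in lborel. \<forall>j. AE q in lborel. s \<ge> 0 \<longrightarrow> \<bar>F s y q\<bar> \<le> ?B j s q"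
        by (rule iffD1[OF AE_all_countable[symmetric]])
      then show ?case
      proof eventually_elim
        case (elim y)
        then have "AE q in lborel. \<forall>j. s \<ge> 0 \<longrightarrow> \<bar>F s y q\<bar> \<le> ?B j s q"
          by (rule iffD1[OF AE_all_countable[symmetric]])
        then show ?case
        proof eventually_elim
          case (elim q)
          show ?case
          proof
            assume s: "s \<ge> 0"
            have "(\<lambda>j. ?B j s q) \<longlonglongrightarrow> A * slow b k a s q * (energy q powr (- m) + 0 * energy q powr (- n))"
              unfolding barrier_def by (intro tendsto_intros LIMSEQ_realpow_zero) auto
            then have "\<bar>F s y q\<bar> \<le> A * slow b k a s q * (energy q powr (- m) + 0 * energy q powr (- n))"
              by (rule LIMSEQ_le_const) (use elim s in auto)
            then show "\<bar>f (max 0 s) y q\<bar> \<le> (F0 + N * R powr m) * slow b k a s q * energy q powr (- m)"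
              by (simp add: F_def A_def)
          qed
        qed
      qed
    qed
  qed
qed

end

section \<open>The remainder\<close>

text \<open>A velocity v = q/q_0 satisfies |v| < 1 and determines q = v / sqrt(1 - |v|^2). As r is
  not 0, q is a differentiable function of the position, so the bad momenta lie in the image of a
  null set under this function.\<close>

lemma AE_velocity:
  assumes P: "AE y in lborel. P y" and r: "r \<noteq> 0"
  shows "AE q in lborel. P (c - r *\<^sub>R velocity q)"
proof -
  obtain Z where Z: "Z \<in> null_sets lborel" "{x \<in> space lborel. \<not> P x} \<subseteq> Z"
    using P unfolding eventually_ae_filter by blast
  define u where "u y = (1 / r) *\<^sub>R (c - y)" for y :: vec3
  define h where "h y = (1 / sqrt (1 - u y \<bullet> u y)) *\<^sub>R u y" for y
  define S where "S = Z \<inter> {y. u y \<bullet> u y < 1}"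
  have du: "u differentiable (at y)" for y unfolding u_def by (intro derivative_intros)
  have "h differentiable (at y)" if "u y \<bullet> u y < 1" for y
  proof -
    obtain D0 where D0: "(u has_derivative D0) (at y)" using du[of y] by (auto simp: differentiable_def)
    have D: "((\<lambda>y. 1 - u y \<bullet> u y) has_derivative (\<lambda>h. 0 - (u y \<bullet> D0 h + D0 h \<bullet> u y))) (at y)"
      by (intro has_derivative_diff has_derivative_const has_derivative_inner D0)
    have "((\<lambda>x. inverse (sqrt x)) has_derivative (*) (- inverse (sqrt (1 - u y \<bullet> u y)) * (inverse (sqrt (1 - u y \<bullet> u y)) / 2) * inverse (sqrt (1 - u y \<bullet> u y)))) (at (1 - u y \<bullet> u y))"
      by (rule has_field_derivative_imp_has_derivative)
        (use that in \<open>auto intro!: derivative_eq_intros simp: field_simps\<close>)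
    from has_derivative_compose[OF D this] have "(\<lambda>y. 1 / sqrt (1 - u y \<bullet> u y)) differentiable (at y)"
      by (auto simp: differentiable_def inverse_eq_divide)
    then show ?thesis unfolding h_def by (intro differentiable_scaleR du)
  qed
  then have dh: "h differentiable_on S"
    by (auto simp: S_def intro!: differentiable_at_imp_differentiable_on)
  have "negligible Z" using Z(1) by (simp add: negligible_iff_null_sets null_sets_completionI)
  then have "negligible S" by (rule negligible_subset) (simp add: S_def)
  then have "negligible (h ` S)" using dh by (intro negligible_differentiable_image_negligible) auto
  then obtain N where N: "N \<in> null_sets lborel" "h ` S \<subseteq> N"
    by (auto simp: negligible_iff_null_sets null_sets_completion_iff2)
  have "q \<in> N" if "\<not> P (c - r *\<^sub>R velocity q)" for q
  proof -
    let ?y = "c - r *\<^sub>R velocity q"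
    have uy: "u ?y = velocity q" using r by (simp add: u_def)
    have vv: "velocity q \<bullet> velocity q = (q \<bullet> q) / (energy q)\<^sup>2"
      by (simp add: velocity_def power2_eq_square divide_inverse)
    have e: "(energy q)\<^sup>2 = 1 + q \<bullet> q" by (simp add: energy_sq power2_norm_eq_inner)
    have pos: "1 + q \<bullet> q > 0" by (simp add: add_pos_nonneg)
    have "1 - velocity q \<bullet> velocity q = 1 / (energy q)\<^sup>2"
      unfolding vv e using pos by (simp add: field_simps)
    then have "sqrt (1 - velocity q \<bullet> velocity q) = 1 / energy q"
      using energy_pos[of q] by (simp add: real_sqrt_divide)
    then have "h ?y = q" unfolding h_def uy using energy_pos[of q] by (simp add: velocity_def)
    moreover have "u ?y \<bullet> u ?y < 1" unfolding uy vv e using pos by simp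
    then have "?y \<in> S" using that Z(2) by (auto simp: S_def)
    ultimately show ?thesis using N(2) by force
  qed
  then show ?thesis by (intro AE_I'[OF N(1)]) auto
qed

lemma AE_permute4:
  fixes Q :: "real \<times> vec3 \<times> real \<times> vec3 \<Rightarrow> bool"
  assumes [measurable]: "Measurable.pred (borel \<Otimes>\<^sub>M (borel \<Otimes>\<^sub>M (borel \<Otimes>\<^sub>M borel))) Q"
    and ae: "AE a in lborel. AE y in lborel. AE b in lborel. AE z in lborel. Q (a, y, b, z)"
  shows "AE z in lborel. AE y in lborel. AE b in lborel. AE a in lborel. Q (a, y, b, z)"
proof -
  have "AE a in lborel. AE y in lborel. AE z in lborel. AE b in lborel. Q (a, y, b, z)"
    using ae
  proof eventually_elim
    case (elim a)
    then show ?case by eventually_elim (erule AE_lborel_swap, measurable)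
  qed
  then have "AE a in lborel. AE z in lborel. AE y in lborel. AE b in lborel. Q (a, y, b, z)"
    by eventually_elim (erule AE_lborel_swap, rule pred_AE_lborel, measurable)
  then have "AE z in lborel. AE a in lborel. AE y in lborel. AE b in lborel. Q (a, y, b, z)"
    by (rule AE_lborel_swap) (rule pred_AE_lborel, rule pred_AE_lborel, measurable)
  then show ?thesis
  proof eventually_elim
    case (elim z)
    then have "AE y in lborel. AE a in lborel. AE b in lborel. Q (a, y, b, z)"
      by (rule AE_lborel_swap) (rule pred_AE_lborel, measurable)
    then show ?case by eventually_elim (erule AE_lborel_swap, measurable)
  qed
qed

text \<open>The bounds on \<open>f s\<close> hold for almost every position, but in the remainder the position is a
  function of \<open>q1\<close>; this function is nonsingular because \<open>velocity\<close> has a differentiable inverse.\<close>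

lemma AE_remainder:
  fixes G :: "real \<times> vec3 \<times> vec3 \<Rightarrow> bool"
  assumes [measurable]: "Measurable.pred (borel \<Otimes>\<^sub>M (borel \<Otimes>\<^sub>M borel)) G"
    and ae: "AE s in lborel. AE y in lborel. AE q in lborel. G (s, y, q)"
  shows "AE q1 in lborel. AE q2 in lborel. AE s1 in lborel. AE s2 in lborel.
     G (s2, x - (t - s1) *\<^sub>R velocity p - (s1 - s2) *\<^sub>R velocity q1, q2)"
proof -
  let ?Q = "\<lambda>(s2, q2, s1, q1). G (s2, x - (t - s1) *\<^sub>R velocity p - (s1 - s2) *\<^sub>R velocity q1, q2)"
  have "AE s2 in lborel. AE q2 in lborel. AE s1 in lborel. AE q1 in lborel. ?Q (s2, q2, s1, q1)"
    using ae
  proof eventually_elim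
    case (elim s2)
    then have "AE q in lborel. AE y in lborel. G (s2, y, q)" by (rule AE_lborel_swap) measurable
    then show ?case
    proof eventually_elim
      case (elim q2)
      \<comment> \<open>For s1 = s2 the position does not depend on q1; this single time is
        discarded.\<close>
      show ?case using AE_lborel_singleton[of s2]
      proof eventually_elim
        case (elim s1)
        then have "s1 - s2 \<noteq> 0" by simp
        from AE_velocity[OF \<open>AE y in lborel. G (s2, y, q2)\<close> this] show ?case by simp
      qed
    qed
  qed
  then have "AE q1 in lborel. AE q2 in lborel. AE s1 in lborel. AE s2 in lborel. ?Q (s2, q2, s1, q1)"
    by (rule AE_permute4[rotated]) measurable
  then show ?thesis by simp
qed

lemma abs_integral_le_measure:
  fixes f :: "'a \<Rightarrow> real"
  assumes D: "D \<ge> 0" and A: "A \<in> sets M" "emeasure M A < \<infinity>"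
    and le: "AE x in M. \<bar>f x\<bar> \<le> D * indicator A x"
  shows "\<bar>integral\<^sup>L M f\<bar> \<le> D * measure M A"
proof -
  have "ennreal (norm (integral\<^sup>L M f)) \<le> (\<integral>\<^sup>+x. ennreal (norm (f x)) \<partial>M)" by (rule norm_integral_le_nn_integral)
  also have "\<dots> \<le> (\<integral>\<^sup>+x. ennreal D * indicator A x \<partial>M)"
  proof (rule nn_integral_mono_AE)
    show "AE x in M. ennreal (norm (f x)) \<le> ennreal D * indicator A x"
      using le by eventually_elim (use D in \<open>auto simp: indicator_def intro!: ennreal_leI split: if_splits\<close>)
  qed
  also have "\<dots> = ennreal D * emeasure M A" using A by (simp add: nn_integral_cmult)
  also have "\<dots> = ennreal (D * measure M A)"
    using A D by (simp add: emeasure_eq_ennreal_measure ennreal_mult)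
  finally show ?thesis using D by (simp add: ennreal_le_iff)
qed

lemma abs_LBINT_exp_le:
  fixes g :: "real \<Rightarrow> real"
  assumes D: "D \<ge> 0" and \<alpha>: "\<alpha> > 0" and u: "u \<ge> 0"
    and le: "AE s in lborel. 0 \<le> s \<longrightarrow> s \<le> u \<longrightarrow> \<bar>g s\<bar> \<le> D * exp (- \<alpha> * (u - s))"
  shows "\<bar>LBINT s:{0..u}. g s\<bar> \<le> D / \<alpha>"
proof -
  have "\<bar>LBINT s:{0..u}. g s\<bar> \<le> (\<integral>s. indicator {0..u} s *\<^sub>R (D * exp (- \<alpha> * (u - s))) \<partial>lborel)"
  proof (cases "integrable lborel (\<lambda>s. indicator {0..u} s *\<^sub>R g s)")
    case True
    have "\<bar>LBINT s:{0..u}. g s\<bar> \<le> (\<integral>s. \<bar>indicator {0..u} s *\<^sub>R g s\<bar> \<partial>lborel)"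
      unfolding set_lebesgue_integral_def by (rule integral_abs_bound)
    also have "\<dots> \<le> (\<integral>s. indicator {0..u} s *\<^sub>R (D * exp (- \<alpha> * (u - s))) \<partial>lborel)"
    proof (rule integral_mono_AE)
      show "integrable lborel (\<lambda>s. \<bar>indicator {0..u} s *\<^sub>R g s\<bar>)" using True by (rule integrable_abs)
      show "integrable lborel (\<lambda>s. indicator {0..u} s *\<^sub>R (D * exp (- \<alpha> * (u - s))))"
        by (rule borel_integrable_compact) (auto intro!: continuous_intros)
      show "AE s in lborel. \<bar>indicator {0..u} s *\<^sub>R g s\<bar> \<le> indicator {0..u} s *\<^sub>R (D * exp (- \<alpha> * (u - s)))"
        using le by eventually_elim (auto simp: indicator_def)
    qed
    finally show ?thesis .
  next
    case False
    then show ?thesis using D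
      by (auto simp: set_lebesgue_integral_def not_integrable_integral_eq intro!: integral_nonneg_AE)
  qed
  also have "\<dots> = D / \<alpha> * exp (- \<alpha> * (u - u)) - D / \<alpha> * exp (- \<alpha> * (u - 0))"
    by (rule integral_FTC_atLeastAtMost[OF u])
      (use \<alpha> in \<open>auto intro!: continuous_intros derivative_eq_intros simp: has_real_derivative_iff_has_vector_derivative[symmetric]\<close>)
  also have "\<dots> \<le> D / \<alpha>" using D \<alpha> by simp
  finally show ?thesis .
qed

text \<open>The decay in time survives the convolution with \<open>exp (- \<nu> (t - s))\<close> if \<open>\<nu> \<ge> 2 k \<beta>\<close>.\<close>

lemma decay_shift:
  fixes k \<beta> s t :: real
  assumes k: "0 \<le> k" and \<beta>: "0 \<le> \<beta>" and s: "0 \<le> s" "s \<le> t"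
  shows "(1 + \<beta> * s) powr (- k) \<le> (1 + \<beta> * t) powr (- k) * exp (k * \<beta> * (t - s))"
proof -
  have p: "1 + \<beta> * s > 0" "1 + \<beta> * t > 0" using \<beta> s by (auto intro!: add_pos_nonneg mult_nonneg_nonneg)
  have "ln ((1 + \<beta> * t) / (1 + \<beta> * s)) \<le> (1 + \<beta> * t) / (1 + \<beta> * s) - 1"
    using p by (intro ln_le_minus_one) auto
  also have "\<dots> = \<beta> * (t - s) / (1 + \<beta> * s)" using p by (simp add: field_simps)
  also have "\<dots> \<le> \<beta> * (t - s) / 1" using \<beta> s p by (intro divide_left_mono) auto
  finally have "ln (1 + \<beta> * t) - ln (1 + \<beta> * s) \<le> \<beta> * (t - s)" using p by (simp add: ln_div)
  then have "k * (ln (1 + \<beta> * t) - ln (1 + \<beta> * s)) \<le> k * (\<beta> * (t - s))" using k by (rule mult_left_mono)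
  then have "- k * ln (1 + \<beta> * s) \<le> - k * ln (1 + \<beta> * t) + k * \<beta> * (t - s)" by (simp add: algebra_simps)
  then show ?thesis using p by (simp add: powr_def exp_add[symmetric])
qed

section \<open>Energies on the support of the remainder\<close>

lemma energy_le_double: "norm q \<le> 2 * norm p \<Longrightarrow> energy q \<le> 2 * energy p"
proof -
  assume "norm q \<le> 2 * norm p"
  then have "(norm q)\<^sup>2 \<le> (2 * norm p)\<^sup>2" by (intro power_mono) auto
  then have "(energy q)\<^sup>2 \<le> (2 * energy p)\<^sup>2" by (simp add: power_mult_distrib energy_sq)
  then show ?thesis using energy_pos[of p] by (rule_tac power2_le_imp_le) auto
qed

lemma measure_cball_vec3: "r \<ge> 0 \<Longrightarrow> measure lborel (cball (0::vec3) r) \<le> (2 * r) ^ 3"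
proof -
  assume r: "r \<ge> 0"
  let ?b = "vec r :: vec3"
  have "cball (0::vec3) r \<subseteq> cbox (- ?b) ?b"
  proof
    fix x :: vec3 assume "x \<in> cball 0 r"
    then have "\<bar>x $ i\<bar> \<le> r" for i using component_le_norm_cart[of x i] by simp
    then show "x \<in> cbox (- ?b) ?b" by (simp add: mem_box_cart abs_le_iff minus_le_iff)
  qed
  then have le: "measure lborel (cball (0::vec3) r) \<le> measure lborel (cbox (- ?b) ?b)"
    by (intro measure_mono_fmeasurable) (auto simp: fmeasurable_cbox)
  have z: "0 \<in> cbox (- ?b) ?b" using r by (simp add: mem_box_cart)
  have "measure lborel (cbox (- ?b) ?b) = (\<Prod>i\<in>UNIV. ?b $ i - (- ?b) $ i)"
    by (rule content_cbox_cart) (use z in blast)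
  also have "\<dots> = (\<Prod>i\<in>(UNIV :: 3 set). 2 * r)" by (rule prod.cong) auto
  also have "\<dots> = (2 * r) ^ 3" by (simp only: prod_constant) simp
  finally show ?thesis using le by simp
qed

lemma ind_high_le_1: "0 \<le> ind_high M p q \<and> ind_high M p q \<le> 1"
  by (auto simp: ind_high_def)

lemma comparable_energy:
  assumes "ind_comparable p q \<noteq> 0"
  shows "energy q \<le> 2 * energy p" "energy p \<le> 2 * energy q" "norm q \<le> 2 * norm p"
  using assms by (auto simp: ind_comparable_def intro!: energy_le_double)

lemma high_energy:
  assumes "ind_comparable p q \<noteq> 0" "ind_high M p q \<noteq> 0"
  shows "M / 2 \<le> energy p" "M / 2 \<le> energy q"
  using assms norm_less_energy[of p] norm_less_energy[of q]
  by (auto simp: ind_high_def ind_comparable_def of_bool_def split: if_splits)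

context soft_kernel
begin

text \<open>Both damping rates are at least 2 \<alpha> with \<alpha> = k a \<mu>. One \<alpha> pays
  for moving the time decay from s2 to t by \<open>decay_shift\<close>, the other makes each
  exponential integral at most 1/\<alpha>. Here \<mu> bounds energy^(-b/2) from below for all
  energies up to 4 e.\<close>

lemma duhamel_time_bound:
  fixes t e :: real
  assumes k: "k \<ge> 1" and a: "0 < a" "a \<le> 1" and m: "m \<ge> 0" and A: "A \<ge> 0" and t: "t \<ge> 0" and e: "e > 0"
    and \<mu>_def: "\<mu> = (4 * e) powr (- b / 2)"
    and \<nu>: "2 * k * a * \<mu> \<le> \<nu>p" "2 * k * a * \<mu> \<le> \<nu>q"
    and q2: "energy q2 \<le> 4 * e" "e / 4 \<le> energy q2"
    and ae: "AE s1 in lborel. AE s2 in lborel. s2 \<ge> 0 \<longrightarrow> \<bar>g s1 s2\<bar> \<le> A * slow b k a s2 q2 * energy q2 powr (- m)"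
  shows "\<bar>LBINT s1:{0..t}. exp (- \<nu>p * (t - s1)) * (LBINT s2:{0..s1}. exp (- \<nu>q * (s1 - s2)) * g s1 s2)\<bar>
     \<le> A * (e / 4) powr (- m) * (1 + a * \<mu> * t) powr (- k) / (k * a * \<mu>) ^ 2"
proof -
  define \<alpha> where "\<alpha> = k * a * \<mu>"
  have \<mu>: "\<mu> > 0" using e by (simp add: \<mu>_def)
  have \<alpha>: "\<alpha> > 0" "2 * \<alpha> \<le> \<nu>p" "2 * \<alpha> \<le> \<nu>q" using k a \<mu> \<nu> by (simp_all add: \<alpha>_def)
  define H where "H = A * (e / 4) powr (- m) * (1 + a * \<mu> * t) powr (- k)"
  have H: "H \<ge> 0" using A by (simp add: H_def)
  have \<mu>q: "\<mu> \<le> energy q2 powr (- b / 2)"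
    unfolding \<mu>_def using q2 energy_pos[of q2] b by (intro powr_mono2') auto
  have eq: "energy q2 powr (- m) \<le> (e / 4) powr (- m)" using q2 e m by (intro powr_mono2') auto
  have "AE s1 in lborel. 0 \<le> s1 \<longrightarrow> s1 \<le> t \<longrightarrow>
      \<bar>exp (- \<nu>p * (t - s1)) * (LBINT s2:{0..s1}. exp (- \<nu>q * (s1 - s2)) * g s1 s2)\<bar> \<le> H / \<alpha> * exp (- \<alpha> * (t - s1))"
    using ae
  proof eventually_elim
    case (elim s1)
    show ?case
    proof (intro impI)
      assume s1: "0 \<le> s1" "s1 \<le> t"
      have "AE s2 in lborel. 0 \<le> s2 \<longrightarrow> s2 \<le> s1 \<longrightarrow> \<bar>exp (- \<nu>q * (s1 - s2)) * g s1 s2\<bar> \<le> H * exp (\<alpha> * (t - s1)) * exp (- \<alpha> * (s1 - s2))"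
        using elim
      proof eventually_elim
        case (elim s2)
        show ?case
        proof (intro impI)
          assume s2: "0 \<le> s2" "s2 \<le> s1"
          have "slow b k a s2 q2 \<le> (1 + a * \<mu> * s2) powr (- k)"
            unfolding slow_def using k a \<mu> \<mu>q s2 mult_left_mono[OF \<mu>q, of "a * s2"]
            by (intro powr_mono2') (auto intro!: add_pos_nonneg simp: mult_ac)
          also have "\<dots> \<le> (1 + a * \<mu> * t) powr (- k) * exp (k * (a * \<mu>) * (t - s2))"
            using k a \<mu> s1 s2 by (intro decay_shift) auto
          finally have sl: "slow b k a s2 q2 \<le> (1 + a * \<mu> * t) powr (- k) * exp (\<alpha> * (t - s2))"
            by (simp add: \<alpha>_def mult.assoc)
          have "\<bar>g s1 s2\<bar> \<le> A * slow b k a s2 q2 * energy q2 powr (- m)" using elim s2 by simp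
          also have "\<dots> \<le> A * ((1 + a * \<mu> * t) powr (- k) * exp (\<alpha> * (t - s2))) * (e / 4) powr (- m)"
            using A sl eq by (intro mult_mono mult_nonneg_nonneg slow_pos) auto
          also have "\<dots> = H * exp (\<alpha> * (t - s2))" by (simp add: H_def mult_ac)
          finally have g: "\<bar>g s1 s2\<bar> \<le> H * exp (\<alpha> * (t - s2))" .
          have "- \<nu>q * (s1 - s2) \<le> - (2 * \<alpha>) * (s1 - s2)" using \<alpha> s2 by (intro mult_right_mono) auto
          then have "exp (- \<nu>q * (s1 - s2)) \<le> exp (- (2 * \<alpha>) * (s1 - s2))" by simp
          then have "exp (- \<nu>q * (s1 - s2)) * \<bar>g s1 s2\<bar> \<le> exp (- (2 * \<alpha>) * (s1 - s2)) * (H * exp (\<alpha> * (t - s2)))"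
            using g by (intro mult_mono) auto
          also have "\<dots> = H * (exp (- (2 * \<alpha>) * (s1 - s2)) * exp (\<alpha> * (t - s2)))" by simp
          also have "exp (- (2 * \<alpha>) * (s1 - s2)) * exp (\<alpha> * (t - s2)) = exp (\<alpha> * (t - s1)) * exp (- \<alpha> * (s1 - s2))"
            unfolding exp_add[symmetric] by (simp add: algebra_simps)
          finally show "\<bar>exp (- \<nu>q * (s1 - s2)) * g s1 s2\<bar> \<le> H * exp (\<alpha> * (t - s1)) * exp (- \<alpha> * (s1 - s2))"
            by (simp add: abs_mult mult.assoc)
        qed
      qed
      then have I: "\<bar>LBINT s2:{0..s1}. exp (- \<nu>q * (s1 - s2)) * g s1 s2\<bar> \<le> H * exp (\<alpha> * (t - s1)) / \<alpha>"
        using H \<alpha> s1 by (intro abs_LBINT_exp_le) auto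
      have "- \<nu>p * (t - s1) \<le> - (2 * \<alpha>) * (t - s1)" using \<alpha> s1 by (intro mult_right_mono) auto
      then have "exp (- \<nu>p * (t - s1)) \<le> exp (- (2 * \<alpha>) * (t - s1))" by simp
      then have "exp (- \<nu>p * (t - s1)) * \<bar>LBINT s2:{0..s1}. exp (- \<nu>q * (s1 - s2)) * g s1 s2\<bar>
         \<le> exp (- (2 * \<alpha>) * (t - s1)) * (H * exp (\<alpha> * (t - s1)) / \<alpha>)"
        using I by (intro mult_mono) auto
      also have "\<dots> = H / \<alpha> * (exp (- (2 * \<alpha>) * (t - s1)) * exp (\<alpha> * (t - s1)))" by simp
      also have "exp (- (2 * \<alpha>) * (t - s1)) * exp (\<alpha> * (t - s1)) = exp (- \<alpha> * (t - s1))"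
        unfolding exp_add[symmetric] by (simp add: algebra_simps)
      finally show "\<bar>exp (- \<nu>p * (t - s1)) * (LBINT s2:{0..s1}. exp (- \<nu>q * (s1 - s2)) * g s1 s2)\<bar> \<le> H / \<alpha> * exp (- \<alpha> * (t - s1))"
        by (simp add: abs_mult)
    qed
  qed
  then have "\<bar>LBINT s1:{0..t}. exp (- \<nu>p * (t - s1)) * (LBINT s2:{0..s1}. exp (- \<nu>q * (s1 - s2)) * g s1 s2)\<bar> \<le> H / \<alpha> / \<alpha>"
    using H \<alpha> t by (intro abs_LBINT_exp_le) auto
  then show ?thesis by (simp add: H_def \<alpha>_def power2_eq_square)
qed

text \<open>On the support all three energies agree up to a factor 4. Each kernel costs C (4 e)^13,
  and each integration runs over a ball of radius 4 e, contained in a cube of side 8 e. If e < M/2,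
  the indicators make the remainder vanish.\<close>

lemma R1_bound:
  fixes f :: "real \<Rightarrow> vec3 \<Rightarrow> vec3 \<Rightarrow> real" and p :: vec3
  assumes k: "k \<ge> 1" and a: "0 < a" "a \<le> 1" and m: "m \<ge> 0" and A: "A \<ge> 0" and t: "t \<ge> 0"
    and freq: "\<And>p. 8 \<le> energy p \<Longrightarrow> 2 * k * a * energy p powr (- b / 2) \<le> coll_freq \<sigma> p"
    and C: "C > 0" "\<And>p q P. energy p \<le> P \<Longrightarrow> energy q \<le> P \<Longrightarrow> \<bar>k_cut \<sigma> chi c2 p q\<bar> \<le> C * P ^ 13"
    and M: "M \<ge> 16"
    and fm: "(\<lambda>(t, x, p). f t x p) \<in> borel_measurable (restrict_space borel ({0..} \<times> UNIV))"
    and dec: "AE s in lborel. AE y in lborel. AE q in lborel. s \<ge> 0 \<longrightarrow>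
         \<bar>f (max 0 s) y q\<bar> \<le> A * slow b k a s q * energy q powr (- m)"
    and e_def: "e = energy p" and \<mu>_def: "\<mu> = (4 * e) powr (- b / 2)"
  shows "R1 \<sigma> chi c2 M f t x p = 0 \<or> M / 2 \<le> e \<and> \<bar>R1 \<sigma> chi c2 M f t x p\<bar> \<le>
    (C * (4 * e) ^ 13)\<^sup>2 * ((8 * e) ^ 3)\<^sup>2 * (A * (e / 4) powr (- m) * (1 + a * \<mu> * t) powr (- k) / (k * a * \<mu>) ^ 2)"
proof -
  define T where "T q1 q2 = (LBINT s1:{0..t}. exp (- coll_freq \<sigma> p * (t - s1)) *
            (LBINT s2:{0..s1}. exp (- coll_freq \<sigma> q1 * (s1 - s2)) *
               f s2 (x - (t - s1) *\<^sub>R velocity p - (s1 - s2) *\<^sub>R velocity q1) q2))" for q1 q2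
  define S where "S q1 = (LBINT q2. k_cut \<sigma> chi c2 q1 q2 *
          ind_comparable p q1 * ind_comparable q1 q2 * ind_high M p q1 * T q1 q2)" for q1
  have R1: "R1 \<sigma> chi c2 M f t x p = (LBINT q1. k_cut \<sigma> chi c2 p q1 * S q1)"
    by (simp add: R1_def S_def T_def)
  have S0: "S q1 = 0" if "ind_comparable p q1 = 0 \<or> ind_high M p q1 = 0" for q1
    using that by (auto simp: S_def)
  show ?thesis
  proof (cases "M / 2 \<le> e")
    case False
    then have "S q1 = 0" for q1 using S0[of q1] high_energy(1)[of p q1 M] by (auto simp: e_def)
    then show ?thesis by (simp add: R1)
  next
    case True
    have e: "e > 0" by (simp add: e_def energy_pos)
    define K where "K = C * (4 * e) ^ 13"
    have K: "K \<ge> 0" using C e by (simp add: K_def)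
    define B where "B = A * (e / 4) powr (- m) * (1 + a * \<mu> * t) powr (- k) / (k * a * \<mu>) ^ 2"
    have B: "B \<ge> 0" using A by (simp add: B_def)
    let ?X = "\<lambda>s1 s2 q1. x - (t - s1) *\<^sub>R velocity p - (s1 - s2) *\<^sub>R velocity q1"
    let ?G = "\<lambda>z. fst z \<ge> 0 \<longrightarrow> \<bar>f (max 0 (fst z)) (fst (snd z)) (snd (snd z))\<bar> \<le> A * slow b k a (fst z) (snd (snd z)) * energy (snd (snd z)) powr (- m)"
    \<comment> \<open>Transfers the bound, known at almost every position, to the positions that
      occur for the given x and p.\<close>
    have good: "AE q1 in lborel. AE q2 in lborel. AE s1 in lborel. AE s2 in lborel. ?G (s2, ?X s1 s2 q1, q2)"
    proof (rule AE_remainder)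
      note [measurable] = measurable_extend_time[OF fm]
      show "Measurable.pred (borel \<Otimes>\<^sub>M borel \<Otimes>\<^sub>M borel) ?G" by measurable
      show "AE s in lborel. AE y in lborel. AE q in lborel. ?G (s, y, q)" using dec by simp
    qed
    let ?D = "cball (0::vec3) (4 * e)"
    have D: "?D \<in> sets lborel" "emeasure lborel ?D < \<infinity>" "measure lborel ?D \<le> (8 * e) ^ 3"
      using measure_cball_vec3[of "4 * e"] e emeasure_bounded_finite[of ?D] by (auto simp: infinity_ennreal_def)
    have ne: "norm p \<le> e" using norm_less_energy[of p] by (simp add: e_def)
    have "AE q1 in lborel. \<bar>k_cut \<sigma> chi c2 p q1 * S q1\<bar> \<le> K * (K * B * (8 * e) ^ 3) * indicator ?D q1"
      using good
    proof eventually_elim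
      case (elim q1)
      show ?case
      proof (cases "ind_comparable p q1 = 0 \<or> ind_high M p q1 = 0")
        case True
        then have "S q1 = 0" by (rule S0)
        then show ?thesis using K B e by simp
      next
        case False
        note q1 = comparable_energy[of p q1] high_energy[of p q1 M]
        have q1e: "energy q1 \<le> 2 * e" "e \<le> 2 * energy q1" "norm q1 \<le> 2 * e" "8 \<le> energy q1" "8 \<le> energy p"
          using q1 False M ne by (auto simp: e_def)
        have \<nu>: "2 * k * a * \<mu> \<le> coll_freq \<sigma> q" if "8 \<le> energy q" "energy q \<le> 4 * e" for q
        proof -
          have "\<mu> \<le> energy q powr (- b / 2)"
            unfolding \<mu>_def using that b by (intro powr_mono2') auto
          then have "2 * k * a * \<mu> \<le> 2 * k * a * energy q powr (- b / 2)" using k a by (intro mult_left_mono) auto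
          also have "\<dots> \<le> coll_freq \<sigma> q" by (rule freq[OF that(1)])
          finally show ?thesis .
        qed
        have "AE q2 in lborel. \<bar>k_cut \<sigma> chi c2 q1 q2 * ind_comparable p q1 * ind_comparable q1 q2 * ind_high M p q1 * T q1 q2\<bar>
            \<le> K * B * indicator ?D q2"
          using elim
        proof eventually_elim
          case (elim q2)
          show ?case
          proof (cases "ind_comparable q1 q2 = 0")
            case True
            then show ?thesis using K B by simp
          next
            case False
            note q2 = comparable_energy[OF False]
            have q2e: "energy q2 \<le> 4 * e" "e / 4 \<le> energy q2" "q2 \<in> ?D" using q2 q1e by auto
            have "\<bar>T q1 q2\<bar> \<le> B"
              unfolding T_def B_def
            proof (rule duhamel_time_bound[OF k a m A t e \<mu>_def \<nu> \<nu> q2e(1,2)])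
              show "8 \<le> energy p" "8 \<le> energy q1" "energy p \<le> 4 * e" "energy q1 \<le> 4 * e" using q1e e by (auto simp: e_def)
              show "AE s1 in lborel. AE s2 in lborel. s2 \<ge> 0 \<longrightarrow> \<bar>f s2 (?X s1 s2 q1) q2\<bar> \<le> A * slow b k a s2 q2 * energy q2 powr (- m)"
                using elim
              proof eventually_elim
                case (elim s1)
                then show ?case by eventually_elim simp
              qed
            qed
            moreover have "\<bar>k_cut \<sigma> chi c2 q1 q2\<bar> \<le> K" unfolding K_def using q1e q2e e by (intro C) auto
            moreover have "\<bar>ind_comparable p q1 * ind_comparable q1 q2 * ind_high M p q1\<bar> \<le> 1"
              using ind_high_le_1[of M p q1] by (auto simp: ind_comparable_def abs_mult)
            ultimately have "\<bar>k_cut \<sigma> chi c2 q1 q2\<bar> * \<bar>ind_comparable p q1 * ind_comparable q1 q2 * ind_high M p q1\<bar> * \<bar>T q1 q2\<bar> \<le> K * 1 * B"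
              using K B by (intro mult_mono) auto
            then show ?thesis using q2e(3) by (simp add: abs_mult mult_ac)
          qed
        qed
        then have "\<bar>S q1\<bar> \<le> K * B * measure lborel ?D"
          unfolding S_def using K B D by (intro abs_integral_le_measure) auto
        also have "\<dots> \<le> K * B * (8 * e) ^ 3" using K B D by (intro mult_left_mono) auto
        finally have "\<bar>S q1\<bar> \<le> K * B * (8 * e) ^ 3" .
        moreover have "\<bar>k_cut \<sigma> chi c2 p q1\<bar> \<le> K" unfolding K_def using q1e e by (intro C) (auto simp: e_def)
        ultimately have "\<bar>k_cut \<sigma> chi c2 p q1\<bar> * \<bar>S q1\<bar> \<le> K * (K * B * (8 * e) ^ 3)" using K by (intro mult_mono) auto
        moreover have "q1 \<in> ?D" using q1e e by auto
        ultimately show ?thesis by (simp add: abs_mult)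
      qed
    qed
    then have "\<bar>R1 \<sigma> chi c2 M f t x p\<bar> \<le> K * (K * B * (8 * e) ^ 3) * measure lborel ?D"
      unfolding R1 using K B D e by (intro abs_integral_le_measure) auto
    also have "\<dots> \<le> K * (K * B * (8 * e) ^ 3) * (8 * e) ^ 3" using K B D e by (intro mult_left_mono) auto
    also have "\<dots> = K\<^sup>2 * ((8 * e) ^ 3)\<^sup>2 * B" by (simp only: power2_eq_square mult_ac)
    finally show ?thesis using True by (simp only: K_def B_def simp_thms)
  qed
qed

end

text \<open>The essential supremum of a nonnegative function could be negative only on a space of
  measure zero, and \<open>phase_measure\<close> is infinite.\<close>

lemma sup_norm_nonneg: "0 \<le> sup_norm b l h"
proof (rule ccontr)
  assume "\<not> 0 \<le> sup_norm b l h"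
  moreover have "AE z in phase_measure. (case z of (x, p) \<Rightarrow> ereal \<bar>weight b l p * h x p\<bar>) \<le> sup_norm b l h"
    unfolding sup_norm_def by (rule esssup_AE)
  ultimately have "AE z in phase_measure. False"
    by (elim eventually_mono) (metis (mono_tags, lifting) abs_ge_zero case_prod_unfold ereal_less_eq(5) order_trans)
  then have "emeasure phase_measure (space phase_measure) = 0"
    by (simp add: ae_filter_eq_bot_iff trivial_limit_def[symmetric])
  moreover have "emeasure phase_measure (space phase_measure) = \<infinity>"
  proof -
    have [measurable]: "cbox 0 1 \<in> sets (lborel :: vec3 measure)" by simp
    have "emeasure phase_measure (cbox 0 1 \<times> UNIV) = emeasure (restrict_space lborel (cbox (0::vec3) 1)) (cbox 0 1) * emeasure lborel (UNIV :: vec3 set)"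
      unfolding phase_measure_def by (rule lborel.emeasure_pair_measure_Times) (auto simp: sets_restrict_space_iff)
    also have "emeasure (restrict_space lborel (cbox (0::vec3) 1)) (cbox 0 1) = emeasure lborel (cbox (0::vec3) 1)"
      by (rule emeasure_restrict_space) auto
    also have "emeasure lborel (cbox (0::vec3) 1) * emeasure lborel (UNIV :: vec3 set) = \<infinity>"
    proof -
      have one: "(1::vec3) \<bullet> i = 1" if "i \<in> Basis" for i
        using that by (auto simp: Basis_vec_def inner_axis)
      have "emeasure lborel (cbox (0::vec3) 1) \<noteq> 0"
        using one by (simp add: emeasure_lborel_cbox_eq)
      then show ?thesis by (simp add: ennreal_mult_top)
    qed
    finally show ?thesis by (simp add: phase_measure_def space_pair_measure space_restrict_space)
  qed
  ultimately show False by simp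
qed

lemma sup_norm_le_AE:
  assumes "sup_norm b l h \<le> ereal D"
  shows "AE (x, p) in phase_measure. \<bar>h x p\<bar> \<le> D * energy p powr (- (l * b / 2))"
proof -
  have "AE z in phase_measure. (case z of (x, p) \<Rightarrow> ereal \<bar>weight b l p * h x p\<bar>) \<le> sup_norm b l h"
    unfolding sup_norm_def by (rule esssup_AE)
  then show ?thesis
  proof eventually_elim
    case (elim z)
    obtain x p where z: "z = (x, p)" by (cases z)
    have "ereal \<bar>weight b l p * h x p\<bar> \<le> ereal D" using order_trans[OF elim assms] by (simp add: z)
    then have "energy p powr (l * b / 2) * \<bar>h x p\<bar> \<le> D" by (simp add: weight_def abs_mult)
    then show ?case using energy_pos[of p] by (simp add: z powr_minus field_simps)
  qed
qed

lemma sup_norm_le_decay_norm: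
  assumes "decay_norm b k l f \<le> ereal D" "s \<ge> 0"
  shows "sup_norm b l (f s) \<le> ereal (D * (1 + s) powr (- k))"
proof -
  have "ereal ((1 + s) powr k) * sup_norm b l (f s) \<le> decay_norm b k l f"
    unfolding decay_norm_def using assms(2) by (intro SUP_upper) auto
  then have "ereal ((1 + s) powr k) * sup_norm b l (f s) \<le> ereal D" using assms(1) by (rule order_trans)
  then show ?thesis using assms(2)
    by (cases "sup_norm b l (f s)") (auto simp: powr_minus field_simps)
qed

text \<open>In the proof \<open>k'\<close> and \<open>C\<close> are fixed before \<eta>; only the
  threshold \<open>M0\<close> depends on it, through the factor 1/p_0 that remains in
  \<open>powers\<close>.\<close>

theorem proposition6p1:
  fixes b l \<epsilon> c2 :: real
    and \<sigma> :: "real \<Rightarrow> real \<Rightarrow> real"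
    and chi :: "real \<Rightarrow> real"
  assumes "soft_potential b \<sigma>"
    and "l > 3 / b"
    and "\<epsilon> > 0" and "smooth_cutoff \<epsilon> chi"
    and "c2 > 0"
  shows "\<forall>k\<ge>1. \<exists>k'\<ge>k. \<forall>\<eta>>0. \<exists>C>0. \<exists>M0>0. \<forall>M\<ge>M0.
           \<forall>f0 f. conservation_laws f0 \<longrightarrow> semigroup_solution \<sigma> f0 f \<longrightarrow>
             (\<forall>t\<ge>0. \<forall>x p.
                ereal (weight b l p * \<bar>R1 \<sigma> chi c2 M f t x p\<bar>)
                \<le> ereal (\<eta> * (1 + t) powr (- k)) * decay_norm b k l f
                  + ereal (C * (1 + t) powr (- k)) * sup_norm b (l + k') f0)"
proof (intro allI impI)
  fix k :: real assume k: "k \<ge> 1"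
  obtain \<gamma> Csig csig \<sigma>0 where "soft_kernel b \<gamma> Csig csig \<sigma>0 \<sigma>" using soft_potential_kernel[OF assms(1)] .
  then interpret soft_kernel b \<gamma> Csig csig \<sigma>0 \<sigma> .
  have b0: "b > 0" using b by simp
  have l: "l > 0" using assms(2) b0 by (smt (verit) divide_pos_pos)
  \<comment> \<open>Solves m = n + k b / 2 + b + 33 for \<open>k'\<close>; in 33 = 26 + 6 + 1 the
    last unit leaves the factor 1/p_0.\<close>
  define k' where "k' = k + 2 + 66 / b"
  define n where "n = l * b / 2"
  define m where "m = (l + k') * b / 2"
  \<comment> \<open>In powers of the energy, the kernels cost 26, the volumes 6, the time integrals \<open>b\<close>, and the
      time decay \<open>k b / 2\<close>.\<close>
  have m_eq: "m = n + k * b / 2 + b + 33" using b0 by (simp add: m_def n_def k'_def field_simps)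
  have nm: "0 \<le> n" "n \<le> m" "0 \<le> m" using l b0 k by (simp_all add: m_eq) (simp_all add: n_def)
  obtain a R where a: "0 < a" "a \<le> 1" and R: "R \<ge> 8"
    and freq: "\<And>p. 8 \<le> energy p \<Longrightarrow> 2 * k * a * energy p powr (- b / 2) \<le> coll_freq \<sigma> p"
    and decay: "\<And>f0 f N F0. semigroup_solution \<sigma> f0 f \<Longrightarrow> 0 \<le> N \<Longrightarrow> 0 \<le> F0 \<Longrightarrow>
       (\<And>s. s \<ge> 0 \<Longrightarrow> AE (x, p) in phase_measure. \<bar>f s x p\<bar> \<le> N * (1 + s) powr (- k) * energy p powr (- n)) \<Longrightarrow>
       (AE (x, p) in phase_measure. \<bar>f0 x p\<bar> \<le> F0 * energy p powr (- m)) \<Longrightarrow>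
       AE s in lborel. AE y in lborel. AE q in lborel. s \<ge> 0 \<longrightarrow>
         \<bar>f (max 0 s) y q\<bar> \<le> (F0 + N * R powr m) * slow b k a s q * energy q powr (- m)"
  proof (rule high_momentum_decay[OF k nm(1,2)], goal_cases)
    case (1 a R)
    show ?case by (rule 1(1)[OF 1(2-)])
  qed
  obtain C0 where C0: "C0 > 0" "\<And>p q P. energy p \<le> P \<Longrightarrow> energy q \<le> P \<Longrightarrow> \<bar>k_cut \<sigma> chi c2 p q\<bar> \<le> C0 * P ^ 13"
    by (rule k_cut_bound[OF assms(3-5)]) (rule that)
  \<comment> \<open>The factors from \<open>R1_bound\<close> that are free of the energy, of t and
    of A, together with those from replacing the time factor by (1 + t)^(-k).\<close>
  define C where "C = (C0 * 4 ^ 13)\<^sup>2 * (8 ^ 3)\<^sup>2 * (1/4) powr (- m) / (k * a)\<^sup>2 * 4 powr b * a powr (- k) * 4 powr (k * b / 2)"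
  have C: "C > 0" using C0 k a by (simp add: C_def)
  have powers: "e powr n * ((C0 * (4 * e) ^ 13)\<^sup>2 * ((8 * e) ^ 3)\<^sup>2 *
      (A * (e / 4) powr (- m) * (1 + a * (4 * e) powr (- b / 2) * t) powr (- k) / (k * a * (4 * e) powr (- b / 2)) ^ 2))
      \<le> C * A * (1 + t) powr (- k) / e" if e: "e \<ge> 1" and A: "A \<ge> 0" and t: "t \<ge> 0" for e A t :: real
  proof -
    define \<mu> where "\<mu> = (4 * e) powr (- b / 2)"
    have \<mu>: "0 < \<mu>" "\<mu> \<le> 1" using e b0 powr_mono2'[of "- b / 2" 1 "4 * e"] by (auto simp: \<mu>_def)
    \<comment> \<open>Compares the slow clock with the true time: 1 + a \<mu> t \<ge> a \<mu> (1 +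
      t). The factor \<mu>^(-k) is the loss of k b / 2 powers of the energy.\<close>
    have "a * \<mu> \<le> 1" using a \<mu> by (intro mult_le_one) auto
    then have "a * \<mu> * (1 + t) \<le> 1 + a * \<mu> * t" by (simp add: distrib_left)
    then have "(1 + a * \<mu> * t) powr (- k) \<le> (a * \<mu> * (1 + t)) powr (- k)"
      using a \<mu> t k by (intro powr_mono2') auto
    also have "\<dots> = a powr (- k) * \<mu> powr (- k) * (1 + t) powr (- k)" by (simp only: powr_mult)
    also have "\<mu> powr (- k) = 4 powr (k * b / 2) * e powr (k * b / 2)"
      by (simp add: \<mu>_def powr_powr powr_mult mult.commute)
    finally have h: "(1 + a * \<mu> * t) powr (- k) \<le> a powr (- k) * (4 powr (k * b / 2) * e powr (k * b / 2)) * (1 + t) powr (- k)" .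
    have l2: "1 / \<mu>\<^sup>2 = 4 powr b * e powr b"
    proof -
      have "\<mu>\<^sup>2 = (4 * e) powr (- b)" unfolding \<mu>_def power2_eq_square powr_add[symmetric] by simp
      then show ?thesis by (simp add: powr_minus powr_mult inverse_eq_divide)
    qed
    have e4: "(e / 4) powr (- m) = (1/4) powr (- m) * e powr (- m)"
      by (simp add: powr_mult[symmetric])
    have ep: "e ^ 26 = e powr 26" "e ^ 6 = e powr 6" using e by (simp_all add: powr_numeral)
    have "e powr n * ((C0 * (4 * e) ^ 13)\<^sup>2 * ((8 * e) ^ 3)\<^sup>2 *
      (A * (e / 4) powr (- m) * (1 + a * \<mu> * t) powr (- k) / (k * a * \<mu>) ^ 2))
      = e powr n * ((C0 * (4 * e) ^ 13)\<^sup>2 * ((8 * e) ^ 3)\<^sup>2 * (A * (e / 4) powr (- m) / (k * a)\<^sup>2 * (1 / \<mu>\<^sup>2))) * (1 + a * \<mu> * t) powr (- k)"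
      by (simp add: power_mult_distrib)
    also have "\<dots> \<le> e powr n * ((C0 * (4 * e) ^ 13)\<^sup>2 * ((8 * e) ^ 3)\<^sup>2 * (A * (e / 4) powr (- m) / (k * a)\<^sup>2 * (1 / \<mu>\<^sup>2)))
       * (a powr (- k) * (4 powr (k * b / 2) * e powr (k * b / 2)) * (1 + t) powr (- k))"
      using h A by (intro mult_left_mono) auto
    also have "\<dots> = C * A * (1 + t) powr (- k) * (e powr n * e powr (- m) * e powr (k * b / 2) * e powr b * (e ^ 26 * e ^ 6))"
      unfolding l2 e4 C_def by (simp add: power_mult_distrib power_mult[symmetric] mult_ac)
    also have "e powr n * e powr (- m) * e powr (k * b / 2) * e powr b * (e ^ 26 * e ^ 6) = e powr (- 1)"
      unfolding ep powr_add[symmetric] by (simp add: m_eq)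
    also have "e powr (- 1) = 1 / e" using e by (simp add: powr_minus_divide)
    finally show ?thesis by (simp add: \<mu>_def)
  qed
  show "\<exists>k'\<ge>k. \<forall>\<eta>>0. \<exists>C>0. \<exists>M0>0. \<forall>M\<ge>M0.
           \<forall>f0 f. conservation_laws f0 \<longrightarrow> semigroup_solution \<sigma> f0 f \<longrightarrow>
             (\<forall>t\<ge>0. \<forall>x p.
                ereal (weight b l p * \<bar>R1 \<sigma> chi c2 M f t x p\<bar>)
                \<le> ereal (\<eta> * (1 + t) powr (- k)) * decay_norm b k l f
                  + ereal (C * (1 + t) powr (- k)) * sup_norm b (l + k') f0)"
  proof (rule exI[of _ k'], intro conjI allI impI)
    show "k \<le> k'" using b0 by (simp add: k'_def)
    fix \<eta> :: real assume \<eta>: "\<eta> > 0"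
    \<comment> \<open>16 keeps the energies of p and q1 on the support at 8 or more, where the lower
      bound on the collision frequency holds; the second entry gives C R^m / p_0 \<le>
      \<eta>.\<close>
    define M0 where "M0 = max 16 (2 * C * R powr m / \<eta>)"
    show "\<exists>C>0. \<exists>M0>0. \<forall>M\<ge>M0.
           \<forall>f0 f. conservation_laws f0 \<longrightarrow> semigroup_solution \<sigma> f0 f \<longrightarrow>
             (\<forall>t\<ge>0. \<forall>x p.
                ereal (weight b l p * \<bar>R1 \<sigma> chi c2 M f t x p\<bar>)
                \<le> ereal (\<eta> * (1 + t) powr (- k)) * decay_norm b k l f
                  + ereal (C * (1 + t) powr (- k)) * sup_norm b (l + k') f0)"
    proof (rule exI[of _ C], rule conjI[OF C], rule exI[of _ M0], intro conjI allI impI)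
      show "M0 > 0" by (simp add: M0_def)
      fix M f0 f t x p
      assume M: "M0 \<le> M" and sol: "semigroup_solution \<sigma> f0 f" and t: "(0::real) \<le> t"
      define w where "w = (1 + t) powr (- k)"
      have w: "w > 0" using t by (simp add: w_def)
      have Nn: "0 \<le> decay_norm b k l f"
      proof -
        have "ereal ((1 + 0) powr k) * sup_norm b l (f 0) \<le> decay_norm b k l f"
          unfolding decay_norm_def by (rule SUP_upper) auto
        then show ?thesis using sup_norm_nonneg[of b l "f 0"] by (simp add: one_ereal_def[symmetric])
      qed
      have Fn: "0 \<le> sup_norm b (l + k') f0" by (rule sup_norm_nonneg)
      show "ereal (weight b l p * \<bar>R1 \<sigma> chi c2 M f t x p\<bar>)
                \<le> ereal (\<eta> * (1 + t) powr (- k)) * decay_norm b k l f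
                  + ereal (C * (1 + t) powr (- k)) * sup_norm b (l + k') f0"
      \<comment> \<open>An infinite norm makes the right-hand side infinite, as both norms are
        nonnegative and their coefficients positive.\<close>
      proof (cases "decay_norm b k l f = \<infinity> \<or> sup_norm b (l + k') f0 = \<infinity>")
        case True
        then have "ereal (\<eta> * w) * decay_norm b k l f + ereal (C * w) * sup_norm b (l + k') f0 = \<infinity>"
          using Nn Fn \<eta> C w by (cases "decay_norm b k l f"; cases "sup_norm b (l + k') f0") auto
        then show ?thesis unfolding w_def by (metis ereal_less_eq(1))
      next
        case False
        then obtain N F0 where N: "decay_norm b k l f = ereal N" "N \<ge> 0" and F0: "sup_norm b (l + k') f0 = ereal F0" "F0 \<ge> 0"
          using Nn Fn by (cases "decay_norm b k l f"; cases "sup_norm b (l + k') f0") auto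
        have "AE (x, p) in phase_measure. \<bar>f s x p\<bar> \<le> N * (1 + s) powr (- k) * energy p powr (- n)" if "s \<ge> 0" for s
          using sup_norm_le_AE[OF sup_norm_le_decay_norm[OF eq_refl[OF N(1)] that]] by (simp add: n_def)
        moreover have "AE (x, p) in phase_measure. \<bar>f0 x p\<bar> \<le> F0 * energy p powr (- m)"
          using sup_norm_le_AE[OF eq_refl[OF F0(1)]] by (simp add: m_def)
        ultimately have dec: "AE s in lborel. AE y in lborel. AE q in lborel. s \<ge> 0 \<longrightarrow>
           \<bar>f (max 0 s) y q\<bar> \<le> (F0 + N * R powr m) * slow b k a s q * energy q powr (- m)"
          using sol N F0 by (intro decay)
        define A where "A = F0 + N * R powr m"
        have A: "A \<ge> 0" using N F0 by (simp add: A_def)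
        have M16: "M \<ge> 16" using M by (simp add: M0_def)
        have fm: "(\<lambda>(t, x, p). f t x p) \<in> borel_measurable (restrict_space borel ({0..} \<times> UNIV))"
          using sol by (simp add: semigroup_solution_def)
        have "weight b l p * \<bar>R1 \<sigma> chi c2 M f t x p\<bar> \<le> \<eta> * w * N + C * w * F0"
        proof (cases "R1 \<sigma> chi c2 M f t x p = 0")
          case True
          then show ?thesis using \<eta> w N C F0 by simp
        next
          case False
          let ?e = "energy p"
          have Me: "M / 2 \<le> ?e" and le: "\<bar>R1 \<sigma> chi c2 M f t x p\<bar> \<le> (C0 * (4 * ?e) ^ 13)\<^sup>2 * ((8 * ?e) ^ 3)\<^sup>2 *
            (A * (?e / 4) powr (- m) * (1 + a * (4 * ?e) powr (- b / 2) * t) powr (- k) / (k * a * (4 * ?e) powr (- b / 2)) ^ 2)"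
            using R1_bound[OF k a nm(3) A t freq C0 M16 fm dec[folded A_def] refl refl, of x p] False by auto
          have "weight b l p * \<bar>R1 \<sigma> chi c2 M f t x p\<bar> \<le> C * A * w / ?e"
            using order_trans[OF mult_left_mono[OF le, of "?e powr n"] powers[OF energy_ge_1 A t]] by (simp add: weight_def n_def w_def)
          also have "\<dots> = (C * R powr m / ?e) * (w * N) + (C * w * F0) * (1 / ?e)"
            by (simp add: A_def add_divide_distrib distrib_left distrib_right mult_ac)
          also have "\<dots> \<le> \<eta> * (w * N) + (C * w * F0) * 1"
          proof (intro add_mono mult_right_mono mult_left_mono)
            have "2 * C * R powr m / \<eta> \<le> M" using M by (simp add: M0_def)
            then have "C * R powr m \<le> \<eta> * (M / 2)" using \<eta> by (simp add: field_simps)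
            also have "\<dots> \<le> \<eta> * ?e" using Me \<eta> by (intro mult_left_mono) auto
            finally show "C * R powr m / ?e \<le> \<eta>" using energy_pos[of p] by (simp add: field_simps)
            show "1 / ?e \<le> 1" using energy_ge_1[of p] by simp
          qed (use w N C F0 in auto)
          finally show ?thesis by simp
        qed
        then show ?thesis by (simp add: N F0 w_def)
      qed
    qed
  qed
qed

end
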